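(* $\mathcal{C}_{X_m,1,2}$ equals the submonoid of $\mathcal{B}_m$ generated by $\mathcal{A}_{0,1}\cup\mathcal{A}_{1,2}\cup\mathcal{A}_{2,m}\cup\mathcal{D}_m$. Moreover, $(n;H_1,\dots,H_m)\in\mathcal{B}_m$ lies in $\mathcal{C}_{X_m,1,2}$ if and only if there exist non-negative integers $\alpha_0,\alpha_1$ with $\alpha_0\ge\max_{1\le i\le m}d_{0,i}$ and $2\alpha_0+\alpha_1\ge\max_{1\le i\le m}(2d_{0,i}+d_{1,i})$ such that $$\sum_{i=1}^md_{0,i}-(m-1)\alpha_0\ge0\quad\text{and}\quad\Big(\sum_{i=1}^md_{0,i}-(m-1)\alpha_0\Big)+\Big(\sum_{i=1}^m\min(d_{1,i},\alpha_1)-(m-2)\alpha_1\Big)\ge0.$$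
   Context: Fix a prime $p$; $\mathbb{Z}_p$ is the $p$-adic integers; $\overline{\mathbb{Z}}_{\ge c}=\{x\in\mathbb{Z}:x\ge c\}\cup\{\infty\}$, $p^\infty=0$ (so $\mathbb{Z}_p/p^0\mathbb{Z}_p=0$). $X_m=\{x_1,\dots,x_m\}$ is an ordered subset of $\mathbb{Z}_p$ of size $m$ with pairwise distinct reductions mod $p$. $\mathcal{M}_{\mathbb{Z}_p}$: isomorphism classes of finitely generated $\mathbb{Z}_p$-modules; $s(H)=\dim_{\mathbb{F}_p}(H/pH)$. $\mathcal{B}_m:=\{(n;H_1,\dots,H_m)\in\mathbb{Z}_{\ge0}\times\mathcal{M}_{\mathbb{Z}_p}^m: n\ge s(H_i)\ \forall i\}$, with $H_i\cong\prod_{r\in\overline{\mathbb{Z}}_{\ge1}}(\mathbb{Z}_p/p^r\mathbb{Z}_p)^{d_{r,i}}$, $d_{0,i}:=n-\sum_{r\ge1}d_{r,i}$, and monoid operation $(n;H_1,\dots,H_m)+(n';H'_1,\dots,H'_m)=(n+n';H_1\times H_1',\dots,H_m\times H_m')$. $S_m$ acts by $\sigma\cdot(n;H_1,\dots,H_m)=(n;H_{\sigma(1)},\dots,H_{\sigma(m)})$. For $r\in\overline{\mathbb{Z}}_{\ge0}$, $0\le d\le m$, $\mathcal{A}_{r,d}$ is the set of all $\sigma\cdot(1;\mathbb{Z}_p/p^{r_1}\mathbb{Z}_p,\dots,\mathbb{Z}_p/p^{r_d}\mathbb{Z}_p,\mathbb{Z}_p/p^r\mathbb{Z}_p,\dots,\mathbb{Z}_p/p^r\mathbb{Z}_p)$,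 $\sigma\in S_m$, $r_1,\dots,r_d\in\overline{\mathbb{Z}}_{\ge r}$. $\mathcal{D}_m=\mathcal{D}_{m,1}\cup\mathcal{D}_{m,2}$, where $\mathcal{D}_{m,1}$ consists of all $\sigma\cdot(d+1;\mathbb{Z}_p/p^{r_1}\mathbb{Z}_p,\dots,\mathbb{Z}_p/p^{r_{d+2}}\mathbb{Z}_p,\mathbb{Z}_p/p\mathbb{Z}_p,\dots,\mathbb{Z}_p/p\mathbb{Z}_p)$ with $0\le d\le m-2$, $r_j\in\overline{\mathbb{Z}}_{\ge2}$, and $\mathcal{D}_{m,2}$ consists of all $\sigma\cdot(d+1;(\mathbb{Z}_p/p\mathbb{Z}_p)^2,\dots,(\mathbb{Z}_p/p\mathbb{Z}_p)^2,\mathbb{Z}_p/p^{r_1}\mathbb{Z}_p,\dots,\mathbb{Z}_p/p^{r_{m-d}}\mathbb{Z}_p)$ ($d$ entries $(\mathbb{Z}_p/p\mathbb{Z}_p)^2$) with $0\le d\le m$, $r_j\in\overline{\mathbb{Z}}_{\ge2}$. A first integral is a polynomial in $\operatorname{M}_n(\mathbb{Z}_p)[t]$ of the form $A_0+tA_1+pt^2A_2+\dots+p^rt^{r+1}A_{r+1}$. $\mathcal{C}_{X_m,1,2}$ is the set of $(n;H_1,\dots,H_m)\in\mathcal{B}_m$ such that some first integral $P(t)\in\operatorname{M}_n(\mathbb{Z}_p)[t]$ satisfies $\operatorname{cok}_{\mathbb{Z}_p/p^2\mathbb{Z}_p}(P(x_i))\cong H_i/p^2H_i$ for all $i$ (cokernel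 of the reduction mod $p^2$ as a $\mathbb{Z}_p/p^2\mathbb{Z}_p$-module). *)

theory Defs
  imports
    "Berlekamp_Zassenhaus.Finite_Field"
    "Jordan_Normal_Form.VS_Connect"
    "HOL-Algebra.QuotRing"
    "HOL-Combinatorics.Permutations"
    "HOL-Library.Extended_Nat"
begin

section \<open>The ring of p-adic integers\<close>

text \<open>
  The prime $p$ is the cardinality of a type \<open>'p :: prime_card\<close>, as for the prime fields
  \<open>'p mod_ring\<close>. An element of $\mathbf{Z}_p = \varprojlim \mathbf{Z}/p^k$ is the sequence of
  its residues, the $k$-th one being represented in $\{0,\dots,p^k-1\}$.
\<close>

typedef (overloaded) 'p padic_int =
  "{x :: nat \<Rightarrow> int. \<forall>k. 0 \<le> x k \<and> x k < int CARD('p :: prime_card) ^ k \<and>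
      x (Suc k) mod int CARD('p) ^ k = x k}"
  by (rule exI[of _ "\<lambda>_. 0"]) (simp add: prime_gt_0_nat[OF prime_card])

setup_lifting type_definition_padic_int

lemma padic_pow_pos: "0 < int CARD('p :: prime_card) ^ k"
  by (simp add: prime_gt_0_nat[OF prime_card])

lemma padic_mod_Suc:
  "a mod int CARD('p :: prime_card) ^ Suc k mod int CARD('p) ^ k = a mod int CARD('p) ^ k"
  by (rule mod_mod_cancel) simp

instantiation padic_int :: (prime_card) comm_ring_1
begin

lift_definition zero_padic_int :: "'a padic_int" is "\<lambda>_. 0"
  by (simp add: prime_gt_0_nat[OF prime_card])

lift_definition one_padic_int :: "'a padic_int" is "\<lambda>k. 1 mod int CARD('a) ^ k"
  by (simp only: padic_mod_Suc) (simp add: padic_pow_pos)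

lift_definition plus_padic_int :: "'a padic_int \<Rightarrow> 'a padic_int \<Rightarrow> 'a padic_int"
  is "\<lambda>x y k. (x k + y k) mod int CARD('a) ^ k"
  by (simp only: padic_mod_Suc) (metis mod_add_eq pos_mod_bound pos_mod_sign padic_pow_pos)

lift_definition times_padic_int :: "'a padic_int \<Rightarrow> 'a padic_int \<Rightarrow> 'a padic_int"
  is "\<lambda>x y k. (x k * y k) mod int CARD('a) ^ k"
  by (simp only: padic_mod_Suc) (metis mod_mult_eq pos_mod_bound pos_mod_sign padic_pow_pos)

lift_definition uminus_padic_int :: "'a padic_int \<Rightarrow> 'a padic_int"
  is "\<lambda>x k. (- x k) mod int CARD('a) ^ k"
  by (simp only: padic_mod_Suc) (metis mod_minus_eq pos_mod_bound pos_mod_sign padic_pow_pos)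

lift_definition minus_padic_int :: "'a padic_int \<Rightarrow> 'a padic_int \<Rightarrow> 'a padic_int"
  is "\<lambda>x y k. (x k - y k) mod int CARD('a) ^ k"
  by (simp only: padic_mod_Suc) (metis mod_diff_eq pos_mod_bound pos_mod_sign padic_pow_pos)

instance
proof
  fix a b c :: "'a padic_int"
  show "a * b * c = a * (b * c)"
    by transfer (auto simp: mod_simps mult.assoc)
  show "a * b = b * a"
    by transfer (auto simp: mult.commute)
  show "1 * a = a"
    by transfer (auto simp: mod_simps intro!: ext)
  show "a + b + c = a + (b + c)"
    by transfer (auto simp: mod_simps add.assoc)
  show "a + b = b + a"
    by transfer (auto simp: add.commute)
  show "0 + a = a"
    by transfer (auto intro!: ext)
  show "- a + a = 0"
    by transfer (auto simp: mod_simps)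
  show "a - b = a + - b"
    by transfer (auto simp: mod_simps)
  show "(a + b) * c = a * c + b * c"
    by transfer (auto simp: mod_simps distrib_right)
  have "1 < int CARD('a)"
    using prime_gt_1_nat[OF prime_card[where 'a = 'a]] by simp
  then show "(0 :: 'a padic_int) \<noteq> 1"
    by transfer (auto simp: fun_eq_iff intro!: exI[of _ 1])
qed

end

abbreviation Zp :: "'p :: prime_card padic_int ring" where
  "Zp \<equiv> class_ring"

definition padic_p :: "'p :: prime_card padic_int" where
  "padic_p = of_nat CARD('p)"

text \<open>$p^\infty = 0$.\<close>

definition padic_ppow :: "enat \<Rightarrow> 'p :: prime_card padic_int" where
  "padic_ppow r = (case r of enat k \<Rightarrow> padic_p ^ k | \<infinity> \<Rightarrow> 0)"


section \<open>Quotients and products of modules\<close>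

text \<open>
  A module record also has the fields \<open>mult\<close> and \<open>one\<close> of a ring record; they carry no
  meaning for modules and neither the locale \<open>module\<close> nor \<open>module_hom\<close> refers to them.
\<close>

definition mod_iso ::
  "('r, 'k) ring_scheme \<Rightarrow> ('r, 'a) module \<Rightarrow> ('r, 'b) module \<Rightarrow> bool" where
  "mod_iso R M N \<longleftrightarrow> (\<exists>f \<in> module_hom R M N. bij_betw f (carrier M) (carrier N))"

definition fin_gen_module :: "('r, 'k) ring_scheme \<Rightarrow> ('r, 'a) module \<Rightarrow> bool" where
  "fin_gen_module R M \<longleftrightarrow> Module.module R M \<and>
     (\<exists>G. finite G \<and> G \<subseteq> carrier M \<and> LinearCombinations.module.span R M G = carrier M)"

definition quot_module :: "('r, 'a) module \<Rightarrow> 'a set \<Rightarrow> ('r, 'a set) module" where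
  "quot_module M N =
     \<lparr>carrier = a_rcosets\<^bsub>M\<^esub> N, monoid.mult = undefined, one = undefined, zero = N, add = set_add M,
      module.smult = (\<lambda>c X. \<Union>x\<in>X. N +>\<^bsub>M\<^esub> (c \<odot>\<^bsub>M\<^esub> x))\<rparr>"

text \<open>$M/aM$ as a module over $R/aR$ (for the ring \<open>R Quot (PIdl\<^bsub>R\<^esub> a)\<close>).\<close>

definition reduction ::
  "('r, 'k) ring_scheme \<Rightarrow> 'r \<Rightarrow> ('r, 'a) module \<Rightarrow> ('r set, 'a set) module" where
  "reduction R a M = (let N = (\<lambda>x. a \<odot>\<^bsub>M\<^esub> x) ` carrier M in
     \<lparr>carrier = a_rcosets\<^bsub>M\<^esub> N, monoid.mult = undefined, one = undefined, zero = N, add = set_add M,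
      module.smult = (\<lambda>C X. \<Union>c\<in>C. \<Union>x\<in>X. N +>\<^bsub>M\<^esub> (c \<odot>\<^bsub>M\<^esub> x))\<rparr>)"

definition prod_module :: "'i set \<Rightarrow> ('i \<Rightarrow> ('r, 'a) module) \<Rightarrow> ('r, 'i \<Rightarrow> 'a) module" where
  "prod_module I M =
     \<lparr>carrier = (\<Pi>\<^sub>E i\<in>I. carrier (M i)), monoid.mult = undefined, one = undefined,
      zero = (\<lambda>i\<in>I. \<zero>\<^bsub>M i\<^esub>),
      add = (\<lambda>x y. \<lambda>i\<in>I. x i \<oplus>\<^bsub>M i\<^esub> y i),
      module.smult = (\<lambda>c x. \<lambda>i\<in>I. c \<odot>\<^bsub>M i\<^esub> x i)\<rparr>"

definition free_module :: "('r, 'k) ring_scheme \<Rightarrow> nat \<Rightarrow> ('r, 'r vec) module" where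
  "free_module R n =
     \<lparr>carrier = {v \<in> carrier_vec n. set\<^sub>v v \<subseteq> carrier R}, monoid.mult = undefined, one = undefined,
      zero = vec n (\<lambda>_. \<zero>\<^bsub>R\<^esub>),
      add = (\<lambda>v w. vec n (\<lambda>i. v $ i \<oplus>\<^bsub>R\<^esub> w $ i)),
      module.smult = (\<lambda>c v. vec n (\<lambda>i. c \<otimes>\<^bsub>R\<^esub> v $ i))\<rparr>"

text \<open>The cokernel $R^n/AR^n$ of an $n \times n$ matrix over a ring given as a record.\<close>

definition cokernel :: "('r, 'k) ring_scheme \<Rightarrow> nat \<Rightarrow> 'r mat \<Rightarrow> ('r, 'r vec set) module" where
  "cokernel R n A = quot_module (free_module R n)
     ((\<lambda>v. vec n (\<lambda>i. \<Oplus>\<^bsub>R\<^esub>j\<in>{..<n}. A $$ (i, j) \<otimes>\<^bsub>R\<^esub> v $ j)) ` carrier (free_module R n))"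


section \<open>Isomorphism classes of finitely generated modules over the p-adic integers\<close>

text \<open>
  Isomorphism classes are taken among modules whose carrier consists of elements of the type
  \<open>'p padic_int vec set\<close>. Every finitely generated module is isomorphic to a quotient
  $\mathbf{Z}_p^k/N$ and hence to such a module, so the class of a finitely generated module with
  any carrier type is nonempty and determines the module up to isomorphism.
\<close>

type_synonym 'p module_class = "('p padic_int, 'p padic_int vec set) module set"

definition iso_class :: "('p :: prime_card padic_int, 'a) module \<Rightarrow> 'p module_class" where
  "iso_class M = {N. Module.module Zp N \<and> mod_iso Zp M N}"

definition module_classes :: "'p :: prime_card module_class set" where
  "module_classes = {iso_class M | M :: ('p padic_int, 'p padic_int vec set) module.
     fin_gen_module Zp M}"

definition class_times ::
  "'p :: prime_card module_class \<Rightarrow> 'p module_class \<Rightarrow> 'p module_class" where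
  "class_times X Y = (\<Union>M\<in>X. \<Union>N\<in>Y. iso_class (direct_sum M N))"

text \<open>$\mathbf{Z}_p/p^r\mathbf{Z}_p$, so that $r = 0$ gives the zero module and $r = \infty$ gives
  a free module of rank one.\<close>

definition cyclic_module :: "enat \<Rightarrow> ('p :: prime_card padic_int, 'p padic_int set) module" where
  "cyclic_module r = quot_module
     \<lparr>carrier = UNIV, monoid.mult = (*), one = 1, zero = 0, add = (+), module.smult = (*)\<rparr>
     (PIdl\<^bsub>Zp\<^esub> (padic_ppow r))"

abbreviation cyclic_class :: "enat \<Rightarrow> 'p :: prime_card module_class" where
  "cyclic_class r \<equiv> iso_class (cyclic_module r)"

text \<open>$s(H) = \dim_{\mathbf{F}_p}(H/pH)$.\<close>

definition s_rank :: "('p :: prime_card padic_int, 'a) module \<Rightarrow> nat" where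
  "s_rank H = vectorspace.dim (Zp Quot (PIdl\<^bsub>Zp\<^esub> padic_p)) (reduction Zp padic_p H)"

text \<open>$\prod_{r \ge 1} (\mathbf{Z}_p/p^r\mathbf{Z}_p)^{d_r}$; the value \<open>d 0\<close> is not used.\<close>

definition cyclic_product ::
  "(enat \<Rightarrow> nat) \<Rightarrow> ('p :: prime_card padic_int, enat \<times> nat \<Rightarrow> 'p padic_int set) module" where
  "cyclic_product d = prod_module {(r, j). 1 \<le> r \<and> j < d r} (\<lambda>(r, j). cyclic_module r)"

text \<open>The exponents $d_r$ $(r \ge 1)$ of a class. They exist and are unique by the structure
  theorem, so \<open>SOME\<close> only leaves the irrelevant value at $0$ open.\<close>

definition class_exps :: "'p :: prime_card module_class \<Rightarrow> enat \<Rightarrow> nat" where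
  "class_exps X = (SOME d. X = iso_class (cyclic_product d))"

text \<open>$d_0 = n - \sum_{r \ge 1} d_r$, the sum being taken over the support of $d$.\<close>

definition class_d :: "nat \<Rightarrow> 'p :: prime_card module_class \<Rightarrow> enat \<Rightarrow> int" where
  "class_d n X r =
     (if r = 0 then int n - int (\<Sum>q | 1 \<le> q \<and> class_exps X q \<noteq> 0. class_exps X q)
      else int (class_exps X r))"


section \<open>The monoid and its submonoids\<close>

definition B_set :: "nat \<Rightarrow> (nat \<times> 'p :: prime_card module_class list) set" where
  "B_set m = {(n, Hs). length Hs = m \<and> set Hs \<subseteq> module_classes \<and>
     (\<forall>X \<in> set Hs. \<forall>H \<in> X. s_rank H \<le> n)}"

definition B_monoid :: "nat \<Rightarrow> (nat \<times> 'p :: prime_card module_class list) monoid" where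
  "B_monoid m =
     \<lparr>carrier = B_set m,
      monoid.mult = (\<lambda>(n, Hs) (n', Hs'). (n + n', map2 class_times Hs Hs')),
      one = (0, replicate m (cyclic_class 0))\<rparr>"

definition generated_submonoid :: "('a, 'k) monoid_scheme \<Rightarrow> 'a set \<Rightarrow> 'a set" where
  "generated_submonoid G S = \<Inter>{N. submonoid N G \<and> S \<subseteq> N}"

text \<open>The families below are empty when their index $d$ is out of range; in particular
  \<open>A_set m r d = {}\<close> for $d > m$. The permutations act on the indices $0,\dots,m-1$.\<close>

definition A_set :: "nat \<Rightarrow> enat \<Rightarrow> nat \<Rightarrow> (nat \<times> 'p :: prime_card module_class list) set" where
  "A_set m r d =
     {(1, permute_list \<sigma> (map cyclic_class (rs @ replicate (m - d) r))) | \<sigma> rs.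
        d \<le> m \<and> \<sigma> permutes {..<m} \<and> length rs = d \<and> (\<forall>q \<in> set rs. r \<le> q)}"

definition D1_set :: "nat \<Rightarrow> (nat \<times> 'p :: prime_card module_class list) set" where
  "D1_set m =
     {(d + 1, permute_list \<sigma> (map cyclic_class (rs @ replicate (m - (d + 2)) 1))) | \<sigma> d rs.
        d + 2 \<le> m \<and> \<sigma> permutes {..<m} \<and> length rs = d + 2 \<and> (\<forall>q \<in> set rs. 2 \<le> q)}"

definition D2_set :: "nat \<Rightarrow> (nat \<times> 'p :: prime_card module_class list) set" where
  "D2_set m =
     {(d + 1, permute_list \<sigma> (replicate d (class_times (cyclic_class 1) (cyclic_class 1)) @
                              map cyclic_class rs)) | \<sigma> d rs.
        d \<le> m \<and> \<sigma> permutes {..<m} \<and> length rs = m - d \<and> (\<forall>q \<in> set rs. 2 \<le> q)}"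

definition D_set :: "nat \<Rightarrow> (nat \<times> 'p :: prime_card module_class list) set" where
  "D_set m = D1_set m \<union> D2_set m"


section \<open>First integrals\<close>

text \<open>
  $\mathrm{M}_n(\mathbf{Z}_p)[t]$ is identified with $\mathrm{M}_n(\mathbf{Z}_p[t])$. In the
  definition, the coefficient of $t^k$ is $p^{\max(k-1,0)}A_k$, by truncated subtraction.
\<close>

definition first_integral :: "nat \<Rightarrow> 'p :: prime_card padic_int poly mat \<Rightarrow> bool" where
  "first_integral n P \<longleftrightarrow>
     (\<exists>r A. (\<forall>k \<le> r + 1. A k \<in> carrier_mat n n) \<and>
        P = mat n n (\<lambda>(i, j). \<Sum>k\<le>r + 1. monom (padic_p ^ (k - 1) * A k $$ (i, j)) k))"

definition mat_eval :: "'a :: comm_semiring_0 poly mat \<Rightarrow> 'a \<Rightarrow> 'a mat" where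
  "mat_eval P x = map_mat (\<lambda>q. poly q x) P"

text \<open>The cokernel of the reduction of a matrix modulo $p^2$.\<close>

definition cok_p2 ::
  "nat \<Rightarrow> 'p :: prime_card padic_int mat \<Rightarrow>
    ('p padic_int set, 'p padic_int set vec set) module" where
  "cok_p2 n A = (let I = PIdl\<^bsub>Zp\<^esub> (padic_p ^ 2)
     in cokernel (Zp Quot I) n (map_mat (\<lambda>a. I +>\<^bsub>Zp\<^esub> a) A))"

definition C12_set ::
  "'p :: prime_card padic_int list \<Rightarrow> (nat \<times> 'p module_class list) set" where
  "C12_set xs = {(n, Hs) \<in> B_set (length xs).
     \<exists>P. first_integral n P \<and>
       (\<forall>i < length xs. \<exists>H \<in> Hs ! i.
          mod_iso (Zp Quot (PIdl\<^bsub>Zp\<^esub> (padic_p ^ 2)))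
            (cok_p2 n (mat_eval P (xs ! i))) (reduction Zp (padic_p ^ 2) H))}"

end

theory Submission
  imports Defs
begin

text \<open>
  Modulo $p^2$ only the numbers $d_{0,i}$, $d_{1,i}$ of exponents $0$ and $1$ at each $x_i$ matter.

  Necessity: up to a factor prime to $p$, a first integral is a product of width \<open>\<alpha>0\<close> plus $p$
  times a product of width \<open>\<alpha>1\<close> modulo $p^2$. It has a minor of order \<open>\<alpha>0 + \<alpha>1\<close> of the form
  $p^{\alpha_1} g$ with $g$ nonzero modulo $p$. Since the coefficient of $t^k$ in a first integral is
  divisible by $p^{k-1}$, the degree of $g$ modulo $p$ is at most \<open>\<alpha>0 + 2 * \<alpha>1\<close>, while the
  cokernel at $x_i$ forces $g$ to vanish modulo $p$ at $x_i$ to order at least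
  $(\alpha_0-d_{0,i})+\max(\alpha_1-d_{1,i},0)$. The $x_i$ being distinct modulo $p$, these orders
  add up to at most the degree. The minor of order \<open>\<alpha>0\<close> gives the first inequality likewise.

  Sufficiency: the generators are cokernels of explicit matrices, and block sums of first integrals
  are first integrals. A family satisfying the inequalities is decomposed by induction on $n$:
  after lowering \<open>\<alpha>0\<close> and \<open>\<alpha>1\<close> so that \<open>\<alpha>0 + \<alpha>1 \<le> n\<close>, a generator can be split
  off with the inequalities preserved; its type is dictated by whether \<open>\<alpha>0 + \<alpha>1 < n\<close> and
  \<open>\<alpha>1 > 0\<close>.
\<close>


section \<open>Arithmetic of the p-adic integers\<close>

text \<open>The order of vanishing at x_i needs two separate estimates, whence the maximum in the
  exponent. Modulo p, the value P(x_i) is a product of width d_{0,i}; the substitution t = x_i + p t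
  turns powers of p dividing a minor into low Taylor coefficients, but the factor p^a1 of the minor
  is lost on the way. Modulo p^2, the width is d_{0,i} + d_{1,i}; once P is corrected by p^2 G,
  powers of t - x_i themselves divide the minor, and nothing is lost. The degree bound a0 + 2 a1 is
  (a0 + a1) + a1: in a minor of order k the coefficient of t^j is divisible by p^(j-k), and removing
  p^a1 shifts this by a1. Ranks over Z_p/p^2 are awkward, so every rank statement is a factorisation
  E W F plus a multiple of a power of p, and all minors are estimated by one bordered determinant.
  Similarly, the modules over Z_p, F_p and Z_p/p^2 are all treated as quotients of sequences over
  Z_p, scalars acting through a map \<open>\<rho>\<close>; one diagonalisation over Z_p then yields
  the structure theorem, s(H) and the Smith form modulo p^2.\<close>

lemma card_gt_1: "1 < int CARD('p :: prime_card)"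
  using prime_gt_1_nat[OF prime_card[where 'a = 'p]] by simp

lemma prime_int_card: "prime (int CARD('p :: prime_card))"
  using prime_card[where 'a = 'p] by simp

lemma Rep_range: "0 \<le> Rep_padic_int (x :: 'p :: prime_card padic_int) k"
  "Rep_padic_int x k < int CARD('p) ^ k"
  using Rep_padic_int[of x] by auto

lemma Rep_mod:
  fixes x :: "'p :: prime_card padic_int"
  assumes "i \<le> j"
  shows "Rep_padic_int x j mod int CARD('p) ^ i = Rep_padic_int x i"
  using assms
proof (induction j rule: dec_induct)
  case base
  show ?case using Rep_range[of x i] by simp
next
  case (step j)
  have "Rep_padic_int x (Suc j) mod int CARD('p) ^ i
      = Rep_padic_int x (Suc j) mod int CARD('p) ^ j mod int CARD('p) ^ i"
    using step.hyps by (simp add: mod_mod_cancel le_imp_power_dvd)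
  also have "Rep_padic_int x (Suc j) mod int CARD('p) ^ j = Rep_padic_int x j"
    using Rep_padic_int[of x] by auto
  finally show ?case using step.IH by simp
qed

lemma padic_eqI: "(\<And>k. Rep_padic_int x k = Rep_padic_int y k) \<Longrightarrow> x = y"
  by (simp add: Rep_padic_int_inject[symmetric] fun_eq_iff)

lemma Rep_mult: "Rep_padic_int (x * y) k =
    (Rep_padic_int x k * Rep_padic_int y k) mod int CARD('p) ^ k"
  for x y :: "'p :: prime_card padic_int"
  by (simp add: times_padic_int.rep_eq)

lemma Rep_add: "Rep_padic_int (x + y) k =
    (Rep_padic_int x k + Rep_padic_int y k) mod int CARD('p) ^ k"
  for x y :: "'p :: prime_card padic_int"
  by (simp add: plus_padic_int.rep_eq)

lemma Rep_of_nat: "Rep_padic_int (of_nat a :: 'p :: prime_card padic_int) k = int a mod int CARD('p) ^ k"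
  by (induction a) (simp_all add: zero_padic_int.rep_eq one_padic_int.rep_eq Rep_add mod_simps)

lemma Rep_ppow: "Rep_padic_int (padic_p ^ a :: 'p :: prime_card padic_int) k
    = int CARD('p) ^ a mod int CARD('p) ^ k"
proof -
  have "padic_p ^ a = (of_nat (CARD('p) ^ a) :: 'p padic_int)"
    by (simp add: padic_p_def)
  then show ?thesis by (simp only: Rep_of_nat) simp
qed

lemma Rep_ppow_mult: "Rep_padic_int (padic_p ^ a * x :: 'p :: prime_card padic_int) k
    = (int CARD('p) ^ a * Rep_padic_int x k) mod int CARD('p) ^ k"
  by (simp add: Rep_mult Rep_ppow mod_simps)

lemma ppow_dvd_iff:
  fixes x :: "'p :: prime_card padic_int"
  shows "padic_p ^ k dvd x \<longleftrightarrow> Rep_padic_int x k = 0"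
proof
  assume "padic_p ^ k dvd x"
  then show "Rep_padic_int x k = 0" by (auto simp: dvd_def Rep_ppow_mult)
next
  assume 0: "Rep_padic_int x k = 0"
  define q where "q = int CARD('p)"
  have q: "q > 0" using card_gt_1[where 'p = 'p] by (simp add: q_def)
  \<comment> \<open>Dividing by p^k costs k digits, so the j-th residue of the quotient is read off
    at level j + k of \<open>x\<close>.\<close>
  define y where "y j = Rep_padic_int x (j + k) div q ^ k" for j
  have dv: "q ^ k dvd Rep_padic_int x (j + k)" for j
    using Rep_mod[of k "j + k" x] 0 by (simp add: q_def mod_eq_0_iff_dvd)
  have ylt: "y j < q ^ j" for j
  proof -
    have "y j * q ^ k < q ^ j * q ^ k"
      using Rep_range[of x "j + k"] dv[of j] by (simp add: y_def power_add q_def)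
    then show ?thesis using q by simp
  qed
  have yc: "y (Suc j) mod q ^ j = y j" for j
  proof -
    have "Rep_padic_int x (Suc (j + k)) mod q ^ (j + k) = Rep_padic_int x (j + k)"
      using Rep_mod[of "j + k" "Suc (j + k)" x] by (simp add: q_def)
    then have "y j = Rep_padic_int x (Suc (j + k)) mod (q ^ k * q ^ j) div q ^ k"
      by (simp add: y_def power_add mult.commute)
    also have "\<dots> = (Rep_padic_int x (Suc (j + k)) div q ^ k) mod q ^ j"
      using q by (simp add: zmod_zmult2_eq div_pos_pos_trivial)
    finally show ?thesis by (simp add: y_def)
  qed
  have mem: "y \<in> {x. \<forall>k. 0 \<le> x k \<and> x k < int CARD('p) ^ k \<and> x (Suc k) mod int CARD('p) ^ k = x k}"
    using ylt yc q Rep_range(1)[of x] by (auto simp: q_def[symmetric] y_def pos_imp_zdiv_nonneg_iff)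
  have "x = padic_p ^ k * Abs_padic_int y"
  proof (rule padic_eqI)
    fix j
    have "q ^ k * y j mod q ^ j = Rep_padic_int x j"
      using dv[of j] Rep_mod[of j "j + k" x] by (simp add: y_def q_def)
    then show "Rep_padic_int x j = Rep_padic_int (padic_p ^ k * Abs_padic_int y :: 'p padic_int) j"
      by (simp add: Rep_ppow_mult Abs_padic_int_inverse[OF mem] q_def)
  qed
  then show "padic_p ^ k dvd x" by (metis dvd_triv_left)
qed

lemma ppow_mult_eq_0:
  fixes x :: "'p :: prime_card padic_int"
  assumes "padic_p ^ k * x = 0"
  shows "x = 0"
proof (rule padic_eqI)
  fix j
  \<comment> \<open>The product is tested at level j + k, since multiplication by p^k hides the top
    k digits of \<open>x\<close>.\<close>
  have "Rep_padic_int (padic_p ^ k * x) (j + k) = 0"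
    using assms by (simp add: zero_padic_int.rep_eq)
  then have "int CARD('p) ^ k * int CARD('p) ^ j dvd int CARD('p) ^ k * Rep_padic_int x (j + k)"
    by (simp add: Rep_ppow_mult power_add mult.commute[of "int CARD('p) ^ j"] mod_eq_0_iff_dvd)
  then have "int CARD('p) ^ j dvd Rep_padic_int x (j + k)"
    using card_gt_1[where 'p = 'p] by simp
  then show "Rep_padic_int x j = Rep_padic_int 0 j"
    using Rep_mod[of j "j + k" x] by (simp add: zero_padic_int.rep_eq)
qed

text \<open>Z_p is local: \<open>u\<close> is invertible modulo every p^j, and the inverses are
  compatible because an inverse modulo p^j is unique there.\<close>

lemma unit_if_not_p_dvd:
  fixes u :: "'p :: prime_card padic_int"
  assumes "\<not> padic_p dvd u"
  obtains v where "u * v = 1"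
proof -
  define q where "q = int CARD('p)"
  have q: "q > 1" using card_gt_1[where 'p = 'p] by (simp add: q_def)
  have "Rep_padic_int u 1 \<noteq> 0" using assms ppow_dvd_iff[of 1 u] by simp
  have cop: "coprime (Rep_padic_int u j) (q ^ j)" for j
  proof (cases j)
    case (Suc i)
    have "\<not> q dvd Rep_padic_int u j"
      using Rep_mod[of 1 j u] \<open>Rep_padic_int u 1 \<noteq> 0\<close> Suc by (auto simp: q_def)
    then have "coprime q (Rep_padic_int u j)"
      using prime_int_card[where 'p = 'p] by (simp add: prime_imp_coprime q_def)
    then show ?thesis by (simp add: coprime_commute)
  qed simp
  have "\<exists>w. 0 \<le> w \<and> w < q ^ j \<and> [Rep_padic_int u j * w = 1] (mod q ^ j)" for j
  proof -
    obtain w where "[Rep_padic_int u j * w = 1] (mod q ^ j)"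
      using cong_solve_coprime_int[OF cop] by blast
    then have "[Rep_padic_int u j * (w mod q ^ j) = 1] (mod q ^ j)"
      by (simp add: cong_def mod_simps)
    then show ?thesis using q by (intro exI[of _ "w mod q ^ j"]) auto
  qed
  then obtain w where w: "\<And>j. 0 \<le> w j" "\<And>j. w j < q ^ j"
    "\<And>j. [Rep_padic_int u j * w j = 1] (mod q ^ j)" by metis
  have wc: "w (Suc j) mod q ^ j = w j" for j
  proof -
    have "[Rep_padic_int u (Suc j) * w (Suc j) = 1] (mod q ^ j)"
      using w(3)[of "Suc j"] by (rule cong_dvd_modulus) simp
    moreover have "[Rep_padic_int u (Suc j) = Rep_padic_int u j] (mod q ^ j)"
      using Rep_mod[of j "Suc j" u] Rep_mod[of j j u] by (simp add: cong_def q_def)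
    ultimately have "[Rep_padic_int u j * w (Suc j) = 1] (mod q ^ j)"
      by (meson cong_scalar_right cong_sym cong_trans)
    then have "[Rep_padic_int u j * w (Suc j) = Rep_padic_int u j * w j] (mod q ^ j)"
      using w(3)[of j] by (meson cong_sym cong_trans)
    then have "[w (Suc j) = w j] (mod q ^ j)"
      using cop by (simp add: cong_mult_lcancel)
    then show ?thesis using w(1,2)[of j] by (simp add: cong_def)
  qed
  have mem: "w \<in> {x. \<forall>k. 0 \<le> x k \<and> x k < int CARD('p) ^ k \<and> x (Suc k) mod int CARD('p) ^ k = x k}"
    using w wc by (auto simp: q_def)
  have "u * Abs_padic_int w = 1"
    by (rule padic_eqI)
       (use w(3) in \<open>simp add: Rep_mult Abs_padic_int_inverse[OF mem] one_padic_int.rep_eq cong_def q_def\<close>)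
  then show ?thesis by (rule that)
qed

lemma not_p_dvd_1: "\<not> padic_p dvd (1 :: 'p :: prime_card padic_int)"
  using ppow_dvd_iff[of 1 "1 :: 'p padic_int"] card_gt_1[where 'p = 'p]
  by (simp add: one_padic_int.rep_eq)

lemma p_dvd_multD:
  fixes x y :: "'p :: prime_card padic_int"
  assumes "padic_p dvd x * y"
  shows "padic_p dvd x \<or> padic_p dvd y"
proof -
  have "int CARD('p) dvd Rep_padic_int x 1 * Rep_padic_int y 1"
    using assms ppow_dvd_iff[of 1 "x * y"] by (simp add: Rep_mult mod_eq_0_iff_dvd)
  then have "int CARD('p) dvd Rep_padic_int x 1 \<or> int CARD('p) dvd Rep_padic_int y 1"
    using prime_int_card[where 'p = 'p] prime_dvd_mult_iff by blast
  then show ?thesis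
    using Rep_range[of x 1] Rep_range[of y 1] ppow_dvd_iff[of 1 x] ppow_dvd_iff[of 1 y]
    by (auto dest: zdvd_imp_le simp: order.order_iff_strict)
qed

text \<open>Takes the place of a valuation function: \<open>k\<close> is one less than the least
  exponent whose power of p fails to divide \<open>x\<close>.\<close>

lemma padic_decomp:
  fixes x :: "'p :: prime_card padic_int"
  assumes "x \<noteq> 0"
  obtains k u v where "x = padic_p ^ k * u" "u * v = 1"
proof -
  have "\<exists>k. \<not> padic_p ^ k dvd x"
    using assms padic_eqI[of x 0] by (auto simp: ppow_dvd_iff zero_padic_int.rep_eq)
  define k where "k = (LEAST k. \<not> padic_p ^ k dvd x)"
  have k: "\<not> padic_p ^ k dvd x"
    unfolding k_def by (rule LeastI_ex) fact
  then obtain j where j: "k = Suc j" by (cases k) auto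
  have "padic_p ^ j dvd x"
    using not_less_Least[of j "\<lambda>k. \<not> padic_p ^ k dvd x"] j unfolding k_def by auto
  then obtain u where u: "x = padic_p ^ j * u" by (auto simp: dvd_def)
  have "\<not> padic_p dvd u"
    using k unfolding j u by (auto simp: dvd_def mult.assoc mult.left_commute)
  then show ?thesis using unit_if_not_p_dvd[of u] that u by metis
qed

text \<open>Cancellation in Z_p, and hence in Z_p[t], is what the determinant identities and the
  orders of vanishing rely on later.\<close>

instance padic_int :: (prime_card) idom
proof
  fix x y :: "'a padic_int"
  assume "x \<noteq> 0" "y \<noteq> 0"
  then obtain a u u' b v v' where "x = padic_p ^ a * u" "u * u' = 1" "y = padic_p ^ b * v" "v * v' = 1"
    by (metis padic_decomp)
  note d = this
  show "x * y \<noteq> 0"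
  proof
    assume "x * y = 0"
    then have "padic_p ^ (a + b) * (u * v) = 0" by (simp add: d power_add mult_ac)
    then have "u * v = 0" by (rule ppow_mult_eq_0)
    then have "(u * u') * (v * v') = 0" by (metis mult.assoc mult.commute mult_zero_left)
    then show False using d by simp
  qed
qed

lemma padic_p_nz [simp]: "(padic_p :: 'p :: prime_card padic_int) \<noteq> 0"
  using ppow_mult_eq_0[of 1 "1 :: 'p padic_int"] by auto

lemma padic_ppow_simps [simp]: "padic_ppow 0 = 1" "padic_ppow \<infinity> = 0" "padic_ppow 1 = padic_p"
  "padic_ppow (enat k) = padic_p ^ k"
  by (simp_all add: padic_ppow_def zero_enat_def one_enat_def)

text \<open>Digits are natural numbers below p, so that vectors of digits can be counted.\<close>

lemma padic_digit:
  fixes x :: "'p :: prime_card padic_int"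
  shows "\<exists>u < CARD('p). padic_p dvd x - of_nat u"
proof (intro exI conjI)
  let ?u = "nat (Rep_padic_int x 1)"
  show "?u < CARD('p)" using Rep_range[of x 1] by (simp add: nat_less_iff)
  have "of_nat ?u + (x - of_nat ?u) = x" by simp
  then have "Rep_padic_int x 1 = (Rep_padic_int (of_nat ?u :: 'p padic_int) 1 + Rep_padic_int (x - of_nat ?u) 1) mod int CARD('p)"
    using Rep_add[of "of_nat ?u" "x - of_nat ?u" 1] by simp
  then have *: "Rep_padic_int x 1 = (Rep_padic_int x 1 + Rep_padic_int (x - of_nat ?u) 1) mod int CARD('p)"
    using Rep_range[of x 1] by (simp add: Rep_of_nat mod_simps)
  have "int CARD('p) dvd Rep_padic_int (x - of_nat ?u) 1"
    using * by (metis mod_add_right_eq add_cancel_right_right dvd_eq_mod_eq_0 mod_eq_dvd_iff diff_add_cancel add_diff_cancel_left' mod_mod_trivial)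
  then have "Rep_padic_int (x - of_nat ?u) 1 = 0"
    using Rep_range[of "x - of_nat ?u" 1] by (auto dest: zdvd_imp_le simp: order.order_iff_strict)
  then show "padic_p dvd x - of_nat ?u" using ppow_dvd_iff[of 1] by (metis power_one_right)
qed

lemma p_dvd_of_nat_diff:
  assumes "a < CARD('p)" "b < CARD('p)" "padic_p dvd (of_nat a - of_nat b :: 'p :: prime_card padic_int)"
  shows "a = b"
proof -
  have *: "a = b" if "a \<le> b" "b < CARD('p)" "padic_p dvd (of_nat b - of_nat a :: 'p padic_int)" for a b
  proof -
    have "(of_nat b - of_nat a :: 'p padic_int) = of_nat (b - a)" using that by (simp add: of_nat_diff)
    then have "Rep_padic_int (of_nat (b - a) :: 'p padic_int) 1 = 0"
      using that(3) ppow_dvd_iff[of 1] by (metis power_one_right)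
    then have "int (b - a) mod int CARD('p) = 0" unfolding Rep_of_nat by simp
    then show ?thesis using that by simp
  qed
  show ?thesis
    using *[of a b] *[of b a] assms by (metis dvd_minus_iff minus_diff_eq nat_le_linear)
qed

text \<open>The residue field is taken as the type \<open>'p mod_ring\<close> rather than as a
  quotient record, so that \<open>degree\<close> and \<open>order\<close> of polynomials over F_p
  are available.\<close>

definition res :: "'p :: prime_card padic_int \<Rightarrow> 'p mod_ring" where
  "res x = of_int_mod_ring (Rep_padic_int x 1)"

lemma of_int_mod_ring_add:
  "of_int_mod_ring (a + b) = (of_int_mod_ring a + of_int_mod_ring b :: 'p :: prime_card mod_ring)"
  by transfer (simp add: mod_simps)

lemma of_int_mod_ring_mult:
  "of_int_mod_ring (a * b) = (of_int_mod_ring a * of_int_mod_ring b :: 'p :: prime_card mod_ring)"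
  by transfer (simp add: mod_simps)

lemma of_int_mod_ring_mod:
  "(of_int_mod_ring (a mod int CARD('p)) :: 'p :: prime_card mod_ring) = of_int_mod_ring a"
  by transfer simp

lemma of_int_mod_ring_eq_0_iff:
  "(of_int_mod_ring a :: 'p :: prime_card mod_ring) = 0 \<longleftrightarrow> a mod int CARD('p) = 0"
  by transfer simp

lemma res_eq_0_iff: "res x = 0 \<longleftrightarrow> padic_p dvd (x :: 'p :: prime_card padic_int)"
  using Rep_range[of x 1] ppow_dvd_iff[of 1 x] by (simp add: res_def of_int_mod_ring_eq_0_iff)

interpretation res: comm_ring_hom "res :: 'p :: prime_card padic_int \<Rightarrow> 'p mod_ring"
proof
  fix x y :: "'p padic_int"
  show "res (x + y) = res x + res y"
    unfolding res_def Rep_add power_one_right of_int_mod_ring_mod of_int_mod_ring_add ..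
  show "res (x * y) = res x * res y"
    unfolding res_def Rep_mult power_one_right of_int_mod_ring_mod of_int_mod_ring_mult ..
  show "res (0 :: 'p padic_int) = 0"
    by (simp add: res_def zero_padic_int.rep_eq)
  show "res (1 :: 'p padic_int) = 1"
    by (simp add: res_def one_padic_int.rep_eq of_int_mod_ring_mod) (transfer, simp)
qed


section \<open>Submodules of a free module\<close>

definition submod :: "(nat \<Rightarrow> 'p :: prime_card padic_int) set \<Rightarrow> bool" where
  "submod L \<longleftrightarrow> (\<lambda>_. 0) \<in> L \<and> (\<forall>v\<in>L. \<forall>w\<in>L. \<forall>a b. (\<lambda>j. a * v j + b * w j) \<in> L)"

definition flin :: "((nat \<Rightarrow> 'p :: prime_card padic_int) \<Rightarrow> (nat \<Rightarrow> 'p padic_int)) \<Rightarrow> bool" where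
  "flin T \<longleftrightarrow> (\<forall>a b v w. T (\<lambda>j. a * v j + b * w j) = (\<lambda>j. a * T v j + b * T w j))"

text \<open>A change of coordinates supported on \<open>S\<close>, given together with its inverse.
  The last clause lets the coordinates in \<open>S\<close> depend on coordinates in \<open>S\<close>
  only, so that \<open>T\<close> acts on them as a matrix; linearity on infinite sequences would not
  ensure this.\<close>

definition autom ::
  "nat set \<Rightarrow> ((nat \<Rightarrow> 'p :: prime_card padic_int) \<Rightarrow> (nat \<Rightarrow> 'p padic_int)) \<Rightarrow>
    ((nat \<Rightarrow> 'p padic_int) \<Rightarrow> (nat \<Rightarrow> 'p padic_int)) \<Rightarrow> bool" where
  "autom S T T' \<longleftrightarrow> flin T \<and> flin T' \<and> (\<forall>v. T (T' v) = v) \<and> (\<forall>v. T' (T v) = v) \<and>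
     (\<forall>v. \<forall>j. j \<notin> S \<longrightarrow> T v j = v j \<and> T' v j = v j) \<and>
     (\<forall>v w. (\<forall>j\<in>S. v j = w j) \<longrightarrow> (\<forall>j\<in>S. T v j = T w j \<and> T' v j = T' w j))"

lemma submod_0: "submod L \<Longrightarrow> (\<lambda>_. 0) \<in> L"
  by (simp add: submod_def)

lemma submod_comb: "submod L \<Longrightarrow> v \<in> L \<Longrightarrow> w \<in> L \<Longrightarrow> (\<lambda>j. a * v j + b * w j) \<in> L"
  by (simp add: submod_def)

lemma submod_add: "submod L \<Longrightarrow> v \<in> L \<Longrightarrow> w \<in> L \<Longrightarrow> (\<lambda>j. v j + w j) \<in> L"
  using submod_comb[of L v w 1 1] by simp

lemma submod_diff: "submod L \<Longrightarrow> v \<in> L \<Longrightarrow> w \<in> L \<Longrightarrow> (\<lambda>j. v j - w j) \<in> L"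
  using submod_comb[of L v w 1 "-1"] by simp

lemma submod_smult: "submod L \<Longrightarrow> v \<in> L \<Longrightarrow> (\<lambda>j. a * v j) \<in> L"
  using submod_comb[of L v v a 0] by simp

lemma flin_comb: "flin T \<Longrightarrow> T (\<lambda>j. a * v j + b * w j) = (\<lambda>j. a * T v j + b * T w j)"
  by (simp add: flin_def)

lemma flin_add: "flin T \<Longrightarrow> T (\<lambda>j. v j + w j) = (\<lambda>j. T v j + T w j)"
  using flin_comb[of T 1 v 1 w] by simp

lemma flin_diff: "flin T \<Longrightarrow> T (\<lambda>j. v j - w j) = (\<lambda>j. T v j - T w j)"
  using flin_comb[of T 1 v "-1" w] by simp

lemma flin_smult: "flin T \<Longrightarrow> T (\<lambda>j. a * v j) = (\<lambda>j. a * T v j)"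
  using flin_comb[of T a v 0 v] by simp

lemma flin_0: "flin T \<Longrightarrow> T (\<lambda>_. 0) = (\<lambda>_. 0)"
  using flin_smult[of T 0] by simp

lemma automD:
  assumes "autom S T T'"
  shows "flin T" "flin T'" "T (T' v) = v" "T' (T v) = v"
    "j \<notin> S \<Longrightarrow> T v j = v j" "j \<notin> S \<Longrightarrow> T' v j = v j"
    "(\<And>j. j \<in> S \<Longrightarrow> v j = w j) \<Longrightarrow> j \<in> S \<Longrightarrow> T v j = T w j"
    "(\<And>j. j \<in> S \<Longrightarrow> v j = w j) \<Longrightarrow> j \<in> S \<Longrightarrow> T' v j = T' w j"
  using assms unfolding autom_def by blast+

lemma autom_inv: "autom S T T' \<Longrightarrow> autom S T' T"
  unfolding autom_def by blast

lemma autom_id: "autom S (\<lambda>v. v) (\<lambda>v. v)"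
  by (simp add: autom_def flin_def)

lemma autom_mono:
  assumes "autom S1 T T'" "S1 \<subseteq> S"
  shows "autom S T T'"
proof -
  note a = automD[OF assms(1)]
  have "T v j = T w j \<and> T' v j = T' w j" if "\<forall>j\<in>S. v j = w j" "j \<in> S" for v w j
  proof (cases "j \<in> S1")
    case True
    then show ?thesis using a(7,8)[of v w j] that assms(2) by blast
  next
    case False
    then show ?thesis using a(5,6)[of j] that by simp
  qed
  then show ?thesis
    using assms unfolding autom_def by blast
qed

lemma autom_comp:
  assumes "autom S T T'" "autom S U U'"
  shows "autom S (\<lambda>v. T (U v)) (\<lambda>v. U' (T' v))"
proof -
  note a = automD[OF assms(1)] and b = automD[OF assms(2)]
  have "T (U v) j = T (U w) j" "U' (T' v) j = U' (T' w) j"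
    if "\<forall>j\<in>S. v j = w j" "j \<in> S" for v w j
    using a(7)[of "U v" "U w" j] b(7)[of v w] b(8)[of "T' v" "T' w" j] a(8)[of v w] that by auto
  note loc = this
  have "flin (\<lambda>v. T (U v))" "flin (\<lambda>v. U' (T' v))"
    using a(1,2) b(1,2) by (simp_all add: flin_def)
  moreover have "T (U (U' (T' v))) = v" "U' (T' (T (U v))) = v" for v
    by (simp_all add: a(3,4) b(3,4))
  moreover have "T (U v) j = v j" "U' (T' v) j = v j" if "j \<notin> S" for v j
    by (simp_all add: a(5,6) b(5,6) that)
  ultimately show ?thesis unfolding autom_def using loc by blast
qed

text \<open>\<open>w i = 0\<close> leaves the coordinate \<open>v i\<close> unchanged, so reversing
  the sign inverts the map.\<close>

lemma autom_shear:
  assumes "w i = 0" "\<And>j. j \<notin> S \<Longrightarrow> w j = 0" "i \<in> S"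
  shows "autom S (\<lambda>v j. v j - v i * w j) (\<lambda>v j. v j + v i * w j)"
  using assms by (auto simp: autom_def flin_def algebra_simps)

text \<open>The pivot of the diagonalisation: an entry of least valuation, over all vectors of
  \<open>L\<close> and all coordinates in \<open>S\<close>, divides every other entry. Scaling by a
  unit makes it an exact power of p.\<close>

lemma min_valuation:
  fixes L :: "(nat \<Rightarrow> 'p :: prime_card padic_int) set"
  assumes L: "submod L" and "v \<in> L" "i \<in> S" "v i \<noteq> 0"
  obtains e i v where "v \<in> L" "i \<in> S" "v i = padic_p ^ e"
    "\<And>w j. w \<in> L \<Longrightarrow> j \<in> S \<Longrightarrow> padic_p ^ e dvd w j"
proof -
  let ?P = "\<lambda>e. \<exists>v\<in>L. \<exists>i\<in>S. v i = padic_p ^ e"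
  have normalise: "\<exists>v'\<in>L. v' i = padic_p ^ k" if "v \<in> L" "v i = padic_p ^ k * u" "u * u' = 1"
    for v i k and u u' :: "'p padic_int"
    using submod_smult[OF L that(1), of u'] that(2,3)
    by (intro bexI[of _ "\<lambda>j. u' * v j"]) (simp_all add: mult_ac)
  obtain k u u' where "v i = padic_p ^ k * u" "u * u' = 1"
    using padic_decomp[OF assms(4)] .
  then have "?P k" using normalise assms by blast
  define e where "e = (LEAST e. ?P e)"
  have "?P e" unfolding e_def by (rule LeastI[of ?P], fact)
  then obtain v i where *: "v \<in> L" "i \<in> S" "v i = padic_p ^ e" by blast
  have "padic_p ^ e dvd w j" if w: "w \<in> L" "j \<in> S" for w j
  proof (cases "w j = 0")
    case False
    obtain k u u' where d: "w j = padic_p ^ k * u" "u * u' = 1"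
      using padic_decomp[OF False] .
    then have "?P k" using normalise w by blast
    then have "e \<le> k" unfolding e_def by (rule Least_le)
    then show ?thesis unfolding d by (simp add: le_imp_power_dvd)
  qed simp
  then show ?thesis using * that by blast
qed

text \<open>Stacked bases: an entry of minimal valuation is used as a pivot, and a shear splits off its
  coordinate.\<close>

lemma stacked_basis:
  fixes L :: "(nat \<Rightarrow> 'p :: prime_card padic_int) set"
  assumes "finite S" "submod L" "\<And>v w. v \<in> L \<Longrightarrow> (\<And>j. j \<in> S \<Longrightarrow> v j = w j) \<Longrightarrow> w \<in> L"
  obtains T T' r where "autom S T T'" "\<And>v. v \<in> L \<longleftrightarrow> (\<forall>j\<in>S. padic_ppow (r j) dvd T v j)"
proof -
  have "\<exists>T T' r. autom S T T' \<and> (\<forall>v. v \<in> L \<longleftrightarrow> (\<forall>j\<in>S. padic_ppow (r j) dvd T v j))"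
    using assms
  proof (induction "card S" arbitrary: S L rule: less_induct)
    case less
    note L = less.prems(2)
    show ?case
    proof (cases "\<exists>v\<in>L. \<exists>i\<in>S. v i \<noteq> 0")
      \<comment> \<open>All vectors of \<open>L\<close> vanish on \<open>S\<close>; this is the
        exponent \<open>\<infinity>\<close>, as \<open>padic_ppow \<infinity> = 0\<close>.\<close>
      case False
      have "v \<in> L \<longleftrightarrow> (\<forall>j\<in>S. padic_ppow \<infinity> dvd v j)" for v
        using False less.prems(3)[OF submod_0[OF L], of v] by auto
      then show ?thesis
        by (intro exI[of _ "\<lambda>v. v"] exI[of _ "\<lambda>_. \<infinity>"] conjI autom_id) simp
    next
      case True
      then obtain e i v0 where v0: "v0 \<in> L" "i \<in> S" "v0 i = padic_p ^ e"
        and e: "\<And>w j. w \<in> L \<Longrightarrow> j \<in> S \<Longrightarrow> padic_p ^ e dvd w j"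
        using min_valuation[OF L] by metis
      have "\<forall>j. \<exists>x. j \<in> S \<longrightarrow> v0 j = padic_p ^ e * x"
        using e[OF v0(1)] by (auto simp: dvd_def)
      then obtain x where x: "\<And>j. j \<in> S \<Longrightarrow> v0 j = padic_p ^ e * x j" by metis
      \<comment> \<open>The pivot vector divided by p^e, off the pivot; the shear along it clears
        the other coordinates of \<open>v0\<close> in \<open>S\<close>.\<close>
      define w where "w j = (if j \<in> S - {i} then x j else 0)" for j
      have w: "v0 j = padic_p ^ e * w j" if "j \<in> S - {i}" for j
        using x that by (simp add: w_def)
      \<comment> \<open>Overwriting coordinate \<open>i\<close> makes \<open>L'\<close> insensitive
        to it, as the induction hypothesis for \<open>S - {i}\<close> requires.\<close>
      define L' where "L' = {u. u(i := 0) \<in> L}"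
      have L': "submod L'"
      proof -
        have eq: "(\<lambda>j. a * v j + b * w j)(i := 0) = (\<lambda>j. a * (v(i := 0)) j + b * (w(i := 0)) j)"
          for a b and v w :: "nat \<Rightarrow> 'p padic_int" by auto
        have "(\<lambda>_. 0)(i := 0) = (\<lambda>_. 0 :: 'p padic_int)" by auto
        then show ?thesis
          unfolding submod_def L'_def using submod_comb[OF L] submod_0[OF L]
          by (simp add: eq del: fun_upd_apply)
      qed
      have "\<exists>T T' r. autom (S - {i}) T T' \<and>
          (\<forall>v. v \<in> L' \<longleftrightarrow> (\<forall>j\<in>S - {i}. padic_ppow (r j) dvd T v j))"
      proof (rule less.hyps)
        show "card (S - {i}) < card S" using v0(2) less.prems(1) by (meson card_Diff1_less)
        show "finite (S - {i})" using less.prems(1) by simp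
        show "u' \<in> L'" if "u \<in> L'" "\<And>j. j \<in> S - {i} \<Longrightarrow> u j = u' j" for u u'
          using less.prems(3)[of "u(i := 0)" "u'(i := 0)"] that by (auto simp: L'_def)
      qed (fact L')
      then obtain T T' r where T: "autom (S - {i}) T T'"
        and r: "\<And>v. v \<in> L' \<longleftrightarrow> (\<forall>j\<in>S - {i}. padic_ppow (r j) dvd T v j)"
        by blast
      define sh where "sh v j = v j - v i * w j" for v :: "nat \<Rightarrow> 'p padic_int" and j
      have sh: "autom S sh (\<lambda>v j. v j + v i * w j)"
        unfolding sh_def by (rule autom_shear) (use v0 in \<open>auto simp: w_def\<close>)
      have aut: "autom S (\<lambda>v. T (sh v)) (\<lambda>v. (\<lambda>v j. v j + v i * w j) (T' v))"
        by (rule autom_comp[OF autom_mono[OF T] sh]) auto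
      have "v \<in> L \<longleftrightarrow> (\<forall>j\<in>S. padic_ppow ((r(i := enat e)) j) dvd T (sh v) j)" for v
      proof -
        have "T (sh v) i = v i" using automD(5)[OF T, of i "sh v"] by (simp add: sh_def w_def)
        then have *: "(\<forall>j\<in>S. padic_ppow ((r(i := enat e)) j) dvd T (sh v) j) \<longleftrightarrow>
            padic_p ^ e dvd v i \<and> sh v \<in> L'"
          using v0(2) r[of "sh v"] by auto
        have "v \<in> L \<longleftrightarrow> (sh v)(i := 0) \<in> L" if dv: "padic_p ^ e dvd v i"
        proof -
          obtain c where c: "v i = padic_p ^ e * c" using dv by (auto simp: dvd_def)
          have 1: "(sh v)(i := 0) \<in> L" if "v \<in> L"
            by (rule less.prems(3)[OF submod_comb[OF L that v0(1), of 1 "- c"]])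
              (auto simp: sh_def c v0(3) w algebra_simps)
          have 2: "v \<in> L" if "(sh v)(i := 0) \<in> L"
            by (rule less.prems(3)[OF submod_comb[OF L that v0(1), of 1 c]])
              (auto simp: sh_def c v0(3) w algebra_simps)
          from 1 2 show ?thesis by blast
        qed
        then show ?thesis using e[of v i] v0(2) * by (auto simp: L'_def)
      qed
      then show ?thesis using aut by blast
    qed
  qed
  then show ?thesis using that by blast
qed


section \<open>Presentations of modules\<close>

text \<open>\<open>pres \<rho> M L \<phi>\<close>: the map \<open>\<phi>\<close> from sequences onto \<open>M\<close> is linear, scalars
  acting on \<open>M\<close> through \<open>\<rho>\<close>, and has kernel \<open>L\<close>. Sequences replace vectors of a given
  length; \<open>L\<close> contains those vanishing on the relevant coordinates.\<close>

definition pres :: "('p :: prime_card padic_int \<Rightarrow> 'r) \<Rightarrow> ('r, 'a) module \<Rightarrow>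
    (nat \<Rightarrow> 'p padic_int) set \<Rightarrow> ((nat \<Rightarrow> 'p padic_int) \<Rightarrow> 'a) \<Rightarrow> bool" where
  "pres \<rho> M L \<phi> \<longleftrightarrow> range \<phi> = carrier M \<and> \<phi> (\<lambda>_. 0) = \<zero>\<^bsub>M\<^esub> \<and>
     (\<forall>v w. \<phi> (\<lambda>j. v j + w j) = \<phi> v \<oplus>\<^bsub>M\<^esub> \<phi> w) \<and>
     (\<forall>a v. \<phi> (\<lambda>j. a * v j) = \<rho> a \<odot>\<^bsub>M\<^esub> \<phi> v) \<and>
     (\<forall>v w. \<phi> v = \<phi> w \<longleftrightarrow> (\<lambda>j. v j - w j) \<in> L)"

lemma presD:
  assumes "pres \<rho> M L \<phi>"
  shows "\<phi> v \<in> carrier M" "x \<in> carrier M \<Longrightarrow> \<exists>v. x = \<phi> v" "\<phi> (\<lambda>_. 0) = \<zero>\<^bsub>M\<^esub>"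
    "\<phi> (\<lambda>j. v j + w j) = \<phi> v \<oplus>\<^bsub>M\<^esub> \<phi> w" "\<phi> (\<lambda>j. a * v j) = \<rho> a \<odot>\<^bsub>M\<^esub> \<phi> v"
    "\<phi> v = \<phi> w \<longleftrightarrow> (\<lambda>j. v j - w j) \<in> L"
proof -
  have "range \<phi> = carrier M" using assms by (simp add: pres_def)
  then show "\<phi> v \<in> carrier M" "x \<in> carrier M \<Longrightarrow> \<exists>v. x = \<phi> v" by blast+
qed (use assms in \<open>simp_all add: pres_def\<close>)

lemma pres_comb:
  assumes "pres \<rho> M L \<phi>"
  shows "\<phi> (\<lambda>j. a * v j + b * w j) = \<rho> a \<odot>\<^bsub>M\<^esub> \<phi> v \<oplus>\<^bsub>M\<^esub> \<rho> b \<odot>\<^bsub>M\<^esub> \<phi> w"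
  using presD[OF assms] by simp

lemma pres_submod:
  assumes "pres \<rho> M L \<phi>"
  shows "submod L"
proof -
  note d = presD[OF assms]
  have mem: "v \<in> L \<longleftrightarrow> \<phi> v = \<phi> (\<lambda>_. 0)" for v using d(6)[of v "\<lambda>_. 0"] by simp
  have "(\<lambda>j. a * v j + b * w j) \<in> L" if "v \<in> L" "w \<in> L" for v w a b
    using that pres_comb[OF assms, of a v b w] pres_comb[OF assms, of a "\<lambda>_. 0" b "\<lambda>_. 0"]
    unfolding mem by simp
  then show ?thesis unfolding submod_def by (auto simp: mem)
qed

lemma pres_comp:
  assumes "pres \<rho> M L \<phi>" "flin T" "surj T"
  shows "pres \<rho> M {v. T v \<in> L} (\<lambda>v. \<phi> (T v))"
proof -
  note d = presD[OF assms(1)]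
  have "range (\<lambda>v. \<phi> (T v)) = range \<phi>"
    using assms(3) by (metis image_image)
  then show ?thesis
    using assms(1) unfolding pres_def
    by (auto simp: flin_0[OF assms(2)] flin_add[OF assms(2)] flin_smult[OF assms(2)] flin_diff[OF assms(2)])
qed

lemma pres_autom:
  assumes "pres \<rho> M L \<phi>" "autom S T T'" "\<And>v. v \<in> L \<longleftrightarrow> T v \<in> L'"
  shows "pres \<rho> M L' (\<lambda>v. \<phi> (T' v))"
proof -
  note a = automD[OF assms(2)]
  have "pres \<rho> M {v. T' v \<in> L} (\<lambda>v. \<phi> (T' v))"
    by (rule pres_comp[OF assms(1) a(2)]) (metis a(4) surj_def)
  then show ?thesis using assms(3) a(3) by simp
qed

text \<open>The class of a sequence goes to the class of the same sequence; equality of the relation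
  sets makes this well defined and injective.\<close>

lemma pres_iso:
  assumes M: "pres \<rho> M L \<phi>" and N: "pres \<rho> N L \<psi>" and R: "carrier R = range \<rho>"
  shows "mod_iso R M N"
proof -
  define f where "f x = \<psi> (SOME v. \<phi> v = x)" for x
  note m = presD[OF M] and n = presD[OF N]
  have f: "f (\<phi> v) = \<psi> v" for v
  proof -
    have "\<phi> (SOME w. \<phi> w = \<phi> v) = \<phi> v" by (rule someI[of "\<lambda>w. \<phi> w = \<phi> v" v]) simp
    then show ?thesis unfolding f_def n(6) m(6) .
  qed
  have "f \<in> module_hom R M N"
    unfolding module_hom_def
  proof (intro CollectI conjI allI impI Pi_I)
    fix x y assume "x \<in> carrier M \<and> y \<in> carrier M"
    then obtain v w where *: "x = \<phi> v" "y = \<phi> w" using m(2) by metis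
    show "f (x \<oplus>\<^bsub>M\<^esub> y) = f x \<oplus>\<^bsub>N\<^esub> f y"
      by (simp add: * f m(4)[symmetric] n(4)[symmetric])
  next
    fix r x assume "r \<in> carrier R \<and> x \<in> carrier M"
    then obtain v a where *: "x = \<phi> v" "r = \<rho> a" using m(2) R by (metis imageE)
    show "f (r \<odot>\<^bsub>M\<^esub> x) = r \<odot>\<^bsub>N\<^esub> f x"
      by (simp add: * f m(5)[symmetric] n(5)[symmetric])
  next
    fix x assume "x \<in> carrier M"
    then show "f x \<in> carrier N" using m(2) f n(1) by metis
  qed
  moreover have "bij_betw f (carrier M) (carrier N)"
    unfolding bij_betw_def
  proof
    show "inj_on f (carrier M)"
    proof (rule inj_onI)
      fix x y assume xy: "x \<in> carrier M" "y \<in> carrier M" "f x = f y"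
      then obtain v w where *: "x = \<phi> v" "y = \<phi> w" using m(2) by metis
      show "x = y" using xy(3) by (simp add: * f n(6) m(6))
    qed
    show "f ` carrier M = carrier N"
    proof -
      have "f ` range \<phi> = range \<psi>" by (simp add: image_image f)
      then show ?thesis using M N by (simp add: pres_def)
    qed
  qed
  ultimately show ?thesis unfolding mod_iso_def by blast
qed

lemma pres_transfer:
  assumes M: "pres \<rho> M L \<phi>" and f: "f \<in> module_hom R M N" "bij_betw f (carrier M) (carrier N)"
    and R: "carrier R = range \<rho>" "\<rho> 0 = \<zero>\<^bsub>R\<^esub>" and N: "Module.module R N"
  shows "pres \<rho> N L (\<lambda>v. f (\<phi> v))"
proof -
  note m = presD[OF M]
  interpret N: Module.module R N by fact
  have hom: "f (x \<oplus>\<^bsub>M\<^esub> y) = f x \<oplus>\<^bsub>N\<^esub> f y" "f (\<rho> a \<odot>\<^bsub>M\<^esub> x) = \<rho> a \<odot>\<^bsub>N\<^esub> f x"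
    "f x \<in> carrier N" if "x \<in> carrier M" "y \<in> carrier M" for x y a
    using f that R unfolding module_hom_def by auto
  \<comment> \<open>The definition of \<open>module_hom\<close> speaks of sums and scalar multiples
    only. Preservation of zero comes from multiplying by the scalar 0, for which \<open>N\<close>
    has to be a module.\<close>
  have "f (\<phi> (\<lambda>_. 0)) = f (\<phi> (\<lambda>j. 0 * 0))" by simp
  also have "\<dots> = \<rho> 0 \<odot>\<^bsub>N\<^esub> f (\<phi> (\<lambda>_. 0))"
    unfolding m(5)[of 0 "\<lambda>_. 0"] using hom(2)[OF m(1) m(1)] by blast
  also have "\<dots> = \<zero>\<^bsub>N\<^esub>" using R(2) hom(3)[OF m(1) m(1)] N.smult_l_null by simp
  finally have 0: "f (\<phi> (\<lambda>_. 0)) = \<zero>\<^bsub>N\<^esub>" .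
  have inj: "f (\<phi> v) = f (\<phi> w) \<longleftrightarrow> \<phi> v = \<phi> w" for v w
    using f(2) m(1) by (auto simp: bij_betw_def inj_on_def)
  have "range (\<lambda>v. f (\<phi> v)) = f ` range \<phi>" by auto
  then show ?thesis
    using M f(2) 0 unfolding pres_def inj bij_betw_def m(4,5)
    by (simp add: hom[OF m(1) m(1)])
qed

text \<open>The axioms hold for sequences and pass along \<open>\<phi>\<close>, so quotients and
  products need no separate verification once they are presented.\<close>

lemma pres_module:
  assumes M: "pres \<rho> M L \<phi>" and R: "cring R" "carrier R = range \<rho>"
    "\<And>a b. \<rho> (a + b) = \<rho> a \<oplus>\<^bsub>R\<^esub> \<rho> b" "\<And>a b. \<rho> (a * b) = \<rho> a \<otimes>\<^bsub>R\<^esub> \<rho> b" "\<rho> 1 = \<one>\<^bsub>R\<^esub>"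
  shows "Module.module R M"
proof -
  note m = presD[OF M]
  have rep: "\<exists>v. x = \<phi> v" if "x \<in> carrier M" for x using that m(2) by blast
  have repR: "\<exists>a. r = \<rho> a" if "r \<in> carrier R" for r using that R(2) by auto
  show ?thesis
  proof (rule module.intro[OF R(1)])
    show "abelian_group M"
    proof (rule abelian_groupI)
      fix x y z assume "x \<in> carrier M" "y \<in> carrier M" "z \<in> carrier M"
      then obtain u v w where *: "x = \<phi> u" "y = \<phi> v" "z = \<phi> w" using rep by metis
      show "x \<oplus>\<^bsub>M\<^esub> y \<in> carrier M" "x \<oplus>\<^bsub>M\<^esub> y \<oplus>\<^bsub>M\<^esub> z = x \<oplus>\<^bsub>M\<^esub> (y \<oplus>\<^bsub>M\<^esub> z)" "x \<oplus>\<^bsub>M\<^esub> y = y \<oplus>\<^bsub>M\<^esub> x"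
        by (simp_all add: * m(4)[symmetric] m(1) add_ac)
    next
      show "\<zero>\<^bsub>M\<^esub> \<in> carrier M" using m(1,3) by metis
    next
      fix x assume "x \<in> carrier M"
      then obtain u where *: "x = \<phi> u" using rep by metis
      show "\<zero>\<^bsub>M\<^esub> \<oplus>\<^bsub>M\<^esub> x = x" by (simp add: * m(3)[symmetric] m(4)[symmetric])
      show "\<exists>y\<in>carrier M. y \<oplus>\<^bsub>M\<^esub> x = \<zero>\<^bsub>M\<^esub>"
        by (rule bexI[of _ "\<phi> (\<lambda>j. - u j)"]) (simp_all add: * m(3)[symmetric] m(4)[symmetric] m(1))
    qed
    show "module_axioms R M"
    proof
      fix a b x y assume "a \<in> carrier R" "b \<in> carrier R" "x \<in> carrier M" "y \<in> carrier M"
      then obtain c d u v where *: "a = \<rho> c" "b = \<rho> d" "x = \<phi> u" "y = \<phi> v" using rep repR by metis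
      show "a \<odot>\<^bsub>M\<^esub> x \<in> carrier M" "(a \<oplus>\<^bsub>R\<^esub> b) \<odot>\<^bsub>M\<^esub> x = a \<odot>\<^bsub>M\<^esub> x \<oplus>\<^bsub>M\<^esub> b \<odot>\<^bsub>M\<^esub> x"
        "a \<odot>\<^bsub>M\<^esub> (x \<oplus>\<^bsub>M\<^esub> y) = a \<odot>\<^bsub>M\<^esub> x \<oplus>\<^bsub>M\<^esub> a \<odot>\<^bsub>M\<^esub> y"
        "(a \<otimes>\<^bsub>R\<^esub> b) \<odot>\<^bsub>M\<^esub> x = a \<odot>\<^bsub>M\<^esub> (b \<odot>\<^bsub>M\<^esub> x)"
        by (simp_all add: * m(1) m(5)[symmetric] m(4)[symmetric] R(3,4)[symmetric] algebra_simps)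
    next
      fix x assume "x \<in> carrier M"
      then obtain u where *: "x = \<phi> u" using rep by metis
      show "\<one>\<^bsub>R\<^esub> \<odot>\<^bsub>M\<^esub> x = x" by (simp add: * R(5)[symmetric] m(5)[symmetric])
    qed
  qed
qed


text \<open>Relations of the direct sum of the Z_p/p^(r_j). Coordinates beyond the list are
  unconstrained and hence vanish in the quotient. Exponents 0 are allowed, which lets a module with
  s(H) at most n be described by a list of length exactly n.\<close>

definition Lr :: "enat list \<Rightarrow> (nat \<Rightarrow> 'p :: prime_card padic_int) set" where
  "Lr rs = {v. \<forall>j < length rs. padic_ppow (rs ! j) dvd v j}"

definition has_type :: "('p :: prime_card padic_int, 'a) module \<Rightarrow> enat list \<Rightarrow> bool" where
  "has_type M rs \<longleftrightarrow> (\<exists>\<phi>. pres (\<lambda>a. a) M (Lr rs) \<phi>)"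

text \<open>The isomorphism invariant: factors Z_p/p^0 are trivial, and the order of the factors is
  immaterial.\<close>

definition nzm :: "enat list \<Rightarrow> enat multiset" where
  "nzm rs = filter_mset (\<lambda>r. r \<noteq> 0) (mset rs)"

text \<open>The dimension over F_p of p^k M / p^(k+1) M for a module M of type
  \<open>rs\<close>.\<close>

definition cnt :: "nat \<Rightarrow> enat list \<Rightarrow> nat" where
  "cnt k rs = card {j. j < length rs \<and> enat k < rs ! j}"

section \<open>Uniqueness of the exponents\<close>

lemma ppow_dvd_ppow: "r \<le> enat k \<Longrightarrow> padic_ppow r dvd (padic_p ^ k :: 'p :: prime_card padic_int)"
  by (cases r) (auto simp: le_imp_power_dvd)

lemma ppow_Suc_dvd: "enat k < r \<Longrightarrow> padic_ppow r dvd (x :: 'p :: prime_card padic_int) \<Longrightarrow> padic_p ^ Suc k dvd x"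
proof (cases r)
  case (enat i)
  assume "enat k < r" "padic_ppow r dvd x"
  then show ?thesis using enat dvd_trans[OF le_imp_power_dvd[of "Suc k" i padic_p]] by simp
qed simp

text \<open>Counting digit vectors: a family that is independent modulo $p$ in
  $p^kM/p^{k+1}M$ injects, digit by digit, into the coordinates of exponent greater than $k$.\<close>

lemma indep_card:
  fixes \<psi> :: "(nat \<Rightarrow> 'p :: prime_card padic_int) \<Rightarrow> 'a" and J :: "nat set"
  assumes \<psi>: "pres \<rho> M (Lr ss) \<psi>"
    and \<phi>: "\<And>v. \<phi> v \<in> carrier M"
      "\<And>a b v w. \<phi> (\<lambda>j. a * v j + b * w j) = \<rho> a \<odot>\<^bsub>M\<^esub> \<phi> v \<oplus>\<^bsub>M\<^esub> \<rho> b \<odot>\<^bsub>M\<^esub> \<phi> w"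
    and indep: "\<And>u x j. x \<in> carrier M \<Longrightarrow>
      \<rho> (padic_p ^ k) \<odot>\<^bsub>M\<^esub> \<phi> u = \<rho> (padic_p ^ Suc k) \<odot>\<^bsub>M\<^esub> x \<Longrightarrow> j \<in> J \<Longrightarrow> padic_p dvd u j"
    and J: "finite J"
  shows "card J \<le> cnt k ss"
proof -
  note P = presD[OF \<psi>]
  define J' where "J' = {j. j < length ss \<and> enat k < ss ! j}"
  have J': "finite J'" unfolding J'_def by simp
  define u where "u d j = (if j \<in> J then of_nat (d j) else 0 :: 'p padic_int)" for d :: "nat \<Rightarrow> nat" and j :: nat
  have "\<forall>d. \<exists>v. \<phi> (u d) = \<psi> v" using P(2)[OF \<phi>(1)] by blast
  then obtain w where w: "\<And>d. \<phi> (u d) = \<psi> (w d)" by metis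
  obtain dig :: "'p padic_int \<Rightarrow> nat" where dig: "\<And>x. dig x < CARD('p)" "\<And>x. padic_p dvd x - of_nat (dig x)"
    using padic_digit by metis
  \<comment> \<open>Keeps the digits modulo p of those coordinates that survive multiplication by
    p^k. Injectivity compares p^(card J) with p^(card J').\<close>
  define G where "G d = restrict (\<lambda>j. dig (w d j)) J'" for d
  have inj: "inj_on G (J \<rightarrow>\<^sub>E {..<CARD('p)})"
  proof (rule inj_onI)
    fix d d' assume d: "d \<in> J \<rightarrow>\<^sub>E {..<CARD('p)}" "d' \<in> J \<rightarrow>\<^sub>E {..<CARD('p)}" and eq: "G d = G d'"
    have "padic_p dvd w d j - w d' j" if "j \<in> J'" for j
    proof -
      have "dig (w d j) = dig (w d' j)" using fun_cong[OF eq, of j] that by (simp add: G_def)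
      then show ?thesis using dvd_diff[OF dig(2)[of "w d j"] dig(2)[of "w d' j"]] by simp
    qed
    then obtain z' where z': "\<And>j. j \<in> J' \<Longrightarrow> w d j - w d' j = padic_p * z' j"
      unfolding dvd_def by metis
    define z where "z j = (if j \<in> J' then z' j else 0)" for j
    \<comment> \<open>Where the exponent is at most k, the factor p^k already gives a relation; in
      the remaining coordinates equal digits supply one more factor p.\<close>
    have mem: "(\<lambda>j. padic_p ^ k * (w d j - w d' j) - padic_p ^ Suc k * z j) \<in> Lr ss"
    proof -
      have "padic_ppow (ss ! j) dvd padic_p ^ k * (w d j - w d' j) - padic_p ^ Suc k * z j"
        if "j < length ss" for j
      proof (cases "j \<in> J'")
        case True
        then show ?thesis by (simp add: z_def z' algebra_simps)
      next
        case False
        then have "ss ! j \<le> enat k" using that by (simp add: J'_def not_less)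
        then show ?thesis using False by (simp add: z_def dvd_mult2[OF ppow_dvd_ppow])
      qed
      then show ?thesis by (simp add: Lr_def)
    qed
    have diff: "\<phi> (\<lambda>j. u d j - u d' j) = \<psi> (\<lambda>j. w d j - w d' j)"
      using \<phi>(2)[of 1 "u d" "-1" "u d'"] pres_comb[OF \<psi>, of 1 "w d" "-1" "w d'"] w by simp
    have "\<rho> (padic_p ^ k) \<odot>\<^bsub>M\<^esub> \<psi> (\<lambda>j. w d j - w d' j) = \<rho> (padic_p ^ Suc k) \<odot>\<^bsub>M\<^esub> \<psi> z"
      unfolding P(5)[symmetric] P(6) using mem .
    then have "\<rho> (padic_p ^ k) \<odot>\<^bsub>M\<^esub> \<phi> (\<lambda>j. u d j - u d' j) = \<rho> (padic_p ^ Suc k) \<odot>\<^bsub>M\<^esub> \<psi> z"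
      unfolding diff .
    from indep[OF P(1) this] have ind: "j \<in> J \<Longrightarrow> padic_p dvd u d j - u d' j" for j .
    show "d = d'"
    proof (rule PiE_ext[OF d])
      fix j assume j: "j \<in> J"
      have "d j < CARD('p)" "d' j < CARD('p)" using d j by (auto dest: PiE_mem)
      then show "d j = d' j"
        using p_dvd_of_nat_diff[of "d j" "d' j"] ind[OF j] j by (simp add: u_def)
    qed
  qed
  have "G ` (J \<rightarrow>\<^sub>E {..<CARD('p)}) \<subseteq> (J' \<rightarrow>\<^sub>E {..<CARD('p)})"
    using dig(1) by (auto simp: G_def)
  then have "card (J \<rightarrow>\<^sub>E {..<CARD('p)}) \<le> card (J' \<rightarrow>\<^sub>E {..<CARD('p)})"
    by (intro card_inj_on_le[OF inj]) (auto intro: finite_PiE J')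
  then have "CARD('p) ^ card J \<le> CARD('p) ^ card J'" using J J' by (simp add: card_PiE)
  then have "card J \<le> card J'"
    using prime_gt_1_nat[OF prime_card[where 'a = 'p]] by simp
  then show ?thesis by (simp add: cnt_def J'_def)
qed

text \<open>In a coordinate of exponent above k all relations are divisible by p^(k+1), so p^k can
  be cancelled from the equation.\<close>

lemma pres_indep:
  fixes \<phi> :: "(nat \<Rightarrow> 'p :: prime_card padic_int) \<Rightarrow> 'a"
  assumes \<phi>: "pres \<rho> M (Lr rs) \<phi>"
    and x: "x \<in> carrier M" "\<rho> (padic_p ^ k) \<odot>\<^bsub>M\<^esub> \<phi> u = \<rho> (padic_p ^ Suc k) \<odot>\<^bsub>M\<^esub> x"
    and j: "j < length rs" "enat k < rs ! j"
  shows "padic_p dvd u j"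
proof -
  note P = presD[OF \<phi>]
  obtain z where z: "x = \<phi> z" using P(2) x by blast
  have "(\<lambda>j. padic_p ^ k * u j - padic_p ^ Suc k * z j) \<in> Lr rs"
    using x(2) unfolding z P(5)[symmetric] P(6) .
  then have "padic_p ^ Suc k dvd padic_p ^ k * u j - padic_p ^ Suc k * z j"
    using j unfolding Lr_def by (blast intro: ppow_Suc_dvd)
  then have "padic_p ^ k * padic_p dvd padic_p ^ k * (u j - padic_p * z j)"
    by (simp add: algebra_simps)
  then have "padic_p dvd u j - padic_p * z j" by simp
  then show ?thesis using dvd_diff_commute by (metis dvd_triv_left dvd_diff_left_iff diff_add_cancel dvd_add)
qed

text \<open>The scalar map \<open>\<rho>\<close> is arbitrary, so uniqueness of the exponents is
  obtained at once over Z_p, F_p and Z_p/p^2.\<close>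

lemma cnt_unique:
  fixes M :: "('r, 'a) module" and \<rho> :: "'p :: prime_card padic_int \<Rightarrow> 'r"
  assumes "pres \<rho> M (Lr rs) \<phi>" "pres \<rho> M (Lr ss) \<psi>"
  shows "cnt k rs = cnt k ss"
proof -
  have *: "cnt k rs \<le> cnt k ss" if "pres \<rho> M (Lr rs) \<phi>" "pres \<rho> M (Lr ss) \<psi>"
    for rs ss and \<phi> \<psi> :: "(nat \<Rightarrow> 'p padic_int) \<Rightarrow> 'a"
    unfolding cnt_def[of k rs]
    by (rule indep_card[OF that(2) presD(1)[OF that(1)] pres_comb[OF that(1)]])
       (auto intro: pres_indep[OF that(1)])
  show ?thesis using *[OF assms] *[OF assms(2,1)] by simp
qed

lemma cnt_eq: "cnt k rs = size (filter_mset (\<lambda>r. enat k < r) (mset rs))"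
  unfolding cnt_def mset_filter[symmetric] size_mset length_filter_conv_card ..

lemma count_cnt: "count (mset rs) (enat (Suc k)) + cnt (Suc k) rs = cnt k rs"
proof -
  have "filter_mset (\<lambda>r. enat k < r) A = filter_mset (\<lambda>r. r = enat (Suc k)) A + filter_mset (\<lambda>r. enat (Suc k) < r) A"
    for A
  proof (rule multiset_eqI)
    fix r
    show "count (filter_mset (\<lambda>r. enat k < r) A) r =
        count (filter_mset (\<lambda>r. r = enat (Suc k)) A + filter_mset (\<lambda>r. enat (Suc k) < r) A) r"
      by (cases r) auto
  qed
  from arg_cong[OF this[of "mset rs"], of size] show ?thesis
    by (simp add: cnt_eq filter_eq_replicate_mset)
qed

lemma cnt_infinity:
  assumes "\<And>r. r \<in> set rs \<Longrightarrow> r = \<infinity> \<or> r \<le> enat k"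
  shows "count (mset rs) \<infinity> = cnt k rs"
proof -
  have "filter_mset (\<lambda>r. enat k < r) (mset rs) = filter_mset (\<lambda>r. r = \<infinity>) (mset rs)"
    using assms by (intro filter_mset_cong) (auto simp: not_less[symmetric])
  then show ?thesis by (simp add: cnt_eq filter_eq_replicate_mset)
qed

lemma finite_enat_bound:
  assumes "finite A"
  obtains k where "\<And>r. r \<in> A \<Longrightarrow> r = \<infinity> \<or> r \<le> enat k"
proof -
  define k where "k = Max (insert 0 (the_enat ` A))"
  have "r \<le> enat k" if "r \<in> A" "r \<noteq> \<infinity>" for r
  proof -
    have "the_enat r \<le> k" unfolding k_def using that assms by (intro Max_ge) auto
    then show ?thesis using that by auto
  qed
  then show ?thesis using that by blast
qed

text \<open>The multiplicity of k + 1 is a difference of consecutive values of \<open>cnt\<close>,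
  and that of \<open>\<infinity>\<close> is \<open>cnt\<close> beyond all finite exponents. The
  multiplicity of 0 is not determined by \<open>cnt\<close>, hence \<open>nzm\<close>.\<close>

lemma nzm_eqI:
  assumes "\<And>k. cnt k rs = cnt k ss"
  shows "nzm rs = nzm ss"
proof -
  obtain k where k: "\<And>r. r \<in> set (rs @ ss) \<Longrightarrow> r = \<infinity> \<or> r \<le> enat k"
    using finite_enat_bound[of "set (rs @ ss)"] by blast
  have inf: "count (mset rs) \<infinity> = count (mset ss) \<infinity>"
    using cnt_infinity[of rs k] cnt_infinity[of ss k] k assms by simp
  show ?thesis
  proof (rule multiset_eqI)
    fix r
    show "count (nzm rs) r = count (nzm ss) r"
    proof (cases r)
      case (enat i)
      then show ?thesis
        using count_cnt[of rs "i - 1"] count_cnt[of ss "i - 1"] assms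
        by (cases i) (auto simp: nzm_def zero_enat_def)
    qed (use inf in \<open>simp add: nzm_def\<close>)
  qed
qed

section \<open>Changing the exponent list, and existence of the exponents\<close>

lemma pres_perm:
  assumes "pres \<rho> M (Lr rs) \<phi>" "mset rs = mset ss"
  shows "\<exists>\<phi>. pres \<rho> M (Lr ss) \<phi>"
proof -
  obtain \<pi> where \<pi>: "\<pi> permutes {..<length rs}" "permute_list \<pi> rs = ss"
    using mset_eq_permutation[of ss rs] assms(2) by metis
  define T where "T v = (\<lambda>j. v (inv_into UNIV \<pi> j))" for v :: "nat \<Rightarrow> 'a padic_int"
  have "flin T" by (simp add: T_def flin_def)
  moreover have "surj T"
  proof (rule surjI)
    show "T (\<lambda>j. v (\<pi> j)) = v" for v
      using \<pi>(1) by (simp add: T_def permutes_inverses)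
  qed
  moreover have "{v. T v \<in> Lr rs} = Lr ss"
  proof -
    have len: "length ss = length rs" using \<pi>(2) by auto
    have ss: "ss ! i = rs ! \<pi> i" if "i < length rs" for i
      using permute_list_nth[OF \<pi>(1) that] \<pi>(2) by simp
    have "T v \<in> Lr rs \<longleftrightarrow> v \<in> Lr ss" for v
    proof -
      have "T v \<in> Lr rs \<longleftrightarrow> (\<forall>j\<in>{..<length rs}. padic_ppow (rs ! j) dvd v (inv_into UNIV \<pi> j))"
        by (auto simp: Lr_def T_def)
      also have "\<dots> \<longleftrightarrow> (\<forall>i\<in>{..<length rs}. padic_ppow (rs ! \<pi> i) dvd v (inv_into UNIV \<pi> (\<pi> i)))"
        using permutes_image[OF \<pi>(1)] by (metis (no_types, lifting) imageE imageI)
      also have "\<dots> \<longleftrightarrow> v \<in> Lr ss"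
        using ss by (auto simp: permutes_inverses[OF \<pi>(1)] Lr_def len)
      finally show ?thesis .
    qed
    then show ?thesis by blast
  qed
  ultimately show ?thesis using pres_comp[OF assms(1), of T] by auto
qed

lemma Lr_append_0: "Lr (rs @ replicate k 0) = Lr rs"
proof -
  have "padic_ppow ((rs @ replicate k 0) ! j) dvd (x :: 'a padic_int)"
    if "\<not> j < length rs" "j < length rs + k" for j x
    using that by (simp add: nth_append)
  then show ?thesis
    unfolding Lr_def by (auto simp: nth_append)
qed

lemma nzm_rep: "mset (filter (\<lambda>r. r \<noteq> 0) rs @ replicate (length rs - length (filter (\<lambda>r. r \<noteq> 0) rs)) 0) = mset rs"
proof -
  have "length rs = length (filter (\<lambda>r. r \<noteq> 0) rs) + count (mset rs) 0"
    by (induction rs) auto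
  then show ?thesis by (intro multiset_eqI) (auto simp: count_mset)
qed

text \<open>Zeros are moved to the end and dropped, so that lists of different lengths can be
  compared.\<close>

lemma pres_cong:
  assumes "pres \<rho> M (Lr rs) \<phi>" "nzm rs = nzm ss"
  shows "\<exists>\<phi>. pres \<rho> M (Lr ss) \<phi>"
proof -
  let ?f = "filter (\<lambda>r. r \<noteq> (0 :: enat))"
  obtain \<phi>1 where "pres \<rho> M (Lr (?f rs)) \<phi>1"
    using pres_perm[OF assms(1) nzm_rep[symmetric]] unfolding Lr_append_0 by blast
  moreover have "mset (?f rs) = mset (?f ss)" using assms(2) by (simp add: nzm_def)
  ultimately obtain \<phi>2 where "pres \<rho> M (Lr (?f ss)) \<phi>2" using pres_perm by blast
  then show ?thesis using pres_perm[of \<rho> M _ \<phi>2, OF _ nzm_rep] unfolding Lr_append_0 by blast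
qed

lemma cring_Zp: "cring (Zp :: 'p :: prime_card padic_int ring)"
  by (rule cringI[OF abelian_groupI comm_monoidI]) (auto simp: algebra_simps intro: exI[of _ "- _"])

lemma has_type_cong: "has_type M rs \<Longrightarrow> nzm rs = nzm ss \<Longrightarrow> has_type M ss"
  unfolding has_type_def using pres_cong by blast

lemma has_type_unique: "has_type M rs \<Longrightarrow> has_type M ss \<Longrightarrow> nzm rs = nzm ss"
  unfolding has_type_def using cnt_unique by (blast intro: nzm_eqI)

lemma has_type_iso: "has_type M rs \<Longrightarrow> has_type N rs \<Longrightarrow> mod_iso Zp M N"
  unfolding has_type_def by (auto intro: pres_iso)

lemma has_type_module: "has_type M rs \<Longrightarrow> Module.module Zp M"
  unfolding has_type_def by (auto intro: pres_module[OF _ cring_Zp])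

lemma iso_has_type: "mod_iso Zp M N \<Longrightarrow> Module.module Zp N \<Longrightarrow> has_type M rs \<Longrightarrow> has_type N rs"
  unfolding has_type_def mod_iso_def by (fastforce intro: pres_transfer)

text \<open>Existence half of the structure theorem: the relations among the generators are
  diagonalised by \<open>stacked_basis\<close>. The length of the list is recorded because
  \<open>s_rank_eq\<close> turns it into a lower bound for the size of generating sets.\<close>

lemma spanned_pres:
  fixes M :: "('r, 'a) module" and \<rho> :: "'p :: prime_card padic_int \<Rightarrow> 'r"
  assumes M: "Module.module R M" and G: "finite G" "G \<subseteq> carrier M" "LinearCombinations.module.span R M G = carrier M"
    and R: "carrier R = range \<rho>" "\<And>a b. \<rho> (a + b) = \<rho> a \<oplus>\<^bsub>R\<^esub> \<rho> b"
      "\<And>a b. \<rho> (a * b) = \<rho> a \<otimes>\<^bsub>R\<^esub> \<rho> b" "\<rho> 0 = \<zero>\<^bsub>R\<^esub>"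
  obtains rs \<phi> where "pres \<rho> M (Lr rs) \<phi>" "length rs = card G"
proof -
  interpret M: Module.module R M by fact
  define n where "n = card G"
  obtain idx :: "'a \<Rightarrow> nat" where idx: "bij_betw idx G {..<n}"
    using ex_bij_betw_finite_nat[OF G(1)] by (auto simp: atLeast0LessThan n_def)
  define \<phi> where "\<phi> v = M.lincomb (\<lambda>g. \<rho> (v (idx g))) G" for v :: "nat \<Rightarrow> 'p padic_int"
  have \<rho>: "\<rho> a \<in> carrier R" for a using R(1) by auto
  have sm: "\<rho> a \<odot>\<^bsub>M\<^esub> g \<in> carrier M" if "g \<in> G" for a g using that G(2) \<rho> by auto
  have add: "\<phi> (\<lambda>j. v j + w j) = \<phi> v \<oplus>\<^bsub>M\<^esub> \<phi> w" for v w
  proof -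
    have "\<phi> (\<lambda>j. v j + w j) = (\<Oplus>\<^bsub>M\<^esub>g\<in>G. \<rho> (v (idx g)) \<odot>\<^bsub>M\<^esub> g \<oplus>\<^bsub>M\<^esub> \<rho> (w (idx g)) \<odot>\<^bsub>M\<^esub> g)"
      unfolding \<phi>_def M.lincomb_def R(2)
      by (rule M.finsum_cong') (use G(2) M.smult_l_distr \<rho> in \<open>auto simp: subset_iff\<close>)
    also have "\<dots> = \<phi> v \<oplus>\<^bsub>M\<^esub> \<phi> w"
      unfolding \<phi>_def M.lincomb_def by (rule M.finsum_addf) (use sm in auto)
    finally show ?thesis .
  qed
  have smult: "\<phi> (\<lambda>j. a * v j) = \<rho> a \<odot>\<^bsub>M\<^esub> \<phi> v" for a v
    using M.lincomb_smult[OF G(2), of "\<lambda>g. \<rho> (v (idx g))" "\<rho> a"] \<rho> by (simp add: \<phi>_def R(3))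
  have cl: "\<phi> v \<in> carrier M" for v unfolding \<phi>_def by (rule M.lincomb_closed) (use G \<rho> in auto)
  have zero: "\<phi> (\<lambda>_. 0) = \<zero>\<^bsub>M\<^esub>"
    using smult[of 0 "\<lambda>_. 0"] M.smult_l_null[OF cl] by (simp add: R(4))
  have range: "range \<phi> = carrier M"
  proof
    show "carrier M \<subseteq> range \<phi>"
    proof
      fix x assume "x \<in> carrier M"
      then obtain a where a: "a \<in> G \<rightarrow> carrier R" "x = M.lincomb a G"
        using M.finite_in_span[OF G(1,2)] G(3) by metis
      have "\<forall>g. \<exists>c. g \<in> G \<longrightarrow> a g = \<rho> c" using a(1) R(1) by auto
      then obtain c where c: "\<And>g. g \<in> G \<Longrightarrow> a g = \<rho> (c g)" by metis
      have "\<phi> (\<lambda>j. c (the_inv_into G idx j)) = M.lincomb a G"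
        unfolding \<phi>_def using idx G(2) \<rho>
        by (intro M.lincomb_cong) (auto simp: the_inv_into_f_f bij_betw_def c)
      then show "x \<in> range \<phi>" using a(2) by (metis rangeI)
    qed
  qed (use cl in auto)
  define L where "L = {v. \<phi> v = \<zero>\<^bsub>M\<^esub>}"
  have ker: "\<phi> v = \<phi> w \<longleftrightarrow> (\<lambda>j. v j - w j) \<in> L" for v w
  proof -
    have "\<phi> (\<lambda>j. v j - w j) \<oplus>\<^bsub>M\<^esub> \<phi> w = \<phi> v" using add[of "\<lambda>j. v j - w j" w] by simp
    moreover have "\<phi> (\<lambda>j. v j - w j) \<oplus>\<^bsub>M\<^esub> \<phi> w = \<zero>\<^bsub>M\<^esub> \<oplus>\<^bsub>M\<^esub> \<phi> w \<longleftrightarrow> \<phi> (\<lambda>j. v j - w j) = \<zero>\<^bsub>M\<^esub>"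
      by (rule M.add.right_cancel) (simp_all add: cl)
    moreover have "\<zero>\<^bsub>M\<^esub> \<oplus>\<^bsub>M\<^esub> \<phi> w = \<phi> w" by (simp add: cl)
    ultimately show ?thesis unfolding L_def by auto
  qed
  have pr: "pres \<rho> M L \<phi>"
    using range zero add smult ker by (simp add: pres_def)
  have loc: "w \<in> L" if "v \<in> L" "\<And>j. j \<in> {..<n} \<Longrightarrow> v j = w j" for v w
  proof -
    have "idx g < n" if "g \<in> G" for g using bij_betwE[OF idx] that by auto
    then have "\<phi> w = \<phi> v" unfolding \<phi>_def using that(2) G(2) \<rho>
      by (intro M.lincomb_cong) auto
    then show ?thesis using that(1) by (simp add: L_def)
  qed
  obtain T T' r where T: "autom {..<n} T T'"
    and r: "\<And>v. v \<in> L \<longleftrightarrow> (\<forall>j\<in>{..<n}. padic_ppow (r j) dvd T v j)"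
    by (rule stacked_basis[OF finite_lessThan pres_submod[OF pr] loc]) (assumption | rule that)+
  have "pres \<rho> M (Lr (map r [0..<n])) (\<lambda>v. \<phi> (T' v))"
    by (rule pres_autom[OF pr T]) (auto simp: r Lr_def)
  then show ?thesis using that by (simp add: n_def)
qed

lemma fin_gen_has_type:
  fixes M :: "('p :: prime_card padic_int, 'a) module"
  assumes "fin_gen_module Zp M"
  obtains rs where "has_type M rs"
proof -
  obtain G where G: "finite G" "G \<subseteq> carrier M" "LinearCombinations.module.span Zp M G = carrier M"
    and M: "Module.module Zp M"
    using assms unfolding fin_gen_module_def by blast
  show ?thesis
  proof (rule spanned_pres[OF M G, of "\<lambda>a. a"])
    show "pres (\<lambda>a. a) M (Lr rs) \<phi> \<Longrightarrow> thesis" for rs \<phi>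
      using that unfolding has_type_def by blast
  qed auto
qed

lemma pres_span:
  fixes M :: "('r, 'a) module" and \<rho> :: "'p :: prime_card padic_int \<Rightarrow> 'r"
  assumes \<phi>: "pres \<rho> M (Lr rs) \<phi>" and M: "Module.module R M" and R: "carrier R = range \<rho>"
  defines "G \<equiv> (\<lambda>i. \<phi> (\<lambda>j. if j = i then 1 else 0)) ` {..<length rs}"
  shows "finite G" "G \<subseteq> carrier M" "LinearCombinations.module.span R M G = carrier M" "card G \<le> length rs"
proof -
  interpret M: Module.module R M by fact
  note P = presD[OF \<phi>]
  show fin: "finite G" and G: "G \<subseteq> carrier M" and "card G \<le> length rs"
    unfolding G_def using P(1) card_image_le[of "{..<length rs}"] by auto
  have sub: "LinearCombinations.submodule R (M.span G) M" by (rule M.span_is_submodule[OF G])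
  \<comment> \<open>Induction on the number of coordinates kept; those past the length of
    \<open>rs\<close> vanish in \<open>M\<close>.\<close>
  have "\<phi> (\<lambda>j. if j < k then v j else 0) \<in> M.span G" if "k \<le> length rs" for k v
    using that
  proof (induction k)
    case 0
    then show ?case using LinearCombinations.submodule.zero_closed[OF sub] P(3) by simp
  next
    case (Suc k)
    have "\<phi> (\<lambda>j. if j = k then 1 else 0) \<in> M.span G"
      by (rule subsetD[OF M.in_own_span[OF G]]) (use Suc in \<open>auto simp: G_def\<close>)
    then have "\<rho> (v k) \<odot>\<^bsub>M\<^esub> \<phi> (\<lambda>j. if j = k then 1 else 0) \<in> M.span G"
      using LinearCombinations.submodule.smult_closed[OF sub] R by blast
    then have *: "\<phi> (\<lambda>j. if j < k then v j else 0) \<oplus>\<^bsub>M\<^esub> \<rho> (v k) \<odot>\<^bsub>M\<^esub> \<phi> (\<lambda>j. if j = k then 1 else 0) \<in> M.span G"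
      using LinearCombinations.submodule.m_closed[OF sub] Suc by simp
    have "(\<lambda>j. if j < Suc k then v j else 0) =
        (\<lambda>j. (if j < k then v j else 0) + v k * (if j = k then 1 else 0))"
      by (auto simp: fun_eq_iff less_Suc_eq)
    then show ?case using * by (simp only: P(4,5))
  qed
  then have "\<phi> (\<lambda>j. if j < length rs then v j else 0) \<in> M.span G" for v by blast
  moreover have "\<phi> (\<lambda>j. if j < length rs then v j else 0) = \<phi> v" for v
    unfolding P(6) by (simp add: Lr_def)
  ultimately have "carrier M \<subseteq> M.span G" using P(2) by (metis subsetI)
  then show "M.span G = carrier M" using M.span_is_subset2[OF G] by blast
qed

lemma has_type_direct_sum:
  fixes M :: "('p :: prime_card padic_int, 'a) module" and N :: "('p padic_int, 'b) module"
  assumes "has_type M rs" "has_type N ss"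
  shows "has_type (direct_sum M N) (rs @ ss)"
proof -
  obtain \<phi> \<psi> where \<phi>: "pres (\<lambda>a. a) M (Lr rs) \<phi>" and \<psi>: "pres (\<lambda>a. a) N (Lr ss) \<psi>"
    using assms unfolding has_type_def by blast
  note m = presD[OF \<phi>] and n = presD[OF \<psi>]
  define l where "l = length rs"
  define \<chi> where "\<chi> v = (\<phi> v, \<psi> (\<lambda>j. v (j + l)))" for v
  have locM: "\<phi> v = \<phi> w" if "\<And>j. j < l \<Longrightarrow> v j = w j" for v w
    unfolding m(6) using that by (simp add: Lr_def l_def)
  have "range \<chi> = carrier M \<times> carrier N"
  proof (intro equalityI subsetI)
    fix x assume "x \<in> carrier M \<times> carrier N"
    then obtain v w where x: "x = (\<phi> v, \<psi> w)" using m(2) n(2) by (metis SigmaE)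
    let ?u = "\<lambda>j. if j < l then v j else w (j - l)"
    have "\<phi> ?u = \<phi> v" by (rule locM) simp
    then have "\<chi> ?u = x" unfolding \<chi>_def x by simp
    then show "x \<in> range \<chi>" by (metis rangeI)
  qed (auto simp: \<chi>_def m n)
  moreover have "\<chi> v = \<chi> w \<longleftrightarrow> (\<lambda>j. v j - w j) \<in> Lr (rs @ ss)" for v w
  proof -
    have "(\<lambda>j. v j - w j) \<in> Lr (rs @ ss) \<longleftrightarrow> (\<lambda>j. v j - w j) \<in> Lr rs \<and> (\<lambda>j. v (j + l) - w (j + l)) \<in> Lr ss"
    proof -
      have "(\<forall>j<length rs + length ss. P j) \<longleftrightarrow> (\<forall>j<length rs. P j) \<and> (\<forall>j<length ss. P (j + length rs))" for P
      proof (intro iffI allI impI)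
        fix j assume *: "(\<forall>j<length rs. P j) \<and> (\<forall>j<length ss. P (j + length rs))" "j < length rs + length ss"
        show "P j"
        proof (cases "j < length rs")
          case False
          then show ?thesis using *(1)[THEN conjunct2, rule_format, of "j - length rs"] *(2) by simp
        qed (use * in simp)
      qed auto
      then show ?thesis by (simp add: Lr_def l_def nth_append add.commute)
    qed
    then show ?thesis by (simp add: \<chi>_def m(6) n(6))
  qed
  ultimately have "pres (\<lambda>a. a) (direct_sum M N) (Lr (rs @ ss)) \<chi>"
    by (simp add: pres_def direct_sum_def \<chi>_def m(3,4,5) n(3,4,5))
  then show ?thesis unfolding has_type_def by blast
qed


section \<open>Quotients\<close>

text \<open>Serves as the scalar map \<open>\<rho>\<close> of presentations over the quotient
  ring.\<close>

definition crep :: "'p :: prime_card padic_int \<Rightarrow> 'p padic_int \<Rightarrow> 'p padic_int set" where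
  "crep q a = PIdl\<^bsub>Zp\<^esub> q +>\<^bsub>Zp\<^esub> a"

lemma PIdl_eq: "PIdl\<^bsub>Zp\<^esub> q = {x. (q :: 'p :: prime_card padic_int) dvd x}"
  by (auto simp: cgenideal_def dvd_def mult.commute)

lemma crep_eq: "crep q a = {c. q dvd c - a}"
proof -
  have "c \<in> crep q a \<longleftrightarrow> q dvd c - a" for c
    unfolding crep_def PIdl_eq a_r_coset_def' by (auto intro!: exI[of _ "c - a"])
  then show ?thesis by blast
qed

lemma crep_eq_iff: "crep q a = crep q b \<longleftrightarrow> q dvd a - b"
proof
  assume "crep q a = crep q b"
  moreover have "a \<in> crep q a" by (simp add: crep_eq)
  ultimately show "q dvd a - b" by (simp add: crep_eq)
next
  assume d: "q dvd a - b"
  have "q dvd c - a \<longleftrightarrow> q dvd c - b" for c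
    using dvd_add[OF _ d, of "c - a"] dvd_diff[OF _ d, of "c - b"] by auto
  then show "crep q a = crep q b" by (simp add: crep_eq)
qed

lemma ideal_Zp: "ideal (PIdl\<^bsub>Zp\<^esub> (q :: 'p :: prime_card padic_int)) Zp"
  by (rule cring.cgenideal_ideal[OF cring_Zp]) simp

lemma cring_quot: "cring (Zp Quot (PIdl\<^bsub>Zp\<^esub> (q :: 'p :: prime_card padic_int)))"
  by (rule ideal.quotient_is_cring[OF ideal_Zp cring_Zp])

lemma crep_hom: "crep q \<in> Ring.ring_hom Zp (Zp Quot (PIdl\<^bsub>Zp\<^esub> (q :: 'p :: prime_card padic_int)))"
  using ideal.rcos_ring_hom[OF ideal_Zp, of q] unfolding crep_def .

lemma crep_ring:
  fixes q :: "'p :: prime_card padic_int"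
  defines "R \<equiv> Zp Quot (PIdl\<^bsub>Zp\<^esub> q)"
  shows "carrier R = range (crep q)" "crep q (a + b) = crep q a \<oplus>\<^bsub>R\<^esub> crep q b"
    "crep q (a * b) = crep q a \<otimes>\<^bsub>R\<^esub> crep q b" "crep q 1 = \<one>\<^bsub>R\<^esub>" "crep q 0 = \<zero>\<^bsub>R\<^esub>"
proof -
  show "carrier R = range (crep q)"
    unfolding R_def FactRing_def A_RCOSETS_def' by (auto simp: crep_def)
  show "crep q (a + b) = crep q a \<oplus>\<^bsub>R\<^esub> crep q b"
    "crep q (a * b) = crep q a \<otimes>\<^bsub>R\<^esub> crep q b" "crep q 1 = \<one>\<^bsub>R\<^esub>"
    using ring_hom_add[OF crep_hom, of a b] ring_hom_mult[OF crep_hom, of a b] ring_hom_one[OF crep_hom]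
    unfolding R_def by simp_all
  have "crep q 0 = {x. q dvd x}" by (simp add: crep_eq)
  then show "crep q 0 = \<zero>\<^bsub>R\<^esub>" unfolding R_def FactRing_def by (simp add: PIdl_eq)
qed

lemma crep_finsum:
  fixes q :: "'p :: prime_card padic_int"
  shows "finite A \<Longrightarrow> crep q (sum f A) = (\<Oplus>\<^bsub>Zp Quot (PIdl\<^bsub>Zp\<^esub> q)\<^esub> j\<in>A. crep q (f j))"
proof (induction A rule: finite_induct)
  case empty
  interpret cring "Zp Quot (PIdl\<^bsub>Zp\<^esub> q)" by (rule cring_quot)
  show ?case by (simp add: crep_ring(5))
next
  case (insert x A)
  interpret cring "Zp Quot (PIdl\<^bsub>Zp\<^esub> q)" by (rule cring_quot)
  have cl: "crep q a \<in> carrier (Zp Quot (PIdl\<^bsub>Zp\<^esub> q))" for a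
    using crep_ring(1)[of q] by auto
  show ?case
    using insert finsum_insert[of A x "\<lambda>j. crep q (f j)"] cl by (simp add: crep_ring(2))
qed

text \<open>Dividing a presented module by the image of a larger relation set \<open>L\<close> gives
  a module with relations \<open>L\<close>. The records \<open>quot_module\<close> and
  \<open>reduction\<close> have the same kind of cosets and differ only in the scalar
  action.\<close>

context
  fixes \<rho> :: "'p :: prime_card padic_int \<Rightarrow> 'r" and M :: "('r, 'a) module" and L0 L \<pi>
  assumes \<pi>: "pres \<rho> M L0 \<pi>" and L: "submod L" "L0 \<subseteq> L"
begin

lemma coset_image: "(\<pi> ` L) +>\<^bsub>M\<^esub> \<pi> v = \<pi> ` {w. (\<lambda>j. w j - v j) \<in> L}"
proof (intro equalityI subsetI)
  note P = presD[OF \<pi>]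
  fix x assume "x \<in> (\<pi> ` L) +>\<^bsub>M\<^esub> \<pi> v"
  then obtain l where l: "l \<in> L" "x = \<pi> l \<oplus>\<^bsub>M\<^esub> \<pi> v" by (auto simp: a_r_coset_def')
  then have "x = \<pi> (\<lambda>j. l j + v j)" by (simp add: P(4))
  then show "x \<in> \<pi> ` {w. (\<lambda>j. w j - v j) \<in> L}" using l by (auto intro!: image_eqI)
next
  note P = presD[OF \<pi>]
  fix x assume "x \<in> \<pi> ` {w. (\<lambda>j. w j - v j) \<in> L}"
  then obtain w where w: "x = \<pi> w" "(\<lambda>j. w j - v j) \<in> L" by auto
  have "x = \<pi> (\<lambda>j. w j - v j) \<oplus>\<^bsub>M\<^esub> \<pi> v" using P(4)[of "\<lambda>j. w j - v j" v] w(1) by simp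
  then show "x \<in> (\<pi> ` L) +>\<^bsub>M\<^esub> \<pi> v" using w(2) by (auto simp: a_r_coset_def')
qed

lemma coset_eq_iff: "(\<pi> ` L) +>\<^bsub>M\<^esub> \<pi> v = (\<pi> ` L) +>\<^bsub>M\<^esub> \<pi> w \<longleftrightarrow> (\<lambda>j. v j - w j) \<in> L"
proof
  note P = presD[OF \<pi>]
  assume eq: "(\<pi> ` L) +>\<^bsub>M\<^esub> \<pi> v = (\<pi> ` L) +>\<^bsub>M\<^esub> \<pi> w"
  have "\<pi> v \<in> \<pi> ` {u. (\<lambda>j. u j - v j) \<in> L}" using submod_0[OF L(1)] by auto
  then obtain u where u: "\<pi> v = \<pi> u" "(\<lambda>j. u j - w j) \<in> L" using eq unfolding coset_image by auto
  have "(\<lambda>j. v j - u j) \<in> L" using u(1) L(2) unfolding P(6) by auto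
  from submod_add[OF L(1) this u(2)] show "(\<lambda>j. v j - w j) \<in> L" by simp
next
  assume d: "(\<lambda>j. v j - w j) \<in> L"
  have "(\<lambda>j. u j - v j) \<in> L \<longleftrightarrow> (\<lambda>j. u j - w j) \<in> L" for u
    using submod_add[OF L(1) _ d, of "\<lambda>j. u j - v j"] submod_diff[OF L(1) _ d, of "\<lambda>j. u j - w j"] by auto
  then show "(\<pi> ` L) +>\<^bsub>M\<^esub> \<pi> v = (\<pi> ` L) +>\<^bsub>M\<^esub> \<pi> w" unfolding coset_image by simp
qed

lemma coset_add: "set_add M ((\<pi> ` L) +>\<^bsub>M\<^esub> \<pi> v) ((\<pi> ` L) +>\<^bsub>M\<^esub> \<pi> w) = (\<pi> ` L) +>\<^bsub>M\<^esub> \<pi> (\<lambda>j. v j + w j)"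
proof (intro equalityI subsetI)
  note P = presD[OF \<pi>]
  fix x assume "x \<in> set_add M ((\<pi> ` L) +>\<^bsub>M\<^esub> \<pi> v) ((\<pi> ` L) +>\<^bsub>M\<^esub> \<pi> w)"
  then obtain a b where ab: "x = \<pi> a \<oplus>\<^bsub>M\<^esub> \<pi> b" "(\<lambda>j. a j - v j) \<in> L" "(\<lambda>j. b j - w j) \<in> L"
    by (auto simp: set_add_def' coset_image)
  have "x = \<pi> (\<lambda>j. a j + b j)" by (simp add: ab P(4))
  moreover have "(\<lambda>j. (a j + b j) - (v j + w j)) \<in> L"
    using submod_add[OF L(1) ab(2,3)] by (simp add: algebra_simps)
  ultimately show "x \<in> (\<pi> ` L) +>\<^bsub>M\<^esub> \<pi> (\<lambda>j. v j + w j)" unfolding coset_image by auto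
next
  note P = presD[OF \<pi>]
  fix x assume "x \<in> (\<pi> ` L) +>\<^bsub>M\<^esub> \<pi> (\<lambda>j. v j + w j)"
  then obtain u where u: "x = \<pi> u" "(\<lambda>j. u j - (v j + w j)) \<in> L" unfolding coset_image by auto
  have "x = \<pi> v \<oplus>\<^bsub>M\<^esub> \<pi> (\<lambda>j. u j - v j)" by (simp add: u(1) P(4)[symmetric])
  moreover have "\<pi> v \<in> (\<pi> ` L) +>\<^bsub>M\<^esub> \<pi> v" "\<pi> (\<lambda>j. u j - v j) \<in> (\<pi> ` L) +>\<^bsub>M\<^esub> \<pi> w"
    unfolding coset_image using u(2) submod_0[OF L(1)]
    by (auto simp: algebra_simps intro!: image_eqI[where f = \<pi>])
  ultimately show "x \<in> set_add M ((\<pi> ` L) +>\<^bsub>M\<^esub> \<pi> v) ((\<pi> ` L) +>\<^bsub>M\<^esub> \<pi> w)"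
    unfolding set_add_def' by (intro UN_I) auto
qed

text \<open>Covers both scalar actions: \<open>C\<close> is a single scalar for
  \<open>quot_module\<close> and a whole coset of scalars for \<open>reduction\<close>.\<close>

lemma coset_smult:
  assumes "\<And>c u. c \<in> C \<Longrightarrow> (\<lambda>j. u j - v j) \<in> L \<Longrightarrow> (\<lambda>j. c * u j - a * v j) \<in> L" "C \<noteq> {}"
  shows "(\<Union>c\<in>C. \<Union>x\<in>(\<pi> ` L) +>\<^bsub>M\<^esub> \<pi> v. (\<pi> ` L) +>\<^bsub>M\<^esub> (\<rho> c \<odot>\<^bsub>M\<^esub> x)) = (\<pi> ` L) +>\<^bsub>M\<^esub> \<pi> (\<lambda>j. a * v j)"
proof -
  note P = presD[OF \<pi>]
  have *: "(\<pi> ` L) +>\<^bsub>M\<^esub> (\<rho> c \<odot>\<^bsub>M\<^esub> x) = (\<pi> ` L) +>\<^bsub>M\<^esub> \<pi> (\<lambda>j. a * v j)"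
    if c: "c \<in> C" and x: "x \<in> (\<pi> ` L) +>\<^bsub>M\<^esub> \<pi> v" for c x
  proof -
    obtain u where "x = \<pi> u" "(\<lambda>j. u j - v j) \<in> L" using x unfolding coset_image by auto
    then show ?thesis using assms(1)[OF c] by (simp add: P(5)[symmetric] coset_eq_iff)
  qed
  have "\<pi> v \<in> (\<pi> ` L) +>\<^bsub>M\<^esub> \<pi> v" unfolding coset_image using submod_0[OF L(1)] by auto
  then show ?thesis using * assms(2) by blast
qed

lemma coset_zero: "(\<pi> ` L) = (\<pi> ` L) +>\<^bsub>M\<^esub> \<pi> (\<lambda>_. 0)"
  unfolding coset_image by simp

lemma coset_range: "a_rcosets\<^bsub>M\<^esub> (\<pi> ` L) = range (\<lambda>v. (\<pi> ` L) +>\<^bsub>M\<^esub> \<pi> v)"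
proof -
  have "carrier M = range \<pi>" using \<pi> by (simp add: pres_def)
  then show ?thesis unfolding A_RCOSETS_def' by auto
qed

lemma pres_quot: "pres \<rho> (quot_module M (\<pi> ` L)) L (\<lambda>v. (\<pi> ` L) +>\<^bsub>M\<^esub> \<pi> v)"
proof -
  have "(\<Union>x\<in>(\<pi> ` L) +>\<^bsub>M\<^esub> \<pi> v. (\<pi> ` L) +>\<^bsub>M\<^esub> (\<rho> a \<odot>\<^bsub>M\<^esub> x)) = (\<pi> ` L) +>\<^bsub>M\<^esub> \<pi> (\<lambda>j. a * v j)" for a v
  proof -
    have "(\<lambda>j. a * u j - a * v j) \<in> L" if "(\<lambda>j. u j - v j) \<in> L" for u
      using submod_smult[OF L(1) that, of a] by (simp add: right_diff_distrib)
    then have "(\<Union>c\<in>{a}. \<Union>x\<in>(\<pi> ` L) +>\<^bsub>M\<^esub> \<pi> v. (\<pi> ` L) +>\<^bsub>M\<^esub> (\<rho> c \<odot>\<^bsub>M\<^esub> x)) = (\<pi> ` L) +>\<^bsub>M\<^esub> \<pi> (\<lambda>j. a * v j)"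
      by (intro coset_smult) auto
    then show ?thesis by simp
  qed
  then show ?thesis
    unfolding pres_def quot_module_def by (simp add: coset_range coset_add coset_eq_iff coset_zero[symmetric])
qed

end

lemma submod_Lr: "submod (Lr rs)"
  by (auto simp: submod_def Lr_def)

lemma pres_reduction:
  fixes q :: "'p :: prime_card padic_int"
  assumes \<phi>: "pres (\<lambda>a. a) H L0 \<phi>"
  defines "L \<equiv> {v. \<exists>w. (\<lambda>j. v j - q * w j) \<in> L0}"
  shows "\<exists>\<psi>. pres (crep q) (reduction Zp q H) L \<psi>"
proof -
  note P = presD[OF \<phi>]
  note L0 = pres_submod[OF \<phi>]
  have sub: "submod L"
    unfolding submod_def
  proof (intro conjI ballI allI)
    show "(\<lambda>_. 0) \<in> L" unfolding L_def using submod_0[OF L0] by (auto intro!: exI[of _ "\<lambda>_. 0"])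
    fix v w a b assume "v \<in> L" "w \<in> L"
    then obtain x y where xy: "(\<lambda>j. v j - q * x j) \<in> L0" "(\<lambda>j. w j - q * y j) \<in> L0"
      unfolding L_def by auto
    have "(\<lambda>j. (a * v j + b * w j) - q * (a * x j + b * y j)) \<in> L0"
      using submod_comb[OF L0 xy, of a b] by (simp add: algebra_simps)
    then show "(\<lambda>j. a * v j + b * w j) \<in> L" unfolding L_def by (intro CollectI exI)
  qed
  have sup: "L0 \<subseteq> L" unfolding L_def by (auto intro!: exI[of _ "\<lambda>_. 0"])
  have qL: "(\<lambda>j. q * w j) \<in> L" for w
    unfolding L_def using submod_0[OF L0] by (intro CollectI exI[of _ w]) simp
  have N: "(\<lambda>x. q \<odot>\<^bsub>H\<^esub> x) ` carrier H = \<phi> ` L"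
  proof (intro equalityI subsetI)
    fix y assume "y \<in> (\<lambda>x. q \<odot>\<^bsub>H\<^esub> x) ` carrier H"
    then obtain w where "y = q \<odot>\<^bsub>H\<^esub> \<phi> w" using P(2) by blast
    then show "y \<in> \<phi> ` L" using qL P(5) by (metis image_eqI)
  next
    fix y assume "y \<in> \<phi> ` L"
    then obtain v w where v: "y = \<phi> v" "(\<lambda>j. v j - q * w j) \<in> L0" unfolding L_def by auto
    then have "y = q \<odot>\<^bsub>H\<^esub> \<phi> w" unfolding P(5)[symmetric] v(1) P(6) by simp
    then show "y \<in> (\<lambda>x. q \<odot>\<^bsub>H\<^esub> x) ` carrier H" using P(1) by blast
  qed
  have sm: "(\<Union>c\<in>crep q a. \<Union>x\<in>(\<phi> ` L) +>\<^bsub>H\<^esub> \<phi> v. (\<phi> ` L) +>\<^bsub>H\<^esub> (c \<odot>\<^bsub>H\<^esub> x)) =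
      (\<phi> ` L) +>\<^bsub>H\<^esub> \<phi> (\<lambda>j. a * v j)" for a v
  proof (rule coset_smult[OF \<phi> sub sup])
    fix c u assume "c \<in> crep q a" and u: "(\<lambda>j. u j - v j) \<in> L"
    then obtain b where b: "c - a = q * b" by (auto simp: crep_eq dvd_def)
    have "(\<lambda>j. a * (u j - v j) + 1 * (q * (b * u j))) \<in> L"
      by (rule submod_comb[OF sub u qL])
    moreover have "a * (u j - v j) + 1 * (q * (b * u j)) = c * u j - a * v j" for j
    proof -
      have "q * (b * u j) = (c - a) * u j" by (simp add: b mult.assoc)
      then show ?thesis by (simp add: algebra_simps)
    qed
    ultimately show "(\<lambda>j. c * u j - a * v j) \<in> L" by simp
  next
    have "a \<in> crep q a" by (simp add: crep_eq)
    then show "crep q a \<noteq> {}" by blast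
  qed
  have "pres (crep q) (reduction Zp q H) L (\<lambda>v. (\<phi> ` L) +>\<^bsub>H\<^esub> \<phi> v)"
    unfolding pres_def reduction_def N Let_def
    by (simp add: coset_range[OF \<phi> sub sup] coset_add[OF \<phi> sub sup] coset_eq_iff[OF \<phi> sub sup]
        coset_zero[OF \<phi> sub sup, symmetric] sm)
  then show ?thesis by blast
qed

lemma pres_reduction_Lr:
  fixes H :: "('p :: prime_card padic_int, 'a) module"
  assumes "has_type H rs"
  shows "\<exists>\<psi>. pres (crep (padic_p ^ k)) (reduction Zp (padic_p ^ k) H) (Lr (map (min (enat k)) rs)) \<psi>"
proof -
  obtain \<phi> where \<phi>: "pres (\<lambda>a. a) H (Lr rs) \<phi>" using assms unfolding has_type_def by blast
  \<comment> \<open>The powers p^r and p^k together generate the ideal of p^min(k, r).\<close>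
  have *: "(\<exists>w. padic_ppow r dvd x - padic_p ^ k * w) \<longleftrightarrow> padic_ppow (min (enat k) r) dvd x"
    for r and x :: "'p padic_int"
  proof (cases "r \<le> enat k")
    case True
    then have "padic_ppow r dvd padic_p ^ k * w" for w :: "'p padic_int"
      by (rule dvd_mult2[OF ppow_dvd_ppow])
    then have "padic_ppow r dvd x - padic_p ^ k * w \<longleftrightarrow> padic_ppow r dvd x" for w
      by (simp add: dvd_diff_left_iff)
    then show ?thesis using True by (simp add: min_def)
  next
    case False
    then have d: "padic_p ^ k dvd (padic_ppow r :: 'p padic_int)"
      by (cases r) (auto intro: le_imp_power_dvd)
    have "padic_p ^ k dvd x" if "padic_ppow r dvd x - padic_p ^ k * w" for w
      using dvd_add[OF dvd_trans[OF d that], of "padic_p ^ k * w"] by simp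
    moreover have "\<exists>w. padic_ppow r dvd x - padic_p ^ k * w" if "padic_p ^ k dvd x"
    proof -
      obtain w where "x = padic_p ^ k * w" using \<open>padic_p ^ k dvd x\<close> by (auto simp: dvd_def)
      then have "padic_ppow r dvd x - padic_p ^ k * w" by simp
      then show ?thesis ..
    qed
    ultimately show ?thesis using False by (auto simp: min_def)
  qed
  have "{v. \<exists>w. (\<lambda>j. v j - padic_p ^ k * w j) \<in> Lr rs} = (Lr (map (min (enat k)) rs) :: (nat \<Rightarrow> 'p padic_int) set)" (is "?A = _")
  proof -
    have "v \<in> ?A \<longleftrightarrow> v \<in> Lr (map (min (enat k)) rs)" for v
    proof -
      have "v \<in> ?A \<longleftrightarrow> (\<exists>w. \<forall>j. j < length rs \<longrightarrow> padic_ppow (rs ! j) dvd v j - padic_p ^ k * w j)"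
        by (simp add: Lr_def)
      also have "\<dots> \<longleftrightarrow> (\<forall>j. \<exists>w. j < length rs \<longrightarrow> padic_ppow (rs ! j) dvd v j - padic_p ^ k * w)"
        by (rule choice_iff[symmetric])
      also have "\<dots> \<longleftrightarrow> v \<in> Lr (map (min (enat k)) rs)" using * by (simp add: Lr_def)
      finally show ?thesis .
    qed
    then show ?thesis by blast
  qed
  then show ?thesis using pres_reduction[OF \<phi>, of "padic_p ^ k"] by simp
qed

lemma pres_crep_module: "pres (crep q) M L \<psi> \<Longrightarrow> Module.module (Zp Quot (PIdl\<^bsub>Zp\<^esub> q)) M"
  by (rule pres_module[where \<rho> = "crep q", OF _ cring_quot]) (simp_all add: crep_ring)

text \<open>The locale \<open>vectorspace\<close>, in which \<open>dim\<close> is defined, asks for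
  a field.\<close>

lemma field_quot_p: "field (Zp Quot (PIdl\<^bsub>Zp\<^esub> (padic_p :: 'p :: prime_card padic_int)))"
proof (rule cring.cring_fieldI2[OF cring_quot])
  let ?R = "Zp Quot (PIdl\<^bsub>Zp\<^esub> (padic_p :: 'p padic_int))"
  show "\<zero>\<^bsub>?R\<^esub> \<noteq> \<one>\<^bsub>?R\<^esub>"
    unfolding crep_ring(4,5)[symmetric] crep_eq_iff by (simp add: not_p_dvd_1)
  fix x assume "x \<in> carrier ?R" "x \<noteq> \<zero>\<^bsub>?R\<^esub>"
  note x = this
  obtain a where a1: "x = crep padic_p a" using x(1) unfolding crep_ring(1) by auto
  have "\<not> padic_p dvd a - 0"
    using x(2) unfolding a1 crep_ring(5)[symmetric] crep_eq_iff .
  then have a: "x = crep padic_p a" "\<not> padic_p dvd a" using a1 by simp_all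
  obtain b where "a * b = 1" using unit_if_not_p_dvd[OF a(2)] .
  then have "x \<otimes>\<^bsub>?R\<^esub> crep padic_p b = \<one>\<^bsub>?R\<^esub>" by (simp add: a(1) crep_ring(3,4)[symmetric])
  then show "\<exists>b\<in>carrier ?R. x \<otimes>\<^bsub>?R\<^esub> b = \<one>\<^bsub>?R\<^esub>" unfolding crep_ring(1) by blast
qed

lemma cnt_le_length: "cnt k rs \<le> length rs"
  unfolding cnt_eq by (metis size_filter_mset_lesseq size_mset)

text \<open>\<open>dim\<close> is the least size of a generating set. Without the exponents 0 the
  reduction has type [1, ..., 1] and is generated by the images of the unit vectors; conversely, a
  generating set of size c yields a type of length c, whose \<open>cnt 0\<close> is at most
  c.\<close>

lemma s_rank_eq:
  fixes H :: "('p :: prime_card padic_int, 'a) module"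
  assumes "has_type H rs"
  shows "s_rank H = cnt 0 rs"
proof -
  let ?R = "Zp Quot (PIdl\<^bsub>Zp\<^esub> (padic_p :: 'p padic_int))" and ?V = "reduction Zp padic_p H"
  define fs where "fs = filter (\<lambda>r. r \<noteq> 0) rs"
  have "has_type H fs" by (rule has_type_cong[OF assms]) (simp add: nzm_def fs_def flip: mset_filter)
  then obtain \<psi> where \<psi>: "pres (crep padic_p) ?V (Lr (map (min (enat 1)) fs)) \<psi>"
    using pres_reduction_Lr[of H fs 1] by auto
  have M: "Module.module ?R ?V" by (rule pres_crep_module[OF \<psi>])
  interpret vectorspace ?R ?V
    by (rule vectorspace.intro[OF M field_quot_p])
  have len: "length fs = cnt 0 rs" by (simp add: fs_def cnt_eq flip: size_mset) (simp add: zero_enat_def[symmetric])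
  have c: "cnt 0 (map (min (enat 1)) fs) = length fs"
  proof -
    have "enat 0 < min (enat 1) r" if "r \<in> set fs" for r
    proof -
      have "r \<noteq> 0" using that by (simp add: fs_def)
      then have "0 < r" by simp
      then show ?thesis by (simp add: zero_enat_def)
    qed
    then have "{j. j < length (map (min (enat 1)) fs) \<and> enat 0 < map (min (enat 1)) fs ! j} = {..<length fs}"
      by auto
    then show ?thesis unfolding cnt_def by simp
  qed
  have lower: "length fs \<le> card A" if A: "finite A" "A \<subseteq> carrier ?V" "gen_set A" for A
  proof -
    obtain ss \<chi> where s: "pres (crep padic_p) ?V (Lr ss) \<chi>" "length ss = card A"
      by (rule spanned_pres[where \<rho> = "crep padic_p", OF M A]) (assumption | rule crep_ring that)+
    show ?thesis using cnt_unique[OF \<psi> s(1), of 0] c cnt_le_length[of 0 ss] s(2) by simp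
  qed
  note G = pres_span[OF \<psi> M crep_ring(1)]
  have "dim = length fs"
    unfolding dim_def
  proof (rule Least_equality)
    show "\<exists>A. finite A \<and> card A = length fs \<and> A \<subseteq> carrier ?V \<and> gen_set A"
      using G lower[OF G(1-3)] by (intro exI conjI) (assumption | simp)+
    show "length fs \<le> k" if "\<exists>A. finite A \<and> card A = k \<and> A \<subseteq> carrier ?V \<and> gen_set A" for k
      using that lower by blast
  qed
  then show ?thesis unfolding s_rank_def len .
qed


section \<open>Isomorphism classes\<close>

lemma min_simps_cyc: "(\<lambda>v. v 0) ` Lr [r] = {x :: 'p :: prime_card padic_int. padic_ppow r dvd x}"
  by (auto simp: Lr_def image_iff intro: exI[of _ "\<lambda>_. _"])

lemma pres_cyclic:
  "pres (\<lambda>a. a) (cyclic_module r :: ('p :: prime_card padic_int, _) module) (Lr [r]) (\<lambda>v. crep (padic_ppow r) (v 0))"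
proof -
  let ?M = "\<lparr>carrier = UNIV, monoid.mult = (*), one = 1, zero = 0, add = (+), module.smult = (*)\<rparr>
    :: ('p padic_int, 'p padic_int) module"
  have "surj (\<lambda>v :: nat \<Rightarrow> 'p padic_int. v 0)" by (rule surjI[of _ "\<lambda>x _. x"]) simp
  \<comment> \<open>Z_p itself is the case of exponent \<open>\<infinity>\<close>; the cyclic module
    is then a quotient of it.\<close>
  then have \<pi>: "pres (\<lambda>a. a) ?M (Lr [\<infinity>]) (\<lambda>v. v 0)"
    by (simp add: pres_def Lr_def)
  have "pres (\<lambda>a. a) (quot_module ?M ((\<lambda>v. v 0) ` Lr [r])) (Lr [r])
      (\<lambda>v. ((\<lambda>v. v 0) ` Lr [r]) +>\<^bsub>?M\<^esub> v 0)"
    by (rule pres_quot[OF \<pi> submod_Lr]) (auto simp: Lr_def)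
  moreover have "((\<lambda>v. v 0) ` Lr [r]) +>\<^bsub>?M\<^esub> x = crep (padic_ppow r) x" for x :: "'p padic_int"
    unfolding crep_def min_simps_cyc PIdl_eq a_r_coset_def' by simp
  ultimately show ?thesis
    unfolding cyclic_module_def min_simps_cyc PIdl_eq by simp
qed

lemma cyclic_facts:
  fixes r and a b :: "'p :: prime_card padic_int"
  shows "carrier (cyclic_module r) = range (crep (padic_ppow r :: 'p padic_int))"
    "\<zero>\<^bsub>cyclic_module r\<^esub> = crep (padic_ppow r :: 'p padic_int) 0"
    "crep (padic_ppow r) a \<oplus>\<^bsub>cyclic_module r\<^esub> crep (padic_ppow r) b = crep (padic_ppow r) (a + b)"
    "a \<odot>\<^bsub>cyclic_module r\<^esub> crep (padic_ppow r) b = crep (padic_ppow r) (a * b)"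
proof -
  note P = pres_cyclic[where ?'p = 'p, of r]
  have "range (\<lambda>v :: nat \<Rightarrow> 'p padic_int. crep (padic_ppow r) (v 0)) = range (crep (padic_ppow r))"
    by (auto intro!: image_eqI[of _ _ "\<lambda>_. _"])
  then show "carrier (cyclic_module r) = range (crep (padic_ppow r :: 'p padic_int))"
    using P by (simp add: pres_def)
  show "\<zero>\<^bsub>cyclic_module r\<^esub> = crep (padic_ppow r :: 'p padic_int) 0"
    using presD(3)[OF P] by simp
  show "crep (padic_ppow r) a \<oplus>\<^bsub>cyclic_module r\<^esub> crep (padic_ppow r) b = crep (padic_ppow r) (a + b)"
    using presD(4)[OF P, of "\<lambda>_. a" "\<lambda>_. b"] by simp
  show "a \<odot>\<^bsub>cyclic_module r\<^esub> crep (padic_ppow r) b = crep (padic_ppow r) (a * b)"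
    using presD(5)[OF P, of a "\<lambda>_. b"] by simp
qed

lemma has_type_cyclic: "has_type (cyclic_module r) [r]"
  unfolding has_type_def using pres_cyclic by blast

lemma has_type_cyclic_product:
  assumes es: "distinct es" "set es = {(r, j). 1 \<le> r \<and> j < d r}"
  shows "has_type (cyclic_product d :: ('p :: prime_card padic_int, _) module) (map fst es)"
proof -
  let ?M = "cyclic_product d :: ('p padic_int, _) module"
  define I where "I = {(r, j). 1 \<le> r \<and> j < d r}"
  define n where "n = length es"
  define idx where "idx = the_inv_into {..<n} (\<lambda>k. es ! k)"
  have bij: "bij_betw (\<lambda>k. es ! k) {..<n} I"
    using bij_betw_nth[OF es(1) refl es(2)[symmetric]] by (simp add: n_def I_def)
  have idx: "idx (es ! k) = k" if "k < n" for k
    using that bij unfolding idx_def by (auto simp: bij_betw_def intro: the_inv_into_f_f)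
  have idx': "idx i < n" "es ! idx i = i" if "i \<in> I" for i
    using that bij idx by (auto simp: bij_betw_def)
  define \<phi> where "\<phi> v = (\<lambda>i\<in>I. crep (padic_ppow (fst i)) (v (idx i)))" for v :: "nat \<Rightarrow> 'p padic_int"
  have M: "?M = prod_module I (\<lambda>i. cyclic_module (fst i))"
    unfolding cyclic_product_def I_def by (simp add: case_prod_unfold)
  have "range \<phi> = carrier ?M"
  proof (intro equalityI subsetI)
    fix x assume "x \<in> carrier ?M"
    then have x: "x \<in> (\<Pi>\<^sub>E i\<in>I. range (crep (padic_ppow (fst i))))"
      unfolding M prod_module_def by (simp add: cyclic_facts)
    then have "\<forall>i. \<exists>a. i \<in> I \<longrightarrow> x i = crep (padic_ppow (fst i)) a" by (auto dest!: PiE_mem)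
    then obtain a where a: "\<And>i. i \<in> I \<Longrightarrow> x i = crep (padic_ppow (fst i)) (a i)" by metis
    have "x = \<phi> (\<lambda>k. a (es ! k))"
    proof
      fix i
      show "x i = \<phi> (\<lambda>k. a (es ! k)) i"
        using a idx' x by (cases "i \<in> I") (auto simp: \<phi>_def dest: PiE_arb)
    qed
    then show "x \<in> range \<phi>" by blast
  qed (auto simp: \<phi>_def M prod_module_def cyclic_facts)
  moreover have "\<phi> v = \<phi> w \<longleftrightarrow> (\<lambda>j. v j - w j) \<in> Lr (map fst es)" for v w
  proof -
    have "\<phi> v = \<phi> w \<longleftrightarrow> (\<forall>i\<in>I. \<phi> v i = \<phi> w i)"
      by (auto simp: \<phi>_def fun_eq_iff restrict_def)
    also have "\<dots> \<longleftrightarrow> (\<forall>i\<in>I. padic_ppow (fst i) dvd v (idx i) - w (idx i))"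
      by (simp add: \<phi>_def crep_eq_iff)
    also have "\<dots> \<longleftrightarrow> (\<forall>k<n. padic_ppow (fst (es ! k)) dvd v k - w k)"
      using idx idx' bij by (auto simp: bij_betw_def)
    also have "\<dots> \<longleftrightarrow> (\<lambda>j. v j - w j) \<in> Lr (map fst es)"
      by (simp add: Lr_def n_def)
    finally show ?thesis .
  qed
  ultimately have "pres (\<lambda>a. a) ?M (Lr (map fst es)) \<phi>"
    unfolding pres_def by (auto simp: M prod_module_def \<phi>_def cyclic_facts fun_eq_iff)
  then show ?thesis unfolding has_type_def by blast
qed

text \<open>\<open>class_exps\<close> is a choice among all functions \<open>d\<close>, so those
  with infinitely many factors must be excluded. Unit vectors of finitely many factors are
  independent modulo p, and there can be at most \<open>cnt 0 rs\<close> of them.\<close>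

lemma cyclic_product_finite:
  fixes N :: "('p :: prime_card padic_int, 'a) module"
  assumes iso: "mod_iso Zp (cyclic_product d :: ('p padic_int, _) module) N" and N: "has_type N rs"
  shows "finite {(r, j). 1 \<le> r \<and> j < d r}"
proof (rule ccontr)
  let ?M = "cyclic_product d :: ('p padic_int, _) module"
  define I where "I = {(r, j). 1 \<le> r \<and> j < d r}"
  assume "infinite {(r, j). 1 \<le> r \<and> j < d r}"
  then obtain F where F: "finite F" "F \<subseteq> I" "card F = Suc (length rs)"
    using infinite_arbitrarily_large[of I "Suc (length rs)"] unfolding I_def by blast
  obtain f where f: "f \<in> module_hom Zp ?M N" "bij_betw f (carrier ?M) (carrier N)"
    using iso unfolding mod_iso_def by blast
  obtain \<psi> where \<psi>: "pres (\<lambda>a. a) N (Lr rs) \<psi>" using N unfolding has_type_def by blast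
  obtain idx :: "enat \<times> nat \<Rightarrow> nat" where idx: "bij_betw idx F {..<card F}"
    using ex_bij_betw_finite_nat[OF F(1)] by (auto simp: atLeast0LessThan)
  have M: "?M = prod_module I (\<lambda>i. cyclic_module (fst i))"
    unfolding cyclic_product_def I_def by (simp add: case_prod_unfold)
  \<comment> \<open>Embeds the factors indexed by \<open>F\<close>, with 0 in the infinitely many
    remaining ones.\<close>
  define \<chi> where "\<chi> v = (\<lambda>i\<in>I. crep (padic_ppow (fst i)) (if i \<in> F then v (idx i) else 0))"
    for v :: "nat \<Rightarrow> 'p padic_int"
  have \<chi>: "\<chi> v \<in> carrier ?M" for v
    by (auto simp: \<chi>_def M prod_module_def cyclic_facts)
  have \<chi>c: "\<chi> (\<lambda>j. a * v j + b * w j) = a \<odot>\<^bsub>?M\<^esub> \<chi> v \<oplus>\<^bsub>?M\<^esub> b \<odot>\<^bsub>?M\<^esub> \<chi> w" for a b v w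
    by (rule ext) (simp add: \<chi>_def M prod_module_def cyclic_facts restrict_def)
  have sm: "a \<odot>\<^bsub>?M\<^esub> x \<in> carrier ?M" if "x \<in> carrier ?M" for a x
  proof -
    have "a \<odot>\<^bsub>cyclic_module (fst i)\<^esub> y \<in> carrier (cyclic_module (fst i))"
      if "y \<in> carrier (cyclic_module (fst i))" for y and i :: "enat \<times> nat"
      using that by (auto simp: cyclic_facts)
    then show ?thesis using that by (auto simp: M prod_module_def)
  qed
  have hom: "f (x \<oplus>\<^bsub>?M\<^esub> y) = f x \<oplus>\<^bsub>N\<^esub> f y" "f (a \<odot>\<^bsub>?M\<^esub> x) = a \<odot>\<^bsub>N\<^esub> f x" "f x \<in> carrier N"
    if "x \<in> carrier ?M" "y \<in> carrier ?M" for x y a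
    using f(1) that unfolding module_hom_def by auto
  have "card (idx ` F) \<le> cnt 0 rs"
  proof (rule indep_card[OF \<psi>, of "\<lambda>v. f (\<chi> v)"])
    show "f (\<chi> v) \<in> carrier N" for v using hom(3) \<chi> by blast
    show "f (\<chi> (\<lambda>j. a * v j + b * w j)) = a \<odot>\<^bsub>N\<^esub> f (\<chi> v) \<oplus>\<^bsub>N\<^esub> b \<odot>\<^bsub>N\<^esub> f (\<chi> w)" for a b v w
      unfolding \<chi>c by (simp add: hom(1)[OF sm[OF \<chi>] sm[OF \<chi>]] hom(2)[OF \<chi> \<chi>])
    show "finite (idx ` F)" using F(1) by simp
    fix u x j
    assume x: "x \<in> carrier N" and eq: "padic_p ^ 0 \<odot>\<^bsub>N\<^esub> f (\<chi> u) = padic_p ^ Suc 0 \<odot>\<^bsub>N\<^esub> x"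
      and "j \<in> idx ` F"
    then obtain i where i: "i \<in> F" "j = idx i" by blast
    obtain y where y: "y \<in> carrier ?M" "x = f y" using x f(2) by (auto simp: bij_betw_def)
    have "f (1 \<odot>\<^bsub>?M\<^esub> \<chi> u) = f (padic_p \<odot>\<^bsub>?M\<^esub> y)" using eq y(2) hom(2)[OF \<chi> \<chi>] hom(2)[OF y(1) y(1)] by simp
    then have e: "1 \<odot>\<^bsub>?M\<^esub> \<chi> u = padic_p \<odot>\<^bsub>?M\<^esub> y"
      using f(2) sm[OF \<chi>] sm[OF y(1)] by (auto simp: bij_betw_def dest: inj_onD)
    have iI: "i \<in> I" using i F by blast
    then obtain b where b: "y i = crep (padic_ppow (fst i)) b"
      using y(1) unfolding M prod_module_def by (auto simp: cyclic_facts dest: PiE_mem)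
    have "crep (padic_ppow (fst i)) (u j) = crep (padic_ppow (fst i)) (padic_p * b)"
      using fun_cong[OF e, of i] iI i b by (simp add: M prod_module_def \<chi>_def cyclic_facts)
    then have "padic_ppow (fst i) dvd u j - padic_p * b" by (simp add: crep_eq_iff)
    moreover have "enat 0 < fst i" using iI by (auto simp: I_def zero_enat_def[symmetric] one_enat_def Suc_ile_eq)
    ultimately have "padic_p dvd u j - padic_p * b" using ppow_Suc_dvd[of 0] by simp
    from dvd_add[OF this dvd_triv_left[of padic_p b]] show "padic_p dvd u j" by simp
  qed
  moreover have "card (idx ` F) = card F" using idx by (metis bij_betw_def card_image)
  ultimately show False using F(3) cnt_le_length[of 0 rs] by simp
qed

lemma cyclic_product_type:
  assumes "finite {(r, j). 1 \<le> r \<and> j < d r}"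
  shows "\<exists>rs. has_type (cyclic_product d :: ('p :: prime_card padic_int, _) module) rs \<and>
    (\<forall>r\<ge>1. count (mset rs) r = d r) \<and> 0 \<notin> set rs"
proof -
  let ?I = "{(r, j). 1 \<le> r \<and> j < d r}"
  obtain es where es: "set es = ?I" "distinct es" using finite_distinct_list[OF assms] by blast
  have "count (mset (map fst es)) r = d r" if r: "1 \<le> r" for r
  proof -
    have "count (mset (map fst es)) r = length (filter (\<lambda>e. fst e = r) es)"
      by (induction es) auto
    also have "\<dots> = card (set (filter (\<lambda>e. fst e = r) es))"
      by (rule distinct_card[symmetric]) (simp add: es(2))
    also have "set (filter (\<lambda>e. fst e = r) es) = Pair r ` {..<d r}" using r by (auto simp: es(1))
    also have "card \<dots> = d r" by (simp add: card_image inj_on_def)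
    finally show ?thesis .
  qed
  moreover have "0 \<notin> set (map fst es)" using es(1) by auto
  ultimately show ?thesis using has_type_cyclic_product[OF es(2,1)] by blast
qed

text \<open>Written as the set of all modules of the given type, so that computing with classes
  becomes computing with exponent lists.\<close>

definition cls :: "enat list \<Rightarrow> 'p :: prime_card module_class" where
  "cls rs = {N. has_type N rs}"

lemma cls_cong: "nzm rs = nzm ss \<Longrightarrow> cls rs = cls ss"
  unfolding cls_def using has_type_cong by metis

lemma iso_class_eq: "has_type M rs \<Longrightarrow> iso_class M = cls rs"
  unfolding iso_class_def cls_def
  using iso_has_type has_type_iso has_type_module by blast

text \<open>A module of a given type on the carrier type used for the classes: cosets are
  represented by sets of vectors.\<close>

lemma cls_nonempty:
  obtains N where "N \<in> (cls rs :: 'p :: prime_card module_class)"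
proof -
  define n where "n = length rs"
  define e where "e v = vec n ` {w. (\<lambda>j. w j - v j) \<in> Lr rs}" for v :: "nat \<Rightarrow> 'p padic_int"
  have e: "e v = e w \<longleftrightarrow> (\<lambda>j. v j - w j) \<in> Lr rs" for v w
  proof
    assume eq: "e v = e w"
    have "vec n v \<in> e v" unfolding e_def
      by (rule image_eqI[OF refl]) (simp add: submod_0[OF submod_Lr])
    then have "vec n v \<in> e w" unfolding eq .
    then obtain u where u: "vec n v = vec n u" "(\<lambda>j. u j - w j) \<in> Lr rs" unfolding e_def by blast
    have "v j = u j" if "j < n" for j using u(1) that by (metis index_vec)
    then show "(\<lambda>j. v j - w j) \<in> Lr rs" using u(2) by (simp add: Lr_def n_def)
  next
    assume d: "(\<lambda>j. v j - w j) \<in> Lr rs"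
    have "(\<lambda>j. u j - v j) \<in> Lr rs \<longleftrightarrow> (\<lambda>j. u j - w j) \<in> Lr rs" for u
      using submod_add[OF submod_Lr _ d, of "\<lambda>j. u j - v j"] submod_diff[OF submod_Lr _ d, of "\<lambda>j. u j - w j"]
      by auto
    then show "e v = e w" unfolding e_def by simp
  qed
  \<comment> \<open>The operations on classes go through chosen representatives, which differ from
    the original sequence by a relation.\<close>
  define s where "s X = (SOME v. e v = X)" for X
  have s: "(\<lambda>j. s (e v) j - v j) \<in> Lr rs" for v
    unfolding e[symmetric] s_def by (rule someI[of "\<lambda>w. e w = e v" v]) simp
  define N :: "('p padic_int, 'p padic_int vec set) module" where "N = \<lparr>carrier = range e, monoid.mult = undefined, one = undefined, zero = e (\<lambda>_. 0),
    add = (\<lambda>X Y. e (\<lambda>j. s X j + s Y j)), module.smult = (\<lambda>a X. e (\<lambda>j. a * s X j))\<rparr>"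
  have 1: "e (\<lambda>j. s (e v) j + s (e w) j) = e (\<lambda>j. v j + w j)" for v w
    unfolding e using submod_add[OF submod_Lr s[of v] s[of w]] by (simp add: algebra_simps)
  have 2: "e (\<lambda>j. a * s (e v) j) = e (\<lambda>j. a * v j)" for a v
    unfolding e using submod_smult[OF submod_Lr s[of v], of a] by (simp add: algebra_simps)
  have "pres (\<lambda>a. a) N (Lr rs) e"
    unfolding pres_def N_def by (simp add: 1 2 e)
  then have "N \<in> cls rs" unfolding cls_def has_type_def by blast
  then show ?thesis by (rule that)
qed

lemma cls_in_classes: "(cls rs :: 'p :: prime_card module_class) \<in> module_classes"
proof -
  obtain N where "N \<in> (cls rs :: 'p module_class)" using cls_nonempty .
  then have N: "has_type N rs" by (simp add: cls_def)
  then obtain \<phi> where \<phi>: "pres (\<lambda>a. a) N (Lr rs) \<phi>" unfolding has_type_def by blast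
  have R: "carrier (Zp :: 'p padic_int ring) = range (\<lambda>a. a)" by simp
  have "fin_gen_module Zp N"
    unfolding fin_gen_module_def using has_type_module[OF N]
      pres_span(1-3)[OF \<phi> has_type_module[OF N] R] by blast
  then show ?thesis
    unfolding module_classes_def using iso_class_eq[OF N] by (auto intro!: exI[of _ N])
qed

lemma classes_cls:
  assumes "X \<in> (module_classes :: 'p :: prime_card module_class set)"
  obtains rs where "X = cls rs"
proof -
  obtain M :: "('p padic_int, 'p padic_int vec set) module" where "X = iso_class M" "fin_gen_module Zp M"
    using assms unfolding module_classes_def by blast
  then show ?thesis using that iso_class_eq by (metis fin_gen_has_type)
qed

lemma cls_inject: "(cls rs :: 'p :: prime_card module_class) = cls ss \<Longrightarrow> nzm rs = nzm ss"
proof -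
  assume eq: "(cls rs :: 'p module_class) = cls ss"
  obtain N where "N \<in> (cls rs :: 'p module_class)" using cls_nonempty .
  then show ?thesis using eq has_type_unique unfolding cls_def by blast
qed

lemma cyclic_class_eq: "cyclic_class r = cls [r]"
  by (rule iso_class_eq[OF has_type_cyclic])

text \<open>All pairs of representatives give the same class and at least one pair exists, so the
  union in \<open>class_times\<close> is that class.\<close>

lemma class_times_cls: "class_times (cls rs) (cls ss) = (cls (rs @ ss) :: 'p :: prime_card module_class)"
proof -
  have *: "iso_class (direct_sum M N) = (cls (rs @ ss) :: 'p module_class)"
    if "M \<in> (cls rs :: 'p module_class)" "N \<in> (cls ss :: 'p module_class)" for M N
    using that by (intro iso_class_eq has_type_direct_sum) (simp_all add: cls_def)
  obtain M N where "M \<in> (cls rs :: 'p module_class)" "N \<in> (cls ss :: 'p module_class)"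
    using cls_nonempty by metis
  then show ?thesis unfolding class_times_def using * by blast
qed

text \<open>The choice is pinned down at exponents from 1 on: the multiplicities in
  \<open>rs\<close> are one witness, and every witness agrees with them there.\<close>

lemma class_exps_cls:
  assumes "1 \<le> r"
  shows "class_exps (cls rs :: 'p :: prime_card module_class) r = count (mset rs) r"
proof -
  let ?P = "\<lambda>d. (cls rs :: 'p module_class) = iso_class (cyclic_product d :: ('p padic_int, _) module)"
  have unique: "count (mset rs) r = d r" if P: "?P d" "1 \<le> r" for d r
  proof -
    obtain N where N: "N \<in> (cls rs :: 'p module_class)" using cls_nonempty .
    then have N': "mod_iso Zp (cyclic_product d :: ('p padic_int, _) module) N" "has_type N rs"
      using P by (auto simp: iso_class_def cls_def)
    have fin: "finite {(r, j). 1 \<le> r \<and> j < d r}" by (rule cyclic_product_finite[OF N'])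
    obtain ss where ss: "has_type (cyclic_product d :: ('p padic_int, _) module) ss"
      "\<And>r. 1 \<le> r \<Longrightarrow> count (mset ss) r = d r" "0 \<notin> set ss"
      using cyclic_product_type[OF fin] by blast
    have "nzm rs = nzm ss" using P(1) unfolding iso_class_eq[OF ss(1)] by (rule cls_inject)
    then have "count (nzm rs) r = count (nzm ss) r" by simp
    moreover have "r \<noteq> 0" using P(2) by auto
    ultimately show ?thesis
      using ss(2)[rule_format, OF P(2)] by (simp add: nzm_def)
  qed
  let ?d = "count (mset rs)"
  have fin: "finite {(r, j). 1 \<le> r \<and> j < ?d r}"
  proof (rule finite_subset)
    have "r \<in># mset rs" if "j < ?d r" for r j
      using that by (metis count_greater_zero_iff gr_zeroI less_nat_zero_code)
    then show "{(r, j). 1 \<le> r \<and> j < ?d r} \<subseteq> Sigma (set rs) (\<lambda>r. {..<?d r})" by auto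
  qed simp
  obtain ss where ss: "has_type (cyclic_product ?d :: ('p padic_int, _) module) ss"
    "\<And>r. 1 \<le> r \<Longrightarrow> count (mset ss) r = ?d r" "0 \<notin> set ss"
    using cyclic_product_type[OF fin] by blast
  have "nzm ss = nzm rs"
    by (rule multiset_eqI) (use ss in \<open>auto simp: nzm_def ileI1 one_eSuc\<close>)
  then have "?P ?d" unfolding iso_class_eq[OF ss(1)] by (metis cls_cong)
  then have "?P (class_exps (cls rs :: 'p module_class))" unfolding class_exps_def by (rule someI[of ?P])
  then show ?thesis using unique assms by metis
qed

text \<open>With lists padded to length n, the difference n minus the number of nonzero exponents
  becomes the number of zeros in the list.\<close>

lemma class_d_cls:
  assumes "length rs = n"
  shows "class_d n (cls rs :: 'p :: prime_card module_class) 0 = int (count (mset rs) 0)"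
    "class_d n (cls rs :: 'p module_class) 1 = int (count (mset rs) 1)"
proof -
  show "class_d n (cls rs :: 'p module_class) 1 = int (count (mset rs) 1)"
    by (simp add: class_d_def class_exps_cls)
  have "{q. 1 \<le> q \<and> class_exps (cls rs :: 'p module_class) q \<noteq> 0} = set_mset (nzm rs)"
    by (auto simp: class_exps_cls nzm_def ileI1 one_eSuc)
  moreover have "(\<Sum>q\<in>set_mset (nzm rs). class_exps (cls rs :: 'p module_class) q) = (\<Sum>q\<in>set_mset (nzm rs). count (nzm rs) q)"
    by (rule sum.cong) (auto simp: nzm_def class_exps_cls ileI1 one_eSuc)
  ultimately have *: "(\<Sum>q | 1 \<le> q \<and> class_exps (cls rs :: 'p module_class) q \<noteq> 0. class_exps (cls rs :: 'p module_class) q) = size (nzm rs)"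
    by (simp add: size_multiset_overloaded_eq)
  have "size (nzm rs) + count (mset rs) 0 = length rs"
    by (induction rs) (auto simp: nzm_def)
  then show "class_d n (cls rs :: 'p module_class) 0 = int (count (mset rs) 0)"
    using * assms by (simp add: class_d_def)
qed

lemma s_rank_cls: "H \<in> cls rs \<Longrightarrow> s_rank H = size (nzm rs)"
  unfolding cls_def by (simp add: s_rank_eq cnt_eq nzm_def zero_enat_def[symmetric])

text \<open>Since s(H) counts the nonzero exponents, the bound s(H) \<le> n says exactly that the
  list can be padded with zeros to length n.\<close>

lemma B_set_iff:
  "(n, Hs) \<in> (B_set m :: (nat \<times> 'p :: prime_card module_class list) set) \<longleftrightarrow>
     (\<exists>R. (\<forall>i<m. length (R i) = n) \<and> Hs = map (\<lambda>i. cls (R i)) [0..<m])"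
proof
  assume B: "(n, Hs) \<in> (B_set m :: (nat \<times> 'p module_class list) set)"
  have "\<exists>rs. i < m \<longrightarrow> length rs = n \<and> Hs ! i = cls rs" for i
  proof (cases "i < m")
    case True
    then have mem: "Hs ! i \<in> set Hs" using B by (auto simp: B_set_def)
    then have "Hs ! i \<in> module_classes" using B by (auto simp: B_set_def)
    then obtain rs where rs: "Hs ! i = cls rs" by (rule classes_cls)
    obtain N where "N \<in> (cls rs :: 'p module_class)" using cls_nonempty .
    then have "size (nzm rs) \<le> n" using B mem rs s_rank_cls by (fastforce simp: B_set_def)
    then have "length (filter (\<lambda>r. r \<noteq> 0) rs @ replicate (n - size (nzm rs)) 0) = n"
      by (simp add: nzm_def flip: mset_filter)
    moreover have "cls rs = (cls (filter (\<lambda>r. r \<noteq> 0) rs @ replicate (n - size (nzm rs)) 0) :: 'p module_class)"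
      by (rule cls_cong) (simp add: nzm_def flip: mset_filter)
    ultimately show ?thesis using rs by metis
  qed simp
  then obtain R where R: "\<And>i. i < m \<Longrightarrow> length (R i) = n" "\<And>i. i < m \<Longrightarrow> Hs ! i = cls (R i)" by metis
  moreover have "Hs = map (\<lambda>i. cls (R i)) [0..<m]"
    by (rule nth_equalityI) (use B R in \<open>auto simp: B_set_def\<close>)
  ultimately show "\<exists>R. (\<forall>i<m. length (R i) = n) \<and> Hs = map (\<lambda>i. cls (R i)) [0..<m]" by blast
next
  assume "\<exists>R. (\<forall>i<m. length (R i) = n) \<and> Hs = map (\<lambda>i. cls (R i)) [0..<m]"
  then obtain R where R: "\<And>i. i < m \<Longrightarrow> length (R i) = n" "Hs = map (\<lambda>i. cls (R i)) [0..<m]" by blast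
  have "size (nzm rs) \<le> length rs" for rs
    unfolding nzm_def by (metis size_filter_mset_lesseq size_mset)
  then show "(n, Hs) \<in> (B_set m :: (nat \<times> 'p module_class list) set)"
    using R(1) unfolding R(2) by (fastforce simp: B_set_def cls_in_classes s_rank_cls)
qed


section \<open>Cokernels modulo $p^2$\<close>

text \<open>Effect on Z_p/p^r of reduction modulo p^2: the finite exponents from 2 on and
  \<open>\<infinity>\<close> all become 2.\<close>

definition t2 :: "enat \<Rightarrow> nat" where
  "t2 r = the_enat (min 2 r)"

text \<open>Full preimage over Z_p of the image of \<open>A\<close> modulo p^2. It keeps the linear
  algebra over the domain Z_p, where diagonalisation is available.\<close>

definition LA :: "nat \<Rightarrow> 'p :: prime_card padic_int mat \<Rightarrow> (nat \<Rightarrow> 'p padic_int) set" where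
  "LA n A = {v. \<exists>y z. \<forall>i<n. v i = (\<Sum>j<n. A $$ (i, j) * y j) + padic_p ^ 2 * z i}"

text \<open>Smith form of \<open>A\<close> modulo p^2: \<open>es\<close> lists the exponents of the
  cokernel, 2 standing for a free summand over Z_p/p^2.\<close>

definition mat_type :: "nat \<Rightarrow> 'p :: prime_card padic_int mat \<Rightarrow> nat list \<Rightarrow> bool" where
  "mat_type n A es \<longleftrightarrow> length es = n \<and>
     (\<exists>T T'. autom {..<n} T T' \<and> (\<forall>v. v \<in> LA n A \<longleftrightarrow> (\<forall>j<n. padic_p ^ (es ! j) dvd T v j)))"

lemma submod_LA: "submod (LA n A)"
  unfolding submod_def
proof (intro conjI ballI allI)
  show "(\<lambda>_. 0) \<in> LA n A"
    unfolding LA_def by (intro CollectI exI[of _ "\<lambda>_. 0"]) simp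
  fix v w a b assume "v \<in> LA n A" "w \<in> LA n A"
  then obtain y z y' z' where
    "\<And>i. i < n \<Longrightarrow> v i = (\<Sum>j<n. A $$ (i, j) * y j) + padic_p ^ 2 * z i"
    "\<And>i. i < n \<Longrightarrow> w i = (\<Sum>j<n. A $$ (i, j) * y' j) + padic_p ^ 2 * z' i"
    unfolding LA_def by blast
  then show "(\<lambda>j. a * v j + b * w j) \<in> LA n A"
    unfolding LA_def
    by (intro CollectI exI[of _ "\<lambda>j. a * y j + b * y' j"] exI[of _ "\<lambda>j. a * z j + b * z' j"])
      (simp add: algebra_simps sum.distrib sum_distrib_left)
qed

lemma LA_local: "v \<in> LA n A \<Longrightarrow> (\<And>j. j \<in> {..<n} \<Longrightarrow> v j = w j) \<Longrightarrow> w \<in> LA n A"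
  unfolding LA_def by simp

lemma p2_LA: "(\<lambda>j. padic_p ^ 2 * v j) \<in> LA n A"
  unfolding LA_def by (intro CollectI exI[of _ "\<lambda>_. 0"] exI[of _ v]) simp

lemma pres_free:
  fixes q :: "'p :: prime_card padic_int"
  shows "pres (crep q) (free_module (Zp Quot (PIdl\<^bsub>Zp\<^esub> q)) n) {v. \<forall>j<n. q dvd v j} (\<lambda>v. vec n (\<lambda>j. crep q (v j)))"
proof -
  let ?M = "free_module (Zp Quot (PIdl\<^bsub>Zp\<^esub> q)) n"
  have "range (\<lambda>v. vec n (\<lambda>j. crep q (v j))) = carrier ?M"
  proof (intro equalityI subsetI)
    fix x assume "x \<in> carrier ?M"
    then have x: "x \<in> carrier_vec n" "set\<^sub>v x \<subseteq> range (crep q)"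
      by (simp_all add: free_module_def crep_ring(1))
    have "\<exists>a. j < n \<longrightarrow> x $ j = crep q a" for j
    proof (cases "j < n")
      case True
      then have "x $ j \<in> set\<^sub>v x" using x(1) by (auto simp: vec_set_def)
      then show ?thesis using x(2) by auto
    qed simp
    then obtain a where "\<And>j. j < n \<Longrightarrow> x $ j = crep q (a j)" by metis
    then have "x = vec n (\<lambda>j. crep q (a j))" using x(1) by (intro eq_vecI) auto
    then show "x \<in> range (\<lambda>v. vec n (\<lambda>j. crep q (v j)))" by blast
  qed (auto simp: free_module_def crep_ring(1) vec_set_def)
  moreover have "vec n (\<lambda>j. crep q (v j)) = vec n (\<lambda>j. crep q (w j)) \<longleftrightarrow> (\<forall>j<n. q dvd v j - w j)" for v w
    by (simp add: crep_eq_iff vec_eq_iff)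
  ultimately show ?thesis
    by (simp add: pres_def free_module_def crep_ring(2,3,5)[symmetric] vec_eq_iff)
qed

text \<open>The coordinates modulo p^2 are followed by the quotient by the image of
  \<open>A\<close>; the two sets of relations together make up \<open>LA n A\<close>.\<close>

lemma pres_cok:
  fixes A :: "'p :: prime_card padic_int mat"
  assumes A: "A \<in> carrier_mat n n"
  shows "\<exists>c. pres (crep (padic_p ^ 2)) (cok_p2 n A) (LA n A) c"
proof -
  define q where "q = (padic_p ^ 2 :: 'p padic_int)"
  let ?Q = "Zp Quot (PIdl\<^bsub>Zp\<^esub> q)"
  define M where "M = free_module ?Q n"
  define \<pi> where "\<pi> v = vec n (\<lambda>j. crep q (v j))" for v :: "nat \<Rightarrow> 'p padic_int"
  have \<pi>: "pres (crep q) M {v. \<forall>j<n. q dvd v j} \<pi>"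
    unfolding M_def \<pi>_def by (rule pres_free)
  define F where "F v = vec n (\<lambda>i. \<Oplus>\<^bsub>?Q\<^esub>j\<in>{..<n}. map_mat (\<lambda>a. PIdl\<^bsub>Zp\<^esub> q +>\<^bsub>Zp\<^esub> a) A $$ (i, j) \<otimes>\<^bsub>?Q\<^esub> v $ j)" for v
  have cM: "carrier M = range \<pi>" using \<pi> by (simp add: pres_def)
  have F: "F (\<pi> y) = \<pi> (\<lambda>i. \<Sum>j<n. A $$ (i, j) * y j)" for y
  proof (unfold F_def \<pi>_def, intro eq_vecI)
    fix i assume i: "i < dim_vec (vec n (\<lambda>i. crep q (\<Sum>j<n. A $$ (i, j) * y j)))"
    interpret Q: cring ?Q by (rule cring_quot)
    have "(\<Oplus>\<^bsub>?Q\<^esub>j\<in>{..<n}. map_mat (\<lambda>a. PIdl\<^bsub>Zp\<^esub> q +>\<^bsub>Zp\<^esub> a) A $$ (i, j) \<otimes>\<^bsub>?Q\<^esub> vec n (\<lambda>j. crep q (y j)) $ j)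
        = (\<Oplus>\<^bsub>?Q\<^esub>j\<in>{..<n}. crep q (A $$ (i, j) * y j))"
      by (rule Q.finsum_cong') (use i A in \<open>auto simp: crep_ring(1) crep_ring(3)[symmetric] crep_def[symmetric]\<close>)
    then show "vec n (\<lambda>i. \<Oplus>\<^bsub>?Q\<^esub>j\<in>{..<n}. map_mat (\<lambda>a. PIdl\<^bsub>Zp\<^esub> q +>\<^bsub>Zp\<^esub> a) A $$ (i, j) \<otimes>\<^bsub>?Q\<^esub> vec n (\<lambda>j. crep q (y j)) $ j) $ i
        = vec n (\<lambda>i. crep q (\<Sum>j<n. A $$ (i, j) * y j)) $ i"
      using i by (simp add: crep_finsum)
  qed simp
  have im: "F ` carrier M = \<pi> ` LA n A"
  proof (intro equalityI subsetI)
    fix x assume "x \<in> F ` carrier M"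
    then obtain y where "x = \<pi> (\<lambda>i. \<Sum>j<n. A $$ (i, j) * y j)" unfolding cM by (auto simp: F)
    moreover have "(\<lambda>i. \<Sum>j<n. A $$ (i, j) * y j) \<in> LA n A"
      unfolding LA_def by (intro CollectI exI[of _ y] exI[of _ "\<lambda>_. 0"]) simp
    ultimately show "x \<in> \<pi> ` LA n A" by blast
  next
    fix x assume "x \<in> \<pi> ` LA n A"
    then obtain v y z where v: "x = \<pi> v" "\<And>i. i < n \<Longrightarrow> v i = (\<Sum>j<n. A $$ (i, j) * y j) + q * z i"
      unfolding LA_def q_def by blast
    have "\<pi> v = \<pi> (\<lambda>i. \<Sum>j<n. A $$ (i, j) * y j)"
      unfolding presD(6)[OF \<pi>] using v(2) by simp
    then have "x = F (\<pi> y)" by (simp add: v(1) F)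
    then show "x \<in> F ` carrier M" unfolding cM by blast
  qed
  have "pres (crep q) (quot_module M (\<pi> ` LA n A)) (LA n A) (\<lambda>v. (\<pi> ` LA n A) +>\<^bsub>M\<^esub> \<pi> v)"
  proof (rule pres_quot[OF \<pi> submod_LA])
    show "{v. \<forall>j<n. q dvd v j} \<subseteq> LA n A"
    proof
      fix v assume "v \<in> {v. \<forall>j<n. q dvd v j}"
      then have "\<exists>z. j < n \<longrightarrow> v j = q * z" for j by (auto simp: dvd_def)
      then obtain z where "\<And>j. j < n \<Longrightarrow> v j = q * z j" by metis
      then show "v \<in> LA n A" using p2_LA[of z n A] by (auto intro: LA_local simp: q_def)
    qed
  qed
  moreover have "cok_p2 n A = quot_module M (\<pi> ` LA n A)"
    unfolding cok_p2_def Let_def cokernel_def im[symmetric] F_def M_def q_def ..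
  ultimately show ?thesis unfolding q_def by metis
qed

lemma autom_permute:
  assumes "\<pi> permutes S"
  shows "autom S (\<lambda>v j. v (\<pi> j)) (\<lambda>v j. v (inv_into UNIV \<pi> j))"
proof -
  have "inv_into UNIV \<pi> permutes S" using assms by (rule permutes_inv)
  then show ?thesis
    using assms permutes_in_image[OF assms] permutes_in_image[of "inv_into UNIV \<pi>" S]
    by (auto simp: autom_def flin_def permutes_inverses[OF assms] permutes_not_in)
qed

lemma mat_type_perm:
  assumes "mat_type n A es" "mset es = mset fs"
  shows "mat_type n A fs"
proof -
  obtain T T' where T: "autom {..<n} T T'" "\<And>v. v \<in> LA n A \<longleftrightarrow> (\<forall>j<n. padic_p ^ (es ! j) dvd T v j)"
    and len: "length es = n"
    using assms(1) unfolding mat_type_def by blast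
  obtain \<pi> where \<pi>: "\<pi> permutes {..<n}" "permute_list \<pi> es = fs"
    using mset_eq_permutation[of fs es] assms(2) len by metis
  have fs: "fs ! j = es ! \<pi> j" if "j < n" for j
    using permute_list_nth[of \<pi> es j] \<pi> len that by simp
  have "autom {..<n} (\<lambda>v j. T v (\<pi> j)) (\<lambda>v. T' (\<lambda>j. v (inv_into UNIV \<pi> j)))"
    using autom_comp[OF autom_permute[OF \<pi>(1)] T(1)] .
  moreover have "v \<in> LA n A \<longleftrightarrow> (\<forall>j<n. padic_p ^ (fs ! j) dvd T v (\<pi> j))" for v
  proof -
    have "v \<in> LA n A \<longleftrightarrow> (\<forall>j\<in>{..<n}. padic_p ^ (es ! j) dvd T v j)" using T(2) by auto
    also have "\<dots> \<longleftrightarrow> (\<forall>j\<in>\<pi> ` {..<n}. padic_p ^ (es ! j) dvd T v j)" by (simp only: permutes_image[OF \<pi>(1)])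
    also have "\<dots> \<longleftrightarrow> (\<forall>j<n. padic_p ^ (fs ! j) dvd T v (\<pi> j))" using fs by auto
    finally show ?thesis .
  qed
  ultimately show ?thesis
    unfolding mat_type_def using assms(2) len by (metis size_mset)
qed

lemma mat_type_exists:
  fixes A :: "'p :: prime_card padic_int mat"
  obtains es where "mat_type n A es"
proof -
  have "\<exists>T T' r. autom {..<n} T T' \<and> (\<forall>v. v \<in> LA n A \<longleftrightarrow> (\<forall>j\<in>{..<n}. padic_ppow (r j) dvd T v j))"
    by (rule stacked_basis[OF finite_lessThan submod_LA LA_local[of _ n A]]) blast+
  then obtain T T' r where T: "autom {..<n} T T'"
    and r: "\<And>v. v \<in> LA n A \<longleftrightarrow> (\<forall>j\<in>{..<n}. padic_ppow (r j) dvd T v j)" by blast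
  \<comment> \<open>A coordinate of exponent \<open>\<infinity>\<close> would vanish on all of
    \<open>LA\<close>, which contains p^2 times every vector.\<close>
  have fin: "r j \<noteq> \<infinity>" if "j < n" for j
  proof
    assume inf: "r j = \<infinity>"
    let ?e = "\<lambda>i. if i = j then 1 else (0 :: 'p padic_int)"
    have "T (\<lambda>i. padic_p ^ 2 * T' ?e i) = (\<lambda>i. padic_p ^ 2 * ?e i)"
      using flin_smult[OF automD(1)[OF T], of "padic_p ^ 2" "T' ?e"] by (simp only: automD(3)[OF T])
    moreover have "padic_ppow (r j) dvd T (\<lambda>i. padic_p ^ 2 * T' ?e i) j"
      using r[of "\<lambda>i. padic_p ^ 2 * T' ?e i"] p2_LA[of "T' ?e" n A] that by simp
    ultimately have "padic_ppow (r j) dvd (padic_p ^ 2 * ?e j)" by simp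
    then show False using inf by simp
  qed
  have "padic_ppow (r j) = (padic_p ^ the_enat (r j) :: 'p padic_int)" if "j < n" for j
    using fin[OF that] by (cases "r j") auto
  then have "v \<in> LA n A \<longleftrightarrow> (\<forall>j<n. padic_p ^ (map (\<lambda>j. the_enat (r j)) [0..<n] ! j) dvd T v j)" for v
    unfolding r by auto
  then have "mat_type n A (map (\<lambda>j. the_enat (r j)) [0..<n])"
    unfolding mat_type_def using T by auto
  then show ?thesis by (rule that)
qed

lemma mset_eq_nzm:
  assumes "nzm rs = nzm ss" "length rs = length ss"
  shows "mset rs = mset ss"
proof -
  have "size (nzm rs) + count (mset rs) 0 = length rs" for rs
    by (induction rs) (auto simp: nzm_def)
  from this[of rs] this[of ss] have 0: "count (mset rs) 0 = count (mset ss) 0" using assms by simp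
  show ?thesis
  proof (rule multiset_eqI)
    fix r show "count (mset rs) r = count (mset ss) r"
      using 0 arg_cong[OF assms(1), of "\<lambda>M. count M r"] by (cases "r = 0") (simp_all add: nzm_def)
  qed
qed

lemma enat_t2: "enat (t2 r) = min 2 r"
  unfolding t2_def by (cases r) (auto simp: min_def numeral_eq_enat)

text \<open>Both modules are presented over Z_p/p^2: a matching Smith form gives an isomorphism, and
  an isomorphism forces equal nonzero exponents. The common length n then fixes the number of zeros
  as well.\<close>

lemma cok_iso_iff:
  fixes A :: "'p :: prime_card padic_int mat" and H :: "('p padic_int, 'a) module"
  assumes H: "has_type H rs" "length rs = n" and A: "A \<in> carrier_mat n n"
  shows "mod_iso (Zp Quot (PIdl\<^bsub>Zp\<^esub> (padic_p ^ 2))) (cok_p2 n A) (reduction Zp (padic_p ^ 2) H)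
    \<longleftrightarrow> mat_type n A (map t2 rs)"
proof -
  let ?q = "padic_p ^ 2 :: 'p padic_int" and ?N = "reduction Zp (padic_p ^ 2) H"
  obtain c where c: "pres (crep ?q) (cok_p2 n A) (LA n A) c" using pres_cok[OF A] by blast
  obtain \<psi> where \<psi>: "pres (crep ?q) ?N (Lr (map (min 2) rs)) \<psi>"
    using pres_reduction_Lr[OF H(1), of 2] by (auto simp: numeral_eq_enat)
  have eq: "map enat (map t2 rs) = map (min 2) rs" by (simp add: enat_t2)
  have cok: "pres (crep ?q) (cok_p2 n A) (Lr (map enat es)) (\<lambda>v. c (T' v))"
    if "length es = n" "autom {..<n} T T'" "\<And>v. v \<in> LA n A \<longleftrightarrow> (\<forall>j<n. padic_p ^ (es ! j) dvd T v j)"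
    for es T T'
    by (rule pres_autom[OF c that(2)]) (simp add: that(1,3) Lr_def)
  show ?thesis
  proof
    assume "mat_type n A (map t2 rs)"
    then obtain T T' where "autom {..<n} T T'" "\<And>v. v \<in> LA n A \<longleftrightarrow> (\<forall>j<n. padic_p ^ (map t2 rs ! j) dvd T v j)"
      unfolding mat_type_def by blast
    from pres_iso[OF cok[OF _ this, unfolded eq] \<psi> crep_ring(1)] show
      "mod_iso (Zp Quot (PIdl\<^bsub>Zp\<^esub> ?q)) (cok_p2 n A) ?N"
      using H(2) by simp
  next
    assume "mod_iso (Zp Quot (PIdl\<^bsub>Zp\<^esub> ?q)) (cok_p2 n A) ?N"
    then obtain f where f: "f \<in> module_hom (Zp Quot (PIdl\<^bsub>Zp\<^esub> ?q)) (cok_p2 n A) ?N"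
      "bij_betw f (carrier (cok_p2 n A)) (carrier ?N)" unfolding mod_iso_def by blast
    obtain es where es: "mat_type n A es" by (rule mat_type_exists)
    then obtain T T' where T: "length es = n" "autom {..<n} T T'"
      "\<And>v. v \<in> LA n A \<longleftrightarrow> (\<forall>j<n. padic_p ^ (es ! j) dvd T v j)"
      unfolding mat_type_def by blast
    have "pres (crep ?q) ?N (Lr (map enat es)) (\<lambda>v. f (c (T' v)))"
      by (rule pres_transfer[OF cok[OF T] f crep_ring(1) crep_ring(5) pres_crep_module[OF \<psi>]])
    from cnt_unique[OF this \<psi>] have "nzm (map enat es) = nzm (map (min 2) rs)" by (rule nzm_eqI)
    then have "mset (map enat es) = mset (map enat (map t2 rs))"
      unfolding eq by (rule mset_eq_nzm) (simp add: T(1) H(2))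
    then have "image_mset the_enat (mset (map enat es)) = image_mset the_enat (mset (map enat (map t2 rs)))"
      by simp
    then have "mset es = mset (map t2 rs)" by (simp add: multiset.map_comp o_def)
    then show "mat_type n A (map t2 rs)" using mat_type_perm[OF es] by blast
  qed
qed

lemma first_integral_carrier: "first_integral n P \<Longrightarrow> P \<in> carrier_mat n n"
  unfolding first_integral_def by auto

text \<open>All members of a class have the same type, so the choice of H in \<open>C12_set\<close>
  does not matter and only the Smith forms of the values P(x_i) remain.\<close>

lemma C12_iff:
  fixes xs :: "'p :: prime_card padic_int list"
  assumes len: "length xs = m" "\<And>i. i < m \<Longrightarrow> length (R i) = n"
  shows "(n, map (\<lambda>i. cls (R i)) [0..<m]) \<in> C12_set xs \<longleftrightarrow>
    (\<exists>P. first_integral n P \<and> (\<forall>i<m. mat_type n (mat_eval P (xs ! i)) (map t2 (R i))))"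
proof -
  have B: "(n, map (\<lambda>i. cls (R i)) [0..<m]) \<in> (B_set m :: (nat \<times> 'p module_class list) set)"
    unfolding B_set_iff using len(2) by blast
  have iff: "(\<exists>H \<in> (cls (R i) :: 'p module_class).
          mod_iso (Zp Quot (PIdl\<^bsub>Zp\<^esub> (padic_p ^ 2)))
            (cok_p2 n (mat_eval P (xs ! i))) (reduction Zp (padic_p ^ 2) H)) \<longleftrightarrow>
      mat_type n (mat_eval P (xs ! i)) (map t2 (R i))"
    if "first_integral n P" "i < m" for P i
  proof -
    have A: "mat_eval P (xs ! i) \<in> carrier_mat n n"
      using first_integral_carrier[OF that(1)] by (simp add: mat_eval_def)
    have *: "mod_iso (Zp Quot (PIdl\<^bsub>Zp\<^esub> (padic_p ^ 2)))
            (cok_p2 n (mat_eval P (xs ! i))) (reduction Zp (padic_p ^ 2) H) \<longleftrightarrow>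
      mat_type n (mat_eval P (xs ! i)) (map t2 (R i))" if "H \<in> (cls (R i) :: 'p module_class)" for H
      using cok_iso_iff[OF _ len(2)[OF \<open>i < m\<close>] A] that by (simp add: cls_def)
    obtain N where "N \<in> (cls (R i) :: 'p module_class)" using cls_nonempty .
    then show ?thesis using * by blast
  qed
  show ?thesis
    unfolding C12_set_def using B iff len(1) by (auto 4 3)
qed


section \<open>Minors\<close>

lemma det_diag: "det (mat_diag n f :: 'a :: comm_ring_1 mat) = (\<Prod>i<n. f i)"
proof -
  have "det (mat_diag n f) = prod_list (diag_mat (mat_diag n f))"
    by (rule det_upper_triangular[of _ n]) (auto simp: mat_diag_def)
  also have "diag_mat (mat_diag n f) = map f [0..<n]"
    by (auto simp: diag_mat_def mat_diag_def)
  also have "prod_list (map f [0..<n]) = (\<Prod>i<n. f i)"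
    by (induction n) (simp_all add: mult.commute)
  finally show ?thesis .
qed

lemma det_scalar: "det (c \<cdot>\<^sub>m 1\<^sub>m n) = (c :: 'a :: comm_ring_1) ^ n"
  by simp

text \<open>The weights of \<open>W\<close> are traded against powers of \<open>c\<close> by clearing them in a bordered
  matrix.\<close>

lemma det_weighted:
  fixes c :: "'a :: idom"
  assumes E: "E \<in> carrier_mat k N" and F: "F \<in> carrier_mat N k" and Y: "Y \<in> carrier_mat k k"
    and W: "W \<in> carrier_mat N N" "W' \<in> carrier_mat N N" "W' * W = c \<cdot>\<^sub>m 1\<^sub>m N"
  shows "c ^ k * det (four_block_mat Y E (- F) W') = det (E * W * F + c \<cdot>\<^sub>m Y) * det W'"
proof -
  let ?M = "four_block_mat Y E (- F) W'" and ?B = "four_block_mat (c \<cdot>\<^sub>m 1\<^sub>m k) (0\<^sub>m k N) (W * F) (1\<^sub>m N)"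
  have dims: "?M \<in> carrier_mat (k + N) (k + N)" "?B \<in> carrier_mat (k + N) (k + N)"
    using E F Y W by auto
  have WF: "W * F \<in> carrier_mat N k" using W F by simp
  have e1: "Y * (c \<cdot>\<^sub>m 1\<^sub>m k) + E * (W * F) = E * W * F + c \<cdot>\<^sub>m Y"
    using E F Y W comm_add_mat[of "c \<cdot>\<^sub>m Y" k k "E * W * F"] by (simp add: assoc_mult_mat[of E k N W N F k] mult_smult_distrib[of Y k k "1\<^sub>m k" k])
  have e2: "Y * 0\<^sub>m k N + E * 1\<^sub>m N = E" using E Y by simp
  have e3: "- F * (c \<cdot>\<^sub>m 1\<^sub>m k) + W' * (W * F) = 0\<^sub>m N k"
  proof -
    have "W' * (W * F) = c \<cdot>\<^sub>m F"
      using W F by (simp add: assoc_mult_mat[of W' N N W N F k, symmetric] mult_smult_assoc_mat[of "1\<^sub>m N" N N F k])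
    moreover have "- F * (c \<cdot>\<^sub>m 1\<^sub>m k) = c \<cdot>\<^sub>m - F"
    proof -
      have "- F * (c \<cdot>\<^sub>m 1\<^sub>m k) = c \<cdot>\<^sub>m (- F * 1\<^sub>m k)"
        by (rule mult_smult_distrib[of _ N k _ k]) (use F in auto)
      also have "- F * 1\<^sub>m k = - F" using F by (intro right_mult_one_mat) auto
      finally show ?thesis .
    qed
    ultimately show ?thesis using F by (intro eq_matI) auto
  qed
  have e4: "- F * 0\<^sub>m k N + W' * 1\<^sub>m N = W'" using F W by simp
  \<comment> \<open>The relation W' W = c makes the lower left block vanish, as - c F + W' W F =
    0.\<close>
  have "?M * ?B = four_block_mat (Y * (c \<cdot>\<^sub>m 1\<^sub>m k) + E * (W * F)) (Y * 0\<^sub>m k N + E * 1\<^sub>m N)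
      (- F * (c \<cdot>\<^sub>m 1\<^sub>m k) + W' * (W * F)) (- F * 0\<^sub>m k N + W' * 1\<^sub>m N)"
    by (rule mult_four_block_mat) (use E F Y W WF in auto)
  then have "?M * ?B = four_block_mat (E * W * F + c \<cdot>\<^sub>m Y) E (0\<^sub>m N k) W'"
    unfolding e1 e2 e3 e4 .
  then have "det (?M * ?B) = det (E * W * F + c \<cdot>\<^sub>m Y) * det W'"
    using det_four_block_mat_lower_left_zero[of "E * W * F + c \<cdot>\<^sub>m Y" k E N "0\<^sub>m N k" W'] E F Y W by simp
  moreover have "det ?B = c ^ k"
    using det_four_block_mat_upper_right_zero[of "c \<cdot>\<^sub>m 1\<^sub>m k" k "0\<^sub>m k N" N "W * F" "1\<^sub>m N"] WF by simp
  ultimately show ?thesis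
    using det_mult[OF dims] by (simp add: mult.commute)
qed

text \<open>The common source of all divisibility statements about minors: X P Y carries the factor
  c^k, up to det W' and \<open>\<delta> ^ k\<close>. It is used with W = 1 for c = p and for c = t -
  x, and with W = diag(1, ..., 1, p, ..., p) for c = p^2.\<close>

lemma weighted_minor:
  fixes c :: "'a :: idom"
  assumes P: "P \<in> carrier_mat n n" and T: "T \<in> carrier_mat n n" and E: "E \<in> carrier_mat n N" and F: "F \<in> carrier_mat N n"
    and W: "W \<in> carrier_mat N N" "W' \<in> carrier_mat N N" "W' * W = c \<cdot>\<^sub>m 1\<^sub>m N"
    and eq: "\<delta> \<cdot>\<^sub>m P = E * W * F + c \<cdot>\<^sub>m T"
    and X: "X \<in> carrier_mat k n" and Y: "Y \<in> carrier_mat n k"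
  shows "\<delta> ^ k * det (X * P * Y) * det W' = c ^ k * det (four_block_mat (X * T * Y) (X * E) (- (F * Y)) W')"
proof -
  have "X * E * W * (F * Y) + c \<cdot>\<^sub>m (X * T * Y) = X * (E * W * F + c \<cdot>\<^sub>m T) * Y"
  proof -
    have "X * (E * W * F + c \<cdot>\<^sub>m T) = X * (E * W * F) + X * (c \<cdot>\<^sub>m T)"
      by (rule mult_add_distrib_mat[of _ k n _ n]) (use X E W F T in auto)
    then have "X * (E * W * F + c \<cdot>\<^sub>m T) * Y = (X * (E * W * F) + X * (c \<cdot>\<^sub>m T)) * Y"
      by simp
    also have "\<dots> = X * (E * W * F) * Y + X * (c \<cdot>\<^sub>m T) * Y"
      using X E W F T Y by (intro add_mult_distrib_mat[of _ k n]) auto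
    also have "X * (c \<cdot>\<^sub>m T) * Y = c \<cdot>\<^sub>m (X * T * Y)"
      using X T Y by (simp add: mult_smult_distrib[of X k n T n] mult_smult_assoc_mat[of "X * T" k n Y k])
    also have "X * (E * W * F) * Y = X * E * W * (F * Y)"
    proof -
      have "X * E * W * (F * Y) = X * E * W * F * Y"
        by (rule assoc_mult_mat[symmetric, of _ k N _ n _ k]) (use X E W F Y in auto)
      also have "X * E * W * F = X * (E * W * F)"
      proof -
        have "X * E * W = X * (E * W)"
          by (rule assoc_mult_mat[of _ k n _ N _ N]) (use X E W in auto)
        moreover have "X * (E * W) * F = X * (E * W * F)"
          by (rule assoc_mult_mat[of _ k n _ N _ n]) (use X E W F in auto)
        ultimately show ?thesis by simp
      qed
      finally show ?thesis by simp
    qed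
    finally show ?thesis by simp
  qed
  also have "\<dots> = \<delta> \<cdot>\<^sub>m (X * P * Y)"
    unfolding eq[symmetric] using X P Y
    by (simp add: mult_smult_distrib[of X k n P n] mult_smult_assoc_mat[of "X * P" k n Y k])
  finally have "det (X * E * W * (F * Y) + c \<cdot>\<^sub>m (X * T * Y)) = \<delta> ^ k * det (X * P * Y)"
    using X P Y by simp
  moreover have "c ^ k * det (four_block_mat (X * T * Y) (X * E) (- (F * Y)) W') = det (X * E * W * (F * Y) + c \<cdot>\<^sub>m (X * T * Y)) * det W'"
    by (rule det_weighted) (use X Y T E F W in auto)
  ultimately show ?thesis by simp
qed

text \<open>Block elimination with the adjugate in place of the inverse of \<open>Q\<close>, so that
  it makes sense over a domain; the powers of det Q are the price.\<close>

lemma det_schur: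
  fixes Q :: "'a :: idom mat"
  assumes Q: "Q \<in> carrier_mat k k" and B: "B \<in> carrier_mat k r" and C: "C \<in> carrier_mat r k" and D: "D \<in> carrier_mat r r"
    and nz: "det Q \<noteq> 0"
  shows "det (four_block_mat Q B C D) * det Q ^ r = det Q * det (det Q \<cdot>\<^sub>m D - C * adj_mat Q * B)"
proof -
  let ?q = "det Q" and ?A = "adj_mat Q"
  note A = adj_mat[OF Q]
  let ?M = "four_block_mat Q B C D" and ?N = "four_block_mat ?A (- (?A * B)) (0\<^sub>m r k) (?q \<cdot>\<^sub>m 1\<^sub>m r)"
  have dims: "?M \<in> carrier_mat (k + r) (k + r)" "?N \<in> carrier_mat (k + r) (k + r)"
    using A B C D Q by auto
  have AB: "- (?A * B) \<in> carrier_mat k r" using A B by simp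
  have e1: "Q * ?A + B * 0\<^sub>m r k = ?q \<cdot>\<^sub>m 1\<^sub>m k" using A B by simp
  have qab: "Q * (?A * B) = ?q \<cdot>\<^sub>m B"
    using A Q B by (simp add: assoc_mult_mat[of Q k k ?A k B r, symmetric] mult_smult_assoc_mat[of "1\<^sub>m k" k k B r])
  have e2: "Q * - (?A * B) + B * (?q \<cdot>\<^sub>m 1\<^sub>m r) = 0\<^sub>m k r"
  proof -
    have "Q * - (?A * B) = - (?q \<cdot>\<^sub>m B)"
    proof -
      have "Q * - (?A * B) = - (Q * (?A * B))"
        by (rule uminus_mult_right_mat) (use Q A B in auto)
      then show ?thesis unfolding qab .
    qed
    moreover have "B * (?q \<cdot>\<^sub>m 1\<^sub>m r) = ?q \<cdot>\<^sub>m B" using B by (simp add: mult_smult_distrib[of B k r "1\<^sub>m r" r])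
    ultimately show ?thesis using B by (intro eq_matI) auto
  qed
  have e3: "C * ?A + D * 0\<^sub>m r k = C * ?A" using A C D by simp
  have e4: "C * - (?A * B) + D * (?q \<cdot>\<^sub>m 1\<^sub>m r) = ?q \<cdot>\<^sub>m D - C * ?A * B"
  proof -
    have "C * - (?A * B) = - (C * ?A * B)"
    proof -
      have "C * - (?A * B) = - (C * (?A * B))"
        by (rule uminus_mult_right_mat) (use C A B in auto)
      moreover have "C * ?A * B = C * (?A * B)"
        by (rule assoc_mult_mat) (use C A B in auto)
      ultimately show ?thesis by simp
    qed
    moreover have "D * (?q \<cdot>\<^sub>m 1\<^sub>m r) = ?q \<cdot>\<^sub>m D" using D by (simp add: mult_smult_distrib[of D r r "1\<^sub>m r" r])
    ultimately show ?thesis using A B C D by (intro eq_matI) auto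
  qed
  have "?M * ?N = four_block_mat (Q * ?A + B * 0\<^sub>m r k) (Q * - (?A * B) + B * (?q \<cdot>\<^sub>m 1\<^sub>m r))
      (C * ?A + D * 0\<^sub>m r k) (C * - (?A * B) + D * (?q \<cdot>\<^sub>m 1\<^sub>m r))"
    by (rule mult_four_block_mat) (use Q A B C D AB in auto)
  then have "?M * ?N = four_block_mat (?q \<cdot>\<^sub>m 1\<^sub>m k) (0\<^sub>m k r) (C * ?A) (?q \<cdot>\<^sub>m D - C * ?A * B)"
    unfolding e1 e2 e3 e4 .
  moreover have "C * ?A * B \<in> carrier_mat r r" using A B C by (meson mult_carrier_mat)
  then have "?q \<cdot>\<^sub>m D - C * ?A * B \<in> carrier_mat r r" by (rule minus_carrier_mat)
  then have "det (four_block_mat (?q \<cdot>\<^sub>m 1\<^sub>m k) (0\<^sub>m k r) (C * ?A) (?q \<cdot>\<^sub>m D - C * ?A * B))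
      = det (?q \<cdot>\<^sub>m 1\<^sub>m k) * det (?q \<cdot>\<^sub>m D - C * ?A * B)"
    by (intro det_four_block_mat_upper_right_zero) (use A C in auto)
  ultimately have "det (?M * ?N) = ?q ^ k * det (?q \<cdot>\<^sub>m D - C * ?A * B)"
    by (simp only: det_scalar)
  moreover have "det ?N = det ?A * ?q ^ r"
    using det_four_block_mat_lower_left_zero[of ?A k "- (?A * B)" r "0\<^sub>m r k" "?q \<cdot>\<^sub>m 1\<^sub>m r"] A AB by simp
  ultimately have *: "det ?M * (det ?A * ?q ^ r) = ?q ^ k * det (?q \<cdot>\<^sub>m D - C * ?A * B)"
    using det_mult[OF dims] by simp
  \<comment> \<open>Trades the determinant of the adjugate for a power of det Q, after which det Q^k
    can be cancelled.\<close>
  have "?q * det ?A = ?q ^ k" using det_mult[OF Q A(1)] A(2) by simp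
  then have "?q ^ k * (det ?M * ?q ^ r) = ?q * (det ?M * (det ?A * ?q ^ r))" by (simp add: mult_ac)
  also have "\<dots> = ?q ^ k * (?q * det (?q \<cdot>\<^sub>m D - C * ?A * B))" unfolding * by (simp add: mult_ac)
  finally show ?thesis using nz by simp
qed

text \<open>Rows and columns are selected by lists rather than sets, so that bordering a minor is
  appending to the lists.\<close>

definition sub :: "nat list \<Rightarrow> nat list \<Rightarrow> 'a mat \<Rightarrow> 'a mat" where
  "sub I J P = mat (length I) (length J) (\<lambda>(a, b). P $$ (I ! a, J ! b))"

lemma sub_append:
  "sub (I @ I') (J @ J') P = four_block_mat (sub I J P) (sub I J' P) (sub I' J P) (sub I' J' P)"
  by (rule eq_matI) (auto simp: sub_def nth_append)

lemma sub_mult: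
  assumes "A \<in> carrier_mat nr n" "B \<in> carrier_mat n nc" "set I \<subseteq> {..<nr}" "set J \<subseteq> {..<nc}"
  shows "sub I J (A * B) = sub I [0..<n] A * sub [0..<n] J B"
proof (rule eq_matI)
  fix a b assume ab: "a < dim_row (sub I [0..<n] A * sub [0..<n] J B)" "b < dim_col (sub I [0..<n] A * sub [0..<n] J B)"
  then have i: "I ! a < nr" "J ! b < nc" using assms(3,4) by (auto simp: sub_def dest: nth_mem)
  then show "sub I J (A * B) $$ (a, b) = (sub I [0..<n] A * sub [0..<n] J B) $$ (a, b)"
    using ab assms by (auto simp: sub_def scalar_prod_def intro!: sum.cong)
qed (simp_all add: sub_def)

text \<open>Bounds the size of minors not divisible by a prime, so that a maximal one
  exists.\<close>

lemma det_sub_large: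
  fixes P :: "'a :: comm_ring_1 mat"
  assumes "set I \<subseteq> {..<n}" "n < length I" "length J = length I"
  shows "det (sub I J P) = 0"
proof -
  have "card (set I) \<le> n" using card_mono[OF _ assms(1)] by simp
  then have "\<not> distinct I" using assms(2) by (auto simp: distinct_card)
  then obtain a b where ab: "a < length I" "b < length I" "a \<noteq> b" "I ! a = I ! b"
    by (auto simp: distinct_conv_nth)
  show ?thesis
    by (rule det_identical_rows[of _ "length I" a b])
       (use ab assms(3) in \<open>auto simp: sub_def intro!: eq_vecI\<close>)
qed

text \<open>Schur complement with respect to a maximal minor not divisible by \<open>\<pi>\<close>: all bordered
  minors are divisible by \<open>\<pi>\<close>.\<close>

lemma rank_factor:
  fixes P :: "'a :: idom mat"
  assumes P: "P \<in> carrier_mat n n" and \<pi>: "prime_elem \<pi>"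
  obtains I J S where "length I = length J" "set I \<subseteq> {..<n}" "set J \<subseteq> {..<n}" "length I \<le> n"
    "\<not> \<pi> dvd det (sub I J P)" "S \<in> carrier_mat n n"
    "\<And>I' J'. set I' \<subseteq> {..<n} \<Longrightarrow> set J' \<subseteq> {..<n} \<Longrightarrow>
      det (sub I J P) \<cdot>\<^sub>m sub I' J' P = sub I' J P * adj_mat (sub I J P) * sub I J' P + \<pi> \<cdot>\<^sub>m sub I' J' S"
proof -
  let ?K = "{k. \<exists>I J. length I = k \<and> length J = k \<and> set I \<subseteq> {..<n} \<and> set J \<subseteq> {..<n} \<and> \<not> \<pi> dvd det (sub I J P)}"
  have "?K \<subseteq> {..n}"
  proof
    fix k assume "k \<in> ?K"
    then obtain I J where *: "length I = k" "length J = k" "set I \<subseteq> {..<n}" "\<not> \<pi> dvd det (sub I J P)"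
      by blast
    have "\<not> n < k" using det_sub_large[OF *(3), of J P] *(1,2,4) by auto
    then show "k \<in> {..n}" by simp
  qed
  then have fin: "finite ?K" by (rule finite_subset) simp
  have "det (sub [] [] P) = 1" by (simp add: sub_def)
  then have "\<not> \<pi> dvd det (sub [] [] P)" using \<pi> by (simp add: prime_elem_def)
  then have "0 \<in> ?K" by (intro CollectI exI[of _ "[]"]) simp
  then have "?K \<noteq> {}" by blast
  then have "Max ?K \<in> ?K" by (rule Max_in[OF fin])
  then obtain I J where IJ: "length I = Max ?K" "length J = Max ?K" "set I \<subseteq> {..<n}" "set J \<subseteq> {..<n}"
    "\<not> \<pi> dvd det (sub I J P)" by blast
  define k where "k = Max ?K"
  define Q where "Q = sub I J P"
  have len: "length I = k" "length J = k" using IJ by (simp_all add: k_def)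
  have Q: "Q \<in> carrier_mat k k" using len by (simp add: Q_def sub_def)
  have nz: "det Q \<noteq> 0" using IJ(5) by (auto simp: Q_def)
  \<comment> \<open>The entry of P, times det Q, that the rows and columns of the maximal minor
    predict.\<close>
  define Sc where "Sc i j = (sub [i] J P * adj_mat Q * sub I [j] P) $$ (0, 0)" for i j
  have dv: "\<pi> dvd det Q * P $$ (i, j) - Sc i j" if "i < n" "j < n" for i j
  proof -
    \<comment> \<open>One more row and column give a larger minor, divisible by \<open>\<pi>\<close>
      because the size of \<open>Q\<close> is maximal.\<close>
    have "\<pi> dvd det (sub (I @ [i]) (J @ [j]) P)"
    proof (rule ccontr)
      assume "\<not> \<pi> dvd det (sub (I @ [i]) (J @ [j]) P)"
      then have "Suc k \<in> ?K" using IJ len that by (intro CollectI exI[of _ "I @ [i]"] exI[of _ "J @ [j]"]) simp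
      from Max_ge[OF fin this] show False by (simp add: k_def)
    qed
    moreover have "det (sub (I @ [i]) (J @ [j]) P) * det Q ^ 1 =
        det Q * det (det Q \<cdot>\<^sub>m sub [i] [j] P - sub [i] J P * adj_mat Q * sub I [j] P)"
      unfolding sub_append Q_def[symmetric]
      by (rule det_schur[OF Q _ _ _ nz]) (use len in \<open>simp_all add: sub_def\<close>)
    moreover have "det (det Q \<cdot>\<^sub>m sub [i] [j] P - sub [i] J P * adj_mat Q * sub I [j] P) = det Q * P $$ (i, j) - Sc i j"
    proof -
      have c: "sub [i] J P \<in> carrier_mat 1 k" "adj_mat Q \<in> carrier_mat k k" "sub I [j] P \<in> carrier_mat k 1"
        using len adj_mat(1)[OF Q] by (simp_all add: sub_def)
      then have c': "sub [i] J P * adj_mat Q * sub I [j] P \<in> carrier_mat 1 1"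
        by (meson mult_carrier_mat)
      then have "det Q \<cdot>\<^sub>m sub [i] [j] P - sub [i] J P * adj_mat Q * sub I [j] P \<in> carrier_mat 1 1"
        by (rule minus_carrier_mat)
      note d = det_single[OF this]
      have "(det Q \<cdot>\<^sub>m sub [i] [j] P - sub [i] J P * adj_mat Q * sub I [j] P) $$ (0, 0) =
          (det Q \<cdot>\<^sub>m sub [i] [j] P) $$ (0, 0) - Sc i j"
        unfolding Sc_def using c' by (intro index_minus_mat(1)) auto
      then show ?thesis unfolding d by (simp add: sub_def)
    qed
    ultimately show ?thesis using nz by (simp add: mult.commute)
  qed
  define S where "S = mat n n (\<lambda>(i, j). SOME x. det Q * P $$ (i, j) - Sc i j = \<pi> * x)"
  have S: "det Q * P $$ (i, j) - Sc i j = \<pi> * S $$ (i, j)" if "i < n" "j < n" for i j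
    using someI_ex[OF dv[OF that, unfolded dvd_def]] that by (simp add: S_def)
  have eq: "det Q \<cdot>\<^sub>m sub I' J' P = sub I' J P * adj_mat Q * sub I J' P + \<pi> \<cdot>\<^sub>m sub I' J' S"
    if I': "set I' \<subseteq> {..<n}" "set J' \<subseteq> {..<n}" for I' J'
  proof (rule eq_matI)
    fix a b assume ab: "a < dim_row (sub I' J P * adj_mat Q * sub I J' P + \<pi> \<cdot>\<^sub>m sub I' J' S)"
      "b < dim_col (sub I' J P * adj_mat Q * sub I J' P + \<pi> \<cdot>\<^sub>m sub I' J' S)"
    then have ab': "a < length I'" "b < length J'" by (simp_all add: sub_def)
    then have i: "I' ! a < n" "J' ! b < n" using I' by (auto dest: nth_mem)
    have "Sc (I' ! a) (J' ! b) = (sub I' J P * adj_mat Q * sub I J' P) $$ (a, b)"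
    proof -
      have A: "adj_mat Q \<in> carrier_mat k k" by (rule adj_mat(1)[OF Q])
      have *: "sub [I' ! a] J P * adj_mat Q * sub I [J' ! b] P =
          sub [a] [b] (sub I' J P * adj_mat Q * sub I J' P)"
        using ab' A len by (intro eq_matI) (auto simp: sub_def scalar_prod_def intro!: sum.cong)
      show ?thesis unfolding Sc_def * by (simp add: sub_def)
    qed
    then show "(det Q \<cdot>\<^sub>m sub I' J' P) $$ (a, b) = (sub I' J P * adj_mat Q * sub I J' P + \<pi> \<cdot>\<^sub>m sub I' J' S) $$ (a, b)"
      using S[OF i] ab' by (simp add: sub_def algebra_simps)
  qed (simp_all add: sub_def)
  have "length I \<le> n" using \<open>?K \<subseteq> {..n}\<close> \<open>Max ?K \<in> ?K\<close> IJ(1) by auto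
  moreover have "S \<in> carrier_mat n n" by (simp add: S_def)
  ultimately show ?thesis
    using that[of I J S] IJ len eq by (simp add: Q_def)
qed

lemma sub_full:
  assumes "P \<in> carrier_mat n m"
  shows "sub [0..<n] [0..<m] P = P"
  using assms by (intro eq_matI) (auto simp: sub_def)

text \<open>Brings a submatrix into the shape X P Y with constant selection matrices, in which
  minors are estimated.\<close>

lemma sub_eq_mult:
  fixes P :: "'a :: comm_ring_1 mat"
  assumes P: "P \<in> carrier_mat n m" and I: "set I \<subseteq> {..<n}" "set J \<subseteq> {..<m}"
  shows "sub I J P = sub I [0..<n] (1\<^sub>m n) * P * sub [0..<m] J (1\<^sub>m m)"
proof -
  have "sub I J P = sub I J (1\<^sub>m n * P)" using P by simp
  also have "\<dots> = sub I [0..<n] (1\<^sub>m n) * sub [0..<n] J P" by (rule sub_mult[OF _ P I]) simp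
  also have "sub [0..<n] J P = sub [0..<n] J (P * 1\<^sub>m m)" using P by simp
  also have "\<dots> = P * sub [0..<m] J (1\<^sub>m m)"
    using sub_mult[of P n m "1\<^sub>m m" m "[0..<n]" J] P I by (simp add: sub_full[OF P] atLeast0LessThan)
  also have "sub I [0..<n] (1\<^sub>m n) * (P * sub [0..<m] J (1\<^sub>m m)) = sub I [0..<n] (1\<^sub>m n) * P * sub [0..<m] J (1\<^sub>m m)"
    by (rule assoc_mult_mat[symmetric, of _ "length I" n _ m _ "length J"]) (use P in \<open>simp_all add: sub_def\<close>)
  finally show ?thesis .
qed

lemma prime_pow_dvd_cancel:
  fixes \<pi> :: "'a :: idom"
  assumes "prime_elem \<pi>" "\<not> \<pi> dvd d" "\<pi> ^ a dvd d * f"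
  shows "\<pi> ^ a dvd f"
  using assms(3)
proof (induction a arbitrary: f)
  case (Suc a)
  have "\<pi> dvd d * f" by (rule dvd_trans[OF _ Suc.prems]) simp
  then have "\<pi> dvd f" using assms(1,2) by (simp add: prime_elem_dvd_mult_iff)
  then obtain g where g: "f = \<pi> * g" by (auto simp: dvd_def)
  have "\<pi> * \<pi> ^ a dvd \<pi> * (d * g)" using Suc.prems by (simp add: g mult_ac)
  then have "\<pi> ^ a dvd d * g" using assms(1) by (simp add: prime_elem_def)
  then have "\<pi> ^ a dvd g" by (rule Suc.IH)
  then show ?case by (simp add: g)
qed simp


section \<open>Reduction of polynomials modulo $p$\<close>

interpretation res_poly: map_poly_comm_ring_hom "res :: 'p :: prime_card padic_int \<Rightarrow> 'p mod_ring" ..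

abbreviation pc :: "'p :: prime_card padic_int poly" where
  "pc \<equiv> [:padic_p:]"

lemma pc_dvd_iff: "pc dvd f \<longleftrightarrow> map_poly res f = 0"
  by (simp add: const_poly_dvd_iff poly_eq_iff coeff_map_poly res_eq_0_iff)

lemma pc_prime: "prime_elem (pc :: 'p :: prime_card padic_int poly)"
proof (rule prime_elemI)
  show "\<not> pc dvd (1 :: 'p padic_int poly)" by (simp add: pc_dvd_iff not_p_dvd_1)
  show "pc dvd f \<or> pc dvd g" if "pc dvd f * g" for f g :: "'p padic_int poly"
    using that by (simp add: pc_dvd_iff res_poly.hom_mult)
qed simp

lemma pc_power: "pc ^ k = [:padic_p ^ k:]"
  by (induction k) (simp_all add: one_pCons mult.commute)

lemma pc_power_dvd_iff: "pc ^ k dvd f \<longleftrightarrow> (\<forall>j. padic_p ^ k dvd coeff f j)"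
  by (simp add: pc_power const_poly_dvd_iff)

text \<open>Taylor expansion at \<open>x\<close>, by composing with t + x and back. It is applied
  over F_p, where derivatives would not detect the order.\<close>

lemma low_coeffs_dvd:
  fixes q :: "'a :: comm_ring_1 poly"
  assumes "\<And>b. b < e \<Longrightarrow> coeff (pcompose q [:x, 1:]) b = 0"
  shows "[:- x, 1:] ^ e dvd q"
proof -
  have "monom 1 e dvd pcompose q [:x, 1:]" using assms by (simp add: monom_1_dvd_iff')
  then obtain h where h: "pcompose q [:x, 1:] = [:0, 1:] ^ e * h"
    by (auto simp: dvd_def monom_altdef)
  have "q = pcompose (pcompose q [:x, 1:]) [:- x, 1:]"
    by (simp add: pcompose_assoc[symmetric])
  also have "\<dots> = pcompose ([:0, 1:] ^ e) [:- x, 1:] * pcompose h [:- x, 1:]"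
    by (simp add: h pcompose_mult)
  also have "pcompose ([:0, 1:] ^ e) [:- x, 1:] = [:- x, 1:] ^ e"
    by (induction e) (simp_all add: pcompose_mult pcompose_1)
  finally show ?thesis by (metis dvd_triv_left)
qed

lemma pcompose_scaled:
  fixes q :: "'a :: comm_ring_1 poly"
  shows "coeff (pcompose q [:x, c:]) b = c ^ b * coeff (pcompose q [:x, 1:]) b"
proof -
  have "pcompose q [:x, c:] = pcompose (pcompose q [:x, 1:]) [:0, c:]"
    by (simp add: pcompose_assoc[symmetric])
  then show ?thesis by (simp only: coeff_pcompose_linear)
qed

lemma res_linear: "map_poly res [:x, 1:] = [:res x, 1:]"
  by (rule poly_eqI) (simp add: coeff_map_poly coeff_pCons split: nat.splits)

lemma scalar_one: "c \<cdot>\<^sub>m 1\<^sub>m N * 1\<^sub>m N = (c :: 'a :: comm_ring_1) \<cdot>\<^sub>m 1\<^sub>m N"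
  by (rule right_mult_one_mat[of _ N N]) simp

text \<open>First lower bound for the vanishing order. Under t = x + p t the matrix P becomes a
  product of width d modulo p, so its k-minors are divisible by p^(k - d). The b-th Taylor
  coefficient of g at x acquires the factor p^b only; for b < k - d - a it must therefore be
  divisible by p itself.\<close>

lemma order_rank:
  fixes P X Y :: "'p :: prime_card padic_int poly mat"
  assumes P: "P \<in> carrier_mat n n" and X: "X \<in> carrier_mat k n" and Y: "Y \<in> carrier_mat n k"
    and g: "det (X * P * Y) = pc ^ a * g"
    and E: "E \<in> carrier_mat n d" and F: "F \<in> carrier_mat d n" and G: "G \<in> carrier_mat n n"
    and Px: "mat_eval P x = E * F + padic_p \<cdot>\<^sub>m G"
  shows "[:- res x, 1:] ^ (k - d - a) dvd map_poly res g"
proof -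
  define c where "c q = pcompose q [:x, padic_p:]" for q
  let ?c = "c"
  let ?C = "map_mat (\<lambda>a. [:a :: 'p padic_int:])"
  interpret c: comm_ring_hom c
    by unfold_locales (simp_all add: c_def pcompose_add pcompose_mult pcompose_1)
  interpret C: comm_ring_hom "\<lambda>a. [:a :: 'p padic_int:]"
    by unfold_locales (simp_all add: one_pCons)
  \<comment> \<open>Modulo p the polynomial q(x + p t) is the constant q(x).\<close>
  have "pc dvd ?c q - [:poly q x:]" for q
  proof -
    have "padic_p dvd coeff (?c q - [:poly q x:]) j" for j
      by (cases j) (simp_all add: c_def pcompose_scaled[of q x padic_p])
    then show ?thesis by (simp add: const_poly_dvd_iff)
  qed
  then have "\<exists>b. ?c q = [:poly q x:] + pc * b" for q
    by (metis dvd_def diff_add_cancel add.commute)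
  then obtain b where b: "\<And>q. ?c q = [:poly q x:] + pc * b q" by metis
  define T where "T = ?C G + map_mat b P"
  have T: "T \<in> carrier_mat n n" using P G by (simp add: T_def)
  have cP: "map_mat ?c P = ?C E * 1\<^sub>m d * ?C F + pc \<cdot>\<^sub>m T"
  proof -
    have "map_mat ?c P = ?C (mat_eval P x) + pc \<cdot>\<^sub>m map_mat b P"
      by (rule eq_matI) (simp_all add: mat_eval_def b)
    also have "?C (mat_eval P x) = ?C (E * F) + pc \<cdot>\<^sub>m ?C G"
      unfolding Px using E F G by (intro eq_matI) auto
    also have "?C (E * F) = ?C E * ?C F" by (rule C.mat_hom_mult[OF E F])
    also have "?C E * ?C F = ?C E * 1\<^sub>m d * ?C F" using E by simp
    finally show ?thesis
      using E F G P by (intro eq_matI) (auto simp: T_def algebra_simps)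
  qed
  have "1 ^ k * det (map_mat ?c X * map_mat ?c P * map_mat ?c Y) * det (pc \<cdot>\<^sub>m 1\<^sub>m d) =
      pc ^ k * det (four_block_mat (map_mat ?c X * T * map_mat ?c Y) (map_mat ?c X * ?C E)
        (- (?C F * map_mat ?c Y)) (pc \<cdot>\<^sub>m 1\<^sub>m d))"
  proof (rule weighted_minor[OF _ T _ _ one_carrier_mat _ scalar_one])
    have "1 \<cdot>\<^sub>m M = M" for M :: "'p padic_int poly mat" by (rule eq_matI) auto
    then show "1 \<cdot>\<^sub>m map_mat ?c P = ?C E * 1\<^sub>m d * ?C F + pc \<cdot>\<^sub>m T" using cP by simp
  qed (use P E F X Y in simp_all)
  moreover have "det (map_mat ?c X * map_mat ?c P * map_mat ?c Y) = ?c (det (X * P * Y))"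
  proof -
    have "map_mat ?c X * map_mat ?c P * map_mat ?c Y = map_mat ?c (X * P * Y)"
      using c.mat_hom_mult[OF X P] c.mat_hom_mult[of "X * P" k n Y k] X P Y by simp
    then show ?thesis by (simp only: c.hom_det)
  qed
  moreover have "?c (det (X * P * Y)) = pc ^ a * ?c g"
    unfolding g by (simp add: c.hom_mult pc_power) (simp add: c_def pcompose_smult)
  ultimately have "pc ^ a * ?c g * pc ^ d = pc ^ k * det (four_block_mat (map_mat ?c X * T * map_mat ?c Y) (map_mat ?c X * ?C E)
        (- (?C F * map_mat ?c Y)) (pc \<cdot>\<^sub>m 1\<^sub>m d))"
    by simp
  then have dv: "pc ^ k dvd pc ^ (a + d) * ?c g" by (simp add: power_add mult_ac)
  have "coeff (pcompose (map_poly res g) [:res x, 1:]) b = 0" if b: "b < k - d - a" for b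
  proof -
    have "pc ^ (a + d) * pc ^ (k - d - a) dvd pc ^ (a + d) * ?c g"
      using dv b by (simp add: power_add[symmetric])
    then have "pc ^ (k - d - a) dvd ?c g" by simp
    then have "padic_p ^ (k - d - a) dvd padic_p ^ b * coeff (pcompose g [:x, 1:]) b"
      by (simp only: c_def pc_power_dvd_iff pcompose_scaled[of g x padic_p])
    note d1 = this
    have d2: "padic_p ^ Suc b dvd (padic_p ^ (k - d - a) :: 'p padic_int)"
      using b by (intro le_imp_power_dvd) simp
    have "padic_p ^ b * padic_p dvd padic_p ^ b * coeff (pcompose g [:x, 1:]) b"
      using dvd_trans[OF d2 d1] by (simp only: power_Suc2)
    then have "padic_p dvd coeff (pcompose g [:x, 1:]) b" by simp
    then have "coeff (map_poly res (pcompose g [:x, 1:])) b = 0"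
      by (simp add: coeff_map_poly res_eq_0_iff)
    then show ?thesis unfolding res.map_poly_pcompose res_linear .
  qed
  then show ?thesis by (rule low_coeffs_dvd)
qed

text \<open>The second lower bound for the vanishing order. Subtracting $p^2G$ does not change the
  minor modulo $p^{a_1+1}$, since its bordered form has a vanishing lower right block modulo $p$.\<close>

lemma order_rank2:
  fixes P X Y :: "'p :: prime_card padic_int poly mat"
  assumes P: "P \<in> carrier_mat n n" and X: "X \<in> carrier_mat k n" and Y: "Y \<in> carrier_mat n k"
    and k: "k = a0 + a1" and g: "det (X * P * Y) = pc ^ a1 * g"
    and E: "E \<in> carrier_mat n d" and F: "F \<in> carrier_mat d n" and G: "G \<in> carrier_mat n n"
    and Px: "mat_eval P x = E * F + padic_p ^ 2 \<cdot>\<^sub>m G"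
    and E2: "E2 \<in> carrier_mat n k" and F2: "F2 \<in> carrier_mat k n" and T: "T \<in> carrier_mat n n"
    and \<delta>: "\<not> pc dvd \<delta>"
    and eq: "\<delta> \<cdot>\<^sub>m P = E2 * mat_diag k (\<lambda>i. if i < a0 then 1 else pc) * F2 + pc ^ 2 \<cdot>\<^sub>m T"
  shows "[:- res x, 1:] ^ (k - d) dvd map_poly res g"
proof -
  let ?C = "map_mat (\<lambda>a. [:a :: 'p padic_int:])"
  interpret C: comm_ring_hom "\<lambda>a. [:a :: 'p padic_int:]"
    by unfold_locales (simp_all add: one_pCons)
  let ?W = "mat_diag k (\<lambda>i. if i < a0 then 1 else pc :: 'p padic_int poly)"
  \<comment> \<open>Chosen so that W' W = p^2; then (p^2)^k divided by det W' is p^a1, exactly the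
    factor of the minor.\<close>
  define W' where "W' = mat_diag k (\<lambda>i. if i < a0 then pc ^ 2 else pc :: 'p padic_int poly)"
  have W': "W' \<in> carrier_mat k k" by (simp add: W'_def)
  have WW: "W' * ?W = pc ^ 2 \<cdot>\<^sub>m 1\<^sub>m k"
    unfolding W'_def mat_diag_diag by (rule eq_matI) (auto simp: mat_diag_def power2_eq_square)
  have detW: "det W' = pc ^ (2 * a0 + a1)"
  proof -
    have "(\<Prod>i<a0 + a1. if i < a0 then pc ^ 2 else pc :: 'p padic_int poly) = pc ^ (2 * a0 + a1)"
      by (induction a1) (simp_all add: power_mult[symmetric] mult.commute flip: power_mult)
    then show ?thesis unfolding W'_def det_diag k .
  qed
  define Z where "Z T = det (four_block_mat (X * T * Y) (X * E2) (- (F2 * Y)) W')" for T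
  have Z: "\<delta> ^ k * det (X * P * Y) * det W' = (pc ^ 2) ^ k * Z T"
    if "P \<in> carrier_mat n n" "T \<in> carrier_mat n n" "\<delta> \<cdot>\<^sub>m P = E2 * ?W * F2 + pc ^ 2 \<cdot>\<^sub>m T" for P T
    unfolding Z_def by (rule weighted_minor[OF that(1,2) E2 F2 _ W' WW that(3) X Y]) simp
  have pw: "(pc ^ 2) ^ k = (pc ^ a1 * pc ^ (2 * a0 + a1) :: 'p padic_int poly)"
    by (simp add: k power_mult[symmetric] power_add[symmetric] algebra_simps)
  have Z': "\<delta> ^ k * det (X * P * Y) = pc ^ a1 * Z T"
    if "P \<in> carrier_mat n n" "T \<in> carrier_mat n n" "\<delta> \<cdot>\<^sub>m P = E2 * ?W * F2 + pc ^ 2 \<cdot>\<^sub>m T" for P T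
    using Z[OF that] unfolding detW pw by (simp add: mult_ac)
  have gZ: "\<delta> ^ k * g = Z T" using Z'[OF P T eq] unfolding g by (simp add: mult_ac)
  \<comment> \<open>Removing p^2 G makes the value at \<open>x\<close> equal to E F, of rank at most
    d over Z_p and not only modulo p^2.\<close>
  define Pi where "Pi = P - pc ^ 2 \<cdot>\<^sub>m ?C G"
  define Ti where "Ti = T - \<delta> \<cdot>\<^sub>m ?C G"
  have Pi: "Pi \<in> carrier_mat n n" and Ti: "Ti \<in> carrier_mat n n" using P T G by (simp_all add: Pi_def Ti_def minus_carrier_mat)
  have eqi: "\<delta> \<cdot>\<^sub>m Pi = E2 * ?W * F2 + pc ^ 2 \<cdot>\<^sub>m Ti"
  proof (rule eq_matI)
    fix i j assume ij: "i < dim_row (E2 * ?W * F2 + pc ^ 2 \<cdot>\<^sub>m Ti)" "j < dim_col (E2 * ?W * F2 + pc ^ 2 \<cdot>\<^sub>m Ti)"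
    then have ij': "i < n" "j < n" using Ti by auto
    have "\<delta> * P $$ (i, j) = (E2 * ?W * F2) $$ (i, j) + pc ^ 2 * T $$ (i, j)"
      using arg_cong[OF eq, of "\<lambda>M. M $$ (i, j)"] ij' P T E2 F2
      by (simp del: index_mult_mat(1))
    then show "(\<delta> \<cdot>\<^sub>m Pi) $$ (i, j) = (E2 * ?W * F2 + pc ^ 2 \<cdot>\<^sub>m Ti) $$ (i, j)"
      using ij' P T G E2 F2 by (simp add: Pi_def Ti_def algebra_simps del: index_mult_mat(1))
  qed (use P T G E2 F2 in \<open>simp_all add: Pi_def Ti_def\<close>)
  have \<delta>k: "\<not> pc dvd \<delta> ^ k"
    using \<delta> pc_prime by (meson prime_elem_dvd_power)
  have "pc ^ a1 dvd det (X * Pi * Y)"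
    by (rule prime_pow_dvd_cancel[OF pc_prime \<delta>k]) (simp add: Z'[OF Pi Ti eqi])
  then obtain gi where gi: "det (X * Pi * Y) = pc ^ a1 * gi" by (auto simp: dvd_def)
  have giZ: "\<delta> ^ k * gi = Z Ti" using Z'[OF Pi Ti eqi] unfolding gi by (simp add: mult_ac)
  \<comment> \<open>\<open>W'\<close> vanishes modulo p, so modulo p the bordered determinant does
    not see the block containing \<open>T\<close>.\<close>
  have "map_poly res (Z T) = det (- (map_mat (map_poly res) (X * E2) * map_mat (map_poly res) (- (F2 * Y))))"
    if T: "T \<in> carrier_mat n n" for T
  proof -
    let ?r = "map_mat (map_poly res :: 'p padic_int poly \<Rightarrow> 'p mod_ring poly)"
    have dims: "X * T * Y \<in> carrier_mat k k" "X * E2 \<in> carrier_mat k k" "- (F2 * Y) \<in> carrier_mat k k"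
      using X Y T E2 F2 by auto
    have r0: "?r W' = 0\<^sub>m k k"
    proof (rule eq_matI)
      fix i j assume "i < dim_row (0\<^sub>m k k :: 'p mod_ring poly mat)" "j < dim_col (0\<^sub>m k k :: 'p mod_ring poly mat)"
      moreover have "map_poly res (pc :: 'p padic_int poly) = 0" by (simp add: map_poly_pCons res_eq_0_iff)
      ultimately show "?r W' $$ (i, j) = 0\<^sub>m k k $$ (i, j)"
        by (simp add: W'_def mat_diag_def res_poly.hom_power)
    qed (simp_all add: W'_def mat_diag_def)
    have "map_poly res (Z T) = det (?r (four_block_mat (X * T * Y) (X * E2) (- (F2 * Y)) W'))"
      unfolding Z_def by (rule res_poly.hom_det[symmetric])
    also have "?r (four_block_mat (X * T * Y) (X * E2) (- (F2 * Y)) W') =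
        four_block_mat (?r (X * T * Y)) (?r (X * E2)) (?r (- (F2 * Y))) (0\<^sub>m k k)"
      by (subst map_four_block_mat[OF dims W']) (simp add: r0)
    also have "det \<dots> = det (?r (X * T * Y) * 0\<^sub>m k k - ?r (X * E2) * ?r (- (F2 * Y)))"
    proof (rule det_four_block_mat)
      have m: "?r (- (F2 * Y)) \<in> carrier_mat k k" using dims(3) by simp
      show "?r (- (F2 * Y)) * 0\<^sub>m k k = 0\<^sub>m k k * ?r (- (F2 * Y))"
        unfolding right_mult_zero_mat[OF m] left_mult_zero_mat[OF m] ..
    qed (use dims in \<open>auto intro!: carrier_matI\<close>)
    also have "?r (X * T * Y) * 0\<^sub>m k k - ?r (X * E2) * ?r (- (F2 * Y)) = - (?r (X * E2) * ?r (- (F2 * Y)))"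
    proof -
      have "?r (X * T * Y) * 0\<^sub>m k k = 0\<^sub>m k k" by (rule right_mult_zero_mat[of _ k k]) (use dims in simp)
      moreover have "0\<^sub>m k k - M = - M" if "M \<in> carrier_mat k k" for M :: "'p mod_ring poly mat"
        using that by (intro eq_matI) auto
      moreover have "?r (X * E2) * ?r (- (F2 * Y)) \<in> carrier_mat k k" using dims by (intro mult_carrier_mat) auto
      ultimately show ?thesis by simp
    qed
    finally show ?thesis .
  qed
  then have "map_poly res (Z T) = map_poly res (Z Ti)" using T Ti by simp
  then have "map_poly res \<delta> ^ k * map_poly res g = map_poly res \<delta> ^ k * map_poly res gi"
    by (simp add: gZ[symmetric] giZ[symmetric] res_poly.hom_mult res_poly.hom_power)
  then have gg: "map_poly res g = map_poly res gi"
    using \<delta> by (simp add: pc_dvd_iff)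
  \<comment> \<open>From here t - x plays the part of p: \<open>Pi\<close> is a product of width d
    plus a multiple of t - x.\<close>
  have "[:- x, 1:] dvd Pi $$ (i, j) - [:(E * F) $$ (i, j):]" if "i < n" "j < n" for i j
  proof -
    have "poly (P $$ (i, j)) x = (E * F) $$ (i, j) + padic_p ^ 2 * G $$ (i, j)"
      using arg_cong[OF Px, of "\<lambda>M. M $$ (i, j)"] that P E F G
      by (simp add: mat_eval_def del: index_mult_mat(1))
    then have "poly (Pi $$ (i, j) - [:(E * F) $$ (i, j):]) x = 0"
      using that P G by (simp add: Pi_def pc_power del: index_mult_mat(1))
    then show ?thesis by (simp only: poly_eq_0_iff_dvd)
  qed
  then have "\<exists>b. i < n \<and> j < n \<longrightarrow> Pi $$ (i, j) = [:(E * F) $$ (i, j):] + [:- x, 1:] * b" for i j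
    by (metis dvd_def diff_add_cancel add.commute)
  then obtain b where b: "\<And>i j. i < n \<Longrightarrow> j < n \<Longrightarrow> Pi $$ (i, j) = [:(E * F) $$ (i, j):] + [:- x, 1:] * b i j" by metis
  define B where "B = mat n n (\<lambda>(i, j). b i j)"
  have B: "B \<in> carrier_mat n n" by (simp add: B_def)
  have "1 \<cdot>\<^sub>m Pi = ?C E * 1\<^sub>m d * ?C F + [:- x, 1:] \<cdot>\<^sub>m B"
  proof -
    have "?C E * 1\<^sub>m d * ?C F = ?C (E * F)" using C.mat_hom_mult[OF E F] E by simp
    then show ?thesis using E F Pi by (intro eq_matI) (auto simp: B_def b simp del: index_mult_mat(1))
  qed
  from weighted_minor[OF Pi B _ _ one_carrier_mat _ scalar_one this X Y]
  have "1 ^ k * det (X * Pi * Y) * det ([:- x, 1:] \<cdot>\<^sub>m 1\<^sub>m d) =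
      [:- x, 1:] ^ k * det (four_block_mat (X * B * Y) (X * ?C E) (- (?C F * Y)) ([:- x, 1:] \<cdot>\<^sub>m 1\<^sub>m d))"
    using E F by simp
  then have dv: "[:- x, 1:] ^ k dvd [:- x, 1:] ^ d * det (X * Pi * Y)"
    by (simp add: mult.commute)
  have "[:- x, 1:] ^ (k - d) dvd det (X * Pi * Y)"
  proof (cases "d \<le> k")
    case True
    then have "[:- x, 1:] ^ d * [:- x, 1:] ^ (k - d) dvd [:- x, 1:] ^ d * det (X * Pi * Y)"
      using dv by (simp add: power_add[symmetric])
    then show ?thesis by simp
  qed simp
  then have "[:- x, 1:] ^ (k - d) dvd smult (padic_p ^ a1) gi" unfolding gi by (simp add: pc_power)
  \<comment> \<open>The constant p^a1 is nonzero over Z_p and does not affect the order at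
    \<open>x\<close>. Reducing modulo p only afterwards avoids the loss of a1 in the
    exponent.\<close>
  then have "[:- x, 1:] ^ (k - d) dvd gi"
    unfolding order_divides by (simp add: order_smult)
  then have "map_poly res ([:- x, 1:] ^ (k - d)) dvd map_poly res gi"
    by (rule res_poly.hom_dvd)
  then show ?thesis unfolding gg by (simp only: res_poly.hom_power res_linear res.hom_uminus)
qed


section \<open>Necessity of the numerical condition\<close>

lemma flin_expand:
  fixes T :: "(nat \<Rightarrow> 'p :: prime_card padic_int) \<Rightarrow> (nat \<Rightarrow> 'p padic_int)"
  assumes T: "autom {..<n} T T'" and i: "i < n"
  shows "T v i = (\<Sum>j<n. T (\<lambda>l. if l = j then 1 else 0) i * v j)"
proof -
  have "T (\<lambda>l. if l < k then v l else 0) i = (\<Sum>j<k. T (\<lambda>l. if l = j then 1 else 0) i * v j)" for k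
  proof (induction k)
    case 0
    then show ?case using flin_0[OF automD(1)[OF T]] by simp
  next
    case (Suc k)
    have "(\<lambda>l. if l < Suc k then v l else 0) =
        (\<lambda>l. 1 * (if l < k then v l else 0) + v k * (if l = k then 1 else 0))"
      by (auto simp: fun_eq_iff less_Suc_eq)
    then show ?case
      using flin_comb[OF automD(1)[OF T], of 1 "\<lambda>l. if l < k then v l else 0" "v k" "\<lambda>l. if l = k then 1 else 0"] Suc
      by (simp add: mult.commute)
  qed
  from this[of n] show ?thesis
    using automD(7)[OF T, of v "\<lambda>l. if l < n then v l else 0" i] i by simp
qed

text \<open>The columns of \<open>A\<close> lie in \<open>LA\<close>, which gives the factorisation
  of \<open>A\<close> over Z_p. In the other direction, the images under \<open>T'\<close> of the
  scaled unit vectors lie in \<open>LA\<close>; this recovers the diagonal matrix from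
  \<open>A\<close>, but only modulo p^2.\<close>

lemma mat_type_factor:
  fixes A :: "'p :: prime_card padic_int mat"
  assumes mt: "mat_type n A es" and A: "A \<in> carrier_mat n n"
  obtains U U' V Y Z where "U \<in> carrier_mat n n" "U' \<in> carrier_mat n n" "V \<in> carrier_mat n n"
    "Y \<in> carrier_mat n n" "Z \<in> carrier_mat n n"
    "A = U' * mat_diag n (\<lambda>j. padic_p ^ (es ! j)) * V"
    "mat_diag n (\<lambda>j. padic_p ^ (es ! j)) = U * A * Y + padic_p ^ 2 \<cdot>\<^sub>m Z"
proof -
  obtain T T' where T: "autom {..<n} T T'"
    and L: "\<And>v. v \<in> LA n A \<longleftrightarrow> (\<forall>j<n. padic_p ^ (es ! j) dvd T v j)"
    using mt unfolding mat_type_def by blast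
  define un where "un j = (\<lambda>l. if l = j then 1 else 0 :: 'p padic_int)" for j :: nat
  define U where "U = mat n n (\<lambda>(i, j). T (un j) i)"
  define U' where "U' = mat n n (\<lambda>(i, j). T' (un j) i)"
  have U: "T v i = (\<Sum>j<n. U $$ (i, j) * v j)" if "i < n" for v i
    using flin_expand[OF T that, of v] that by (simp add: U_def un_def)
  have U': "T' v i = (\<Sum>j<n. U' $$ (i, j) * v j)" if "i < n" for v i
    using flin_expand[OF autom_inv[OF T] that, of v] that by (simp add: U'_def un_def)
  define a where "a j = (\<lambda>i. A $$ (i, j))" for j
  have aL: "a j \<in> LA n A" if "j < n" for j
  proof -
    have "(\<Sum>l<n. A $$ (i, l) * un j l) = A $$ (i, j)" for i
    proof -
      have "(\<Sum>l<n. A $$ (i, l) * un j l) = (\<Sum>l<n. if l = j then A $$ (i, j) else 0)"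
        by (rule sum.cong) (auto simp: un_def)
      then show ?thesis using that by simp
    qed
    then show ?thesis unfolding LA_def a_def
      by (intro CollectI exI[of _ "un j"] exI[of _ "\<lambda>_. 0"]) simp
  qed
  have "\<exists>x. i < n \<and> j < n \<longrightarrow> T (a j) i = padic_p ^ (es ! i) * x" for i j
    using L[of "a j"] aL[of j] by (auto simp: dvd_def)
  then obtain V' where V': "\<And>i j. i < n \<Longrightarrow> j < n \<Longrightarrow> T (a j) i = padic_p ^ (es ! i) * V' i j" by metis
  define V where "V = mat n n (\<lambda>(i, j). V' i j)"
  have factor: "A = U' * mat_diag n (\<lambda>j. padic_p ^ (es ! j)) * V"
  proof (rule eq_matI)
    fix i j assume "i < dim_row (U' * mat_diag n (\<lambda>j. padic_p ^ (es ! j)) * V)"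
      "j < dim_col (U' * mat_diag n (\<lambda>j. padic_p ^ (es ! j)) * V)"
    then have ij: "i < n" "j < n" by (simp_all add: U'_def V_def)
    have "A $$ (i, j) = T' (T (a j)) i" using automD(4)[OF T] by (simp add: a_def)
    also have "\<dots> = (\<Sum>l<n. U' $$ (i, l) * (padic_p ^ (es ! l) * V' l j))"
      using U'[OF ij(1), of "T (a j)"] V' ij by simp
    also have "\<dots> = (U' * mat_diag n (\<lambda>j. padic_p ^ (es ! j)) * V) $$ (i, j)"
      using ij by (subst mat_diag_mult_right[of _ n]) (auto simp: U'_def V_def scalar_prod_def mult.assoc atLeast0LessThan)
    finally show "A $$ (i, j) = (U' * mat_diag n (\<lambda>j. padic_p ^ (es ! j)) * V) $$ (i, j)" .
  qed (use A in \<open>simp_all add: U'_def V_def\<close>)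
  have "\<exists>y z. j < n \<longrightarrow> (\<forall>i<n. T' (\<lambda>l. padic_p ^ (es ! j) * un j l) i = (\<Sum>l<n. A $$ (i, l) * y l) + padic_p ^ 2 * z i)" for j
  proof -
    have "T' (\<lambda>l. padic_p ^ (es ! j) * un j l) \<in> LA n A"
      unfolding L automD(3)[OF T] by (auto simp: un_def)
    then show ?thesis unfolding LA_def by blast
  qed
  then obtain y z where yz: "\<And>i j. j < n \<Longrightarrow> i < n \<Longrightarrow>
      T' (\<lambda>l. padic_p ^ (es ! j) * un j l) i = (\<Sum>l<n. A $$ (i, l) * y j l) + padic_p ^ 2 * z j i" by metis
  define Y where "Y = mat n n (\<lambda>(i, j). y j i)"
  define Z where "Z = U * mat n n (\<lambda>(i, j). z j i)"
  have Zc: "Z \<in> carrier_mat n n"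
    unfolding Z_def by (rule mult_carrier_mat[of _ n n]) (simp_all add: U_def)
  have diag: "mat_diag n (\<lambda>j. padic_p ^ (es ! j)) = U * A * Y + padic_p ^ 2 \<cdot>\<^sub>m Z"
  proof (rule eq_matI)
    fix i j assume "i < dim_row (U * A * Y + padic_p ^ 2 \<cdot>\<^sub>m Z)" "j < dim_col (U * A * Y + padic_p ^ 2 \<cdot>\<^sub>m Z)"
    then have ij: "i < n" "j < n" using Zc by auto
    let ?w = "\<lambda>l. padic_p ^ (es ! j) * un j l"
    have "mat_diag n (\<lambda>j. padic_p ^ (es ! j)) $$ (i, j) = ?w i"
      using ij by (simp add: mat_diag_def un_def)
    also have "\<dots> = T (T' ?w) i" using automD(3)[OF T, of ?w] by simp
    also have "\<dots> = (\<Sum>l<n. U $$ (i, l) * ((\<Sum>h<n. A $$ (l, h) * y j h) + padic_p ^ 2 * z j l))"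
      unfolding U[OF ij(1)] using yz ij by (intro sum.cong) auto
    also have "\<dots> = (U * (A * Y) + padic_p ^ 2 \<cdot>\<^sub>m Z) $$ (i, j)"
      using ij A by (simp add: U_def Y_def Z_def scalar_prod_def algebra_simps sum.distrib sum_distrib_left atLeast0LessThan)
    also have "U * (A * Y) = U * A * Y"
      by (rule assoc_mult_mat[symmetric, of _ n n _ n _ n]) (use A in \<open>simp_all add: U_def Y_def\<close>)
    finally show "mat_diag n (\<lambda>j. padic_p ^ (es ! j)) $$ (i, j) = (U * A * Y + padic_p ^ 2 \<cdot>\<^sub>m Z) $$ (i, j)" .
  qed (use Zc in \<open>simp_all add: mat_diag_def\<close>)
  show ?thesis
    by (rule that[OF _ _ _ _ Zc factor diag]) (simp_all add: U_def U'_def V_def Y_def)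
qed

lemma diag_split:
  fixes U V :: "'a :: comm_ring_1 mat"
  assumes U: "U \<in> carrier_mat n n" and V: "V \<in> carrier_mat n n" and d: "d \<le> n"
    and f: "\<And>l. d \<le> l \<Longrightarrow> l < n \<Longrightarrow> f l = c * h l"
  shows "\<exists>E F G. E \<in> carrier_mat n d \<and> F \<in> carrier_mat d n \<and> G \<in> carrier_mat n n \<and>
    U * mat_diag n f * V = E * F + c \<cdot>\<^sub>m G"
proof (intro exI conjI)
  let ?E = "mat n d (\<lambda>(i, l). U $$ (i, l) * f l)" and ?F = "mat d n (\<lambda>(l, j). V $$ (l, j))"
  let ?G = "mat n n (\<lambda>(i, j). \<Sum>l = d..<n. U $$ (i, l) * h l * V $$ (l, j))"
  show "?E \<in> carrier_mat n d" "?F \<in> carrier_mat d n" "?G \<in> carrier_mat n n" by simp_all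
  show "U * mat_diag n f * V = ?E * ?F + c \<cdot>\<^sub>m ?G"
  proof (rule eq_matI)
    fix i j assume "i < dim_row (?E * ?F + c \<cdot>\<^sub>m ?G)" "j < dim_col (?E * ?F + c \<cdot>\<^sub>m ?G)"
    then have ij: "i < n" "j < n" by simp_all
    have "(U * mat_diag n f * V) $$ (i, j) = (\<Sum>l<n. U $$ (i, l) * f l * V $$ (l, j))"
      using ij U V by (subst mat_diag_mult_right[of _ n]) (auto simp: scalar_prod_def atLeast0LessThan)
    also have "{..<n} = {..<d} \<union> {d..<n}" using d by auto
    also have "(\<Sum>l\<in>{..<d} \<union> {d..<n}. U $$ (i, l) * f l * V $$ (l, j)) =
        (\<Sum>l<d. U $$ (i, l) * f l * V $$ (l, j)) + (\<Sum>l = d..<n. U $$ (i, l) * f l * V $$ (l, j))"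
      by (rule sum.union_disjoint) auto
    also have "(\<Sum>l = d..<n. U $$ (i, l) * f l * V $$ (l, j)) = c * (\<Sum>l = d..<n. U $$ (i, l) * h l * V $$ (l, j))"
      unfolding sum_distrib_left by (rule sum.cong) (auto simp: f mult_ac)
    finally show "(U * mat_diag n f * V) $$ (i, j) = (?E * ?F + c \<cdot>\<^sub>m ?G) $$ (i, j)"
      using ij by (simp add: scalar_prod_def atLeast0LessThan)
  qed (use U V in simp_all)
qed

text \<open>Yields a minor of valuation exactly the sum of the first k exponents. As these are at
  most 1, the error p^2 Z is divisible by p times the diagonal entry of its row, so the minor is det
  D times det(1 - p Z'), and the latter is prime to p.\<close>

lemma diag_minor:
  fixes A :: "'p :: prime_card padic_int mat"
  assumes c: "U \<in> carrier_mat n n" "A \<in> carrier_mat n n" "Y \<in> carrier_mat n n" "Z \<in> carrier_mat n n"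
    and eq: "mat_diag n (\<lambda>j. padic_p ^ (es ! j)) = U * A * Y + padic_p ^ 2 \<cdot>\<^sub>m Z"
    and k: "k \<le> n" "\<And>j. j < k \<Longrightarrow> es ! j \<le> 1"
  obtains u where "det (sub [0..<k] [0..<n] U * A * sub [0..<n] [0..<k] Y) = padic_p ^ (\<Sum>j<k. es ! j) * u"
    "\<not> padic_p dvd u"
proof -
  \<comment> \<open>The power 1 - e_i makes up for the rows with diagonal entry 1, so that p^(e_i) p
    Z' = p^2 Z in every row.\<close>
  define Z' where "Z' = mat k k (\<lambda>(i, j). padic_p ^ (1 - es ! i) * Z $$ (i, j))"
  have Z': "Z' \<in> carrier_mat k k" by (simp add: Z'_def)
  let ?S = "sub [0..<k] [0..<n] U * A * sub [0..<n] [0..<k] Y" and ?D = "mat_diag k (\<lambda>j. padic_p ^ (es ! j) :: 'p padic_int)"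
  have set: "set [0..<k] \<subseteq> {..<n}" "set [0..<n] \<subseteq> {..<n}" using k(1) by auto
  have "sub [0..<k] [0..<k] (U * A * Y) = sub [0..<k] [0..<n] (U * A) * sub [0..<n] [0..<k] Y"
    by (rule sub_mult[OF _ c(3) set(1) set(1)]) (use c in simp)
  also have "sub [0..<k] [0..<n] (U * A) = sub [0..<k] [0..<n] U * sub [0..<n] [0..<n] A"
    by (rule sub_mult[OF c(1,2) set])
  finally have S: "?S = sub [0..<k] [0..<k] (U * A * Y)" by (simp add: sub_full[OF c(2)])
  have "?S = ?D * (1\<^sub>m k - padic_p \<cdot>\<^sub>m Z')"
  proof (rule eq_matI)
    fix i j assume "i < dim_row (?D * (1\<^sub>m k - padic_p \<cdot>\<^sub>m Z'))" "j < dim_col (?D * (1\<^sub>m k - padic_p \<cdot>\<^sub>m Z'))"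
    then have ij: "i < k" "j < k" by (simp_all add: mat_diag_def Z'_def)
    then have ijn: "i < n" "j < n" using k(1) by auto
    have m1: "mat_diag n (\<lambda>j. padic_p ^ (es ! j)) $$ (i, j) = (U * A * Y) $$ (i, j) + padic_p ^ 2 * Z $$ (i, j)"
      unfolding eq using ijn c by (simp del: index_mult_mat(1))
    have m2: "padic_p ^ (es ! i) * (padic_p * Z' $$ (i, j)) = padic_p ^ 2 * Z $$ (i, j)"
    proof -
      have "es ! i + Suc (1 - es ! i) = 2" using k(2)[OF ij(1)] by simp
      then have "padic_p ^ (es ! i) * (padic_p * padic_p ^ (1 - es ! i)) = (padic_p ^ 2 :: 'p padic_int)"
        by (metis power_Suc power_add)
      moreover have "Z' $$ (i, j) = padic_p ^ (1 - es ! i) * Z $$ (i, j)" using ij by (simp add: Z'_def)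
      ultimately show ?thesis by (metis mult.assoc)
    qed
    have "(U * A * Y) $$ (i, j) = mat_diag n (\<lambda>j. padic_p ^ (es ! j)) $$ (i, j) - padic_p ^ (es ! i) * (padic_p * Z' $$ (i, j))"
      unfolding m1 m2 by simp
    then show "?S $$ (i, j) = (?D * (1\<^sub>m k - padic_p \<cdot>\<^sub>m Z')) $$ (i, j)"
      unfolding S using ij ijn Z'
      by (subst mat_diag_mult_left[of _ k k]) (auto simp: sub_def mat_diag_def algebra_simps simp del: index_mult_mat(1))
  qed (simp_all add: sub_def mat_diag_def Z'_def)
  then have "det ?S = det ?D * det (1\<^sub>m k - padic_p \<cdot>\<^sub>m Z')"
    using det_mult[of ?D k "1\<^sub>m k - padic_p \<cdot>\<^sub>m Z'"] Z' by (simp add: minus_carrier_mat)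
  also have "det ?D = padic_p ^ (\<Sum>j<k. es ! j)"
    by (simp add: det_diag power_sum)
  finally have 1: "det ?S = padic_p ^ (\<Sum>j<k. es ! j) * det (1\<^sub>m k - padic_p \<cdot>\<^sub>m Z')" .
  have "res (det (1\<^sub>m k - padic_p \<cdot>\<^sub>m Z')) = det (map_mat res (1\<^sub>m k - padic_p \<cdot>\<^sub>m Z'))"
    by (rule res.hom_det[symmetric])
  also have "map_mat res (1\<^sub>m k - padic_p \<cdot>\<^sub>m Z') = 1\<^sub>m k"
  proof -
    have "res (padic_p :: 'p padic_int) = 0" by (simp add: res_eq_0_iff)
    then show ?thesis using Z'
      by (intro eq_matI) (auto simp: res.hom_minus res.hom_mult)
  qed
  finally have "\<not> padic_p dvd det (1\<^sub>m k - padic_p \<cdot>\<^sub>m Z')" by (simp flip: res_eq_0_iff)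
  with 1 show ?thesis by (rule that)
qed

text \<open>Says that p^k f(t/p) has coefficients in Z_p, hence the additivity under products. First
  integrals are the matrices whose entries have weight 1.\<close>

definition wdeg :: "nat \<Rightarrow> 'p :: prime_card padic_int poly \<Rightarrow> bool" where
  "wdeg k f \<longleftrightarrow> (\<forall>j. padic_p ^ (j - k) dvd coeff f j)"

section \<open>Weights of minors and degrees modulo p\<close>

lemma wdeg_mult:
  fixes f g :: "'p :: prime_card padic_int poly"
  assumes "wdeg a f" "wdeg b g"
  shows "wdeg (a + b) (f * g)"
  unfolding wdeg_def
proof
  fix j
  have "padic_p ^ (j - (a + b)) dvd coeff f i * coeff g (j - i)" if "i \<le> j" for i
  proof -
    have "padic_p ^ (i - a) * padic_p ^ (j - i - b) dvd coeff f i * coeff g (j - i)"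
      by (rule mult_dvd_mono[OF assms(1)[unfolded wdeg_def, rule_format, of i] assms(2)[unfolded wdeg_def, rule_format, of "j - i"]])
    moreover have "padic_p ^ (j - (a + b)) dvd (padic_p ^ (i - a) * padic_p ^ (j - i - b) :: 'p padic_int)"
      unfolding power_add[symmetric] using that by (intro le_imp_power_dvd) simp
    ultimately show ?thesis by (rule dvd_trans[rotated])
  qed
  then show "padic_p ^ (j - (a + b)) dvd coeff (f * g) j"
    unfolding coeff_mult by (intro dvd_sum) auto
qed

lemma wdeg_sum: "(\<And>x. x \<in> A \<Longrightarrow> wdeg k (f x)) \<Longrightarrow> wdeg k (sum f A)"
  unfolding wdeg_def by (auto simp: coeff_sum intro: dvd_sum)

lemma wdeg_const: "wdeg 0 [:c:]"
  unfolding wdeg_def by (auto simp: coeff_pCons split: nat.splits)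

lemma wdeg_det:
  fixes M :: "'p :: prime_card padic_int poly mat"
  assumes M: "M \<in> carrier_mat k k" and w: "\<And>i j. i < k \<Longrightarrow> j < k \<Longrightarrow> wdeg 1 (M $$ (i, j))"
  shows "wdeg k (det M)"
  unfolding det_def'[OF M]
proof (rule wdeg_sum)
  fix \<pi> assume "\<pi> \<in> {\<pi>. \<pi> permutes {0..<k}}"
  then have \<pi>: "\<pi> i < k" if "i < k" for i using that permutes_in_image[of \<pi> "{0..<k}" i] by simp
  have "wdeg l (\<Prod>i = 0..<l. M $$ (i, \<pi> i))" if "l \<le> k" for l
    using that
  proof (induction l)
    case 0
    then show ?case using wdeg_const[of 1] by (simp add: one_pCons)
  next
    case (Suc l)
    then show ?case using wdeg_mult[of l "\<Prod>i = 0..<l. M $$ (i, \<pi> i)" 1 "M $$ (l, \<pi> l)"] w \<pi> by simp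
  qed
  then have "wdeg k (\<Prod>i = 0..<k. M $$ (i, \<pi> i))" by simp
  moreover have "(signof \<pi> :: 'p padic_int poly) = [:signof \<pi>:]"
    by (simp add: sign_def one_pCons)
  ultimately show "wdeg k (signof \<pi> * (\<Prod>i = 0..<k. M $$ (i, \<pi> i)))"
    using wdeg_mult[OF wdeg_const[of "signof \<pi>"]] by simp
qed

lemma first_integral_wdeg:
  assumes "first_integral n P" "i < n" "j < n"
  shows "wdeg 1 (P $$ (i, j))"
proof -
  obtain r A where P: "P = mat n n (\<lambda>(i, j). \<Sum>k\<le>r + 1. monom (padic_p ^ (k - 1) * A k $$ (i, j)) k)"
    using assms(1) unfolding first_integral_def by blast
  have "wdeg 1 (\<Sum>k\<le>r + 1. monom (padic_p ^ (k - 1) * A k $$ (i, j)) k)"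
    by (rule wdeg_sum) (simp add: wdeg_def)
  then show ?thesis using assms(2,3) by (simp add: P)
qed

text \<open>Dividing by p^a raises the degree bound modulo p by a. With minors of order a0 + a1 and
  a = a1 this is the source of a0 + 2 a1.\<close>

lemma degree_res:
  assumes "wdeg k (pc ^ a * g)"
  shows "degree (map_poly res g) \<le> k + a"
proof (rule degree_le, intro allI impI)
  fix j assume j: "k + a < j"
  have "padic_p ^ (j - k) dvd padic_p ^ a * coeff g j"
    using assms by (simp add: wdeg_def pc_power)
  moreover have "padic_p ^ Suc a dvd (padic_p ^ (j - k) :: 'a padic_int)"
    using j by (intro le_imp_power_dvd) simp
  ultimately have "padic_p ^ Suc a dvd padic_p ^ a * coeff g j" by (rule dvd_trans[rotated])
  then have "padic_p ^ a * padic_p dvd padic_p ^ a * coeff g j" by (simp only: power_Suc2)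
  then have "padic_p dvd coeff g j" by simp
  then show "coeff (map_poly res g) j = 0" by (simp add: coeff_map_poly res_eq_0_iff)
qed

lemma sum_vanishing_le_degree:
  fixes q :: "'a :: idom poly" and m :: nat
  assumes q: "q \<noteq> 0" and inj: "inj_on x {..<m}" and dv: "\<And>i. i < m \<Longrightarrow> [:- x i, 1:] ^ o' i dvd q"
  shows "(\<Sum>i<m. o' i) \<le> degree q"
proof -
  have le: "o' i \<le> order (x i) q" if "i < m" for i using dv[OF that] q by (simp add: order_divides)
  have "(\<Sum>i<m. o' i) \<le> (\<Sum>i<m. order (x i) q)" by (rule sum_mono) (use le in simp)
  also have "\<dots> = (\<Sum>y\<in>x ` {..<m}. order y q)" by (simp add: sum.reindex[OF inj])
  also have "\<dots> = (\<Sum>y\<in>{y \<in> x ` {..<m}. poly q y = 0}. order y q)"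
    by (rule sum.mono_neutral_right) (auto simp: order_root q)
  also have "\<dots> \<le> (\<Sum>y | poly q y = 0. order y q)"
    by (rule sum_mono2) (auto simp: poly_roots_finite q)
  also have "\<dots> \<le> degree q" by (rule sum_order_le_degree[OF q])
  finally show ?thesis .
qed

text \<open>The first two parts bound the rank of \<open>A\<close> modulo p and modulo p^2 from
  above and feed the vanishing orders; the last two exhibit minors of known valuation and bound the
  generic ranks from below.\<close>

lemma mat_type_data:
  fixes A :: "'p :: prime_card padic_int mat"
  assumes mt: "mat_type n A es" and A: "A \<in> carrier_mat n n" and es: "set es \<subseteq> {0, 1, 2}"
  defines "d0 \<equiv> count (mset es) 0" and "d1 \<equiv> count (mset es) 1"
  shows "\<exists>E F G. E \<in> carrier_mat n d0 \<and> F \<in> carrier_mat d0 n \<and> G \<in> carrier_mat n n \<and> A = E * F + padic_p \<cdot>\<^sub>m G"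
    and "\<exists>E F G. E \<in> carrier_mat n (d0 + d1) \<and> F \<in> carrier_mat (d0 + d1) n \<and> G \<in> carrier_mat n n \<and>
      A = E * F + padic_p ^ 2 \<cdot>\<^sub>m G"
    and "\<exists>X Y u. X \<in> carrier_mat d0 n \<and> Y \<in> carrier_mat n d0 \<and> det (X * A * Y) = padic_p ^ 0 * u \<and> \<not> padic_p dvd u"
    and "\<exists>X Y u. X \<in> carrier_mat (d0 + d1) n \<and> Y \<in> carrier_mat n (d0 + d1) \<and>
      det (X * A * Y) = padic_p ^ d1 * u \<and> \<not> padic_p dvd u"
proof -
  define d2 where "d2 = count (mset es) 2"
  \<comment> \<open>Sorting puts the exponents 0 first and the exponents 1 next, so that leading
    blocks of the diagonal suffice.\<close>
  define ss where "ss = replicate d0 0 @ replicate d1 1 @ replicate d2 (2 :: nat)"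
  have ms: "mset ss = mset es"
  proof (rule multiset_eqI)
    fix e
    show "count (mset ss) e = count (mset es) e"
    proof (cases "e \<in> {0, 1, 2}")
      case False
      then have "e \<notin> set es" "e \<notin> set ss" using es by (auto simp: ss_def)
      then have "e \<notin># mset ss" "e \<notin># mset es" by simp_all
      then show ?thesis unfolding not_in_iff by (rule trans[OF _ sym])
    qed (auto simp: ss_def d0_def d1_def d2_def)
  qed
  have len: "length ss = n" using mt ms by (metis mat_type_def size_mset)
  have n: "n = d0 + d1 + d2" using len by (simp add: ss_def)
  have nth: "j < d0 \<Longrightarrow> ss ! j = 0" "d0 \<le> j \<Longrightarrow> j < d0 + d1 \<Longrightarrow> ss ! j = 1"
    "d0 + d1 \<le> j \<Longrightarrow> j < n \<Longrightarrow> ss ! j = 2" for j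
    by (auto simp: ss_def nth_append n)
  have "mat_type n A ss" by (rule mat_type_perm[OF mt ms[symmetric]])
  then obtain U U' V Y Z where c: "U \<in> carrier_mat n n" "U' \<in> carrier_mat n n" "V \<in> carrier_mat n n"
    "Y \<in> carrier_mat n n" "Z \<in> carrier_mat n n"
    and fac: "A = U' * mat_diag n (\<lambda>j. padic_p ^ (ss ! j)) * V"
    and diag: "mat_diag n (\<lambda>j. padic_p ^ (ss ! j)) = U * A * Y + padic_p ^ 2 \<cdot>\<^sub>m Z"
    by (rule mat_type_factor[OF _ A])
  show "\<exists>E F G. E \<in> carrier_mat n d0 \<and> F \<in> carrier_mat d0 n \<and> G \<in> carrier_mat n n \<and> A = E * F + padic_p \<cdot>\<^sub>m G"
    unfolding fac
  proof (rule diag_split[OF c(2,3)])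
    show "padic_p ^ (ss ! l) = padic_p * (padic_p ^ (ss ! l - 1) :: 'p padic_int)" if "d0 \<le> l" "l < n" for l
    proof -
      have "ss ! l \<noteq> 0" using nth(2,3)[of l] that by (cases "l < d0 + d1") auto
      then show ?thesis by (cases "ss ! l") simp_all
    qed
  qed (simp add: n)
  show "\<exists>E F G. E \<in> carrier_mat n (d0 + d1) \<and> F \<in> carrier_mat (d0 + d1) n \<and> G \<in> carrier_mat n n \<and>
      A = E * F + padic_p ^ 2 \<cdot>\<^sub>m G"
    unfolding fac
  proof (rule diag_split[OF c(2,3)])
    show "padic_p ^ (ss ! l) = padic_p ^ 2 * (1 :: 'p padic_int)" if "d0 + d1 \<le> l" "l < n" for l
      using nth(3)[OF that] by simp
  qed (simp add: n)
  have minor: "\<exists>X Y u. X \<in> carrier_mat k n \<and> Y \<in> carrier_mat n k \<and>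
      det (X * A * Y) = padic_p ^ (\<Sum>j<k. ss ! j) * u \<and> \<not> padic_p dvd u" if k: "k \<le> d0 + d1" for k
  proof -
    have kn: "k \<le> n" using k n by simp
    have le1: "ss ! j \<le> 1" if "j < k" for j
      using nth(1,2)[of j] that k by (cases "j < d0") auto
    obtain u where "det (sub [0..<k] [0..<n] U * A * sub [0..<n] [0..<k] Y) = padic_p ^ (\<Sum>j<k. ss ! j) * u"
      "\<not> padic_p dvd u"
      using diag_minor[OF c(1) A c(4,5) diag kn le1] by metis
    then show ?thesis by (intro exI[of _ "sub [0..<k] [0..<n] U"] exI[of _ "sub [0..<n] [0..<k] Y"] exI[of _ u]) (simp add: sub_def)
  qed
  have s0: "(\<Sum>j<d0. ss ! j) = 0" using nth(1) by simp
  have "(\<Sum>j<d0 + l. ss ! j) = l" if "l \<le> d1" for l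
    using that by (induction l) (simp_all add: s0 nth(2))
  then have s1: "(\<Sum>j<d0 + d1. ss ! j) = d1" by simp
  show "\<exists>X Y u. X \<in> carrier_mat d0 n \<and> Y \<in> carrier_mat n d0 \<and> det (X * A * Y) = padic_p ^ 0 * u \<and> \<not> padic_p dvd u"
    using minor[of d0] unfolding s0 by simp
  show "\<exists>X Y u. X \<in> carrier_mat (d0 + d1) n \<and> Y \<in> carrier_mat n (d0 + d1) \<and>
      det (X * A * Y) = padic_p ^ d1 * u \<and> \<not> padic_p dvd u"
    using minor[of "d0 + d1"] unfolding s1 by simp
qed

text \<open>\<open>\<delta>\<close> is prime to p, so p^(a - b) divides f as a polynomial; hence it
  divides the value at x, whose valuation is e.\<close>

lemma eval_bound:
  fixes f :: "'p :: prime_card padic_int poly"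
  assumes \<delta>: "\<not> pc dvd \<delta>" and eq: "\<delta> ^ K * f * pc ^ b = pc ^ a * Z"
    and val: "poly f x = padic_p ^ e * u" "\<not> padic_p dvd u"
  shows "a \<le> b + e"
proof (rule ccontr)
  assume "\<not> a \<le> b + e"
  then have a: "a = b + (a - b)" "Suc e \<le> a - b" by simp_all
  have "pc ^ b * (\<delta> ^ K * f) = pc ^ b * (pc ^ (a - b) * Z)"
    using eq by (subst (asm) a(1)) (simp add: power_add mult_ac)
  then have d1: "pc ^ (a - b) dvd \<delta> ^ K * f" by simp
  have d2: "\<not> pc dvd \<delta> ^ K" using \<delta> pc_prime by (meson prime_elem_dvd_power)
  have "pc ^ (a - b) dvd f" by (rule prime_pow_dvd_cancel[OF pc_prime d2 d1])
  then obtain h where "f = pc ^ (a - b) * h" by (auto simp: dvd_def)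
  then have "padic_p ^ e * u = padic_p ^ (a - b) * poly h x" using val(1) by (simp add: pc_power)
  moreover have "padic_p ^ Suc e dvd (padic_p ^ (a - b) :: 'p padic_int)" by (rule le_imp_power_dvd[OF a(2)])
  ultimately have "padic_p ^ Suc e dvd padic_p ^ e * u" by (simp only: dvd_mult2)
  then have "padic_p ^ e * padic_p dvd padic_p ^ e * u" by (simp only: power_Suc2)
  then show False using val(2) by simp
qed

lemma sum_split_add: "(\<Sum>l<a + b. f l) = (\<Sum>l<a. f l) + (\<Sum>l<b. f (l + a :: nat) :: 'a :: comm_monoid_add)"
  by (induction b) (simp_all add: add_ac)

lemma poly_det_const:
  fixes P :: "'a :: idom poly mat"
  assumes "P \<in> carrier_mat n n" "X \<in> carrier_mat k n" "Y \<in> carrier_mat n k"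
  shows "poly (det (map_mat (\<lambda>a. [:a:]) X * P * map_mat (\<lambda>a. [:a:]) Y)) x = det (X * mat_eval P x * Y)"
proof -
  define ev where "ev q = poly q x" for q :: "'a poly"
  let ?C = "map_mat (\<lambda>a :: 'a. [:a:])" and ?e = "map_mat ev"
  interpret ev: comm_ring_hom ev by unfold_locales (simp_all add: ev_def)
  have "?e (?C X * P * ?C Y) = ?e (?C X * P) * ?e (?C Y)"
    by (rule ev.mat_hom_mult[of _ k n _ k]) (use assms in auto)
  also have "?e (?C X * P) = ?e (?C X) * ?e P"
    by (rule ev.mat_hom_mult[of _ k n _ n]) (use assms in auto)
  also have "?e (?C X) = X" by (auto intro!: eq_matI simp: ev_def)
  also have "?e (?C Y) = Y" by (auto intro!: eq_matI simp: ev_def)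
  also have "?e P = mat_eval P x" by (auto intro!: eq_matI simp: ev_def mat_eval_def)
  finally show ?thesis by (metis ev.hom_det ev_def)
qed


text \<open>\<open>a0\<close> and \<open>a1\<close> are the generic ranks at the first two levels of the $p$-adic filtration:
  up to a factor prime to $p$, the matrix is a product of width \<open>a0\<close> plus $p$ times a product of
  width \<open>a1\<close> plus a multiple of $p^2$.\<close>

lemma two_level_factor:
  fixes P :: "'p :: prime_card padic_int poly mat"
  assumes P: "P \<in> carrier_mat n n"
  obtains \<Delta> E F S I J a0 a1 \<delta> E2 F2 T I' J' g g0 where
    "\<not> pc dvd \<Delta>" "E \<in> carrier_mat n a0" "F \<in> carrier_mat a0 n" "S \<in> carrier_mat n n"
    "\<Delta> \<cdot>\<^sub>m P = E * F + pc \<cdot>\<^sub>m S"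
    "\<not> pc dvd \<delta>" "E2 \<in> carrier_mat n (a0 + a1)" "F2 \<in> carrier_mat (a0 + a1) n" "T \<in> carrier_mat n n"
    "\<delta> \<cdot>\<^sub>m P = E2 * mat_diag (a0 + a1) (\<lambda>i. if i < a0 then 1 else pc) * F2 + pc ^ 2 \<cdot>\<^sub>m T"
    "length I = a0" "length J = a0" "set I \<subseteq> {..<n}" "set J \<subseteq> {..<n}"
    "det (sub I J P) = pc ^ 0 * g0" "\<not> pc dvd g0"
    "length I' = a0 + a1" "length J' = a0 + a1" "set I' \<subseteq> {..<n}" "set J' \<subseteq> {..<n}"
    "det (sub I' J' P) = pc ^ a1 * g" "\<not> pc dvd g"
proof -
  obtain I J S where IJ: "length I = length J" "set I \<subseteq> {..<n}" "set J \<subseteq> {..<n}" "length I \<le> n"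
    "\<not> pc dvd det (sub I J P)" and S: "S \<in> carrier_mat n n"
    and fac0: "\<And>I' J'. set I' \<subseteq> {..<n} \<Longrightarrow> set J' \<subseteq> {..<n} \<Longrightarrow>
      det (sub I J P) \<cdot>\<^sub>m sub I' J' P = sub I' J P * adj_mat (sub I J P) * sub I J' P + pc \<cdot>\<^sub>m sub I' J' S"
    using rank_factor[OF P pc_prime] by metis
  obtain I1 J1 T where IJ1: "length I1 = length J1" "set I1 \<subseteq> {..<n}" "set J1 \<subseteq> {..<n}" "length I1 \<le> n"
    "\<not> pc dvd det (sub I1 J1 S)" and T: "T \<in> carrier_mat n n"
    and fac1: "\<And>I' J'. set I' \<subseteq> {..<n} \<Longrightarrow> set J' \<subseteq> {..<n} \<Longrightarrow>
      det (sub I1 J1 S) \<cdot>\<^sub>m sub I' J' S = sub I' J1 S * adj_mat (sub I1 J1 S) * sub I1 J' S + pc \<cdot>\<^sub>m sub I' J' T"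
    using rank_factor[OF S pc_prime] by metis
  define a0 a1 where "a0 = length I" and "a1 = length I1"
  define \<Delta> \<Delta>1 where "\<Delta> = det (sub I J P)" and "\<Delta>1 = det (sub I1 J1 S)"
  have Q: "sub I J P \<in> carrier_mat a0 a0" "sub I1 J1 S \<in> carrier_mat a1 a1"
    using IJ(1) IJ1(1) by (simp_all add: sub_def a0_def a1_def)
  define full where "full = [0..<n]"
  have full: "set full \<subseteq> {..<n}" "length full = n" by (auto simp: full_def)
  define E0 F0 where "E0 = sub full J P * adj_mat (sub I J P)" and "F0 = sub I full P"
  define E1 F1 where "E1 = sub full J1 S * adj_mat (sub I1 J1 S)" and "F1 = sub I1 full S"
  have c: "E0 \<in> carrier_mat n a0" "F0 \<in> carrier_mat a0 n" "E1 \<in> carrier_mat n a1" "F1 \<in> carrier_mat a1 n"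
    using IJ(1) IJ1(1) adj_mat(1)[OF Q(1)] adj_mat(1)[OF Q(2)] full(2)
    by (auto simp: E0_def F0_def E1_def F1_def sub_def a0_def a1_def intro: mult_carrier_mat)
  have eq0: "\<Delta> \<cdot>\<^sub>m P = E0 * F0 + pc \<cdot>\<^sub>m S"
    using fac0[OF full(1) full(1)] by (simp add: \<Delta>_def E0_def F0_def sub_full[OF P] sub_full[OF S] full_def)
  have eq1: "\<Delta>1 \<cdot>\<^sub>m S = E1 * F1 + pc \<cdot>\<^sub>m T"
    using fac1[OF full(1) full(1)] by (simp add: \<Delta>1_def E1_def F1_def sub_full[OF S] sub_full[OF T] full_def)
  \<comment> \<open>The factorisation of \<open>S\<close> is inserted into that of \<open>P\<close>
    after multiplying by \<open>\<Delta>1\<close>; its columns are appended and will carry the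
    weight p.\<close>
  define E2 where "E2 = mat n (a0 + a1) (\<lambda>(i, l). if l < a0 then \<Delta>1 * E0 $$ (i, l) else E1 $$ (i, l - a0))"
  define F2 where "F2 = mat (a0 + a1) n (\<lambda>(l, j). if l < a0 then F0 $$ (l, j) else F1 $$ (l - a0, j))"
  have c2: "E2 \<in> carrier_mat n (a0 + a1)" "F2 \<in> carrier_mat (a0 + a1) n" by (simp_all add: E2_def F2_def)
  let ?W = "mat_diag (a0 + a1) (\<lambda>i. if i < a0 then 1 else pc :: 'p padic_int poly)"
  have eq2: "(\<Delta> * \<Delta>1) \<cdot>\<^sub>m P = E2 * ?W * F2 + pc ^ 2 \<cdot>\<^sub>m T"
  proof (rule eq_matI)
    fix i j assume "i < dim_row (E2 * ?W * F2 + pc ^ 2 \<cdot>\<^sub>m T)" "j < dim_col (E2 * ?W * F2 + pc ^ 2 \<cdot>\<^sub>m T)"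
    then have ij: "i < n" "j < n" using T by auto
    have 0: "\<Delta> * P $$ (i, j) = (\<Sum>l<a0. E0 $$ (i, l) * F0 $$ (l, j)) + pc * S $$ (i, j)"
      using arg_cong[OF eq0, of "\<lambda>M. M $$ (i, j)"] ij P S c by (simp add: scalar_prod_def atLeast0LessThan)
    have 1: "\<Delta>1 * S $$ (i, j) = (\<Sum>l<a1. E1 $$ (i, l) * F1 $$ (l, j)) + pc * T $$ (i, j)"
      using arg_cong[OF eq1, of "\<lambda>M. M $$ (i, j)"] ij S T c by (simp add: scalar_prod_def atLeast0LessThan)
    have "(E2 * ?W * F2) $$ (i, j) = (\<Sum>l<a0 + a1. E2 $$ (i, l) * (if l < a0 then 1 else pc) * F2 $$ (l, j))"
      using ij c2 by (subst mat_diag_mult_right[OF c2(1)]) (auto simp: scalar_prod_def atLeast0LessThan intro!: sum.cong)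
    also have "\<dots> = (\<Sum>l<a0. \<Delta>1 * (E0 $$ (i, l) * F0 $$ (l, j))) + (\<Sum>l<a1. pc * (E1 $$ (i, l) * F1 $$ (l, j)))"
      unfolding sum_split_add using ij by (intro arg_cong2[where f = "(+)"] sum.cong) (auto simp: E2_def F2_def)
    also have "\<dots> = \<Delta>1 * (\<Sum>l<a0. E0 $$ (i, l) * F0 $$ (l, j)) + pc * (\<Sum>l<a1. E1 $$ (i, l) * F1 $$ (l, j))"
      by (simp only: sum_distrib_left)
    finally have 2: "(E2 * ?W * F2) $$ (i, j) = \<dots>" .
    have "\<Delta> * \<Delta>1 * P $$ (i, j) = \<Delta>1 * (\<Sum>l<a0. E0 $$ (i, l) * F0 $$ (l, j)) + pc * (\<Delta>1 * S $$ (i, j))"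
      using arg_cong[OF 0, of "\<lambda>x. \<Delta>1 * x"] by (simp only: distrib_left mult_ac)
    also have "\<dots> = (E2 * ?W * F2) $$ (i, j) + pc ^ 2 * T $$ (i, j)"
      unfolding 1 2 by (simp only: distrib_left power2_eq_square add.assoc mult.assoc)
    finally show "((\<Delta> * \<Delta>1) \<cdot>\<^sub>m P) $$ (i, j) = (E2 * ?W * F2 + pc ^ 2 \<cdot>\<^sub>m T) $$ (i, j)"
      using ij P T by (simp del: index_mult_mat(1))
  qed (use P T in simp_all)
  have \<Delta>: "\<not> pc dvd \<Delta>" "\<not> pc dvd \<Delta>1" using IJ(5) IJ1(5) by (simp_all add: \<Delta>_def \<Delta>1_def)
  then have \<delta>: "\<not> pc dvd \<Delta> * \<Delta>1" by (simp add: prime_elem_dvd_mult_iff[OF pc_prime])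
  \<comment> \<open>Eliminating the first maximal minor leaves p times the submatrix of the second
    one, which pulls out p^a1 and leaves factors prime to p.\<close>
  define f where "f = det (sub (I @ I1) (J @ J1) P)"
  have "f * \<Delta> ^ a1 = \<Delta> * det (\<Delta> \<cdot>\<^sub>m sub I1 J1 P - sub I1 J P * adj_mat (sub I J P) * sub I J1 P)"
    unfolding f_def sub_append \<Delta>_def
    by (rule det_schur[OF Q(1)]) (use IJ IJ1 in \<open>auto simp: sub_def a0_def a1_def\<close>)
  also have "\<Delta> \<cdot>\<^sub>m sub I1 J1 P - sub I1 J P * adj_mat (sub I J P) * sub I J1 P = pc \<cdot>\<^sub>m sub I1 J1 S"
    unfolding fac0[OF IJ1(2,3), folded \<Delta>_def]
  proof -
    have "A + B - A = B" if "A \<in> carrier_mat a1 a1" "B \<in> carrier_mat a1 a1" for A B :: "'p padic_int poly mat"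
      using that by (intro eq_matI) auto
    moreover have "sub I1 J P * adj_mat (sub I J P) * sub I J1 P \<in> carrier_mat a1 a1"
    proof -
      have "sub I1 J P \<in> carrier_mat a1 a0" "sub I J1 P \<in> carrier_mat a0 a1"
        using IJ(1) IJ1(1) by (simp_all add: sub_def a0_def a1_def)
      then show ?thesis using adj_mat(1)[OF Q(1)] by (meson mult_carrier_mat)
    qed
    ultimately show "sub I1 J P * adj_mat (sub I J P) * sub I J1 P + pc \<cdot>\<^sub>m sub I1 J1 S -
        sub I1 J P * adj_mat (sub I J P) * sub I J1 P = pc \<cdot>\<^sub>m sub I1 J1 S"
      using Q(2) by simp
  qed
  also have "det (pc \<cdot>\<^sub>m sub I1 J1 S) = pc ^ a1 * \<Delta>1"
    using Q(2) by (simp add: \<Delta>1_def)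
  finally have f: "f * \<Delta> ^ a1 = pc ^ a1 * (\<Delta> * \<Delta>1)" by (simp only: mult_ac)
  have "\<not> pc dvd \<Delta> ^ a1" using \<Delta>(1) prime_elem_dvd_power[OF pc_prime] by blast
  then have "pc ^ a1 dvd f"
    by (rule prime_pow_dvd_cancel[OF pc_prime]) (use f in \<open>simp add: mult.commute\<close>)
  then obtain g where g: "f = pc ^ a1 * g" by (auto simp: dvd_def)
  have "pc ^ a1 * (g * \<Delta> ^ a1) = pc ^ a1 * (\<Delta> * \<Delta>1)"
    using f unfolding g by (simp only: mult.assoc)
  then have "g * \<Delta> ^ a1 = \<Delta> * \<Delta>1" by simp
  then have "\<not> pc dvd g" using \<delta> by (metis dvd_mult2)
  show ?thesis
    by (rule that[of \<Delta> E0 a0 F0 S "\<Delta> * \<Delta>1" E2 a1 F2 T I J \<Delta> "I @ I1" "J @ J1" g])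
      (use \<Delta>(1) c S eq0 \<delta> c2 T eq2 IJ IJ1 \<open>\<not> pc dvd g\<close> g in \<open>simp_all add: a0_def a1_def \<Delta>_def f_def\<close>)
qed

text \<open>The witnesses are the generic ranks at the two levels. The first two bounds compare
  minors of P with minors of its values; the last two count zeros of a polynomial modulo p against
  its degree.\<close>

lemma necessity:
  fixes P :: "'p :: prime_card padic_int poly mat" and m :: nat
  assumes fi: "first_integral n P"
    and mt: "\<And>i. i < m \<Longrightarrow> mat_type n (mat_eval P (x i)) (es i)"
    and es: "\<And>i. i < m \<Longrightarrow> set (es i) \<subseteq> {0, 1, 2}"
    and dist: "\<And>i j. i < m \<Longrightarrow> j < m \<Longrightarrow> i \<noteq> j \<Longrightarrow> \<not> padic_p dvd x i - x j"
  defines "d \<equiv> \<lambda>e i. count (mset (es i)) e"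
  obtains a0 a1 where "\<And>i. i < m \<Longrightarrow> d 0 i \<le> a0" "\<And>i. i < m \<Longrightarrow> 2 * d 0 i + d 1 i \<le> 2 * a0 + a1"
    "(\<Sum>i<m. a0 - d 0 i) \<le> a0" "(\<Sum>i<m. (a0 - d 0 i) + (a1 - d 1 i)) \<le> a0 + 2 * a1"
proof -
  have P: "P \<in> carrier_mat n n" by (rule first_integral_carrier[OF fi])
  have A: "mat_eval P y \<in> carrier_mat n n" for y using P by (simp add: mat_eval_def)
  obtain \<Delta> E F S I J a0 a1 \<delta> E2 F2 T I' J' g g0 where
    \<Delta>: "\<not> pc dvd \<Delta>" "E \<in> carrier_mat n a0" "F \<in> carrier_mat a0 n" "S \<in> carrier_mat n n"
    "\<Delta> \<cdot>\<^sub>m P = E * F + pc \<cdot>\<^sub>m S"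
    and \<delta>: "\<not> pc dvd \<delta>" "E2 \<in> carrier_mat n (a0 + a1)" "F2 \<in> carrier_mat (a0 + a1) n" "T \<in> carrier_mat n n"
    "\<delta> \<cdot>\<^sub>m P = E2 * mat_diag (a0 + a1) (\<lambda>i. if i < a0 then 1 else pc) * F2 + pc ^ 2 \<cdot>\<^sub>m T"
    and I: "length I = a0" "length J = a0" "set I \<subseteq> {..<n}" "set J \<subseteq> {..<n}"
    "det (sub I J P) = pc ^ 0 * g0" "\<not> pc dvd g0"
    and I': "length I' = a0 + a1" "length J' = a0 + a1" "set I' \<subseteq> {..<n}" "set J' \<subseteq> {..<n}"
    "det (sub I' J' P) = pc ^ a1 * g" "\<not> pc dvd g"
    by (rule two_level_factor[OF P])
  note data = mat_type_data[OF mt A es]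
  have one: "M = 1 \<cdot>\<^sub>m M" for M :: "'p padic_int poly mat" by (rule eq_matI) auto
  let ?C = "map_mat (\<lambda>a :: 'p padic_int. [:a:])"
  \<comment> \<open>Up to \<open>\<Delta>\<close>, a minor of order d_0 is divisible by p^(d_0 -
    a0); one that is prime to p at x_i excludes a positive exponent.\<close>
  have b0: "d 0 i \<le> a0" if i: "i < m" for i
  proof -
    obtain X Y u where XY: "X \<in> carrier_mat (d 0 i) n" "Y \<in> carrier_mat n (d 0 i)"
      "det (X * mat_eval P (x i) * Y) = padic_p ^ 0 * u" "\<not> padic_p dvd u"
      using data(3)[OF i i] unfolding d_def by blast
    have "\<Delta> ^ d 0 i * det (?C X * P * ?C Y) * det (pc \<cdot>\<^sub>m 1\<^sub>m a0) =
      pc ^ d 0 i * det (four_block_mat (?C X * S * ?C Y) (?C X * E) (- (F * ?C Y)) (pc \<cdot>\<^sub>m 1\<^sub>m a0))"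
      by (rule weighted_minor[OF P \<Delta>(4) \<Delta>(2,3) one_carrier_mat _ scalar_one])
        (use \<Delta> XY in simp_all)
    then have "\<Delta> ^ d 0 i * det (?C X * P * ?C Y) * pc ^ a0 =
      pc ^ d 0 i * det (four_block_mat (?C X * S * ?C Y) (?C X * E) (- (F * ?C Y)) (pc \<cdot>\<^sub>m 1\<^sub>m a0))"
      by (simp only: det_scalar)
    from eval_bound[OF \<Delta>(1) this, of "x i" 0 u] show ?thesis
      using poly_det_const[OF P XY(1,2)] XY(3,4) by simp
  qed
  let ?k = "a0 + a1"
  define W' where "W' = mat_diag ?k (\<lambda>i. if i < a0 then pc ^ 2 else pc :: 'p padic_int poly)"
  have detW: "det W' = pc ^ (2 * a0 + a1)"
  proof -
    have "(\<Prod>i<a0 + a1. if i < a0 then pc ^ 2 else pc :: 'p padic_int poly) = pc ^ (2 * a0 + a1)"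
      by (induction a1) (simp_all add: mult.commute flip: power_mult)
    then show ?thesis unfolding W'_def det_diag .
  qed
  have WW: "W' * mat_diag ?k (\<lambda>i. if i < a0 then 1 else pc) = pc ^ 2 \<cdot>\<^sub>m 1\<^sub>m ?k"
    unfolding W'_def mat_diag_diag by (rule eq_matI) (auto simp: mat_diag_def power2_eq_square)
  \<comment> \<open>A minor of order d_0 + d_1 has valuation d_1 at x_i, while the weights force at
    least 2 (d_0 + d_1) - (2 a0 + a1).\<close>
  have b1: "2 * d 0 i + d 1 i \<le> 2 * a0 + a1" if i: "i < m" for i
  proof -
    obtain X Y u where XY: "X \<in> carrier_mat (d 0 i + d 1 i) n" "Y \<in> carrier_mat n (d 0 i + d 1 i)"
      "det (X * mat_eval P (x i) * Y) = padic_p ^ d 1 i * u" "\<not> padic_p dvd u"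
      using data(4)[OF i i] unfolding d_def by blast
    let ?K = "d 0 i + d 1 i"
    have "\<delta> ^ ?K * det (?C X * P * ?C Y) * det W' =
      (pc ^ 2) ^ ?K * det (four_block_mat (?C X * T * ?C Y) (?C X * E2) (- (F2 * ?C Y)) W')"
      by (rule weighted_minor[OF P \<delta>(4) \<delta>(2,3) mat_diag_dim _ WW \<delta>(5)])
        (use XY in \<open>simp_all add: W'_def\<close>)
    then have "\<delta> ^ ?K * det (?C X * P * ?C Y) * pc ^ (2 * a0 + a1) =
      pc ^ (2 * ?K) * det (four_block_mat (?C X * T * ?C Y) (?C X * E2) (- (F2 * ?C Y)) W')"
      by (simp only: detW power_mult)
    from eval_bound[OF \<delta>(1) this, of "x i" "d 1 i" u] show ?thesis
      using poly_det_const[OF P XY(1,2)] XY(3,4) by simp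
  qed
  have inj: "inj_on (\<lambda>i. res (x i)) {..<m}"
  proof (rule inj_onI, rule ccontr)
    fix i j assume ij: "i \<in> {..<m}" "j \<in> {..<m}" "res (x i) = res (x j)" "i \<noteq> j"
    then have "res (x i - x j) = 0" by (simp add: res.hom_minus)
    then show False using dist ij by (simp add: res_eq_0_iff)
  qed
  have wd: "wdeg (length I) (det (sub I J P))" if "length J = length I" "set I \<subseteq> {..<n}" "set J \<subseteq> {..<n}" for I J
  proof (rule wdeg_det)
    show "sub I J P \<in> carrier_mat (length I) (length I)" using that(1) by (simp add: sub_def)
    fix i j assume ij: "i < length I" "j < length I"
    then have "I ! i < n" "J ! j < n" using subsetD[OF that(2) nth_mem[of i I]] subsetD[OF that(3) nth_mem[of j J]] that(1) by simp_all
    then show "wdeg 1 (sub I J P $$ (i, j))"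
      using first_integral_wdeg[OF fi, of "I ! i" "J ! j"] ij that(1) by (simp add: sub_def)
  qed
  have sel: "sub I [0..<n] (1\<^sub>m n) \<in> carrier_mat (length I) n" "sub [0..<n] J (1\<^sub>m n) \<in> carrier_mat n (length J)"
    for I J by (simp_all add: sub_def)
  have ord: "[:- res (x i), 1:] ^ (length I - d 0 i - a) dvd map_poly res g"
    if i: "i < m" and "length J = length I" "set I \<subseteq> {..<n}" "set J \<subseteq> {..<n}" "det (sub I J P) = pc ^ a * g"
    for i I J a g
  proof -
    obtain E F G where "E \<in> carrier_mat n (d 0 i)" "F \<in> carrier_mat (d 0 i) n" "G \<in> carrier_mat n n"
      "mat_eval P (x i) = E * F + padic_p \<cdot>\<^sub>m G"
      using data(1)[OF i i] unfolding d_def by blast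
    note EFG = this
    have "det (sub I [0..<n] (1\<^sub>m n) * P * sub [0..<n] J (1\<^sub>m n)) = pc ^ a * g"
      using that(5) unfolding sub_eq_mult[OF P that(3,4)] .
    from order_rank[OF P sel(1) _ this EFG, of ] sel(2)[of J] that(2) show ?thesis by simp
  qed
  have s0: "(\<Sum>i<m. a0 - d 0 i) \<le> a0"
  proof -
    have "(\<Sum>i<m. a0 - d 0 i) \<le> degree (map_poly res g0)"
    proof (rule sum_vanishing_le_degree[OF _ inj])
      show "map_poly res g0 \<noteq> 0" using I(6) by (simp add: pc_dvd_iff)
      show "[:- res (x i), 1:] ^ (a0 - d 0 i) dvd map_poly res g0" if "i < m" for i
        using ord[OF that _ I(3,4,5)] I(1,2) by simp
    qed
    also have "\<dots> \<le> a0 + 0"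
      by (rule degree_res) (use wd[OF _ I(3,4)] I(1,2,5) in simp)
    finally show ?thesis by simp
  qed
  have s1: "(\<Sum>i<m. (a0 - d 0 i) + (a1 - d 1 i)) \<le> a0 + 2 * a1"
  proof -
    have "(\<Sum>i<m. (a0 - d 0 i) + (a1 - d 1 i)) \<le> degree (map_poly res g)"
    proof (rule sum_vanishing_le_degree[OF _ inj])
      show "map_poly res g \<noteq> 0" using I'(6) by (simp add: pc_dvd_iff)
      fix i assume i: "i < m"
      show "[:- res (x i), 1:] ^ ((a0 - d 0 i) + (a1 - d 1 i)) dvd map_poly res g"
      \<comment> \<open>Each case uses the stronger of the two lower bounds: modulo p when the
        truncated difference a1 - d_1 is 0, modulo p^2 otherwise.\<close>
      proof (cases "a1 \<le> d 1 i")
        case True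
        then have "(a0 - d 0 i) + (a1 - d 1 i) = length I' - d 0 i - a1" using b0[OF i] I'(1) by simp
        then show ?thesis using ord[OF i _ I'(3,4,5)] I'(1,2) by simp
      next
        case False
        obtain E F G where EFG: "E \<in> carrier_mat n (d 0 i + d 1 i)" "F \<in> carrier_mat (d 0 i + d 1 i) n" "G \<in> carrier_mat n n"
          "mat_eval P (x i) = E * F + padic_p ^ 2 \<cdot>\<^sub>m G"
          using data(2)[OF i i] unfolding d_def by blast
        have dt: "det (sub I' [0..<n] (1\<^sub>m n) * P * sub [0..<n] J' (1\<^sub>m n)) = pc ^ a1 * g"
          using I'(5) unfolding sub_eq_mult[OF P I'(3,4)] .
        have "[:- res (x i), 1:] ^ (a0 + a1 - (d 0 i + d 1 i)) dvd map_poly res g"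
          by (rule order_rank2[OF P _ _ refl dt EFG \<delta>(2,3,4,1,5)])
            (use sel(1)[of I'] sel(2)[of J'] I'(1,2) in simp_all)
        moreover have "a0 + a1 - (d 0 i + d 1 i) = (a0 - d 0 i) + (a1 - d 1 i)" using b0[OF i] False by simp
        ultimately show ?thesis by simp
      qed
    qed
    also have "\<dots> \<le> (a0 + a1) + a1"
      by (rule degree_res) (use wd[OF _ I'(3,4)] I'(1,2,5) in simp)
    finally show ?thesis by simp
  qed
  show ?thesis by (rule that[OF b0 b1 s0 s1])
qed


section \<open>Realizing the generators\<close>

text \<open>Reduces the definition to a condition on single entries, which is visibly stable under
  block sums. The sum of all degrees serves as the common bound \<open>r\<close>.\<close>

lemma first_integral_iff:
  fixes P :: "'p :: prime_card padic_int poly mat"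
  shows "first_integral n P \<longleftrightarrow> P \<in> carrier_mat n n \<and> (\<forall>i<n. \<forall>j<n. wdeg 1 (P $$ (i, j)))"
proof
  assume "first_integral n P"
  then show "P \<in> carrier_mat n n \<and> (\<forall>i<n. \<forall>j<n. wdeg 1 (P $$ (i, j)))"
    using first_integral_carrier first_integral_wdeg by blast
next
  assume P: "P \<in> carrier_mat n n \<and> (\<forall>i<n. \<forall>j<n. wdeg 1 (P $$ (i, j)))"
  define r where "r = (\<Sum>i<n. \<Sum>j<n. degree (P $$ (i, j)))"
  define A where "A k = mat n n (\<lambda>(i, j). SOME a. coeff (P $$ (i, j)) k = padic_p ^ (k - 1) * a)" for k
  have A: "padic_p ^ (k - 1) * A k $$ (i, j) = coeff (P $$ (i, j)) k" if "i < n" "j < n" for i j k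
  proof -
    have "\<exists>a. coeff (P $$ (i, j)) k = padic_p ^ (k - 1) * a"
      using P that by (auto simp: wdeg_def dvd_def)
    from someI_ex[OF this] show ?thesis using that by (simp add: A_def)
  qed
  have "P = mat n n (\<lambda>(i, j). \<Sum>k\<le>r + 1. monom (padic_p ^ (k - 1) * A k $$ (i, j)) k)"
  proof (rule eq_matI)
    fix i j assume "i < dim_row (mat n n (\<lambda>(i, j). \<Sum>k\<le>r + 1. monom (padic_p ^ (k - 1) * A k $$ (i, j)) k))"
      "j < dim_col (mat n n (\<lambda>(i, j). \<Sum>k\<le>r + 1. monom (padic_p ^ (k - 1) * A k $$ (i, j)) k))"
    then have ij: "i < n" "j < n" by simp_all
    have "degree (P $$ (i, j)) \<le> (\<Sum>j<n. degree (P $$ (i, j)))"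
      using ij by (intro member_le_sum) auto
    also have "\<dots> \<le> r" unfolding r_def
      using ij by (intro member_le_sum[of i "{..<n}" "\<lambda>i. \<Sum>j<n. degree (P $$ (i, j))"]) auto
    finally have "(\<Sum>k\<le>r + 1. monom (coeff (P $$ (i, j)) k) k) = P $$ (i, j)"
      by (intro poly_as_sum_of_monoms') simp
    then show "P $$ (i, j) = mat n n (\<lambda>(i, j). \<Sum>k\<le>r + 1. monom (padic_p ^ (k - 1) * A k $$ (i, j)) k) $$ (i, j)"
      using ij by (simp only: A index_mat(1) split)
  qed (use P in auto)
  moreover have "\<forall>k\<le>r + 1. A k \<in> carrier_mat n n" by (simp add: A_def)
  ultimately show "first_integral n P" unfolding first_integral_def by blast
qed

lemma wdeg_quadratic: "wdeg 1 [:a, b, padic_p * c:]"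
proof -
  have "padic_p ^ (j - 1) dvd coeff [:a, b, padic_p * c:] j" for j
  proof -
    consider "j = 0" | "j = 1" | "j = 2" | "j > 2" by linarith
    then show ?thesis
      by cases (auto simp: coeff_eq_0 numeral_2_eq_2)
  qed
  then show ?thesis by (simp add: wdeg_def)
qed

lemma wdeg_quadratic': "wdeg (Suc 0) [:a, b, c * padic_p:]"
  using wdeg_quadratic[of a b c] by (simp add: mult.commute)

text \<open>The condition of \<open>C12_set\<close> in terms of exponents modulo p^2 alone;
  multisets, because a Smith form is unique only up to order.\<close>

definition realizable :: "'p :: prime_card padic_int list \<Rightarrow> nat \<Rightarrow> (nat \<Rightarrow> nat multiset) \<Rightarrow> bool" where
  "realizable xs n M \<longleftrightarrow> (\<exists>P. first_integral n P \<and>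
     (\<forall>i<length xs. \<exists>es. mset es = M i \<and> mat_type n (mat_eval P (xs ! i)) es))"

section \<open>Block sums of first integrals\<close>

lemma LA_block:
  fixes A B :: "'p :: prime_card padic_int mat"
  assumes A: "A \<in> carrier_mat n n" and B: "B \<in> carrier_mat k k"
  shows "v \<in> LA (n + k) (four_block_mat A (0\<^sub>m n k) (0\<^sub>m k n) B) \<longleftrightarrow> v \<in> LA n A \<and> (\<lambda>j. v (j + n)) \<in> LA k B"
proof -
  let ?M = "four_block_mat A (0\<^sub>m n k) (0\<^sub>m k n) B"
  have 1: "(\<Sum>j<n + k. ?M $$ (i, j) * y j) = (\<Sum>j<n. A $$ (i, j) * y j)" if "i < n" for i y
    unfolding sum_split_add using that A B by simp
  have 2: "(\<Sum>j<n + k. ?M $$ (i + n, j) * y j) = (\<Sum>j<k. B $$ (i, j) * y (j + n))" if "i < k" for i y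
    unfolding sum_split_add using that A B by simp
  show ?thesis
  proof
    assume "v \<in> LA (n + k) ?M"
    then obtain y z where yz: "\<And>i. i < n + k \<Longrightarrow> v i = (\<Sum>j<n + k. ?M $$ (i, j) * y j) + padic_p ^ 2 * z i"
      unfolding LA_def by blast
    have "v i = (\<Sum>j<n. A $$ (i, j) * y j) + padic_p ^ 2 * z i" if "i < n" for i
      using yz[of i] 1[OF that] that by simp
    moreover have "v (i + n) = (\<Sum>j<k. B $$ (i, j) * y (j + n)) + padic_p ^ 2 * z (i + n)" if "i < k" for i
      using yz[of "i + n"] 2[OF that] that by simp
    ultimately show "v \<in> LA n A \<and> (\<lambda>j. v (j + n)) \<in> LA k B"
      unfolding LA_def by (intro conjI CollectI exI[of _ y] exI[of _ z] exI[of _ "\<lambda>j. y (j + n)"] exI[of _ "\<lambda>i. z (i + n)"]) auto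
  next
    assume "v \<in> LA n A \<and> (\<lambda>j. v (j + n)) \<in> LA k B"
    then obtain y z y' z' where yz: "\<And>i. i < n \<Longrightarrow> v i = (\<Sum>j<n. A $$ (i, j) * y j) + padic_p ^ 2 * z i"
      "\<And>i. i < k \<Longrightarrow> v (i + n) = (\<Sum>j<k. B $$ (i, j) * y' j) + padic_p ^ 2 * z' i"
      unfolding LA_def by blast
    let ?y = "\<lambda>j. if j < n then y j else y' (j - n)" and ?z = "\<lambda>j. if j < n then z j else z' (j - n)"
    have "v i = (\<Sum>j<n + k. ?M $$ (i, j) * ?y j) + padic_p ^ 2 * ?z i" if "i < n + k" for i
    proof (cases "i < n")
      case True
      then show ?thesis using 1[OF True, of ?y] yz(1)[OF True] by simp
    next
      case False
      then have "i = (i - n) + n" "i - n < k" using that by auto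
      then show ?thesis using 2[of "i - n" ?y] yz(2)[of "i - n"] False by simp
    qed
    then show "v \<in> LA (n + k) ?M"
      unfolding LA_def by (intro CollectI exI[of _ ?y] exI[of _ ?z] allI impI)
  qed
qed

lemma autom_block:
  assumes T: "autom {..<n} T T'" and U: "autom {..<k} U U'"
  shows "autom {..<n + k} (\<lambda>v j. if j < n then T v j else U (\<lambda>j. v (j + n)) (j - n))
    (\<lambda>v j. if j < n then T' v j else U' (\<lambda>j. v (j + n)) (j - n))"
proof -
  let ?b = "\<lambda>T U v j. if j < n then T v j else U (\<lambda>j. v (j + n)) (j - n)"
  note t = automD[OF T] and u = automD[OF U]
  have lin: "flin (?b T U)" if "flin T" "flin U" for T U :: "(nat \<Rightarrow> 'a padic_int) \<Rightarrow> nat \<Rightarrow> 'a padic_int"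
    unfolding flin_def using flin_comb[OF that(1)] flin_comb[OF that(2)] by (auto simp: fun_eq_iff)
  have inv: "?b T U (?b T' U' v) = v" if T: "autom {..<n} T T'" and U: "autom {..<k} U U'" for T T' U U' and v :: "nat \<Rightarrow> 'a padic_int"
  proof
    fix j
    have "T (?b T' U' v) j = v j" if "j < n"
      using automD(7)[OF T, of "?b T' U' v" "T' v" j] automD(3)[OF T, of v] that by simp
    moreover have "(\<lambda>j. ?b T' U' v (j + n)) = U' (\<lambda>j. v (j + n))" by auto
    ultimately show "?b T U (?b T' U' v) j = v j" using automD(3)[OF U, of "\<lambda>j. v (j + n)"] by simp
  qed
  have off: "?b T U v j = v j" if "autom {..<n} T T'" "autom {..<k} U U'" "j \<notin> {..<n + k}" for T T' U U' j and v :: "nat \<Rightarrow> 'a padic_int"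
    using automD(5)[OF that(2), of "j - n" "\<lambda>j. v (j + n)"] that(3) by auto
  have loc: "?b T U v j = ?b T U w j" if a: "autom {..<n} T T'" "autom {..<k} U U'" and e: "\<forall>j\<in>{..<n + k}. v j = w j" and j: "j \<in> {..<n + k}"
    for T T' U U' j and v w :: "nat \<Rightarrow> 'a padic_int"
  proof (cases "j < n")
    case True
    then show ?thesis using automD(7)[OF a(1), of v w j] e by simp
  next
    case False
    then show ?thesis using automD(7)[OF a(2), of "\<lambda>j. v (j + n)" "\<lambda>j. w (j + n)" "j - n"] e j by auto
  qed
  show ?thesis
    unfolding autom_def
    using lin[OF t(1) u(1)] lin[OF t(2) u(2)] inv[OF T U] inv[OF autom_inv[OF T] autom_inv[OF U]]
      off[OF T U] off[OF autom_inv[OF T] autom_inv[OF U]] loc[OF T U] loc[OF autom_inv[OF T] autom_inv[OF U]]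
    by blast
qed

lemma mat_type_block:
  fixes A B :: "'p :: prime_card padic_int mat"
  assumes A: "A \<in> carrier_mat n n" "mat_type n A es" and B: "B \<in> carrier_mat k k" "mat_type k B fs"
  shows "mat_type (n + k) (four_block_mat A (0\<^sub>m n k) (0\<^sub>m k n) B) (es @ fs)"
proof -
  obtain T T' where T: "autom {..<n} T T'" "\<And>v. v \<in> LA n A \<longleftrightarrow> (\<forall>j<n. padic_p ^ (es ! j) dvd T v j)"
    and le: "length es = n" using A(2) unfolding mat_type_def by blast
  obtain U U' where U: "autom {..<k} U U'" "\<And>v. v \<in> LA k B \<longleftrightarrow> (\<forall>j<k. padic_p ^ (fs ! j) dvd U v j)"
    and lf: "length fs = k" using B(2) unfolding mat_type_def by blast
  let ?T = "\<lambda>v j. if j < n then T v j else U (\<lambda>j. v (j + n)) (j - n)"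
  have "v \<in> LA (n + k) (four_block_mat A (0\<^sub>m n k) (0\<^sub>m k n) B) \<longleftrightarrow>
      (\<forall>j<n + k. padic_p ^ ((es @ fs) ! j) dvd ?T v j)" for v
  proof -
    have "(\<forall>j<n + k. Q j) \<longleftrightarrow> (\<forall>j<n. Q j) \<and> (\<forall>j<k. Q (j + n))" for Q
    proof (intro iffI allI impI)
      fix j assume *: "(\<forall>j<n. Q j) \<and> (\<forall>j<k. Q (j + n))" "j < n + k"
      show "Q j"
      proof (cases "j < n")
        case False
        then show ?thesis using *(1)[THEN conjunct2, rule_format, of "j - n"] *(2) by simp
      qed (use * in simp)
    qed auto
    then show ?thesis
      unfolding LA_block[OF A(1) B(1)] T(2) U(2) by (simp add: nth_append le)
  qed
  note L = this
  have "length (es @ fs) = n + k" by (simp add: le lf)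
  then show ?thesis
    unfolding mat_type_def using L autom_block[OF T(1) U(1)] by blast
qed

lemma realizable_add:
  fixes xs :: "'p :: prime_card padic_int list"
  assumes "realizable xs n M" "realizable xs k N"
  shows "realizable xs (n + k) (\<lambda>i. M i + N i)"
proof -
  obtain P where P: "first_integral n P" "\<And>i. i < length xs \<Longrightarrow> \<exists>es. mset es = M i \<and> mat_type n (mat_eval P (xs ! i)) es"
    using assms(1) unfolding realizable_def by blast
  obtain Q where Q: "first_integral k Q" "\<And>i. i < length xs \<Longrightarrow> \<exists>es. mset es = N i \<and> mat_type k (mat_eval Q (xs ! i)) es"
    using assms(2) unfolding realizable_def by blast
  have c: "P \<in> carrier_mat n n" "Q \<in> carrier_mat k k" using P(1) Q(1) by (simp_all add: first_integral_iff)
  define B where "B = four_block_mat P (0\<^sub>m n k) (0\<^sub>m k n) Q"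
  have "first_integral (n + k) B"
    unfolding first_integral_iff
  proof (intro conjI allI impI)
    show "B \<in> carrier_mat (n + k) (n + k)" using c by (simp add: B_def)
    fix i j assume "i < n + k" "j < n + k"
    moreover have "wdeg 1 (0 :: 'p padic_int poly)" by (simp add: wdeg_def)
    ultimately show "wdeg 1 (B $$ (i, j))"
      using c P(1) Q(1) unfolding B_def first_integral_iff by auto
  qed
  moreover have "\<exists>es. mset es = M i + N i \<and> mat_type (n + k) (mat_eval B (xs ! i)) es" if i: "i < length xs" for i
  proof -
    obtain es fs where "mset es = M i" "mat_type n (mat_eval P (xs ! i)) es" "mset fs = N i" "mat_type k (mat_eval Q (xs ! i)) fs"
      using P(2)[OF i] Q(2)[OF i] by blast
    moreover have "mat_eval B (xs ! i) = four_block_mat (mat_eval P (xs ! i)) (0\<^sub>m n k) (0\<^sub>m k n) (mat_eval Q (xs ! i))"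
      unfolding mat_eval_def B_def using c by (intro eq_matI) auto
    ultimately show ?thesis
      using mat_type_block[of "mat_eval P (xs ! i)" n es "mat_eval Q (xs ! i)" k fs] c
      by (intro exI[of _ "es @ fs"]) (simp add: mat_eval_def)
  qed
  ultimately show ?thesis unfolding realizable_def by blast
qed

text \<open>A single shear, adding a combination of the other coordinates to coordinate
  \<open>i0\<close>, is all the change of coordinates that the explicit matrices require.\<close>

lemma mat_typeI:
  fixes A :: "'p :: prime_card padic_int mat"
  assumes "i0 < n" "c i0 = 0" "length es = n"
    and "\<And>v. v \<in> LA n A \<longleftrightarrow> (\<forall>j<n. padic_p ^ (es ! j) dvd (if j = i0 then v j + (\<Sum>l<n. c l * v l) else v j))"
  shows "mat_type n A es"
proof -
  let ?s = "\<lambda>v. \<Sum>l<n. c l * v l"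
  let ?T = "\<lambda>v j. if j = i0 then v j + ?s v else v j" and ?T' = "\<lambda>v j. if j = i0 then v j - ?s v else v j"
  have s: "?s (?T v) = ?s v" "?s (?T' v) = ?s v" for v
    by (intro sum.cong; use assms(2) in auto)+
  have "autom {..<n} ?T ?T'"
    unfolding autom_def
  proof (intro conjI allI impI)
    show "flin ?T" "flin ?T'"
      by (auto simp: flin_def fun_eq_iff algebra_simps sum.distrib sum_distrib_left)
    show "?T (?T' v) = v" "?T' (?T v) = v" for v
      by (rule ext; simp only: s; simp)+
    show "?T v j = v j" "?T' v j = v j" if "j \<notin> {..<n}" for v j using that assms(1) by auto
    show "\<forall>j\<in>{..<n}. ?T v j = ?T w j \<and> ?T' v j = ?T' w j" if e: "\<forall>j\<in>{..<n}. v j = w j" for v w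
    proof -
      have "?s v = ?s w" by (rule sum.cong) (use e in auto)
      then show ?thesis using e by auto
    qed
  qed
  then show ?thesis unfolding mat_type_def using assms(3,4) by blast
qed

section \<open>Explicit matrices for the generators\<close>

lemma mat_type_1:
  fixes a :: "'p :: prime_card padic_int"
  assumes "a = padic_p ^ e * u + padic_p ^ 2 * w" "u * u' = 1" "e \<le> 2"
  shows "mat_type 1 (mat 1 1 (\<lambda>_. a)) [e]"
proof (rule mat_typeI[of 0 _ "\<lambda>_. 0"])
  fix v :: "nat \<Rightarrow> 'p padic_int"
  have "(\<exists>y z. v 0 = a * y + padic_p ^ 2 * z) \<longleftrightarrow> padic_p ^ e dvd v 0"
  proof
    assume "\<exists>y z. v 0 = a * y + padic_p ^ 2 * z"
    then obtain y z where "v 0 = padic_p ^ e * (u * y) + padic_p ^ 2 * (w * y + z)"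
      by (auto simp: assms(1) algebra_simps)
    then show "padic_p ^ e dvd v 0"
      by (simp only: dvd_add[OF dvd_triv_left dvd_mult2[OF le_imp_power_dvd[OF assms(3)]]])
  next
    assume "padic_p ^ e dvd v 0"
    then obtain s where s: "v 0 = padic_p ^ e * s" by (auto simp: dvd_def)
    have "v 0 = padic_p ^ e * (u * u') * s" by (simp add: s assms(2))
    also have "\<dots> = a * (u' * s) + padic_p ^ 2 * (- (w * u' * s))"
      by (simp add: assms(1) algebra_simps)
    finally show "\<exists>y z. v 0 = a * y + padic_p ^ 2 * z" by blast
  qed
  moreover have "v \<in> LA 1 (mat 1 1 (\<lambda>_. a)) \<longleftrightarrow> (\<exists>y z. v 0 = a * y + padic_p ^ 2 * z)"
  proof -
    have "v \<in> LA 1 (mat 1 1 (\<lambda>_. a)) \<longleftrightarrow> (\<exists>y z. v 0 = a * y (0 :: nat) + padic_p ^ 2 * z (0 :: nat))"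
      by (simp add: LA_def)
    then show ?thesis by (metis (full_types))
  qed
  ultimately show "v \<in> LA 1 (mat 1 1 (\<lambda>_. a)) \<longleftrightarrow>
      (\<forall>j<1. padic_p ^ ([e] ! j) dvd (if j = 0 then v j + (\<Sum>l<1. 0 * v l) else v j))" by simp
qed simp_all

lemma realizable_0: "realizable xs 0 (\<lambda>_. {#})"
proof -
  have "first_integral 0 (mat 0 0 (\<lambda>_. 0))" by (simp add: first_integral_iff)
  moreover have "mat_type 0 A []" for A :: "'a padic_int mat"
    unfolding mat_type_def using autom_id[of "{..<0}"] by (auto simp: LA_def)
  ultimately show ?thesis unfolding realizable_def by fastforce
qed

text \<open>For matrices of size one: \<open>u\<close> is the unit part of the value and
  \<open>w\<close> collects what is invisible modulo p^2.\<close>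

lemma realizable_1:
  fixes xs :: "'p :: prime_card padic_int list"
  assumes q: "wdeg 1 q" and M: "\<And>i. i < length xs \<Longrightarrow> \<exists>e u u' w. e \<le> 2 \<and> M i = {#e#} \<and>
    poly q (xs ! i) = padic_p ^ e * u + padic_p ^ 2 * w \<and> u * u' = 1"
  shows "realizable xs 1 M"
  unfolding realizable_def
proof (intro exI[of _ "mat 1 1 (\<lambda>_. q)"] conjI allI impI)
  show "first_integral 1 (mat 1 1 (\<lambda>_. q))" using q by (simp add: first_integral_iff)
  fix i assume "i < length xs"
  from M[OF this] obtain e u u' w where *: "e \<le> 2" "M i = {#e#}" "poly q (xs ! i) = padic_p ^ e * u + padic_p ^ 2 * w" "u * u' = 1"
    by blast
  have "mat_eval (mat 1 1 (\<lambda>_. q)) (xs ! i) = mat 1 1 (\<lambda>_. poly q (xs ! i))"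
    unfolding mat_eval_def by (rule eq_matI) auto
  then show "\<exists>es. mset es = M i \<and> mat_type 1 (mat_eval (mat 1 1 (\<lambda>_. q)) (xs ! i)) es"
    using mat_type_1[OF *(3,4,1)] *(2) by (intro exI[of _ "[e]"]) simp
qed

lemma unit_if_res: "\<not> padic_p dvd (u :: 'p :: prime_card padic_int) \<Longrightarrow> \<exists>v. u * v = 1"
  using unit_if_not_p_dvd by metis

lemma p_dvd_prodD: "finite A \<Longrightarrow> padic_p dvd prod f A \<Longrightarrow> \<exists>a\<in>A. padic_p dvd f a"
  for f :: "'b \<Rightarrow> 'p :: prime_card padic_int"
  by (induction A rule: finite_induct) (auto simp: not_p_dvd_1 dest: p_dvd_multD)

context
  fixes xs :: "'p :: prime_card padic_int list" and m :: nat
  assumes len: "length xs = m"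
    and dist: "\<And>i j. i < m \<Longrightarrow> j < m \<Longrightarrow> i \<noteq> j \<Longrightarrow> \<not> padic_p dvd (xs ! i - xs ! j)"
begin

text \<open>The zero polynomial: 0 = p^2 - p^2 has exponent 2 modulo p^2.\<close>

lemma realizable_A2: "realizable xs 1 (\<lambda>_. {#2#})"
  by (rule realizable_1[of 0])
    (simp add: wdeg_def, rule exI[of _ 2], rule exI[of _ 1], rule exI[of _ 1], rule exI[of _ "- 1"], simp)

lemma realizable_A0:
  assumes "i0 < m" "e \<le> 2"
  shows "realizable xs 1 (\<lambda>i. if i = i0 then {#e#} else {#0#})"
proof (cases "e = 0")
  case True
  have "realizable xs 1 (\<lambda>_. {#0#})"
  proof (rule realizable_1[of 1])
    show "wdeg 1 (1 :: 'p padic_int poly)" using wdeg_quadratic[of 1 0 0] by (simp add: one_pCons)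
    fix i
    show "\<exists>e u u' w. e \<le> 2 \<and> {#0#} = {#e#} \<and>
        poly 1 (xs ! i) = padic_p ^ e * u + padic_p ^ 2 * w \<and> u * u' = 1"
      by (rule exI[of _ 0], rule exI[of _ 1], rule exI[of _ 1], rule exI[of _ 0]) simp
  qed
  then show ?thesis using True by (simp cong: if_cong)
next
  case False
  \<comment> \<open>The polynomial t - x_{i0} + c takes the value c at x_{i0}, which is p for e = 1
    and 0 for e = 2. At the other points it is a unit, c being divisible by p.\<close>
  define c where "c = (if e = 1 then padic_p else 0 :: 'p padic_int)"
  show ?thesis
  proof (rule realizable_1[of "[:c - xs ! i0, 1:]"])
    show "wdeg 1 [:c - xs ! i0, 1:]" using wdeg_quadratic[of "c - xs ! i0" 1 0] by simp
    fix i assume i: "i < length xs"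
    show "\<exists>e' u u' w. e' \<le> 2 \<and> (if i = i0 then {#e#} else {#0#}) = {#e'#} \<and>
        poly [:c - xs ! i0, 1:] (xs ! i) = padic_p ^ e' * u + padic_p ^ 2 * w \<and> u * u' = 1"
    proof (cases "i = i0")
      case True
      have "c = padic_p ^ e * 1 + padic_p ^ 2 * (if e = 1 then 0 else -1)"
        using False assms(2) by (cases "e = 1") (auto simp: c_def numeral_2_eq_2 le_Suc_eq)
      then show ?thesis using True assms(2) by (intro exI[of _ e] exI[of _ 1] exI[of _ "if e = 1 then 0 else -1"]) simp
    next
      case ne: False
      have "\<not> padic_p dvd (xs ! i - xs ! i0)" using dist i assms(1) ne len by simp
      moreover have "padic_p dvd c" by (simp add: c_def)
      ultimately have "\<not> padic_p dvd c + (xs ! i - xs ! i0)" by (simp add: dvd_add_right_iff)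
      then obtain v where "(c + (xs ! i - xs ! i0)) * v = 1" using unit_if_res by blast
      then show ?thesis using ne
        by (intro exI[of _ 0] exI[of _ "c + (xs ! i - xs ! i0)"] exI[of _ v]) simp
    qed
  qed
qed

text \<open>The row (1, t, ..., t^d) annihilates all columns of the matrix but the first, which it
  sends to p f, where f is the product of t - x_i over S; the other columns eliminate d coordinates.
  At x there remains the cokernel of p f(x): exponent 2 on S, where f vanishes, and 1 elsewhere,
  where f is a unit. In a first integral a quadratic term needs one factor p, so entries of the
  first column give degree 2, and each of the d further rows raises the degree of f by one; hence
  the bound d + 2.\<close>

lemma realizable_D1:
  assumes S: "S \<subseteq> {..<m}" "card S \<le> d + 2"
  shows "realizable xs (d + 1) (\<lambda>i. replicate_mset d 0 + (if i \<in> S then {#2#} else {#1#}))"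
proof -
  define f where "f = (\<Prod>i\<in>S. [:- (xs ! i), 1:])"
  have degf: "degree f \<le> d + 2"
    using S(2) degree_prod_sum_le[of S "\<lambda>i. [:- (xs ! i), 1:]"] finite_subset[OF S(1)] by (simp add: f_def)
  \<comment> \<open>Writes f as the sum of t^k q_k with every q_k of degree at most 2.\<close>
  define q where "q j = (if j = 0 then [:coeff f 0, coeff f 1, coeff f 2:] else [:0, 0, coeff f (j + 2):])" for j
  define P where "P = mat (d + 1) (d + 1) (\<lambda>(i, j). if j = 0 then pc * q i else if i = j - 1 then [:0, 1:] else if i = j then [:-1:] else 0)"
  have "first_integral (d + 1) P"
    unfolding first_integral_iff
  proof (intro conjI allI impI)
    fix i j assume "i < d + 1" "j < d + 1"
    moreover have "wdeg 1 (pc * q i)" by (cases "i = 0") (simp_all add: q_def wdeg_quadratic')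
    moreover have "wdeg 1 [:0, 1 :: 'p padic_int:]" "wdeg 1 [:-1 :: 'p padic_int:]" "wdeg 1 (0 :: 'p padic_int poly)"
      using wdeg_quadratic[of 0 1 0] wdeg_quadratic[of "-1" 0 0] wdeg_quadratic[of 0 0 0] by simp_all
    ultimately show "wdeg 1 (P $$ (i, j))" by (simp add: P_def)
  qed (simp add: P_def)
  moreover have "\<exists>es. mset es = replicate_mset d 0 + (if i \<in> S then {#2#} else {#1#}) \<and> mat_type (d + 1) (mat_eval P (xs ! i)) es"
    if i: "i < length xs" for i
  proof -
    define x where "x = xs ! i"
    define e where "e = (if i \<in> S then 2 else 1 :: nat)"
    define A where "A = mat_eval P x"
    have A: "A $$ (k, j) = (if j = 0 then padic_p * poly (q k) x else if k = j - 1 then x else if k = j then -1 else 0)"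
      if "k < d + 1" "j < d + 1" for k j
      using that by (simp add: A_def mat_eval_def P_def)
    have fx: "(\<Sum>k<d + 1. x ^ k * poly (q k) x) = poly f x"
    proof -
      have "poly f x = (\<Sum>k\<le>d + 2. coeff f k * x ^ k)"
        using arg_cong[OF poly_as_sum_of_monoms'[OF degf], of "\<lambda>q. poly q x"]
        by (simp only: poly_sum poly_monom)
      also have "\<dots> = (\<Sum>k<3 + d. coeff f k * x ^ k)" by (rule sum.cong) auto
      also have "\<dots> = (coeff f 0 + coeff f 1 * x + coeff f 2 * x ^ 2) + (\<Sum>k<d. coeff f (k + 3) * x ^ (k + 3))"
        unfolding sum_split_add by (simp add: numeral_3_eq_3 numeral_2_eq_2)
      also have "\<dots> = (\<Sum>k<1 + d. x ^ k * poly (q k) x)"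
        unfolding sum_split_add by (simp add: q_def algebra_simps power2_eq_square power3_eq_cube power_add numeral_3_eq_3 numeral_2_eq_2)
      finally show ?thesis by simp
    qed
    \<comment> \<open>The value at x of the annihilating row, which is the only linear form
      constrained on the image.\<close>
    define W where "W v = (\<Sum>k<d + 1. x ^ k * v k)" for v :: "nat \<Rightarrow> 'p padic_int"
    have W: "v 0 + (\<Sum>l<d + 1. (if l = 0 then 0 else x ^ l) * v l) = W v" for v
    proof -
      have "v 0 + (\<Sum>l<1 + d. (if l = 0 then 0 else x ^ l) * v l) = (\<Sum>k<1 + d. x ^ k * v k)"
        unfolding sum_split_add by simp
      then show ?thesis by (simp add: W_def)
    qed
    have Ay: "(\<Sum>j<d + 1. A $$ (k, j) * y j) = padic_p * poly (q k) x * y 0 + (if k < d then x * y (Suc k) else 0) - (if k = 0 then 0 else y k)"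
      if k: "k < d + 1" for k y
    proof -
      have "(\<Sum>j<1 + d. A $$ (k, j) * y j) = padic_p * poly (q k) x * y 0 + (\<Sum>j<d. A $$ (k, j + 1) * y (j + 1))"
        unfolding sum_split_add using A[OF k] by simp
      also have "(\<Sum>j<d. A $$ (k, j + 1) * y (j + 1)) = (\<Sum>j<d. (if j = k then x * y (Suc j) else 0) + (if Suc j = k then - y k else 0))"
        by (rule sum.cong) (use A[OF k] in auto)
      also have "\<dots> = (if k < d then x * y (Suc k) else 0) + (\<Sum>j<d. if Suc j = k then - y k else 0)"
        unfolding sum.distrib by simp
      also have "(\<Sum>j<d. if Suc j = k then - y k else 0) = - (if k = 0 then 0 else y k)"
      proof (cases k)
        case (Suc l)
        then show ?thesis using k by simp
      qed simp
      finally show ?thesis by simp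
    qed
    have WA: "W (\<lambda>k. \<Sum>j<d + 1. A $$ (k, j) * y j) = padic_p * poly f x * y 0" for y
    proof -
      have "W (\<lambda>k. \<Sum>j<d + 1. A $$ (k, j) * y j) =
          (\<Sum>k<d + 1. x ^ k * (padic_p * poly (q k) x * y 0 + (if k < d then x * y (Suc k) else 0) - (if k = 0 then 0 else y k)))"
        unfolding W_def by (rule sum.cong) (use Ay in auto)
      also have "\<dots> = padic_p * y 0 * (\<Sum>k<d + 1. x ^ k * poly (q k) x) +
          ((\<Sum>k<d + 1. if k < d then x ^ Suc k * y (Suc k) else 0) - (\<Sum>k<1 + d. if k = 0 then 0 else x ^ k * y k))"
      proof -
        have "x ^ k * (padic_p * poly (q k) x * y 0 + (if k < d then x * y (Suc k) else 0) - (if k = 0 then 0 else y k)) =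
            padic_p * y 0 * (x ^ k * poly (q k) x) + ((if k < d then x ^ Suc k * y (Suc k) else 0) - (if k = 0 then 0 else x ^ k * y k))" for k
          by (simp add: algebra_simps)
        then show ?thesis
          by (simp only: sum.distrib sum_subtractf sum_distrib_left add.commute[of 1 d])
      qed
      also have "(\<Sum>k<d + 1. if k < d then x ^ Suc k * y (Suc k) else 0) = (\<Sum>k<d. x ^ Suc k * y (Suc k))"
        by simp
      also have "(\<Sum>k<1 + d. if k = 0 then 0 else x ^ k * y k) = (\<Sum>k<d. x ^ Suc k * y (Suc k))"
        unfolding sum_split_add by simp
      finally show ?thesis using fx by (simp add: mult_ac)
    qed
    have Wlin: "W (\<lambda>k. a k + padic_p ^ 2 * b k) = W a + padic_p ^ 2 * W b" for a b
      by (simp add: W_def algebra_simps sum.distrib sum_distrib_left)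
    have fe: "padic_p ^ e dvd padic_p * poly f x" "\<And>s :: 'p padic_int. padic_p ^ e dvd s \<Longrightarrow> \<exists>y0 z0. s = padic_p * poly f x * y0 + padic_p ^ 2 * z0"
    proof -
      show "padic_p ^ e dvd padic_p * poly f x"
      proof (cases "i \<in> S")
        case True
        then have "poly f x = 0" using finite_subset[OF S(1)] by (auto simp: f_def x_def poly_prod)
        then show ?thesis by simp
      qed (simp add: e_def)
      fix s :: "'p padic_int" assume s: "padic_p ^ e dvd s"
      show "\<exists>y0 z0. s = padic_p * poly f x * y0 + padic_p ^ 2 * z0"
      proof (cases "i \<in> S")
        case True
        then have "padic_p ^ 2 dvd s" using s by (simp add: e_def)
        then obtain z0 where "s = padic_p ^ 2 * z0" by (auto simp: dvd_def)
        then have "s = padic_p * poly f x * 0 + padic_p ^ 2 * z0" by simp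
        then show ?thesis by blast
      next
        case False
        then obtain t where t: "s = padic_p * t" using s by (auto simp: e_def dvd_def)
        have "\<not> padic_p dvd poly f x"
        proof
          assume "padic_p dvd poly f x"
          then have "padic_p dvd (\<Prod>j\<in>S. xs ! i - xs ! j)" by (simp add: f_def poly_prod x_def)
          then obtain j where "j \<in> S" "padic_p dvd (xs ! i - xs ! j)"
            using p_dvd_prodD[OF finite_subset[OF S(1) finite_lessThan]] by blast
          then show False using dist[of i j] False S(1) i len by auto
        qed
        then obtain v where v: "poly f x * v = 1" using unit_if_res by blast
        have "s = padic_p * (poly f x * v) * t" by (simp add: t v)
        then have "s = padic_p * poly f x * (v * t) + padic_p ^ 2 * 0" by (simp add: mult_ac)
        then show ?thesis by blast
      qed
    qed
    have LA: "v \<in> LA (d + 1) A \<longleftrightarrow> padic_p ^ e dvd W v" for v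
    proof
      assume "v \<in> LA (d + 1) A"
      then obtain y z where "\<And>k. k < d + 1 \<Longrightarrow> v k = (\<Sum>j<d + 1. A $$ (k, j) * y j) + padic_p ^ 2 * z k"
        unfolding LA_def by blast
      then have "W v = W (\<lambda>k. (\<Sum>j<d + 1. A $$ (k, j) * y j) + padic_p ^ 2 * z k)"
        unfolding W_def by (intro sum.cong) auto
      also have "\<dots> = padic_p * poly f x * y 0 + padic_p ^ 2 * W z" unfolding Wlin WA ..
      finally show "padic_p ^ e dvd W v"
        using fe(1) le_imp_power_dvd[of e 2 padic_p] by (simp add: dvd_add dvd_mult2 e_def)
    next
      assume "padic_p ^ e dvd W v"
      then obtain y0 z0 where s: "W v = padic_p * poly f x * y0 + padic_p ^ 2 * z0" using fe(2) by blast
      \<comment> \<open>Subtracting the first column leaves a vector on which W is a multiple of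
        p^2. The other columns are then solved from the last row upwards, and the error p^2 z0 ends
        up in row 0.\<close>
      define v' where "v' k = v k - padic_p * poly (q k) x * y0" for k
      have Wv': "W v' = padic_p ^ 2 * z0"
      proof -
        have "W v' = W v - padic_p * y0 * (\<Sum>k<d + 1. x ^ k * poly (q k) x)"
          by (simp add: W_def v'_def algebra_simps sum_subtractf sum_distrib_left)
        then show ?thesis unfolding fx s by (simp add: mult_ac)
      qed
      define y where "y j = (if j = 0 then y0 else - (\<Sum>l<d + 1 - j. x ^ l * v' (l + j)))" for j
      have yrec: "y k = (if k < d then x * y (Suc k) else 0) - v' k" if "k < d + 1" "k \<noteq> 0" for k
      proof -
        have "d + 1 - k = 1 + (d - k)" using that by simp
        then have "(\<Sum>l<d + 1 - k. x ^ l * v' (l + k)) = (\<Sum>l<1 + (d - k). x ^ l * v' (l + k))" by simp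
        also have "\<dots> = v' k + x * (\<Sum>l<d - k. x ^ l * v' (l + Suc k))"
          unfolding sum_split_add by (simp add: sum_distrib_left mult_ac)
        finally show ?thesis using that by (auto simp: y_def)
      qed
      have y1: "(if 0 < d then x * y (Suc 0) else 0) = v' 0 - padic_p ^ 2 * z0"
      proof -
        have "W v' = (\<Sum>k<1 + d. x ^ k * v' k)" by (simp add: W_def)
        also have "\<dots> = v' 0 + x * (\<Sum>l<d. x ^ l * v' (l + 1))"
          unfolding sum_split_add by (simp add: sum_distrib_left mult_ac)
        finally have "padic_p ^ 2 * z0 = v' 0 + x * (\<Sum>l<d. x ^ l * v' (l + 1))" using Wv' by simp
        then show ?thesis by (simp add: y_def)
      qed
      have "v k = (\<Sum>j<d + 1. A $$ (k, j) * y j) + padic_p ^ 2 * (if k = 0 then z0 else 0)" if k: "k < d + 1" for k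
      proof (cases "k = 0")
        case True
        have "v 0 = padic_p * poly (q 0) x * y 0 + (v' 0 - padic_p ^ 2 * z0) + padic_p ^ 2 * z0"
          by (simp add: v'_def y_def[of 0])
        moreover have "(\<Sum>j<d + 1. A $$ (0, j) * y j) = padic_p * poly (q 0) x * y 0 + (v' 0 - padic_p ^ 2 * z0)"
          using Ay[of 0 y] y1 by (simp only: if_True zero_less_Suc Suc_eq_plus1[symmetric] refl diff_zero)
        ultimately show ?thesis unfolding True by (simp only: if_True refl)
      next
        case False
        then show ?thesis unfolding Ay[OF k] using yrec[OF k False] by (simp add: v'_def y_def[of 0])
      qed
      then show "v \<in> LA (d + 1) A"
        unfolding LA_def by (intro CollectI exI[of _ y] exI[of _ "\<lambda>k. if k = 0 then z0 else 0"] allI impI)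
    qed
    have "mat_type (d + 1) A (e # replicate d 0)"
    proof (rule mat_typeI[of 0 _ "\<lambda>l. if l = 0 then 0 else x ^ l"])
      fix v :: "nat \<Rightarrow> 'p padic_int"
      have "(\<forall>j<d + 1. padic_p ^ ((e # replicate d 0) ! j) dvd
          (if j = 0 then v j + (\<Sum>l<d + 1. (if l = 0 then 0 else x ^ l) * v l) else v j)) \<longleftrightarrow> padic_p ^ e dvd W v"
        unfolding W[symmetric] by (auto simp: nth_Cons' dest: spec[of _ 0])
      then show "v \<in> LA (d + 1) A \<longleftrightarrow> (\<forall>j<d + 1. padic_p ^ ((e # replicate d 0) ! j) dvd
          (if j = 0 then v j + (\<Sum>l<d + 1. (if l = 0 then 0 else x ^ l) * v l) else v j))"
        unfolding LA by blast
    qed simp_all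
    then show ?thesis
      by (intro exI[of _ "e # replicate d 0"]) (simp add: A_def x_def e_def)
  qed
  ultimately show ?thesis unfolding realizable_def by blast
qed

lemma mset_map_pivot:
  assumes "j0 < d"
  shows "mset (map (\<lambda>j. if j = j0 then a else b) [0..<d]) = add_mset a (replicate_mset (d - 1) b)"
proof -
  have "[0..<d] = [0..<j0] @ j0 # [Suc j0..<d]"
    using assms by (metis append_Cons append_Nil le_add_same_cancel1 less_imp_le_nat upt_add_eq_append upt_conv_Cons zero_le le_Suc_ex)
  moreover have "map (\<lambda>j. if j = j0 then a else b) [0..<j0] = replicate j0 b"
    "map (\<lambda>j. if j = j0 then a else b) [Suc j0..<d] = replicate (d - Suc j0) b"
    by (intro nth_equalityI; simp)+
  ultimately have "mset (map (\<lambda>j. if j = j0 then a else b) [0..<d]) = add_mset a (replicate_mset j0 b + replicate_mset (d - Suc j0) b)"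
    by simp
  also have "replicate_mset j0 b + replicate_mset (d - Suc j0) b = replicate_mset (d - 1) b"
    by (rule multiset_eqI) (use assms in auto)
  finally show ?thesis .
qed

text \<open>An arrow matrix: t - x_s on the diagonal for s in S, p along the last row and column, 0
  in the corner. Outside S the diagonal is invertible and the Schur complement in the corner is a
  multiple of p^2, hence exponent 2. At a point of S one diagonal entry vanishes; eliminating the
  others leaves p off the diagonal of a block of size two, hence two exponents 1.\<close>

lemma realizable_D2:
  assumes S: "S \<subseteq> {..<m}" "card S = d"
  shows "realizable xs (d + 1) (\<lambda>i. if i \<in> S then replicate_mset (d - 1) 0 + {#1, 1#} else replicate_mset d 0 + {#2#})"
proof -
  obtain s where s: "bij_betw s {..<d} S"
    using ex_bij_betw_nat_finite[OF finite_subset[OF S(1)]] S(2) by (auto simp: atLeast0LessThan)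
  define P where "P = mat (d + 1) (d + 1) (\<lambda>(k, j). if k = j \<and> k < d then [:- (xs ! s k), 1:] else if (k = d) \<noteq> (j = d) then pc else 0)"
  have "first_integral (d + 1) P"
    unfolding first_integral_iff
  proof (intro conjI allI impI)
    fix k j assume "k < d + 1" "j < d + 1"
    moreover have "wdeg 1 [:- (xs ! s k), 1:]" "wdeg 1 (pc :: 'p padic_int poly)" "wdeg 1 (0 :: 'p padic_int poly)"
      using wdeg_quadratic[of "- (xs ! s k)" 1 0] wdeg_quadratic[of padic_p 0 0] wdeg_quadratic[of 0 0 0] by simp_all
    ultimately show "wdeg 1 (P $$ (k, j))" by (auto simp: P_def)
  qed (simp add: P_def)
  moreover have "\<exists>es. mset es = (if i \<in> S then replicate_mset (d - 1) 0 + {#1, 1#} else replicate_mset d 0 + {#2#}) \<and>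
      mat_type (d + 1) (mat_eval P (xs ! i)) es"
    if i: "i < length xs" for i
  proof -
    define A where "A = mat_eval P (xs ! i)"
    define a where "a k = xs ! i - xs ! s k" for k
    have A: "A $$ (k, j) = (if k = j \<and> k < d then a k else if (k = d) \<noteq> (j = d) then padic_p else 0)"
      if "k < d + 1" "j < d + 1" for k j
      using that by (simp add: A_def mat_eval_def P_def a_def)
    have Ay: "(\<Sum>j<d + 1. A $$ (k, j) * y j) = a k * y k + padic_p * y d" if "k < d" for k y
    proof -
      have "(\<Sum>j<d. A $$ (k, j) * y j) = (\<Sum>j<d. if j = k then a k * y k else 0)"
        by (rule sum.cong) (use A that in auto)
      then show ?thesis using A[of k d] that by simp
    qed
    have Ad: "(\<Sum>j<d + 1. A $$ (d, j) * y j) = padic_p * (\<Sum>j<d. y j)" for y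
      using A[of d] by (simp add: sum_distrib_left)
    have unit: "\<exists>b. a k * b = 1" if "k < d" "s k \<noteq> i" for k
    proof -
      have "s k < m" using s that(1) S(1) by (auto dest: bij_betwE)
      then show ?thesis unfolding a_def using dist[of i "s k"] that(2) i len by (intro unit_if_res) auto
    qed
    show ?thesis
    proof (cases "i \<in> S")
      case True
      then obtain j0 where j0: "j0 < d" "s j0 = i" using s by (auto simp: bij_betw_def)
      have "s k \<noteq> i" if "k < d" "k \<noteq> j0" for k
        using s j0 that by (auto simp: bij_betw_def inj_on_def)
      then obtain b where b: "\<And>k. k < d \<Longrightarrow> k \<noteq> j0 \<Longrightarrow> a k * b k = 1" using unit by metis
      have a0: "a j0 = 0" using j0 by (simp add: a_def)
      define es where "es = map (\<lambda>j. if j = j0 then 1 else 0 :: nat) [0..<d] @ [1]"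
      have LA: "v \<in> LA (d + 1) A \<longleftrightarrow> padic_p dvd v j0 \<and> padic_p dvd v d" for v
      proof
        assume "v \<in> LA (d + 1) A"
        then obtain y z where yz: "\<And>k. k < d + 1 \<Longrightarrow> v k = (\<Sum>j<d + 1. A $$ (k, j) * y j) + padic_p ^ 2 * z k"
          unfolding LA_def by blast
        have "v j0 = padic_p * (y d + padic_p * z j0)"
          using yz[of j0] Ay[OF j0(1), of y] a0 j0(1) by (simp add: power2_eq_square algebra_simps)
        moreover have "v d = padic_p * ((\<Sum>j<d. y j) + padic_p * z d)"
          using yz[of d] Ad[of y] by (simp add: power2_eq_square algebra_simps)
        ultimately show "padic_p dvd v j0 \<and> padic_p dvd v d" by simp
      next
        assume "padic_p dvd v j0 \<and> padic_p dvd v d"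
        then obtain \<alpha> \<beta> where ab: "v j0 = padic_p * \<alpha>" "v d = padic_p * \<beta>" by (auto simp: dvd_def)
        define y0 where "y0 k = (v k - padic_p * \<alpha>) * b k" for k
        \<comment> \<open>Row \<open>j0\<close> fixes the last coordinate; the coordinate
          \<open>j0\<close>, free because its diagonal entry vanishes, adjusts the sum required by
          the last row.\<close>
        define y where "y k = (if k = d then \<alpha> else if k = j0 then \<beta> - (\<Sum>k\<in>{..<d} - {j0}. y0 k) else y0 k)" for k
        have sy: "(\<Sum>j<d. y j) = \<beta>"
        proof -
          have "(\<Sum>j<d. y j) = y j0 + (\<Sum>j\<in>{..<d} - {j0}. y j)"
            using j0(1) by (intro sum.remove) auto
          also have "(\<Sum>j\<in>{..<d} - {j0}. y j) = (\<Sum>k\<in>{..<d} - {j0}. y0 k)"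
            by (rule sum.cong) (auto simp: y_def)
          finally show ?thesis using j0(1) by (simp add: y_def)
        qed
        have "v k = (\<Sum>j<d + 1. A $$ (k, j) * y j) + padic_p ^ 2 * 0" if "k < d + 1" for k
        proof (cases "k = d")
          case True
          then show ?thesis unfolding True Ad sy by (simp add: ab)
        next
          case False
          then have k: "k < d" using that by simp
          show ?thesis
          proof (cases "k = j0")
            case True
            then show ?thesis unfolding Ay[OF k] using a0 ab by (simp add: y_def)
          next
            case ne: False
            have "a k * y k = (v k - padic_p * \<alpha>) * (a k * b k)" using ne k by (simp add: y_def y0_def mult_ac)
            then show ?thesis unfolding Ay[OF k] using b[OF k ne] by (simp add: y_def)
          qed
        qed
        then show "v \<in> LA (d + 1) A"
          unfolding LA_def by (intro CollectI exI[of _ y] exI[of _ "\<lambda>_. 0"] allI impI)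
      qed
      have "mat_type (d + 1) A es"
      proof (rule mat_typeI[of 0 _ "\<lambda>_. 0"])
        fix v :: "nat \<Rightarrow> 'p padic_int"
        have "(\<forall>j<d + 1. padic_p ^ (es ! j) dvd (if j = 0 then v j + (\<Sum>l<d + 1. 0 * v l) else v j)) \<longleftrightarrow>
            (\<forall>j<Suc d. padic_p ^ (es ! j) dvd v j)"
        proof -
          have "(if j = 0 then v j + (\<Sum>l<d + 1. 0 * v l) else v j) = v j" for j by simp
          then show ?thesis by (simp only: Suc_eq_plus1)
        qed
        also have "\<dots> \<longleftrightarrow> padic_p dvd v j0 \<and> padic_p dvd v d"
          unfolding All_less_Suc using j0(1) by (auto simp: es_def nth_append split: if_splits)
        finally show "v \<in> LA (d + 1) A \<longleftrightarrow>
            (\<forall>j<d + 1. padic_p ^ (es ! j) dvd (if j = 0 then v j + (\<Sum>l<d + 1. 0 * v l) else v j))"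
          unfolding LA by blast
      qed (simp_all add: es_def)
      moreover have "mset es = replicate_mset (d - 1) 0 + {#1, 1#}"
        unfolding es_def mset_append mset_map_pivot[OF j0(1)] by simp
      ultimately show ?thesis using True by (intro exI[of _ es]) (simp add: A_def)
    next
      case False
      then have "s k \<noteq> i" if "k < d" for k using s that by (auto dest: bij_betwE)
      then obtain b where b: "\<And>k. k < d \<Longrightarrow> a k * b k = 1" using unit by metis
      \<comment> \<open>The row operation that clears the last row by means of the invertible
        diagonal.\<close>
      define c where "c l = (if l < d then - (padic_p * b l) else 0)" for l
      define es where "es = replicate d 0 @ [2 :: nat]"
      have w: "v d + (\<Sum>l<d + 1. c l * v l) = v d - padic_p * (\<Sum>l<d. b l * v l)" for v
        by (simp add: c_def sum_negf sum_distrib_left mult.assoc)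
      have LA: "v \<in> LA (d + 1) A \<longleftrightarrow> padic_p ^ 2 dvd v d - padic_p * (\<Sum>l<d. b l * v l)" for v
      proof
        assume "v \<in> LA (d + 1) A"
        then obtain y z where yz: "\<And>k. k < d + 1 \<Longrightarrow> v k = (\<Sum>j<d + 1. A $$ (k, j) * y j) + padic_p ^ 2 * z k"
          unfolding LA_def by blast
        have "(\<Sum>l<d. b l * v l) = (\<Sum>l<d. y l + padic_p * (b l * (y d + padic_p * z l)))"
        proof (rule sum.cong)
          fix l assume "l \<in> {..<d}"
          then have l: "l < d" by simp
          have "b l * v l = (a l * b l) * y l + padic_p * (b l * (y d + padic_p * z l))"
            using yz[of l] Ay[OF l, of y] l by (simp add: power2_eq_square algebra_simps)
          then show "b l * v l = y l + padic_p * (b l * (y d + padic_p * z l))" by (simp add: b[OF l])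
        qed simp
        also have "\<dots> = (\<Sum>l<d. y l) + padic_p * (\<Sum>l<d. b l * (y d + padic_p * z l))"
          by (simp add: sum.distrib sum_distrib_left)
        finally have "v d - padic_p * (\<Sum>l<d. b l * v l) = padic_p ^ 2 * (z d - (\<Sum>l<d. b l * (y d + padic_p * z l)))"
          using yz[of d] Ad[of y] by (simp add: power2_eq_square algebra_simps)
        then show "padic_p ^ 2 dvd v d - padic_p * (\<Sum>l<d. b l * v l)" by simp
      next
        assume "padic_p ^ 2 dvd v d - padic_p * (\<Sum>l<d. b l * v l)"
        then obtain \<gamma> where g: "v d - padic_p * (\<Sum>l<d. b l * v l) = padic_p ^ 2 * \<gamma>" by (auto simp: dvd_def)
        define y where "y k = (if k < d then b k * v k else 0)" for k
        have sy: "(\<Sum>l<d. y l) = (\<Sum>l<d. b l * v l)" by (rule sum.cong) (auto simp: y_def)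
        have "v k = (\<Sum>j<d + 1. A $$ (k, j) * y j) + padic_p ^ 2 * (if k = d then \<gamma> else 0)" if "k < d + 1" for k
        proof (cases "k = d")
          case True
          then show ?thesis unfolding True Ad sy using g by (simp add: algebra_simps)
        next
          case False
          then have k: "k < d" using that by simp
          have "a k * y k = (a k * b k) * v k" using k by (simp add: y_def mult.assoc)
          then show ?thesis unfolding Ay[OF k] using b[OF k] k by (simp add: y_def)
        qed
        then show "v \<in> LA (d + 1) A"
          unfolding LA_def by (intro CollectI exI[of _ y] exI[of _ "\<lambda>k. if k = d then \<gamma> else 0"] allI impI)
      qed
      have "mat_type (d + 1) A es"
      proof (rule mat_typeI[of d _ c])
        fix v :: "nat \<Rightarrow> 'p padic_int"
        have "(\<forall>j<d + 1. padic_p ^ (es ! j) dvd (if j = d then v j + (\<Sum>l<d + 1. c l * v l) else v j)) \<longleftrightarrow>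
            padic_p ^ 2 dvd v d + (\<Sum>l<d + 1. c l * v l)"
          by (auto simp: es_def nth_append less_Suc_eq)
        then show "v \<in> LA (d + 1) A \<longleftrightarrow>
            (\<forall>j<d + 1. padic_p ^ (es ! j) dvd (if j = d then v j + (\<Sum>l<d + 1. c l * v l) else v j))"
          unfolding LA w by blast
      qed (simp_all add: es_def c_def)
      then show ?thesis using False by (intro exI[of _ es]) (simp add: A_def es_def)
    qed
  qed
  ultimately show ?thesis unfolding realizable_def by blast
qed

end


section \<open>Decomposition into generators\<close>

lemma count_01_le_size:
  fixes M :: "enat multiset"
  shows "count M 0 + count M 1 \<le> size M"
  by (induction M) auto

lemma ex_exponent_ge_2:
  fixes M :: "enat multiset"
  assumes "count M 0 + count M 1 < size M"
  shows "\<exists>r. r \<in># M \<and> 2 \<le> r"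
  using assms
proof (induction M)
  case (add x M)
  have "x = 0 \<or> x = 1 \<or> 2 \<le> x"
    by (cases x) (auto simp: zero_enat_def one_enat_def numeral_eq_enat)
  then show ?case using add by fastforce
qed simp

text \<open>The numerical condition in terms of the gaps a0 - d_0 and a1 - d_1. Truncation of the
  second gap accounts for the minimum of d_1 and a1; the first gap is a true difference by the first
  clause.\<close>

definition feasible :: "nat \<Rightarrow> (nat \<Rightarrow> nat) \<Rightarrow> (nat \<Rightarrow> nat) \<Rightarrow> nat \<Rightarrow> nat \<Rightarrow> bool" where
  "feasible m d0 d1 a0 a1 \<longleftrightarrow> (\<forall>i<m. d0 i \<le> a0) \<and> (\<forall>i<m. 2 * d0 i + d1 i \<le> 2 * a0 + a1) \<and>
     (\<Sum>i<m. a0 - d0 i) \<le> a0 \<and> (\<Sum>i<m. a0 - d0 i) + (\<Sum>i<m. a1 - d1 i) \<le> a0 + 2 * a1"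

text \<open>The slack \<open>e\<close> of the second condition can be lowered by one wherever it is positive: if this
  happens at fewer than two indices then the bound on the first slack \<open>\<delta>\<close> suffices.\<close>

lemma lower_slack:
  fixes e :: "nat \<Rightarrow> nat"
  assumes "D \<le> a0" "D + (\<Sum>i<m. e i) \<le> a0 + 2 * a1" "1 \<le> a1" "\<And>i. i < m \<Longrightarrow> e i \<le> a1"
    and S: "S \<subseteq> {i. i < m \<and> 0 < e i}" "2 \<le> card S \<or> S = {i. i < m \<and> 0 < e i}"
  shows "D + (\<Sum>i<m. if i \<in> S then e i - 1 else e i) \<le> a0 + 2 * (a1 - 1)"
proof -
  have fin: "finite S" using S(1) by (rule finite_subset) simp
  have "(\<Sum>i<m. e i) = (\<Sum>i<m. (if i \<in> S then e i - 1 else e i) + (if i \<in> S then 1 else 0))"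
    using S(1) by (intro sum.cong) auto
  also have "\<dots> = (\<Sum>i<m. if i \<in> S then e i - 1 else e i) + card ({..<m} \<inter> S)"
    by (simp add: sum.distrib sum.If_cases)
  also have "{..<m} \<inter> S = S" using S(1) by auto
  finally have eq: "(\<Sum>i<m. e i) = (\<Sum>i<m. if i \<in> S then e i - 1 else e i) + card S" .
  show ?thesis
  proof (cases "2 \<le> card S")
    case True
    then show ?thesis using eq assms(2,3) by linarith
  next
    \<comment> \<open>At most one slack is positive, and it is at most a1, so after lowering the
      total is at most a0 + (a1 - 1).\<close>
    case False
    then have SE: "S = {i. i < m \<and> 0 < e i}" and "card S \<le> 1" using S(2) by auto
    have "(\<Sum>i<m. if i \<in> S then e i - 1 else e i) = (\<Sum>i\<in>S. e i - 1)"
      using S(1) by (intro sum.mono_neutral_cong_right) (auto simp: SE)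
    also have "\<dots> \<le> (\<Sum>i\<in>S. a1 - 1)"
      using assms(4) S(1) by (intro sum_mono diff_le_mono) auto
    also have "\<dots> \<le> 1 * (a1 - 1)" using \<open>card S \<le> 1\<close> by (simp only: sum_constant of_nat_id mult_le_mono1)
    finally show ?thesis using assms(1,3) by linarith
  qed
qed

text \<open>While a0 + a1 exceeds n, one of the two parameters can be lowered by one without losing
  feasibility.\<close>

lemma feasible_bounded:
  assumes "feasible m d0 d1 a0 a1" and n: "\<And>i. i < m \<Longrightarrow> d0 i + d1 i \<le> n"
  shows "\<exists>a0 a1. feasible m d0 d1 a0 a1 \<and> a0 + a1 \<le> n"
  using assms(1)
proof (induction "a0 + a1" arbitrary: a0 a1 rule: less_induct)
  case less
  note f = less.prems[unfolded feasible_def]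
  consider "m = 0" | "a0 + a1 \<le> n" | "0 < m" "n < a0" | "0 < m" "a0 \<le> n" "n < a0 + a1" by linarith
  then show ?case
  proof cases
    case 1
    then have "feasible m d0 d1 0 0" by (simp add: feasible_def)
    then show ?thesis by fastforce
  next
    case 2
    then show ?thesis using less.prems by blast
  next
    \<comment> \<open>Every gap a0 - d_0 is positive, so lowering a0 reduces their sum by m \<ge> 1
      and the bounds by 1 only.\<close>
    case 3
    have d: "d0 i \<le> a0 - 1" if "i < m" for i using n[OF that] 3 by simp
    have "(\<Sum>i<m. a0 - d0 i) = (\<Sum>i<m. (a0 - 1 - d0 i) + 1)"
    proof (rule sum.cong)
      show "a0 - d0 i = a0 - 1 - d0 i + 1" if "i \<in> {..<m}" for i using d[of i] that 3 by simp
    qed simp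
    also have "\<dots> = (\<Sum>i<m. a0 - 1 - d0 i) + m" unfolding sum.distrib by simp
    finally have eq: "(\<Sum>i<m. a0 - d0 i) = (\<Sum>i<m. a0 - 1 - d0 i) + m" .
    have "feasible m d0 d1 (a0 - 1) a1"
      unfolding feasible_def
    proof (intro conjI allI impI)
      show "2 * d0 i + d1 i \<le> 2 * (a0 - 1) + a1" if "i < m" for i
        using n[OF that] 3 by simp
    qed (use d eq f 3 in auto)
    moreover have "a0 - 1 + a1 < a0 + a1" using 3 by simp
    ultimately show ?thesis using less.hyps by blast
  next
    \<comment> \<open>Lowering a1 shortens every positive gap a1 - d_1 by one, which
      \<open>lower_slack\<close> allows. The bound on 2 d_0 + d_1 survives since d_0 + d_1 \<le> n <
      a0 + a1 and d_0 \<le> a0.\<close>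
    case 4
    have a1: "1 \<le> a1" using 4 by simp
    have "(\<Sum>i<m. a0 - d0 i) + (\<Sum>i<m. if i \<in> {i. i < m \<and> 0 < a1 - d1 i} then a1 - d1 i - 1 else a1 - d1 i) \<le> a0 + 2 * (a1 - 1)"
      using f a1 by (intro lower_slack) auto
    moreover have "(\<Sum>i<m. if i \<in> {i. i < m \<and> 0 < a1 - d1 i} then a1 - d1 i - 1 else a1 - d1 i) = (\<Sum>i<m. a1 - 1 - d1 i)"
      by (intro sum.cong) auto
    ultimately have "(\<Sum>i<m. a0 - d0 i) + (\<Sum>i<m. a1 - 1 - d1 i) \<le> a0 + 2 * (a1 - 1)" by simp
    moreover have "2 * d0 i + d1 i \<le> 2 * a0 + (a1 - 1)" if "i < m" for i
    proof -
      have "d0 i \<le> a0" using f that by blast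
      then show ?thesis using n[OF that] 4 by linarith
    qed
    ultimately have "feasible m d0 d1 a0 (a1 - 1)" using f by (simp add: feasible_def)
    moreover have "a0 + (a1 - 1) < a0 + a1" using a1 by simp
    ultimately show ?thesis using less.hyps by blast
  qed
qed

lemma card_le_sum:
  fixes f :: "nat \<Rightarrow> nat"
  assumes "finite A" "S \<subseteq> A" "\<And>i. i \<in> S \<Longrightarrow> 1 \<le> f i"
  shows "card S \<le> sum f A"
proof -
  have "card S \<le> sum f S" using sum_mono[of S "\<lambda>_. 1" f] assms(3) by simp
  also have "\<dots> \<le> sum f A" using assms(1,2) by (intro sum_mono2) auto
  finally show ?thesis .
qed

lemma sum_diff_indicator:
  fixes f :: "nat \<Rightarrow> nat"
  assumes "finite A" "S \<subseteq> A" "\<And>i. i \<in> S \<Longrightarrow> 1 \<le> f i"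
  shows "sum f A = (\<Sum>i\<in>A. if i \<in> S then f i - 1 else f i) + card S"
proof -
  have "sum f A = (\<Sum>i\<in>A. (if i \<in> S then f i - 1 else f i) + (if i \<in> S then 1 else 0))"
    by (rule sum.cong) (use assms(3) in force)+
  also have "\<dots> = (\<Sum>i\<in>A. if i \<in> S then f i - 1 else f i) + card (A \<inter> S)"
    using assms(1) by (simp add: sum.distrib sum.If_cases)
  also have "A \<inter> S = S" using assms(2) by auto
  finally show ?thesis .
qed

text \<open>\<open>Q n M\<close> stands for membership of the tuple with exponents \<open>M\<close>
  in a submonoid containing the generators, and \<open>peel\<close> for closure under the operation.
  This separates the combinatorics of exponents from the modules.\<close>

context
  fixes m :: nat and Q :: "nat \<Rightarrow> (nat \<Rightarrow> enat multiset) \<Rightarrow> bool"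
  assumes peel: "\<And>k n G M. Q k G \<Longrightarrow> Q n (\<lambda>i. M i - G i) \<Longrightarrow> (\<And>i. i < m \<Longrightarrow> G i \<subseteq># M i) \<Longrightarrow> Q (k + n) M"
    and Q0: "\<And>M. (\<And>i. i < m \<Longrightarrow> M i = {#}) \<Longrightarrow> Q 0 M"
    and QA0: "\<And>i0 r. i0 < m \<Longrightarrow> Q 1 (\<lambda>i. if i = i0 then {#r#} else {#0#})"
    and QA1: "\<And>S \<rho>. 2 \<le> m \<Longrightarrow> S \<subseteq> {..<m} \<Longrightarrow> card S \<le> 2 \<Longrightarrow> (\<And>i. i \<in> S \<Longrightarrow> 2 \<le> \<rho> i) \<Longrightarrow>
      Q 1 (\<lambda>i. if i \<in> S then {#\<rho> i#} else {#1#})"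
    and QA2: "\<And>\<rho>. (\<And>i. i < m \<Longrightarrow> 2 \<le> \<rho> i) \<Longrightarrow> Q 1 (\<lambda>i. {#\<rho> i#})"
    and QD1: "\<And>S d \<rho>. S \<subseteq> {..<m} \<Longrightarrow> card S = d + 2 \<Longrightarrow> (\<And>i. i \<in> S \<Longrightarrow> 2 \<le> \<rho> i) \<Longrightarrow>
      Q (d + 1) (\<lambda>i. replicate_mset d 0 + (if i \<in> S then {#\<rho> i#} else {#1#}))"
    and QD2: "\<And>S d \<rho>. S \<subseteq> {..<m} \<Longrightarrow> card S = d \<Longrightarrow> (\<And>i. i < m \<Longrightarrow> i \<notin> S \<Longrightarrow> 2 \<le> \<rho> i) \<Longrightarrow>
      Q (d + 1) (\<lambda>i. if i \<in> S then replicate_mset (d - 1) 0 + {#1, 1#} else replicate_mset d 0 + {#\<rho> i#})"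
begin

text \<open>For m \<le> 1 the family \<open>A_set m 1 2\<close> is empty; with a single point, any
  exponent can be peeled off on its own by \<open>QA0\<close>.\<close>

lemma decompose_small:
  assumes "m \<le> 1" "\<And>i. i < m \<Longrightarrow> size (M i) = n"
  shows "Q n M"
  using assms(2)
proof (induction n arbitrary: M)
  case 0
  then show ?case by (intro Q0) simp
next
  case (Suc n)
  show ?case
  proof (cases "m = 0")
    case True
    have "Q 1 (\<lambda>i. {#2#})" using QA2[of "\<lambda>_. 2"] by simp
    then have "Q (1 + n) M" by (rule peel) (use True Suc in simp_all)
    then show ?thesis by simp
  next
    case False
    then have m: "m = 1" using assms(1) by simp
    have "size (M 0) = Suc n" using Suc.prems m by simp
    then obtain r where r: "r \<in># M 0" by (metis Suc_not_Zero multiset_nonemptyE size_empty)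
    have "Q 1 (\<lambda>i. if i = 0 then {#r#} else {#0#})" using QA0[of 0 r] m by simp
    then have "Q (1 + n) M"
    proof (rule peel)
      show "Q n (\<lambda>i. M i - (if i = 0 then {#r#} else {#0#}))"
        by (rule Suc.IH) (use Suc.prems r m in \<open>simp add: size_Diff_singleton\<close>)
    qed (use r m in simp)
    then show ?thesis by simp
  qed
qed

text \<open>If a0 + a1 < n, an element of \<open>D2_set\<close> is split off; for d = 0 it has only
  exponents at least 2. If a0 + a1 = n and a1 > 0, exponent 1 is taken wherever the gap a1 - d_1 is
  zero, by an element of \<open>D1_set\<close> or \<open>A_set m 1 2\<close>. If a1 = 0 and a0 = n,
  an element of \<open>A_set m 0 1\<close> is split off.\<close>

lemma decompose:
  assumes "\<And>i. i < m \<Longrightarrow> size (M i) = n"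
    and "feasible m (\<lambda>i. count (M i) 0) (\<lambda>i. count (M i) 1) a0 a1" "a0 + a1 \<le> n" "2 \<le> m"
  shows "Q n M"
  using assms(1-3)
proof (induction n arbitrary: M a0 a1 rule: less_induct)
  case (less n)
  define d0 where "d0 i = count (M i) 0" for i
  define d1 where "d1 i = count (M i) 1" for i
  have f: "d0 i \<le> a0" "2 * d0 i + d1 i \<le> 2 * a0 + a1" if "i < m" for i
    using less.prems(2) that unfolding feasible_def d0_def d1_def by auto
  have f3: "(\<Sum>i<m. a0 - d0 i) \<le> a0" and f4: "(\<Sum>i<m. a0 - d0 i) + (\<Sum>i<m. a1 - d1 i) \<le> a0 + 2 * a1"
    using less.prems(2) unfolding feasible_def d0_def d1_def by auto
  have le: "d0 i + d1 i \<le> n" if "i < m" for i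
    using count_01_le_size[of "M i"] less.prems(1)[OF that] by (simp add: d0_def d1_def)
  \<comment> \<open>An exponent at least 2 for the part split off; it exists as soon as the
    exponents 0 and 1 do not exhaust the n entries.\<close>
  obtain \<rho> where \<rho>: "\<And>i. i < m \<Longrightarrow> d0 i + d1 i < n \<Longrightarrow> \<rho> i \<in># M i \<and> 2 \<le> \<rho> i"
  proof
    show "(SOME r. r \<in># M i \<and> 2 \<le> r) \<in># M i \<and> 2 \<le> (SOME r. r \<in># M i \<and> 2 \<le> r)"
      if "i < m" "d0 i + d1 i < n" for i
      by (rule someI_ex[OF ex_exponent_ge_2]) (use that less.prems(1) in \<open>simp add: d0_def d1_def\<close>)
  qed
  have \<rho>01: "\<rho> i \<noteq> 0" "\<rho> i \<noteq> 1" "0 < count (M i) (\<rho> i)" if "i < m" "d0 i + d1 i < n" for i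
    using \<rho>[OF that] by (auto simp: numeral_eq_enat one_enat_def zero_enat_def)
  have step: "Q n M"
    if "Q k G" "0 < k" "\<And>i. i < m \<Longrightarrow> size (G i) = k" "\<And>i. i < m \<Longrightarrow> G i \<subseteq># M i" "k \<le> n"
      "feasible m (\<lambda>i. d0 i - count (G i) 0) (\<lambda>i. d1 i - count (G i) 1) b0 b1" "b0 + b1 \<le> n - k" for k G b0 b1
  proof -
    have "Q (k + (n - k)) M"
    proof (rule peel[OF that(1)])
      show "Q (n - k) (\<lambda>i. M i - G i)"
        by (rule less.IH[of _ _ b0 b1])
          (use that less.prems(1) in \<open>auto simp: size_Diff_submset d0_def d1_def\<close>)
    qed (rule that(4))
    then show ?thesis using that(5) by simp
  qed
  consider "n = 0" | "a0 + a1 < n" | "a0 + a1 = n" "0 < a1" | "a1 = 0" "a0 = n" "0 < n"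
    using less.prems(3) by linarith
  then show ?case
  proof cases
    case 1
    have "Q 0 M" by (rule Q0) (use less.prems(1) 1 in simp)
    then show ?thesis using 1 by simp
  next
    case 2
    \<comment> \<open>The indices with no exponent at least 2 to offer; they contribute two
      exponents 1 instead.\<close>
    define S where "S = {i. i < m \<and> d0 i + d1 i = n}"
    define d where "d = card S"
    have S: "S \<subseteq> {..<m}" by (auto simp: S_def)
    \<comment> \<open>Here the condition on 2 d_0 + d_1 enters: with d_0 + d_1 = n > a0 + a1 it
      forces both d_0 < a0 and d_1 \<ge> a1 + 2.\<close>
    have \<delta>S: "1 \<le> a0 - d0 i" "a1 + 2 \<le> d1 i" if "i \<in> S" for i
      using that f[of i] 2 by (auto simp: S_def)
    have d: "d \<le> (\<Sum>i<m. a0 - d0 i)" unfolding d_def using \<delta>S(1) S by (intro card_le_sum) auto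
    \<comment> \<open>The other members of \<open>S\<close> each contribute at least 1 to the sum of
      the gaps, which is at most a0; so enough zeros are left at \<open>i\<close>.\<close>
    have d0S: "d - 1 \<le> d0 i" if "i \<in> S" for i
    proof -
      have "d - 1 = card (S - {i})" using that by (simp add: d_def)
      also have "\<dots> \<le> (\<Sum>i\<in>{..<m} - {i}. a0 - d0 i)" using \<delta>S(1) S by (intro card_le_sum) auto
      finally have "d - 1 + (a0 - d0 i) \<le> (\<Sum>i<m. a0 - d0 i)"
        using sum.remove[of "{..<m}" i "\<lambda>i. a0 - d0 i"] that S by auto
      then show ?thesis using f3 f(1)[of i] that S by auto
    qed
    have d0nS: "d \<le> d0 i" if "i < m" "i \<notin> S" for i
    proof -
      have "d \<le> (\<Sum>i\<in>{..<m} - {i}. a0 - d0 i)" unfolding d_def using \<delta>S(1) S that by (intro card_le_sum) auto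
      then have "d + (a0 - d0 i) \<le> (\<Sum>i<m. a0 - d0 i)"
        using sum.remove[of "{..<m}" i "\<lambda>i. a0 - d0 i"] that by auto
      then show ?thesis using f3 f(1)[of i] that by auto
    qed
    have dpos: "0 < d" if "i \<in> S" for i
      using that finite_subset[OF S] by (auto simp: d_def card_gt_0_iff)
    have lt: "d0 i + d1 i < n" if "i < m" "i \<notin> S" for i
      using le[OF that(1)] that by (auto simp: S_def)
    define G where "G i = (if i \<in> S then replicate_mset (d - 1) 0 + {#1, 1#} else replicate_mset d 0 + {#\<rho> i#})" for i
    have G0: "count (G i) 0 = (if i \<in> S then d - 1 else d)" and G1: "count (G i) 1 = (if i \<in> S then 2 else 0)" if "i < m" for i
      using \<rho>01[OF that lt[OF that]] by (auto simp: G_def)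
    show ?thesis
    \<comment> \<open>Lowering a0 by d balances the d zeros taken outside \<open>S\<close>. On
      \<open>S\<close> one zero less is taken, so each gap there shrinks by one, and both the sum of
      the gaps and its bound drop by d. The second gaps are unchanged, being 0 on \<open>S\<close>
      before and after.\<close>
    proof (rule step[of "d + 1" G "a0 - d" a1])
      show "Q (d + 1) G" unfolding G_def by (rule QD2[OF S]) (use \<rho> lt in \<open>auto simp: d_def\<close>)
      show "size (G i) = d + 1" if "i < m" for i using dpos[of i] by (auto simp: G_def)
      show "G i \<subseteq># M i" if "i < m" for i
      proof (cases "i \<in> S")
        case True
        then show ?thesis using \<delta>S(2)[OF True] d0S[OF True]
          by (auto simp: subseteq_mset_def G_def d0_def d1_def)
      next
        case False
        then show ?thesis using d0nS[OF that False] \<rho>01[OF that lt[OF that False]]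
          by (auto simp: subseteq_mset_def G_def d0_def d1_def)
      qed
      show "d + 1 \<le> n" using 2 d f3 by simp
      have \<delta>': "a0 - d - (d0 i - count (G i) 0) = (if i \<in> S then a0 - d0 i - 1 else a0 - d0 i)" if "i < m" for i
        using G0[OF that] d0S[of i] d0nS[OF that] dpos[of i] d f3 f(1)[OF that] by auto
      have e': "a1 - (d1 i - count (G i) 1) = a1 - d1 i" if "i < m" for i
        using G1[OF that] \<delta>S(2)[of i] by auto
      have eq: "(\<Sum>i<m. a0 - d0 i) = (\<Sum>i<m. a0 - d - (d0 i - count (G i) 0)) + d"
        using sum_diff_indicator[of "{..<m}" S "\<lambda>i. a0 - d0 i"] S \<delta>S(1) \<delta>' by (simp add: d_def)
      have eq': "(\<Sum>i<m. a1 - (d1 i - count (G i) 1)) = (\<Sum>i<m. a1 - d1 i)" using e' by (intro sum.cong) auto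
      show "feasible m (\<lambda>i. d0 i - count (G i) 0) (\<lambda>i. d1 i - count (G i) 1) (a0 - d) a1"
        unfolding feasible_def
      proof (intro conjI allI impI)
        fix i assume i: "i < m"
        show "d0 i - count (G i) 0 \<le> a0 - d"
          using G0[OF i] d0S[of i] d0nS[OF i] dpos[of i] \<delta>S(1)[of i] d f3 f(1)[OF i] by (auto split: if_splits)
        show "2 * (d0 i - count (G i) 0) + (d1 i - count (G i) 1) \<le> 2 * (a0 - d) + a1"
        proof (cases "i \<in> S")
          case True
          then show ?thesis using G0[OF i] G1[OF i] d0S[of i] dpos[of i] \<delta>S[of i] d f3 f[OF i] by simp
        next
          case False
          then show ?thesis using G0[OF i] G1[OF i] d0nS[OF i] d f3 f[OF i] by simp
        qed
      qed (use eq eq' f3 f4 in linarith)+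
      show "a0 - d + a1 \<le> n - (d + 1)" using 2 d f3 by simp
    qed simp
  next
    case 3
    define E where "E = {i. i < m \<and> 0 < a1 - d1 i}"
    \<comment> \<open>At these indices there is no exponent 1 to take.\<close>
    define U where "U = {i. i < m \<and> d1 i = 0}"
    have UE: "U \<subseteq> E" using 3 by (auto simp: U_def E_def)
    have EM: "E \<subseteq> {..<m}" by (auto simp: E_def)
    have fin: "finite E" by (simp add: E_def)
    have ltE: "d0 i + d1 i < n" if "i \<in> E" for i using that f(1)[of i] 3 by (auto simp: E_def)
    show ?thesis
    proof (cases "2 \<le> card U")
      case True
      define d where "d = card U - 2"
      have cU: "card U = d + 2" using True by (simp add: d_def)
      have UM: "U \<subseteq> {..<m}" using UE EM by blast
      \<comment> \<open>On \<open>U\<close> the second gap is all of a1. Setting 2 a1 aside, the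
        last inequality leaves room for d in the first one, which provides d zeros at every
        index.\<close>
      have "card U * a1 = (\<Sum>i\<in>U. a1 - d1 i)" by (simp add: U_def)
      also have "\<dots> \<le> (\<Sum>i<m. a1 - d1 i)" using UM by (intro sum_mono2) auto
      finally have "(\<Sum>i<m. a0 - d0 i) + d * a1 \<le> a0" using f4 unfolding cU by (simp add: algebra_simps)
      moreover have "d \<le> d * a1" using 3 by simp
      ultimately have D: "(\<Sum>i<m. a0 - d0 i) + d \<le> a0" by linarith
      have d0: "d \<le> d0 i" if "i < m" for i
      proof -
        have "a0 - d0 i \<le> (\<Sum>i<m. a0 - d0 i)"
          using that by (intro member_le_sum[of i "{..<m}" "\<lambda>i. a0 - d0 i"]) auto
        then show ?thesis using D f(1)[OF that] by linarith
      qed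
      define G where "G i = replicate_mset d 0 + (if i \<in> U then {#\<rho> i#} else {#1#})" for i
      have \<rho>U: "\<rho> i \<noteq> 0" "\<rho> i \<noteq> 1" "0 < count (M i) (\<rho> i)" if "i \<in> U" for i
        using \<rho>01[of i] ltE[of i] that UE EM by auto
      have G0: "count (G i) 0 = d" and G1: "count (G i) 1 = (if i \<in> U then 0 else 1)" for i
        using \<rho>U[of i] by (auto simp: G_def)
      show ?thesis
      \<comment> \<open>The second gaps shrink on \<open>U\<close> only, by d + 2 in total, which is
        exactly the drop of a0 + 2 a1.\<close>
      proof (rule step[of "d + 1" G "a0 - d" "a1 - 1"])
        show "Q (d + 1) G" unfolding G_def by (rule QD1[OF UM cU]) (use \<rho> ltE UE EM in auto)
        show "size (G i) = d + 1" for i by (auto simp: G_def)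
        show "G i \<subseteq># M i" if "i < m" for i
        proof (cases "i \<in> U")
          case True
          then show ?thesis using d0[OF that] \<rho>U[OF True] by (auto simp: subseteq_mset_def G_def d0_def)
        next
          case False
          then have "0 < d1 i" using that by (simp add: U_def)
          then show ?thesis using False d0[OF that] by (auto simp: subseteq_mset_def G_def d0_def d1_def)
        qed
        show "d + 1 \<le> n" using D 3 by simp
        have eq0: "(\<Sum>i<m. a0 - d - (d0 i - count (G i) 0)) = (\<Sum>i<m. a0 - d0 i)"
          unfolding G0 using d0 D by (intro sum.cong) auto
        have "(\<Sum>i<m. a1 - d1 i) = (\<Sum>i<m. if i \<in> U then a1 - d1 i - 1 else a1 - d1 i) + card U"
          using UM 3 by (intro sum_diff_indicator) (auto simp: U_def)
        also have "(\<Sum>i<m. if i \<in> U then a1 - d1 i - 1 else a1 - d1 i) = (\<Sum>i<m. a1 - 1 - (d1 i - count (G i) 1))"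
          unfolding G1 by (intro sum.cong) (auto simp: U_def)
        finally have eq1: "(\<Sum>i<m. a1 - d1 i) = (\<Sum>i<m. a1 - 1 - (d1 i - count (G i) 1)) + (d + 2)" unfolding cU .
        show "feasible m (\<lambda>i. d0 i - count (G i) 0) (\<lambda>i. d1 i - count (G i) 1) (a0 - d) (a1 - 1)"
          unfolding feasible_def
        proof (intro conjI allI impI)
          fix i assume i: "i < m"
          show "d0 i - count (G i) 0 \<le> a0 - d" unfolding G0 using f(1)[OF i] by simp
          have "i \<in> U \<Longrightarrow> d1 i = 0" "i \<notin> U \<Longrightarrow> 1 \<le> d1 i" using i by (auto simp: U_def)
          then show "2 * (d0 i - count (G i) 0) + (d1 i - count (G i) 1) \<le> 2 * (a0 - d) + (a1 - 1)"
            unfolding G0 G1 using f[OF i] d0[OF i] D 3 by (cases "i \<in> U") simp_all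
        next
          show "(\<Sum>i<m. a0 - d - (d0 i - count (G i) 0)) \<le> a0 - d" unfolding eq0 using D by simp
          show "(\<Sum>i<m. a0 - d - (d0 i - count (G i) 0)) + (\<Sum>i<m. a1 - 1 - (d1 i - count (G i) 1))
              \<le> a0 - d + 2 * (a1 - 1)"
            unfolding eq0 using eq1 f4 D 3 by linarith
        qed
        show "a0 - d + (a1 - 1) \<le> n - (d + 1)" using D 3 by simp
      qed simp
    next
      case False
      \<comment> \<open>\<open>S\<close> must contain \<open>U\<close>, where exponent 1 is missing,
        lie in \<open>E\<close>, where lowering a1 shortens the gap, and have two elements if
        possible, so that \<open>lower_slack\<close> applies.\<close>
      have "\<exists>S. U \<subseteq> S \<and> S \<subseteq> E \<and> card S \<le> 2 \<and> (2 \<le> card S \<or> S = E)"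
      proof (cases "card E \<le> 2")
        case True
        then show ?thesis using UE by blast
      next
        case E: False
        obtain S where "U \<subseteq> S" "S \<subseteq> E" "card S = 2"
          using exists_subset_between[of U 2 E] UE fin False E by auto
        then show ?thesis by auto
      qed
      then obtain S where S: "U \<subseteq> S" "S \<subseteq> E" "card S \<le> 2" "2 \<le> card S \<or> S = E" by blast
      have SM: "S \<subseteq> {..<m}" using S EM by blast
      define G where "G i = (if i \<in> S then {#\<rho> i#} else {#1#})" for i
      have \<rho>S: "\<rho> i \<noteq> 0" "\<rho> i \<noteq> 1" "0 < count (M i) (\<rho> i)" if "i \<in> S" for i
        using \<rho>01[of i] ltE[of i] that S EM by auto
      have G0: "count (G i) 0 = 0" and G1: "count (G i) 1 = (if i \<in> S then 0 else 1)" for i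
        using \<rho>S[of i] by (auto simp: G_def)
      have nS: "0 < d1 i" if "i < m" "i \<notin> S" for i using that S(1) by (auto simp: U_def)
      show ?thesis
      proof (rule step[of 1 G a0 "a1 - 1"])
        have "2 \<le> \<rho> i" if "i \<in> S" for i
          using \<rho>[of i] ltE[of i] that S(2) EM by blast
        then show "Q 1 G" unfolding G_def by (rule QA1[OF assms(4) SM S(3)])
        show "size (G i) = 1" for i by (auto simp: G_def)
        show "G i \<subseteq># M i" if "i < m" for i
          using \<rho>S[of i] nS[OF that] by (auto simp: G_def d1_def)
        show "1 \<le> n" using 3 by simp
        have "(\<Sum>i<m. a0 - d0 i) + (\<Sum>i<m. if i \<in> S then a1 - d1 i - 1 else a1 - d1 i) \<le> a0 + 2 * (a1 - 1)"
          using S(2,4) 3 f3 f4 by (intro lower_slack) (auto simp: E_def)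
        also have "(\<Sum>i<m. if i \<in> S then a1 - d1 i - 1 else a1 - d1 i) = (\<Sum>i<m. a1 - 1 - (d1 i - count (G i) 1))"
          unfolding G1 using nS 3 by (intro sum.cong) auto
        finally have 4: "(\<Sum>i<m. a0 - d0 i) + (\<Sum>i<m. a1 - 1 - (d1 i - count (G i) 1)) \<le> a0 + 2 * (a1 - 1)" .
        show "feasible m (\<lambda>i. d0 i - count (G i) 0) (\<lambda>i. d1 i - count (G i) 1) a0 (a1 - 1)"
          unfolding feasible_def
        proof (intro conjI allI impI)
          fix i assume i: "i < m"
          show "d0 i - count (G i) 0 \<le> a0" using f(1)[OF i] by simp
          have "i \<in> S \<Longrightarrow> d1 i < a1" using S(2) by (auto simp: E_def)
          then show "2 * (d0 i - count (G i) 0) + (d1 i - count (G i) 1) \<le> 2 * a0 + (a1 - 1)"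
            unfolding G0 G1 using f[OF i] nS[OF i] 3 by (cases "i \<in> S") simp_all
        qed (use 4 f3 in \<open>simp_all add: G0\<close>)
        show "a0 + (a1 - 1) \<le> n - 1" using 3 by simp
      qed simp
    qed
  next
    case 4
    have fs: "feasible m (\<lambda>i. d0 i - count (G i) 0) (\<lambda>i. d1 i - count (G i) 1) (n - 1) 0"
      if G: "\<And>i. i < m \<Longrightarrow> G i \<subseteq># M i" "\<And>i. i < m \<Longrightarrow> size (G i) = 1"
        and s: "(\<Sum>i<m. n - 1 - (d0 i - count (G i) 0)) \<le> n - 1" for G
    proof -
      have "d0 i - count (G i) 0 + (d1 i - count (G i) 1) \<le> n - 1" if "i < m" for i
        using count_01_le_size[of "M i - G i"] G[OF that] less.prems(1)[OF that]
        by (simp add: size_Diff_submset d0_def d1_def)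
      then show ?thesis unfolding feasible_def using s by fastforce
    qed
    have m0: "0 < m" using assms(4) by simp
    show ?thesis
    proof (cases "\<forall>i<m. d0 i = n")
      case True
      define G :: "nat \<Rightarrow> enat multiset" where "G i = {#0#}" for i
      have QG: "Q 1 G" using QA0[OF m0, of 0] unfolding G_def if_cancel .
      have GM: "G i \<subseteq># M i" if "i < m" for i
        using True that 4 by (auto simp: G_def d0_def simp flip: count_greater_zero_iff)
      have sz: "size (G i) = 1" for i by (simp add: G_def)
      have s: "(\<Sum>i<m. n - 1 - (d0 i - count (G i) 0)) \<le> n - 1" using True by (simp add: G_def)
      show ?thesis
        by (rule step[of 1 G "n - 1" 0, OF QG _ sz GM _ fs[OF GM sz s]]) (use 4 in auto)
    next
      case False
      then obtain i0 where i0: "i0 < m" "d0 i0 \<noteq> n" by blast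
      have "d0 i0 < n" using i0 f(1)[of i0] 4 by auto
      have "\<not> (\<forall>r\<in>#M i0. r = 0)"
      proof
        assume "\<forall>r\<in>#M i0. r = 0"
        then have "set_mset (M i0) \<subseteq> {0}" by blast
        then have "M i0 = replicate_mset (size (M i0)) 0" by (rule set_mset_subset_singletonD)
        then have "d0 i0 = n" using less.prems(1)[OF i0(1)] unfolding d0_def by (metis count_replicate_mset)
        then show False using i0(2) by simp
      qed
      then obtain r where r: "r \<in># M i0" "r \<noteq> 0" by blast
      define G where "G i = (if i = i0 then {#r#} else {#0#})" for i
      have QG: "Q 1 G" using QA0[OF i0(1), of r] unfolding G_def .
      \<comment> \<open>The gap at \<open>i0\<close> is positive and all gaps add up to at most a0 =
        n, so no other gap can reach n.\<close>
      have d0: "0 < d0 i" if "i < m" "i \<noteq> i0" for i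
      proof -
        have "(a0 - d0 i) + (a0 - d0 i0) = (\<Sum>i\<in>{i, i0}. a0 - d0 i)" using that by simp
        also have "\<dots> \<le> (\<Sum>i<m. a0 - d0 i)" using that i0 by (intro sum_mono2) auto
        finally show ?thesis using f3 4 \<open>d0 i0 < n\<close> by linarith
      qed
      have GM: "G i \<subseteq># M i" if "i < m" for i
        using d0[OF that] r by (auto simp: G_def d0_def simp flip: count_greater_zero_iff)
      have G0: "count (G i) 0 = (if i = i0 then 0 else 1)" for i using r by (simp add: G_def)
      have "(\<Sum>i<m. a0 - d0 i) = (\<Sum>i<m. if i \<in> {i0} then a0 - d0 i - 1 else a0 - d0 i) + card {i0}"
        using i0 4 \<open>d0 i0 < n\<close> by (intro sum_diff_indicator) auto
      also have "(\<Sum>i<m. if i \<in> {i0} then a0 - d0 i - 1 else a0 - d0 i) = (\<Sum>i<m. n - 1 - (d0 i - count (G i) 0))"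
        unfolding G0 using d0 4 by (intro sum.cong) auto
      finally have s: "(\<Sum>i<m. n - 1 - (d0 i - count (G i) 0)) \<le> n - 1" using f3 4 by simp
      have sz: "size (G i) = 1" for i by (simp add: G_def)
      show ?thesis
        by (rule step[of 1 G "n - 1" 0, OF QG _ sz GM _ fs[OF GM sz s]]) (use 4 in auto)
    qed
  qed
qed

end


section \<open>The generators as multisets of exponents\<close>

definition clsm :: "enat multiset \<Rightarrow> 'p :: prime_card module_class" where
  "clsm M = {N. \<exists>rs. mset rs = M \<and> has_type N rs}"

lemma clsm_mset [simp]: "clsm (mset rs) = (cls rs :: 'p :: prime_card module_class)"
proof -
  have *: "has_type N ss \<longleftrightarrow> has_type N rs" if "mset ss = mset rs" for N :: "('p padic_int, 'p padic_int vec set) module" and ss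
  proof -
    have "(cls ss :: 'p module_class) = cls rs" by (rule cls_cong) (simp add: nzm_def that)
    then show ?thesis by (auto simp: cls_def)
  qed
  have "(\<exists>ss. mset ss = mset rs \<and> has_type N ss) \<longleftrightarrow> has_type N rs" for N :: "('p padic_int, 'p padic_int vec set) module"
  proof
    assume "\<exists>ss. mset ss = mset rs \<and> has_type N ss"
    then obtain ss where "mset ss = mset rs" "has_type N ss" by blast
    then show "has_type N rs" using *[of ss N] by (rule_tac iffD1)
  qed (intro exI[of _ rs] conjI refl)
  then show ?thesis unfolding clsm_def cls_def by (simp only:)
qed

lemma clsm_class_d:
  assumes "size M = n"
  shows "class_d n (clsm M :: 'p :: prime_card module_class) 0 = int (count M 0)"
    "class_d n (clsm M :: 'p :: prime_card module_class) 1 = int (count M 1)"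
proof -
  obtain rs where rs: "mset rs = M" using ex_mset by blast
  show "class_d n (clsm M :: 'p module_class) 0 = int (count M 0)"
    "class_d n (clsm M :: 'p module_class) 1 = int (count M 1)"
    using assms class_d_cls[of rs n] by (auto simp flip: rs)
qed

lemma clsm_cyclic: "cyclic_class r = (clsm {#r#} :: 'p :: prime_card module_class)"
proof -
  have "clsm (mset [r]) = (cls [r] :: 'p module_class)" by (rule clsm_mset)
  then show ?thesis unfolding cyclic_class_eq by simp
qed

lemma clsm_times: "class_times (clsm M) (clsm N) = (clsm (M + N) :: 'p :: prime_card module_class)"
proof -
  obtain rs ss where "mset rs = M" "mset ss = N" using ex_mset by metis
  then show ?thesis using class_times_cls[of rs ss] clsm_mset[of "rs @ ss"] by auto
qed

text \<open>Zeros are invisible in a class and only counted by n, so the multisets of the generators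
  can be padded to the required size.\<close>

lemma clsm_zeros: "clsm (replicate_mset d 0 + M) = clsm M"
proof -
  obtain rs where rs: "mset rs = M" using ex_mset by blast
  have "clsm (mset (replicate d 0 @ rs)) = clsm (mset rs)"
    unfolding clsm_mset by (rule cls_cong) (simp add: nzm_def)
  then show ?thesis by (simp add: rs)
qed

definition b_elem :: "nat \<Rightarrow> nat \<Rightarrow> (nat \<Rightarrow> enat multiset) \<Rightarrow> nat \<times> 'p :: prime_card module_class list" where
  "b_elem m n M = (n, map (\<lambda>i. clsm (M i)) [0..<m])"

lemma b_elem_cong: "(\<And>i. i < m \<Longrightarrow> M i = N i) \<Longrightarrow> (b_elem m n M :: nat \<times> 'p :: prime_card module_class list) = b_elem m n N"
  by (simp add: b_elem_def)

lemma b_elem_lists: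
  assumes "\<And>i. i < m \<Longrightarrow> size (M i) = n"
  obtains R where "\<And>i. i < m \<Longrightarrow> length (R i) = n" "\<And>i. mset (R i) = M i"
    "(b_elem m n M :: nat \<times> 'p :: prime_card module_class list) = (n, map (\<lambda>i. cls (R i)) [0..<m])"
proof -
  define R where "R i = (SOME rs. mset rs = M i)" for i
  have R: "mset (R i) = M i" for i unfolding R_def by (rule someI_ex[OF ex_mset])
  have "length (R i) = n" if "i < m" for i using assms[OF that] R size_mset by metis
  moreover have "b_elem m n M = (n, map (\<lambda>i. cls (R i)) [0..<m])" by (simp add: b_elem_def flip: R)
  ultimately show ?thesis using R that by blast
qed

lemma B_set_elem:
  "x \<in> (B_set m :: (nat \<times> 'p :: prime_card module_class list) set) \<longleftrightarrow>
     (\<exists>n M. (\<forall>i<m. size (M i) = n) \<and> x = b_elem m n M)"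
proof
  assume x: "x \<in> (B_set m :: (nat \<times> 'p :: prime_card module_class list) set)"
  obtain n Hs where nHs: "x = (n, Hs)" by fastforce
  obtain R where R: "\<forall>i<m. length (R i) = n" "Hs = map (\<lambda>i. cls (R i)) [0..<m]"
    using x unfolding nHs B_set_iff by blast
  then show "\<exists>n M. (\<forall>i<m. size (M i) = n) \<and> x = b_elem m n M"
    by (intro exI[of _ n] exI[of _ "\<lambda>i. mset (R i)"]) (simp add: b_elem_def nHs)
next
  assume "\<exists>n M. (\<forall>i<m. size (M i) = n) \<and> x = b_elem m n M"
  then obtain n M where M: "\<And>i. i < m \<Longrightarrow> size (M i) = n" "x = b_elem m n M" by blast
  obtain R where "\<And>i. i < m \<Longrightarrow> length (R i) = n" "x = (n, map (\<lambda>i. cls (R i)) [0..<m])"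
    using b_elem_lists[of m M n] M by metis
  then show "x \<in> B_set m" using B_set_iff[of n _ m] by blast
qed

lemma b_elem_mult:
  "b_elem m n M \<otimes>\<^bsub>B_monoid m\<^esub> b_elem m k N = (b_elem m (n + k) (\<lambda>i. M i + N i) :: nat \<times> 'p :: prime_card module_class list)"
  by (auto simp: b_elem_def B_monoid_def clsm_times intro!: nth_equalityI)

lemma b_elem_one: "\<one>\<^bsub>B_monoid m\<^esub> = (b_elem m 0 (\<lambda>_. {#}) :: nat \<times> 'p :: prime_card module_class list)"
proof -
  have "cyclic_class 0 = (clsm {#} :: 'p module_class)"
    using clsm_zeros[of 1 "{#}"] by (simp add: clsm_cyclic)
  then show ?thesis by (simp add: b_elem_def B_monoid_def map_replicate_trivial map_replicate_const)
qed

lemma C12_elem: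
  fixes xs :: "'p :: prime_card padic_int list"
  assumes "length xs = m" "\<And>i. i < m \<Longrightarrow> size (M i) = n"
  shows "b_elem m n M \<in> C12_set xs \<longleftrightarrow> realizable xs n (\<lambda>i. image_mset t2 (M i))"
proof -
  obtain R where R: "\<And>i. i < m \<Longrightarrow> length (R i) = n" "\<And>i. mset (R i) = M i"
    "(b_elem m n M :: nat \<times> 'p module_class list) = (n, map (\<lambda>i. cls (R i)) [0..<m])"
    using b_elem_lists[of m M n] assms(2) by metis
  have ms: "mset (map t2 (R i)) = image_mset t2 (M i)" for i by (simp add: R(2))
  have "mat_type n A (map t2 (R i)) \<longleftrightarrow> (\<exists>es. mset es = image_mset t2 (M i) \<and> mat_type n A es)" for A :: "'p padic_int mat" and i
    using ms[of i] mat_type_perm by metis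
  then show ?thesis unfolding R(3) realizable_def assms(1) by (subst C12_iff[OF assms(1) R(1)]) simp_all
qed

lemma realizable_cong:
  "(\<And>i. i < length xs \<Longrightarrow> M i = N i) \<Longrightarrow> realizable xs n M \<longleftrightarrow> realizable xs n N"
  by (simp add: realizable_def)

lemma t2_simps: "t2 0 = 0" "t2 1 = 1" "2 \<le> r \<Longrightarrow> t2 r = 2" "t2 r \<le> 2"
proof -
  have "enat (t2 r) \<le> enat 2" unfolding enat_t2 by (simp add: numeral_eq_enat)
  then show "t2 r \<le> 2" by simp
qed (auto simp: t2_def min_def numeral_eq_enat zero_enat_def one_enat_def)

section \<open>Generators indexed by sets of positions instead of permutations\<close>

lemma permute_split:
  assumes "S \<subseteq> {..<m}"
  obtains \<sigma> l k where "\<sigma> permutes {..<m}" "length l = card S" "length k = m - card S" "set l = S"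
    "set k = {..<m} - S" "permute_list \<sigma> (map f l @ map f k) = map f [0..<m]"
proof -
  have fin: "finite S" using assms finite_subset by blast
  define l where "l = sorted_list_of_set S"
  define k where "k = sorted_list_of_set ({..<m} - S)"
  have "mset (l @ k) = mset [0..<m]"
    by (subst set_eq_iff_mset_eq_distinct[symmetric]) (use assms fin in \<open>auto simp: l_def k_def\<close>)
  then have "mset (map f [0..<m]) = mset (map f l @ map f k)"
    by (metis map_append mset_map)
  moreover have "length (map f l @ map f k) = m"
    using calculation by (metis diff_zero length_map length_upt size_mset)
  ultimately obtain \<sigma> where "\<sigma> permutes {..<m}" "permute_list \<sigma> (map f l @ map f k) = map f [0..<m]"
    using mset_eq_permutation by metis
  then show ?thesis
    using that[of \<sigma> l k] assms fin by (simp add: l_def k_def card_Diff_subset)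
qed

lemma permute_list_map: "permute_list \<sigma> ys = map (\<lambda>i. ys ! \<sigma> i) [0..<length ys]"
  by (simp add: permute_list_def)

lemma card_permuted:
  assumes "\<sigma> permutes {..<m}" "d \<le> m"
  shows "card {i. i < m \<and> \<sigma> i < d} = d"
proof -
  have "bij_betw \<sigma> {i. i < m \<and> \<sigma> i < d} {..<d}"
  proof (rule bij_betw_imageI)
    show "inj_on \<sigma> {i. i < m \<and> \<sigma> i < d}" using permutes_inj[OF assms(1)] by (rule inj_on_subset) simp
    have "\<exists>i<m. \<sigma> i = j" if "j < d" for j
      using permutes_image[OF assms(1)] assms(2) that by (metis imageE lessThan_iff order_less_le_trans)
    then show "\<sigma> ` {i. i < m \<and> \<sigma> i < d} = {..<d}" by force
  qed
  then show ?thesis using bij_betw_same_card by fastforce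
qed

lemma map_eq_replicate: "(\<And>x. x \<in> set ys \<Longrightarrow> f x = c) \<Longrightarrow> map f ys = replicate (length ys) c"
  by (induction ys) auto

definition gens :: "nat \<Rightarrow> (nat \<times> 'p :: prime_card module_class list) set" where
  "gens m = A_set m 0 1 \<union> A_set m 1 2 \<union> A_set m 2 m \<union> D_set m"

text \<open>Up to permutation only the set of positions with a free exponent matters;
  \<open>permute_split\<close> supplies a permutation that moves these to the front.\<close>

lemma A_set_elem:
  assumes S: "S \<subseteq> {..<m}" "card S = d" and \<rho>: "\<And>i. i \<in> S \<Longrightarrow> r \<le> \<rho> i" "\<And>i. i < m \<Longrightarrow> i \<notin> S \<Longrightarrow> \<rho> i = r"
  shows "b_elem m 1 (\<lambda>i. {#\<rho> i#}) \<in> (A_set m r d :: (nat \<times> 'p :: prime_card module_class list) set)"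
proof -
  let ?f = "\<lambda>i. clsm {#\<rho> i#} :: 'p module_class"
  obtain \<sigma> l k where \<sigma>: "\<sigma> permutes {..<m}" "length l = card S" "length k = m - card S" "set l = S"
    "set k = {..<m} - S" "permute_list \<sigma> (map ?f l @ map ?f k) = map ?f [0..<m]"
    by (rule permute_split[OF S(1)])
  have "map \<rho> k = replicate (m - d) r" using map_eq_replicate[of k \<rho> r] \<sigma>(3,5) \<rho>(2) S(2) by simp
  moreover have "map ?f l @ map ?f k = map cyclic_class (map \<rho> l @ map \<rho> k)" by (simp add: clsm_cyclic)
  ultimately have eq: "map ?f l @ map ?f k = map cyclic_class (map \<rho> l @ replicate (m - d) r)" by (simp only:)
  have "b_elem m 1 (\<lambda>i. {#\<rho> i#}) = (1, permute_list \<sigma> (map cyclic_class (map \<rho> l @ replicate (m - d) r) :: 'p module_class list))"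
    unfolding b_elem_def \<sigma>(6)[symmetric] eq ..
  moreover have "d \<le> m" using S card_mono[of "{..<m}" S] by simp
  ultimately show ?thesis
    unfolding A_set_def using \<sigma>(1,2,4) \<rho>(1) S(2) by (intro CollectI exI[of _ \<sigma>] exI[of _ "map \<rho> l"]) auto
qed

lemma D1_set_elem:
  assumes S: "S \<subseteq> {..<m}" "card S = d + 2" and \<rho>: "\<And>i. i \<in> S \<Longrightarrow> 2 \<le> \<rho> i"
  shows "b_elem m (d + 1) (\<lambda>i. replicate_mset d 0 + (if i \<in> S then {#\<rho> i#} else {#1#}))
    \<in> (D1_set m :: (nat \<times> 'p :: prime_card module_class list) set)"
proof -
  let ?\<rho> = "\<lambda>i. if i \<in> S then \<rho> i else 1"
  let ?f = "\<lambda>i. clsm {#?\<rho> i#} :: 'p module_class"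
  obtain \<sigma> l k where \<sigma>: "\<sigma> permutes {..<m}" "length l = card S" "length k = m - card S" "set l = S"
    "set k = {..<m} - S" "permute_list \<sigma> (map ?f l @ map ?f k) = map ?f [0..<m]"
    by (rule permute_split[OF S(1)])
  have "map ?\<rho> k = replicate (m - (d + 2)) 1" using map_eq_replicate[of k ?\<rho> 1] \<sigma>(3,5) S(2) by simp
  moreover have "map ?f l @ map ?f k = map cyclic_class (map ?\<rho> l @ map ?\<rho> k)" by (simp add: clsm_cyclic)
  ultimately have eq: "map ?f l @ map ?f k = map cyclic_class (map ?\<rho> l @ replicate (m - (d + 2)) 1)" by (simp only:)
  have * : "clsm (replicate_mset d 0 + (if i \<in> S then {#\<rho> i#} else {#1#})) = ?f i" for i
    by (simp add: clsm_zeros)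
  have "b_elem m (d + 1) (\<lambda>i. replicate_mset d 0 + (if i \<in> S then {#\<rho> i#} else {#1#}))
      = (d + 1, permute_list \<sigma> (map cyclic_class (map ?\<rho> l @ replicate (m - (d + 2)) 1) :: 'p module_class list))"
    unfolding b_elem_def * \<sigma>(6)[symmetric] eq ..
  moreover have "d + 2 \<le> m" using S card_mono[of "{..<m}" S] by simp
  ultimately show ?thesis
    unfolding D1_set_def using \<sigma>(1,2,4) \<rho>(1) S(2) by (intro CollectI exI[of _ \<sigma>] exI[of _ d] exI[of _ "map ?\<rho> l"]) auto
qed

lemma D2_set_elem:
  assumes S: "S \<subseteq> {..<m}" "card S = d" and \<rho>: "\<And>i. i < m \<Longrightarrow> i \<notin> S \<Longrightarrow> 2 \<le> \<rho> i"
  shows "b_elem m (d + 1) (\<lambda>i. if i \<in> S then replicate_mset (d - 1) 0 + {#1, 1#} else replicate_mset d 0 + {#\<rho> i#})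
    \<in> (D2_set m :: (nat \<times> 'p :: prime_card module_class list) set)"
proof -
  let ?f = "\<lambda>i. if i \<in> S then clsm {#1, 1#} else clsm {#\<rho> i#} :: 'p module_class"
  obtain \<sigma> l k where \<sigma>: "\<sigma> permutes {..<m}" "length l = card S" "length k = m - card S" "set l = S"
    "set k = {..<m} - S" "permute_list \<sigma> (map ?f l @ map ?f k) = map ?f [0..<m]"
    by (rule permute_split[OF S(1)])
  have 11: "class_times (cyclic_class 1) (cyclic_class 1) = (clsm {#1, 1#} :: 'p module_class)"
    by (simp add: clsm_cyclic clsm_times add_mset_commute)
  have l: "map ?f l = replicate d (clsm {#1, 1#})" using map_eq_replicate[of l ?f "clsm {#1, 1#}"] \<sigma>(2,4) S(2) by simp
  have k: "map ?f k = map cyclic_class (map \<rho> k)" using \<sigma>(5) by (auto simp: clsm_cyclic)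
  have *: "clsm (if i \<in> S then replicate_mset (d - 1) 0 + {#1, 1#} else replicate_mset d 0 + {#\<rho> i#}) = ?f i" for i
    by (cases "i \<in> S") (simp_all only: clsm_zeros if_True if_False)
  have "b_elem m (d + 1) (\<lambda>i. if i \<in> S then replicate_mset (d - 1) 0 + {#1, 1#} else replicate_mset d 0 + {#\<rho> i#})
      = (d + 1, permute_list \<sigma> (replicate d (class_times (cyclic_class 1) (cyclic_class 1)) @ map cyclic_class (map \<rho> k) :: 'p module_class list))"
    unfolding b_elem_def * \<sigma>(6)[symmetric] l k 11 ..
  moreover have "d \<le> m" using S card_mono[of "{..<m}" S] by simp
  ultimately show ?thesis
    unfolding D2_set_def using \<sigma>(1,3,5) \<rho>(1) S(2) by (intro CollectI exI[of _ \<sigma>] exI[of _ d] exI[of _ "map \<rho> k"]) auto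
qed

text \<open>The abstract predicate of the decomposition becomes membership in \<open>N\<close>. For
  m \<ge> 2 the parameters are bounded by n beforehand.\<close>

lemma generated_elem:
  fixes N :: "(nat \<times> 'p :: prime_card module_class list) set"
  assumes N: "submonoid N (B_monoid m)" "gens m \<subseteq> N"
    and M: "\<And>i. i < m \<Longrightarrow> size (M i) = n" "feasible m (\<lambda>i. count (M i) 0) (\<lambda>i. count (M i) 1) a0 a1"
  shows "b_elem m n M \<in> N"
proof -
  define Q where "Q n M \<longleftrightarrow> b_elem m n M \<in> N" for n M
  have gen: "Q n M" if "b_elem m n M \<in> (gens m :: (nat \<times> 'p module_class list) set)" for n M
    using that N(2) by (auto simp: Q_def)
  have peel: "Q (k + n) M" if "Q k G" "Q n (\<lambda>i. M i - G i)" "\<And>i. i < m \<Longrightarrow> G i \<subseteq># M i" for k n G M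
  proof -
    have "b_elem m k G \<otimes>\<^bsub>B_monoid m\<^esub> b_elem m n (\<lambda>i. M i - G i) \<in> N"
      using that(1,2) submonoid.m_closed[OF N(1)] by (simp add: Q_def)
    moreover have "b_elem m (k + n) (\<lambda>i. G i + (M i - G i)) = (b_elem m (k + n) M :: nat \<times> 'p module_class list)"
      using that(3) by (intro b_elem_cong) simp
    ultimately show ?thesis by (simp add: Q_def b_elem_mult)
  qed
  have Q0: "Q 0 M" if "\<And>i. i < m \<Longrightarrow> M i = {#}" for M
  proof -
    have "(b_elem m 0 M :: nat \<times> 'p module_class list) = b_elem m 0 (\<lambda>_. {#})"
      by (rule b_elem_cong) (rule that)
    then show ?thesis using submonoid.one_closed[OF N(1)] by (simp add: Q_def b_elem_one)
  qed
  have QA0: "Q 1 (\<lambda>i. if i = i0 then {#r#} else {#0#})" if "i0 < m" for i0 r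
  proof (rule gen)
    have "b_elem m 1 (\<lambda>i. {#if i = i0 then r else 0#}) \<in> (A_set m 0 1 :: (nat \<times> 'p module_class list) set)"
      by (rule A_set_elem[of "{i0}"]) (use that in auto)
    moreover have "b_elem m 1 (\<lambda>i. {#if i = i0 then r else 0#}) = (b_elem m 1 (\<lambda>i. if i = i0 then {#r#} else {#0#}) :: nat \<times> 'p module_class list)"
      by (rule b_elem_cong) simp
    ultimately show "b_elem m 1 (\<lambda>i. if i = i0 then {#r#} else {#0#}) \<in> (gens m :: (nat \<times> 'p module_class list) set)"
      by (simp add: gens_def)
  qed
  have QA1: "Q 1 (\<lambda>i. if i \<in> S then {#\<rho> i#} else {#1#})"
    if S: "2 \<le> m" "S \<subseteq> {..<m}" "card S \<le> 2" and \<rho>: "\<And>i. i \<in> S \<Longrightarrow> 2 \<le> \<rho> i" for S \<rho>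
  proof -
    \<comment> \<open>Elements of \<open>A_set m 1 2\<close> have exactly two free positions, but a
      free exponent may itself be 1, so \<open>S\<close> can be enlarged to two positions.\<close>
    obtain S' where S': "S \<subseteq> S'" "S' \<subseteq> {..<m}" "card S' = 2"
      using exists_subset_between[of S 2 "{..<m}"] S by auto
    have "b_elem m 1 (\<lambda>i. {#if i \<in> S then \<rho> i else 1#}) \<in> (A_set m 1 2 :: (nat \<times> 'p module_class list) set)"
    proof (rule A_set_elem[OF S'(2,3)])
      show "1 \<le> (if i \<in> S then \<rho> i else 1)" for i
        using \<rho>[of i] order_trans[of 1 2 "\<rho> i"] by simp
    qed (use S' in auto)
    moreover have "b_elem m 1 (\<lambda>i. {#if i \<in> S then \<rho> i else 1#}) = (b_elem m 1 (\<lambda>i. if i \<in> S then {#\<rho> i#} else {#1#}) :: nat \<times> 'p module_class list)"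
      by (rule b_elem_cong) simp
    ultimately show ?thesis by (intro gen) (simp add: gens_def)
  qed
  have QA2: "Q 1 (\<lambda>i. {#\<rho> i#})" if "\<And>i. i < m \<Longrightarrow> 2 \<le> \<rho> i" for \<rho>
    using A_set_elem[of "{..<m}" m m 2 \<rho>, where ?'p = 'p] that by (intro gen) (simp add: gens_def)
  have QD1: "Q (d + 1) (\<lambda>i. replicate_mset d 0 + (if i \<in> S then {#\<rho> i#} else {#1#}))"
    if "S \<subseteq> {..<m}" "card S = d + 2" "\<And>i. i \<in> S \<Longrightarrow> 2 \<le> \<rho> i" for S d \<rho>
    using D1_set_elem[OF that, where ?'p = 'p] by (intro gen) (simp add: gens_def D_set_def)
  have QD2: "Q (d + 1) (\<lambda>i. if i \<in> S then replicate_mset (d - 1) 0 + {#1, 1#} else replicate_mset d 0 + {#\<rho> i#})"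
    if "S \<subseteq> {..<m}" "card S = d" "\<And>i. i < m \<Longrightarrow> i \<notin> S \<Longrightarrow> 2 \<le> \<rho> i" for S d \<rho>
    using D2_set_elem[OF that, where ?'p = 'p] by (intro gen) (simp add: gens_def D_set_def)
  have "Q n M"
  proof (cases "m \<le> 1")
    case True
    show ?thesis by (rule decompose_small[OF peel Q0 QA0 QA1 QA2 QD1 QD2 True M(1)])
  next
    case False
    have "count (M i) 0 + count (M i) 1 \<le> n" if "i < m" for i
      using count_01_le_size[of "M i"] M(1)[OF that] by simp
    then obtain b0 b1 where b: "feasible m (\<lambda>i. count (M i) 0) (\<lambda>i. count (M i) 1) b0 b1" "b0 + b1 \<le> n"
      using feasible_bounded[OF M(2)] by blast
    have "2 \<le> m" using False by simp
    show ?thesis by (rule decompose[OF peel Q0 QA0 QA1 QA2 QD1 QD2 M(1) b \<open>2 \<le> m\<close>])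
  qed
  then show ?thesis by (simp add: Q_def)
qed


lemma permute_list_elem:
  assumes "length ys = m" "\<And>i. i < m \<Longrightarrow> ys ! \<sigma> i = (clsm (M i) :: 'p :: prime_card module_class)"
  shows "(n, permute_list \<sigma> ys) = b_elem m n M"
  using assms by (simp add: b_elem_def permute_list_map)

lemma A_set_cases:
  assumes "x \<in> (A_set m r d :: (nat \<times> 'p :: prime_card module_class list) set)"
  obtains S \<rho> where "S \<subseteq> {..<m}" "card S = d" "\<And>i. i \<in> S \<Longrightarrow> r \<le> \<rho> i" "\<And>i. i < m \<Longrightarrow> i \<notin> S \<Longrightarrow> \<rho> i = r"
    "x = b_elem m 1 (\<lambda>i. {#\<rho> i#})"
proof -
  obtain \<sigma> rs where \<sigma>: "x = (1, permute_list \<sigma> (map cyclic_class (rs @ replicate (m - d) r)))" "d \<le> m"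
    "\<sigma> permutes {..<m}" "length rs = d" "\<forall>q \<in> set rs. r \<le> q"
    using assms unfolding A_set_def by blast
  have lt: "\<sigma> i < m" if "i < m" for i using permutes_in_image[OF \<sigma>(3), of i] that by simp
  show ?thesis
  proof (rule that[of "{i. i < m \<and> \<sigma> i < d}" "\<lambda>i. (rs @ replicate (m - d) r) ! \<sigma> i"])
    show "x = b_elem m 1 (\<lambda>i. {#(rs @ replicate (m - d) r) ! \<sigma> i#})"
      unfolding \<sigma>(1)
    proof (rule permute_list_elem)
      show "map cyclic_class (rs @ replicate (m - d) r) ! \<sigma> i = (clsm {#(rs @ replicate (m - d) r) ! \<sigma> i#} :: 'p module_class)"
        if "i < m" for i
        unfolding clsm_cyclic[symmetric] by (rule nth_map) (use lt[OF that] \<sigma>(2,4) in simp)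
    qed (use \<sigma>(2,4) in simp)
    show "(rs @ replicate (m - d) r) ! \<sigma> i = r" if "i < m" "i \<notin> {i. i < m \<and> \<sigma> i < d}" for i
      using that lt[of i] \<sigma>(4) by (auto simp: nth_append)
  qed (use \<sigma> lt card_permuted[OF \<sigma>(3,2)] in \<open>auto simp: nth_append\<close>)
qed

lemma D1_set_cases:
  assumes "x \<in> (D1_set m :: (nat \<times> 'p :: prime_card module_class list) set)"
  obtains d S \<rho> where "S \<subseteq> {..<m}" "card S = d + 2" "\<And>i. i \<in> S \<Longrightarrow> 2 \<le> \<rho> i"
    "x = b_elem m (d + 1) (\<lambda>i. replicate_mset d 0 + (if i \<in> S then {#\<rho> i#} else {#1#}))"
proof -
  obtain \<sigma> d rs where \<sigma>: "x = (d + 1, permute_list \<sigma> (map cyclic_class (rs @ replicate (m - (d + 2)) 1)))" "d + 2 \<le> m"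
    "\<sigma> permutes {..<m}" "length rs = d + 2" "\<forall>q \<in> set rs. 2 \<le> q"
    using assms unfolding D1_set_def by blast
  have lt: "\<sigma> i < m" if "i < m" for i using permutes_in_image[OF \<sigma>(3), of i] that by simp
  let ?S = "{i. i < m \<and> \<sigma> i < d + 2}"
  show ?thesis
  proof (rule that[of ?S d "\<lambda>i. rs ! \<sigma> i"])
    have "map cyclic_class (rs @ replicate (m - (d + 2)) 1) ! \<sigma> i =
        (clsm (replicate_mset d 0 + (if i \<in> ?S then {#rs ! \<sigma> i#} else {#1#})) :: 'p module_class)" if "i < m" for i
      unfolding clsm_zeros using \<sigma>(2,4) lt[OF that] that by (auto simp: nth_append clsm_cyclic)
    then show "x = b_elem m (d + 1) (\<lambda>i. replicate_mset d 0 + (if i \<in> ?S then {#rs ! \<sigma> i#} else {#1#}))"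
      unfolding \<sigma>(1) using \<sigma>(2,4) by (intro permute_list_elem) simp_all
  qed (use \<sigma> card_permuted[OF \<sigma>(3,2)] in auto)
qed

lemma D2_set_cases:
  assumes "x \<in> (D2_set m :: (nat \<times> 'p :: prime_card module_class list) set)"
  obtains d S \<rho> where "S \<subseteq> {..<m}" "card S = d" "\<And>i. i < m \<Longrightarrow> i \<notin> S \<Longrightarrow> 2 \<le> \<rho> i"
    "x = b_elem m (d + 1) (\<lambda>i. if i \<in> S then replicate_mset (d - 1) 0 + {#1, 1#} else replicate_mset d 0 + {#\<rho> i#})"
proof -
  obtain \<sigma> d rs where \<sigma>: "x = (d + 1, permute_list \<sigma> (replicate d (class_times (cyclic_class 1) (cyclic_class 1)) @ map cyclic_class rs))" "d \<le> m"
    "\<sigma> permutes {..<m}" "length rs = m - d" "\<forall>q \<in> set rs. 2 \<le> q"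
    using assms unfolding D2_set_def by blast
  have lt: "\<sigma> i < m" if "i < m" for i using permutes_in_image[OF \<sigma>(3), of i] that by simp
  let ?S = "{i. i < m \<and> \<sigma> i < d}"
  have 11: "class_times (cyclic_class 1) (cyclic_class 1) = (clsm {#1, 1#} :: 'p module_class)"
    by (simp add: clsm_cyclic clsm_times add_mset_commute)
  show ?thesis
  proof (rule that[of ?S d "\<lambda>i. rs ! (\<sigma> i - d)"])
    show "2 \<le> rs ! (\<sigma> i - d)" if "i < m" "i \<notin> ?S" for i
    proof -
      have "\<sigma> i - d < length rs" using that lt[of i] \<sigma>(4) by auto
      then show ?thesis using \<sigma>(5) by simp
    qed
    have "(replicate d (class_times (cyclic_class 1) (cyclic_class 1)) @ map cyclic_class rs) ! \<sigma> i =
        (clsm (if i \<in> ?S then replicate_mset (d - 1) 0 + {#1, 1#} else replicate_mset d 0 + {#rs ! (\<sigma> i - d)#}) :: 'p module_class)" if "i < m" for i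
    proof (cases "i \<in> ?S")
      case True
      then show ?thesis unfolding if_P[OF True] clsm_zeros 11 by (simp add: nth_append)
    next
      case False
      then show ?thesis unfolding if_not_P[OF False] clsm_zeros using lt[OF that] that \<sigma>(2,4)
        by (simp add: nth_append clsm_cyclic)
    qed
    then show "x = b_elem m (d + 1) (\<lambda>i. if i \<in> ?S then replicate_mset (d - 1) 0 + {#1, 1#} else replicate_mset d 0 + {#rs ! (\<sigma> i - d)#})"
      unfolding \<sigma>(1) using \<sigma>(2,4) by (intro permute_list_elem) simp_all
  qed (use card_permuted[OF \<sigma>(3,2)] in auto)
qed

text \<open>Each family is matched with an explicit matrix; all exponents from 2 on, finite or
  infinite, truncate to 2.\<close>

lemma gens_subset_C12:
  fixes xs :: "'p :: prime_card padic_int list"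
  assumes len: "length xs = m"
    and dist: "\<forall>i<m. \<forall>j<m. i \<noteq> j \<longrightarrow> \<not> padic_p dvd (xs ! i - xs ! j)"
  shows "gens m \<subseteq> C12_set xs"
proof
  have inC: "b_elem m n M \<in> C12_set xs"
    if "realizable xs n N" "\<And>i. i < m \<Longrightarrow> size (M i) = n" "\<And>i. i < m \<Longrightarrow> image_mset t2 (M i) = N i" for n M N
    using that C12_elem[OF len, of M n] realizable_cong[of xs "\<lambda>i. image_mset t2 (M i)" N n] len by simp
  fix x :: "nat \<times> 'p module_class list"
  assume "x \<in> gens m"
  then consider "x \<in> A_set m 0 1" | "x \<in> A_set m 1 2" | "x \<in> A_set m 2 m" | "x \<in> D1_set m" | "x \<in> D2_set m"
    unfolding gens_def D_set_def by blast
  then show "x \<in> C12_set xs"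
  proof cases
    case 1
    then obtain S \<rho> where S: "S \<subseteq> {..<m}" "card S = 1" "\<And>i. i < m \<Longrightarrow> i \<notin> S \<Longrightarrow> \<rho> i = 0" "x = b_elem m 1 (\<lambda>i. {#\<rho> i#})"
      by (rule A_set_cases) (rule that)
    then obtain i0 where i0: "S = {i0}" using card_1_singletonE by blast
    have "realizable xs 1 (\<lambda>i. if i = i0 then {#t2 (\<rho> i0)#} else {#0#})"
      by (rule realizable_A0[OF len]) (use S(1) i0 dist t2_simps(4) in auto)
    then show ?thesis unfolding S(4) by (rule inC) (use S(3) i0 in \<open>auto simp: t2_simps\<close>)
  next
    case 2
    then obtain S \<rho> where S: "S \<subseteq> {..<m}" "card S = 2" "\<And>i. i \<in> S \<Longrightarrow> 1 \<le> \<rho> i" "\<And>i. i < m \<Longrightarrow> i \<notin> S \<Longrightarrow> \<rho> i = 1"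
      "x = b_elem m 1 (\<lambda>i. {#\<rho> i#})" by (rule A_set_cases) (rule that)
    \<comment> \<open>Free exponents equal to 1 are set aside; the remaining positions, at most two,
      fit the matrix of \<open>realizable_D1\<close> with d = 0.\<close>
    define S' where "S' = {i \<in> S. \<rho> i \<noteq> 1}"
    have ge2: "2 \<le> \<rho> i" if "i \<in> S'" for i
      using S(3)[of i] that unfolding S'_def by (cases "\<rho> i") (auto simp: one_enat_def numeral_eq_enat)
    have one: "\<rho> i = 1" if "i < m" "i \<notin> S'" for i using S(4)[OF that(1)] that(2) by (auto simp: S'_def)
    have "finite S" using S(1) by (rule finite_subset) simp
    then have "card S' \<le> 0 + 2" using S(2) card_mono[of S S'] by (auto simp: S'_def)
    then have "realizable xs (0 + 1) (\<lambda>i. replicate_mset 0 0 + (if i \<in> S' then {#2#} else {#1#}))"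
      by (intro realizable_D1[OF len]) (use S(1) dist in \<open>auto simp: S'_def\<close>)
    then have "realizable xs 1 (\<lambda>i. if i \<in> S' then {#2#} else {#1#})" by simp
    then show ?thesis unfolding S(5)
    proof (rule inC)
      show "image_mset t2 {#\<rho> i#} = (if i \<in> S' then {#2#} else {#1#})" if "i < m" for i
        using ge2[of i] one[OF that] t2_simps(2) t2_simps(3)[of "\<rho> i"] by (cases "i \<in> S'") simp_all
    qed simp
  next
    case 3
    then obtain S \<rho> where S: "\<And>i. i \<in> S \<Longrightarrow> 2 \<le> \<rho> i" "\<And>i. i < m \<Longrightarrow> i \<notin> S \<Longrightarrow> \<rho> i = 2"
      "x = b_elem m 1 (\<lambda>i. {#\<rho> i#})" by (rule A_set_cases) (rule that)
    have ge2: "2 \<le> \<rho> i" if "i < m" for i using S(1)[of i] S(2)[OF that] by (cases "i \<in> S") simp_all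
    have "realizable xs 1 (\<lambda>_. {#2#})" by (rule realizable_A2[OF len]) (use dist in blast)
    then show ?thesis unfolding S(3) by (rule inC) (use ge2 in \<open>simp_all add: t2_simps\<close>)
  next
    case 4
    then obtain d S \<rho> where S: "S \<subseteq> {..<m}" "card S = d + 2" "\<And>i. i \<in> S \<Longrightarrow> 2 \<le> \<rho> i"
      "x = b_elem m (d + 1) (\<lambda>i. replicate_mset d 0 + (if i \<in> S then {#\<rho> i#} else {#1#}))"
      by (rule D1_set_cases) (rule that)
    have "realizable xs (d + 1) (\<lambda>i. replicate_mset d 0 + (if i \<in> S then {#2#} else {#1#}))"
      by (rule realizable_D1[OF len]) (use S(1,2) dist in auto)
    then show ?thesis unfolding S(4) by (rule inC) (use S(3) in \<open>auto simp: t2_simps\<close>)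
  next
    case 5
    then obtain d S \<rho> where S: "S \<subseteq> {..<m}" "card S = d" "\<And>i. i < m \<Longrightarrow> i \<notin> S \<Longrightarrow> 2 \<le> \<rho> i"
      "x = b_elem m (d + 1) (\<lambda>i. if i \<in> S then replicate_mset (d - 1) 0 + {#1, 1#} else replicate_mset d 0 + {#\<rho> i#})"
      by (rule D2_set_cases) (rule that)
    have d: "0 < d" if "i \<in> S" for i
      using that finite_subset[OF S(1)] S(2) by (auto simp: card_gt_0_iff)
    have "realizable xs (d + 1) (\<lambda>i. if i \<in> S then replicate_mset (d - 1) 0 + {#1, 1#} else replicate_mset d 0 + {#2#})"
      by (rule realizable_D2[OF len]) (use S(1,2) dist in auto)
    then show ?thesis unfolding S(4) by (rule inC) (use S(3) d in \<open>auto simp: t2_simps\<close>)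
  qed
qed

lemma C12_submonoid:
  fixes xs :: "'p :: prime_card padic_int list"
  assumes len: "length xs = m"
  shows "submonoid (C12_set xs) (B_monoid m)"
proof
  show sub: "C12_set xs \<subseteq> carrier (B_monoid m)" using len by (auto simp: C12_set_def B_monoid_def)
  have el: "\<exists>n M. (\<forall>i<m. size (M i) = n) \<and> x = b_elem m n M \<and> realizable xs n (\<lambda>i. image_mset t2 (M i))"
    if x: "x \<in> C12_set xs" for x
  proof -
    have "x \<in> B_set m" using x len by (auto simp: C12_set_def)
    then obtain n M where "\<forall>i<m. size (M i) = n" "x = b_elem m n M" unfolding B_set_elem by blast
    then show ?thesis using x C12_elem[OF len, of M n] by blast
  qed
  fix x y assume "x \<in> C12_set xs" "y \<in> C12_set xs"
  then obtain n M k N where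
    M: "\<And>i. i < m \<Longrightarrow> size (M i) = n" "x = b_elem m n M" "realizable xs n (\<lambda>i. image_mset t2 (M i))" and
    N: "\<And>i. i < m \<Longrightarrow> size (N i) = k" "y = b_elem m k N" "realizable xs k (\<lambda>i. image_mset t2 (N i))"
    using el by meson
  have "b_elem m (n + k) (\<lambda>i. M i + N i) \<in> C12_set xs"
    using realizable_add[OF M(3) N(3)] M(1) N(1) C12_elem[OF len, of "\<lambda>i. M i + N i" "n + k"] by simp
  then show "x \<otimes>\<^bsub>B_monoid m\<^esub> y \<in> C12_set xs" unfolding M(2) N(2) b_elem_mult .
next
  show "\<one>\<^bsub>B_monoid m\<^esub> \<in> C12_set xs"
    unfolding b_elem_one using C12_elem[OF len, of "\<lambda>_. {#}" 0] realizable_0 by simp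
qed

text \<open>With truncated subtraction, a1 - d_1 equals a1 minus the minimum of d_1 and a1; the rest
  is moving m a0 and m a1 across the inequalities.\<close>

lemma feasible_iff:
  "feasible m d0 d1 a0 a1 \<longleftrightarrow>
    (\<forall>i<m. int (d0 i) \<le> int a0) \<and> (\<forall>i<m. 2 * int (d0 i) + int (d1 i) \<le> 2 * int a0 + int a1) \<and>
    0 \<le> (\<Sum>i<m. int (d0 i)) - (int m - 1) * int a0 \<and>
    0 \<le> ((\<Sum>i<m. int (d0 i)) - (int m - 1) * int a0) + ((\<Sum>i<m. min (int (d1 i)) (int a1)) - (int m - 2) * int a1)"
proof (cases "\<forall>i<m. d0 i \<le> a0")
  case True
  have "int (\<Sum>i<m. a0 - d0 i) = (\<Sum>i<m. int a0 - int (d0 i))"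
    unfolding of_nat_sum using True by (intro sum.cong) auto
  then have 0: "int (\<Sum>i<m. a0 - d0 i) = int m * int a0 - (\<Sum>i<m. int (d0 i))" by (simp add: sum_subtractf)
  have "int (\<Sum>i<m. a1 - d1 i) = (\<Sum>i<m. int a1 - min (int (d1 i)) (int a1))"
    unfolding of_nat_sum by (intro sum.cong) auto
  then have 1: "int (\<Sum>i<m. a1 - d1 i) = int m * int a1 - (\<Sum>i<m. min (int (d1 i)) (int a1))" by (simp add: sum_subtractf)
  have "(\<Sum>i<m. a0 - d0 i) \<le> a0 \<longleftrightarrow> 0 \<le> (\<Sum>i<m. int (d0 i)) - (int m - 1) * int a0"
    using 0 by (simp only: of_nat_le_iff[symmetric, where ?'a = int]) (simp add: algebra_simps)
  moreover have "(\<Sum>i<m. a0 - d0 i) + (\<Sum>i<m. a1 - d1 i) \<le> a0 + 2 * a1 \<longleftrightarrow>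
      int (\<Sum>i<m. a0 - d0 i) + int (\<Sum>i<m. a1 - d1 i) \<le> int a0 + 2 * int a1" by linarith
  moreover have "int (\<Sum>i<m. a0 - d0 i) + int (\<Sum>i<m. a1 - d1 i) \<le> int a0 + 2 * int a1 \<longleftrightarrow>
      0 \<le> ((\<Sum>i<m. int (d0 i)) - (int m - 1) * int a0) + ((\<Sum>i<m. min (int (d1 i)) (int a1)) - (int m - 2) * int a1)"
    unfolding 0 1 by (simp add: algebra_simps)
  moreover have "2 * d0 i + d1 i \<le> 2 * a0 + a1 \<longleftrightarrow> 2 * int (d0 i) + int (d1 i) \<le> 2 * int a0 + int a1" for i by linarith
  ultimately show ?thesis unfolding feasible_def using True by auto
next
  case False
  then show ?thesis unfolding feasible_def by auto
qed

text \<open>Truncation at 2 preserves the numbers of exponents 0 and 1, so the bounds found for the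
  values of P carry over to the original exponents.\<close>

lemma C12_feasible:
  fixes xs :: "'p :: prime_card padic_int list"
  assumes len: "length xs = m"
    and dist: "\<forall>i<m. \<forall>j<m. i \<noteq> j \<longrightarrow> \<not> padic_p dvd (xs ! i - xs ! j)"
    and M: "\<And>i. i < m \<Longrightarrow> size (M i) = n" "b_elem m n M \<in> C12_set xs"
  shows "\<exists>a0 a1. feasible m (\<lambda>i. count (M i) 0) (\<lambda>i. count (M i) 1) a0 a1"
proof -
  have "realizable xs n (\<lambda>i. image_mset t2 (M i))" using C12_elem[OF len M(1)] M(2) by simp
  then obtain P where P: "first_integral n P"
    "\<And>i. i < m \<Longrightarrow> \<exists>es. mset es = image_mset t2 (M i) \<and> mat_type n (mat_eval P (xs ! i)) es"
    unfolding realizable_def len by blast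
  define es where "es i = (SOME es. mset es = image_mset t2 (M i) \<and> mat_type n (mat_eval P (xs ! i)) es)" for i
  have es: "mset (es i) = image_mset t2 (M i)" "mat_type n (mat_eval P (xs ! i)) (es i)" if "i < m" for i
    using someI_ex[OF P(2)[OF that]] unfolding es_def by blast+
  have t2_eq: "t2 r = 0 \<longleftrightarrow> r = 0" "t2 r = Suc 0 \<longleftrightarrow> r = 1" for r
    by (cases r; auto simp: t2_def min_def numeral_eq_enat zero_enat_def one_enat_def)+
  have cnt: "count (image_mset t2 A) 0 = count A 0" "count (image_mset t2 A) (Suc 0) = count A 1" for A
    by (induction A) (auto simp: t2_eq)
  have sub: "set (es i) \<subseteq> {0, 1, 2}" if "i < m" for i
  proof -
    have "set (es i) = t2 ` set_mset (M i)" using es(1)[OF that] by (metis set_image_mset set_mset_mset)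
    moreover have "t2 r \<in> {0, 1, 2}" for r using t2_simps(4)[of r] by auto
    then have "t2 ` A \<subseteq> {0, 1, 2}" for A by (rule image_subsetI)
    ultimately show ?thesis by (simp only:)
  qed
  obtain a0 a1 where a: "\<And>i. i < m \<Longrightarrow> count (mset (es i)) 0 \<le> a0"
    "\<And>i. i < m \<Longrightarrow> 2 * count (mset (es i)) 0 + count (mset (es i)) 1 \<le> 2 * a0 + a1"
    "(\<Sum>i<m. a0 - count (mset (es i)) 0) \<le> a0"
    "(\<Sum>i<m. (a0 - count (mset (es i)) 0) + (a1 - count (mset (es i)) 1)) \<le> a0 + 2 * a1"
    by (rule necessity[of n P m "(!) xs" es]) (use P(1) es(2) sub dist in blast)+
  have "(\<Sum>i<m. a0 - count (mset (es i)) 0) = (\<Sum>i<m. a0 - count (M i) 0)"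
    "(\<Sum>i<m. a1 - count (mset (es i)) 1) = (\<Sum>i<m. a1 - count (M i) 1)"
    by (intro sum.cong; simp add: es(1) cnt)+
  then have "feasible m (\<lambda>i. count (M i) 0) (\<lambda>i. count (M i) 1) a0 a1"
    using a unfolding feasible_def sum.distrib by (simp add: es(1) cnt)
  then show ?thesis by blast
qed

theorem theorem3p14:
  fixes xs :: "'p :: prime_card padic_int list" and m :: nat
  assumes "length xs = m"
    and "\<forall>i<m. \<forall>j<m. i \<noteq> j \<longrightarrow> \<not> padic_p dvd (xs ! i - xs ! j)"
  shows "C12_set xs =
           generated_submonoid (B_monoid m) (A_set m 0 1 \<union> A_set m 1 2 \<union> A_set m 2 m \<union> D_set m)
    \<and> (\<forall>(n, Hs) \<in> B_set m. (n, Hs) \<in> C12_set xs \<longleftrightarrow>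
         (\<exists>\<alpha>0 \<alpha>1 :: nat.
            (\<forall>i<m. class_d n (Hs ! i) 0 \<le> int \<alpha>0) \<and>
            (\<forall>i<m. 2 * class_d n (Hs ! i) 0 + class_d n (Hs ! i) 1 \<le> 2 * int \<alpha>0 + int \<alpha>1) \<and>
            0 \<le> (\<Sum>i<m. class_d n (Hs ! i) 0) - (int m - 1) * int \<alpha>0 \<and>
            0 \<le> ((\<Sum>i<m. class_d n (Hs ! i) 0) - (int m - 1) * int \<alpha>0) +
                 ((\<Sum>i<m. min (class_d n (Hs ! i) 1) (int \<alpha>1)) - (int m - 2) * int \<alpha>1)))"
proof (intro conjI ballI)
  have gen_sub: "generated_submonoid (B_monoid m) (gens m) \<subseteq> C12_set xs"
    unfolding generated_submonoid_def using C12_submonoid[OF assms(1)] gens_subset_C12[OF assms] by blast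
  have fg: "b_elem m n M \<in> generated_submonoid (B_monoid m) (gens m :: (nat \<times> 'p module_class list) set)"
    if "\<And>i. i < m \<Longrightarrow> size (M i) = n" "feasible m (\<lambda>i. count (M i) 0) (\<lambda>i. count (M i) 1) a0 a1" for n M a0 a1
    unfolding generated_submonoid_def using generated_elem[OF _ _ that] by blast
  have "C12_set xs \<subseteq> generated_submonoid (B_monoid m) (gens m)"
  proof
    fix x assume x: "x \<in> C12_set xs"
    then have "x \<in> B_set m" using assms(1) by (auto simp: C12_set_def)
    then obtain n M where M: "\<And>i. i < m \<Longrightarrow> size (M i) = n" "x = b_elem m n M" unfolding B_set_elem by blast
    obtain a0 a1 where "feasible m (\<lambda>i. count (M i) 0) (\<lambda>i. count (M i) 1) a0 a1"
      using C12_feasible[OF assms, of M n] M(1) x unfolding M(2) by blast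
    then show "x \<in> generated_submonoid (B_monoid m) (gens m)" unfolding M(2) by (intro fg M(1))
  qed
  then show "C12_set xs =
      generated_submonoid (B_monoid m) (A_set m 0 1 \<union> A_set m 1 2 \<union> A_set m 2 m \<union> D_set m)"
    using gen_sub unfolding gens_def by blast
  fix x :: "nat \<times> 'p module_class list"
  assume "x \<in> B_set m"
  then obtain n M where M: "\<And>i. i < m \<Longrightarrow> size (M i) = n" "x = b_elem m n M" unfolding B_set_elem by blast
  obtain Hs where Hs: "x = (n, Hs)" "\<And>i. i < m \<Longrightarrow> Hs ! i = clsm (M i)" using M(2) by (simp add: b_elem_def)
  have d: "class_d n (Hs ! i) 0 = int (count (M i) 0)" "class_d n (Hs ! i) 1 = int (count (M i) 1)" if "i < m" for i
    unfolding Hs(2)[OF that] by (rule clsm_class_d[OF M(1)[OF that]])+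
  have s: "(\<Sum>i<m. class_d n (Hs ! i) 0) = (\<Sum>i<m. int (count (M i) 0))"
    "(\<Sum>i<m. min (class_d n (Hs ! i) 1) (int a)) = (\<Sum>i<m. min (int (count (M i) 1)) (int a))" for a
    by (intro sum.cong; simp add: d)+
  \<comment> \<open>The same circle of implications gives both claims: membership yields
    feasibility, feasibility yields generation, and the generated submonoid lies in
    \<open>C12_set xs\<close>.\<close>
  have "x \<in> C12_set xs \<longleftrightarrow> (\<exists>a0 a1. feasible m (\<lambda>i. count (M i) 0) (\<lambda>i. count (M i) 1) a0 a1)"
    using C12_feasible[OF assms, of M n] fg[of M n] M(1) gen_sub unfolding M(2) by blast
  then show "case x of (n, Hs) \<Rightarrow> (n, Hs) \<in> C12_set xs \<longleftrightarrow>
         (\<exists>\<alpha>0 \<alpha>1 :: nat.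
            (\<forall>i<m. class_d n (Hs ! i) 0 \<le> int \<alpha>0) \<and>
            (\<forall>i<m. 2 * class_d n (Hs ! i) 0 + class_d n (Hs ! i) 1 \<le> 2 * int \<alpha>0 + int \<alpha>1) \<and>
            0 \<le> (\<Sum>i<m. class_d n (Hs ! i) 0) - (int m - 1) * int \<alpha>0 \<and>
            0 \<le> ((\<Sum>i<m. class_d n (Hs ! i) 0) - (int m - 1) * int \<alpha>0) +
                 ((\<Sum>i<m. min (class_d n (Hs ! i) 1) (int \<alpha>1)) - (int m - 2) * int \<alpha>1))"
    unfolding Hs(1) prod.case feasible_iff s by (simp add: d cong: conj_cong)
qed

end
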